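(* Let $E_{min}(q)=\inf\{\int_{\mathbb R^N}|\nabla\psi|^2dx+\int_{\mathbb R^N}|V(|\psi|^2)|dx:\psi\in\mathcal E,\ Q(\psi)=q\}$. (a) If $N\ge2$ and (A1) holds, there is $C>0$ such that $E_{min}(q)\le Cq^{\frac{N-2}{N-1}}\ln q$ for all sufficiently large $q$. (b) If $N\ge2$ and (A1), (A2) hold, then $E_{min}(q)\to\infty$ as $q\to\infty$. Moreover, if $N\ge3$ there is $C>0$ such that $E_{min}(q)\ge Cq^{\frac{N-2}{N-1}}$ for all sufficiently large $q$.
   Context: $F:[0,\infty)\to\mathbb R$, $V(s)=\int_s^1F$. (A1) $F$ continuous on $[0,\infty)$, $C^1$ near $1$, $F(1)=0$, $F'(1)=-1$ (paper's normalization of $F'(1)<0$). (A2) $|F(s)|\le C(1+s^{p_0})$ with $p_0<\frac2{N-2}$ ($p_0<\infty$ if $N=2$). Fix odd $\varphi\in C^\infty(\mathbb R)$, $\varphi(s)=s$ on $[0,2]$, $0\le\varphi'\le1$, $\varphi=3$ on $[4,\infty)$; $\mathcal E=\{\psi\in L^1_{loc}(\mathbb R^N;\mathbb C):\nabla\psi\in L^2,\varphi^2(|\psi|)-1\in L^2\}$. Momentum: $\mathcal Y=\{\partial_{x_1}\phi:\phi\in L^1_{loc},\nabla\phi\in L^2\}$, $L(v+w)=\int v$ ($v\in L^1$, $w\in\mathcal Y$), $Q(\psi)=L(\langle i\partial_{x_1}\psi,\psi\rangle)$, $\langle z_1,z_2\rangle=\mathrm{Re}(z_1\bar z_2)$.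 *)

theory Defs
  imports "HOL-Analysis.Analysis"
begin

primrec Ck :: "nat \<Rightarrow> ('a::euclidean_space \<Rightarrow> real) set" where
  "Ck 0 = {f. continuous_on UNIV f}"
| "Ck (Suc k) = {f. (\<forall>x. f differentiable (at x)) \<and>
                     (\<forall>v. (\<lambda>x. frechet_derivative f (at x) v) \<in> Ck k)}"

definition smooth :: "('a::euclidean_space \<Rightarrow> real) \<Rightarrow> bool" where
  "smooth f \<longleftrightarrow> (\<forall>k. f \<in> Ck k)"

definition test_function :: "('a::euclidean_space \<Rightarrow> real) \<Rightarrow> bool" where
  "test_function f \<longleftrightarrow> smooth f \<and> compact (closure {x. f x \<noteq> 0})"

definition loc_int :: "('a::euclidean_space \<Rightarrow> 'b::{banach,second_countable_topology}) \<Rightarrow> bool" where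
  "loc_int u \<longleftrightarrow> (\<forall>K. compact K \<longrightarrow> set_integrable lborel K u)"

definition weak_partial ::
  "('a::euclidean_space \<Rightarrow> 'b::{banach,second_countable_topology}) \<Rightarrow> 'a \<Rightarrow> ('a \<Rightarrow> 'b) \<Rightarrow> bool" where
  "weak_partial u b g \<longleftrightarrow> loc_int u \<and> loc_int g \<and>
     (\<forall>\<phi>. test_function \<phi> \<longrightarrow>
        (\<integral>x. frechet_derivative \<phi> (at x) b *\<^sub>R u x \<partial>lborel) = - (\<integral>x. \<phi> x *\<^sub>R g x \<partial>lborel))"

definition grad_L2 ::
  "('a::euclidean_space \<Rightarrow> 'b::{banach,second_countable_topology}) \<Rightarrow> ('a \<Rightarrow> 'a \<Rightarrow> 'b) \<Rightarrow> bool" where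
  "grad_L2 u G \<longleftrightarrow> (\<forall>b\<in>Basis. weak_partial u b (G b) \<and> integrable lborel (\<lambda>x. (norm (G b x))\<^sup>2))"

definition e1 :: "'a::euclidean_space" where
  "e1 = (SOME b. b \<in> Basis)"

definition cutoff_ok :: "(real \<Rightarrow> real) \<Rightarrow> bool" where
  "cutoff_ok \<phi> \<longleftrightarrow> smooth \<phi> \<and> (\<forall>s. \<phi> (-s) = - \<phi> s) \<and> (\<forall>s\<in>{0..2}. \<phi> s = s) \<and>
      (\<forall>s. 0 \<le> deriv \<phi> s \<and> deriv \<phi> s \<le> 1) \<and> (\<forall>s\<ge>4. \<phi> s = 3)"

definition in_E :: "(real \<Rightarrow> real) \<Rightarrow> ('a::euclidean_space \<Rightarrow> complex) \<Rightarrow> ('a \<Rightarrow> 'a \<Rightarrow> complex) \<Rightarrow> bool" where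
  "in_E \<phi> \<psi> G \<longleftrightarrow> loc_int \<psi> \<and> grad_L2 \<psi> G \<and>
      integrable lborel (\<lambda>x. ((\<phi> (cmod (\<psi> x)))\<^sup>2 - 1)\<^sup>2)"

text \<open>L(v + w) = integral of v, for v in L^1 and w = d_{x_1} phi in Y (a.e. equality).\<close>
definition Lmom :: "('a::euclidean_space \<Rightarrow> real) \<Rightarrow> real" where
  "Lmom w = (THE c. \<exists>v \<phi> H. integrable lborel v \<and> loc_int \<phi> \<and> grad_L2 (\<phi> :: 'a \<Rightarrow> real) H \<and>
              (AE x in lborel. w x = v x + H e1 x) \<and> c = (\<integral>x. v x \<partial>lborel))"

definition Qmom :: "('a::euclidean_space \<Rightarrow> complex) \<Rightarrow> ('a \<Rightarrow> 'a \<Rightarrow> complex) \<Rightarrow> real" where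
  "Qmom \<psi> G = Lmom (\<lambda>x. Re ((\<i> * G e1 x) * cnj (\<psi> x)))"

definition Vpot :: "(real \<Rightarrow> real) \<Rightarrow> real \<Rightarrow> real" where
  "Vpot F s = (LBINT t=s..1. F t)"

definition energy :: "(real \<Rightarrow> real) \<Rightarrow> ('a::euclidean_space \<Rightarrow> complex) \<Rightarrow> ('a \<Rightarrow> 'a \<Rightarrow> complex) \<Rightarrow> ennreal" where
  "energy F \<psi> G = (\<integral>\<^sup>+x. ennreal (\<Sum>b\<in>Basis. (cmod (G b x))\<^sup>2) \<partial>lborel)
                 + (\<integral>\<^sup>+x. ennreal \<bar>Vpot F ((cmod (\<psi> x))\<^sup>2)\<bar> \<partial>lborel)"

definition Emin :: "(real \<Rightarrow> real) \<Rightarrow> (real \<Rightarrow> real) \<Rightarrow> real \<Rightarrow> 'a::euclidean_space itself \<Rightarrow> ennreal" where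
  "Emin \<phi> F q _ = (INF \<psi>G \<in> {(\<psi>::'a \<Rightarrow> complex, G). in_E \<phi> \<psi> G \<and> Qmom \<psi> G = q}. energy F (fst \<psi>G) (snd \<psi>G))"

definition A1 :: "(real \<Rightarrow> real) \<Rightarrow> bool" where
  "A1 F \<longleftrightarrow> continuous_on {0..} F \<and>
     (\<exists>\<delta>>0. \<exists>F'. (\<forall>s\<in>{1-\<delta><..<1+\<delta>}. (F has_real_derivative F' s) (at s)) \<and>
                  continuous_on {1-\<delta><..<1+\<delta>} F' \<and> F' 1 = -1) \<and>
     F 1 = 0"

definition A2 :: "nat \<Rightarrow> (real \<Rightarrow> real) \<Rightarrow> bool" where
  "A2 N F \<longleftrightarrow> (\<exists>p0 C. (N \<ge> 3 \<longrightarrow> p0 < 2 / (real N - 2)) \<and>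
                     (\<forall>s\<ge>0. \<bar>F s\<bar> \<le> C * (1 + s powr p0)))"

end

theory Submission
  imports Defs
begin

text \<open>
  Upper bound: a vortex ring whose phase turns once around the circle inside a lens-shaped region is
  scaled by a factor $R$. Its momentum is of order $R^{N-1}$ and its energy of order $R^{N-2} \ln R$,
  the logarithm coming from the dyadic layers around the singular ring.

  Lower bound: mollify $\psi$ at a scale $h \ge 1$ and write $\psi = f + r$. If $|f|$ stays close to $1$,
  then $f = |f| e^{i\theta}$ with a global phase, and the momentum density is
  $\partial_1(\langle i r, f\rangle - \theta)$ plus an integrable remainder of norm at most $C h E$, where $E$ is
  the energy. The modulus is close to $1$ as soon as $E \le \eta h^{N-2}$. For $N \ge 3$ the choice
  $h = (E/\eta)^{1/(N-2)}$ gives $|q| \le C E^{(N-1)/(N-2)}$. For $N = 2$ the energy is scale invariant: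
  with $h = 1$ the modulus is close to $1$ off at most $E/\eta$ balls of fixed radius. Around each
  cluster of them a logarithmic annulus contains a square on which $f$ is nearly constant; hence $f$ has
  no winding there, the phase exists outside the square and extends inside with bounded gradient,
  and the momentum is bounded in terms of $E$.
\<close>

section \<open>Smooth functions and test functions\<close>

text \<open>The obstacle in the lower bound is that the energy says little about the modulus away
  from 1: the potential is coercive only near 1 and may vanish elsewhere. Small local energy
  therefore does not place \<open>cmod (f x)\<close> near 1; it only forbids values whose distance
  from 1 lies between \<open>\<delta>/2\<close> and \<open>\<delta>\<close>. On a connected set the
  modulus stays on one side of this gap. The far side is excluded on sets of infinite measure,
  because membership in the energy space makes the far region finite in measure, though without any
  bound. This is why connected sets of infinite measure occur throughout.

  The factor \<open>h * E\<close> comes from \<open>L^2\<close> sizes: gradients have size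
  \<open>sqrt E\<close> and \<open>r\<close> has size \<open>h * sqrt E\<close>, so each product of
  the two costs \<open>h * E\<close>.

  The momentum is a definite description. It can be evaluated only once the decomposition behind it
  is known to determine the integral, hence the early section on this point. In both bounds the work
  is then to exhibit one explicit decomposition of the density into an integrable part and an exact
  derivative in direction \<open>e1\<close>.\<close>

lemma Ck_SucI:
  fixes f :: "'a::euclidean_space \<Rightarrow> real"
  assumes "\<And>x. (f has_derivative D x) (at x)" "\<And>v. (\<lambda>x. D x v) \<in> Ck k"
  shows "f \<in> Ck (Suc k)"
proof -
  have "frechet_derivative f (at x) = D x" for x
    using frechet_derivative_at[OF assms(1)] by simp
  with assms show ?thesis by (auto simp: differentiable_def)
qed

lemma Ck_SucD:
  assumes "f \<in> Ck (Suc k)"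
  shows "(f has_derivative frechet_derivative f (at x)) (at x)"
    and "(\<lambda>x. frechet_derivative f (at x) v) \<in> Ck k"
  using assms by (auto simp: frechet_derivative_works[symmetric])

lemma Ck_Suc_subset: "f \<in> Ck (Suc k) \<Longrightarrow> f \<in> Ck k"
proof (induction k arbitrary: f)
  case 0
  then show ?case
    by (auto intro!: continuous_at_imp_continuous_on differentiable_imp_continuous_within)
next
  case (Suc k)
  from Ck_SucD[OF Suc.prems] Suc.IH show ?case by (intro Ck_SucI) blast+
qed

lemma Ck_const: "(\<lambda>x. c) \<in> Ck k"
proof (induction k arbitrary: c)
  case (Suc k)
  then show ?case by (intro Ck_SucI[where D="\<lambda>x v. 0"]) auto
qed simp

lemma Ck_add: "f \<in> Ck k \<Longrightarrow> g \<in> Ck k \<Longrightarrow> (\<lambda>x. f x + g x) \<in> Ck k"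
proof (induction k arbitrary: f g)
  case 0
  then show ?case by (auto intro: continuous_intros)
next
  case (Suc k)
  show ?case
    by (rule Ck_SucI) (auto intro!: has_derivative_add Ck_SucD[OF Suc.prems(1)] Ck_SucD[OF Suc.prems(2)] Suc.IH)
qed

lemma Ck_mult: "f \<in> Ck k \<Longrightarrow> g \<in> Ck k \<Longrightarrow> (\<lambda>x. f x * g x) \<in> Ck k"
proof (induction k arbitrary: f g)
  case 0
  then show ?case by (auto intro: continuous_intros)
next
  case (Suc k)
  show ?case
    by (rule Ck_SucI)
      (auto intro!: has_derivative_mult Ck_SucD[OF Suc.prems(1)] Ck_SucD[OF Suc.prems(2)]
        Suc.IH Ck_add Suc.prems[THEN Ck_Suc_subset])
qed

lemma Ck_bounded_linear: 
  assumes "bounded_linear f" shows "f \<in> Ck k"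
proof (cases k)
  case 0
  then show ?thesis using assms linear_continuous_on by auto
next
  case (Suc m)
  show ?thesis unfolding Suc
    by (rule Ck_SucI[where D="\<lambda>x. f"]) (auto intro: bounded_linear_imp_has_derivative assms Ck_const)
qed

lemma Ck_compose_affine:
  fixes L :: "'a::euclidean_space \<Rightarrow> 'b::euclidean_space"
  assumes L: "bounded_linear L"
  shows "f \<in> Ck k \<Longrightarrow> (\<lambda>x. f (L x + a)) \<in> Ck k"
proof (induction k arbitrary: f)
  case 0
  then have "continuous_on UNIV f" by simp
  moreover have "continuous_on UNIV (\<lambda>x. L x + a)"
    by (intro continuous_on_add continuous_on_const linear_continuous_on L)
  ultimately show ?case using continuous_on_compose2[of UNIV f UNIV "\<lambda>x. L x + a"] by simp
next
  case (Suc k)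
  have "((\<lambda>x. f (L x + a)) has_derivative (\<lambda>v. frechet_derivative f (at (L x + a)) (L v))) (at x)" for x
    by (rule has_derivative_compose[OF _ Ck_SucD(1)[OF Suc.prems], unfolded o_def])
      (auto intro!: derivative_eq_intros bounded_linear_imp_has_derivative L)
  then show ?case
    by (rule Ck_SucI) (rule Suc.IH[OF Ck_SucD(2)[OF Suc.prems]])
qed

section \<open>Flat exponentials, the source of the bump functions\<close>

definition flat_exp :: "nat \<Rightarrow> real \<Rightarrow> real" where
  "flat_exp n t = (if t > 0 then exp (- 1 / t) / t ^ n else 0)"

lemma flat_exp_nonneg: "flat_exp n t \<ge> 0"
  by (simp add: flat_exp_def)

lemma flat_exp_pos_iff: "flat_exp n t > 0 \<longleftrightarrow> t > 0"
  by (simp add: flat_exp_def)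

lemma flat_exp_tendsto_0: "(flat_exp n \<longlongrightarrow> 0) (at 0)"
proof -
  have "((\<lambda>t. (inverse t) ^ n / exp (inverse t)) \<longlongrightarrow> (0::real)) (at_right 0)"
    using filterlim_compose[OF tendsto_power_div_exp_0 filterlim_inverse_at_top_right] .
  moreover have "\<forall>\<^sub>F t::real in at_right 0. (inverse t) ^ n / exp (inverse t) = flat_exp n t"
    by (auto simp: eventually_at_right_field flat_exp_def exp_minus field_simps power_inverse intro!: exI[of _ 1])
  ultimately have r: "(flat_exp n \<longlongrightarrow> 0) (at_right 0)" 
    by (rule Lim_transform_eventually)
  have "\<forall>\<^sub>F t::real in at_left 0. 0 = flat_exp n t"
    by (auto simp: eventually_at_left_field flat_exp_def intro!: exI[of _ "-1"])
  then have "(flat_exp n \<longlongrightarrow> 0) (at_left 0)"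
    by (rule Lim_transform_eventually[OF tendsto_const])
  with r show ?thesis by (simp add: filterlim_split_at)
qed

text \<open>The exponent \<open>n\<close> makes the family closed under differentiation, so
  smoothness of all members follows from one induction in which \<open>n\<close> varies. At 0 the
  difference quotient of \<open>flat_exp n\<close> is \<open>flat_exp (n+1)\<close>, which tends to
  0.\<close>

lemma flat_exp_has_derivative:
  "(flat_exp n has_real_derivative (flat_exp (n+2) t - real n * flat_exp (n+1) t)) (at t)"
proof (cases "t = 0")
  case True
  have "(flat_exp n has_real_derivative 0) (at 0)"
  proof -
    have "\<forall>\<^sub>F h::real in at 0. (flat_exp n (0 + h) - flat_exp n 0) / h = flat_exp (n+1) h"
      by (auto simp: flat_exp_def eventually_at intro!: exI[of _ 1])
    then show ?thesis
      unfolding DERIV_def using flat_exp_tendsto_0[of "n+1"] tendsto_cong by fastforce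
  qed
  with True show ?thesis by (simp add: flat_exp_def)
next
  case False
  show ?thesis
  proof (cases "t > 0")
    case True
    have "((\<lambda>t. exp (- 1 / t) / t ^ n) has_real_derivative (flat_exp (n+2) t - real n * flat_exp (n+1) t)) (at t)"
      using True
      apply (auto intro!: derivative_eq_intros simp: flat_exp_def)
      apply (cases n)
       apply (auto simp: field_simps power2_eq_square power_add)
      done
    then show ?thesis
      by (rule has_field_derivative_transform_within_open[of _ _ _ "{0<..}"]) (use True in \<open>auto simp: flat_exp_def\<close>)
  next
    case f: False
    with False have "t < 0" by simp
    have "((\<lambda>t. 0) has_real_derivative (flat_exp (n+2) t - real n * flat_exp (n+1) t)) (at t)"
      using \<open>t < 0\<close> by (auto simp: flat_exp_def)
    then show ?thesis
      by (rule has_field_derivative_transform_within_open[of _ _ _ "{..<0}"]) (use \<open>t<0\<close> in \<open>auto simp: flat_exp_def\<close>)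
  qed
qed

lemma smooth_has_derivative: "smooth f \<Longrightarrow> (f has_derivative frechet_derivative f (at x)) (at x)"
  unfolding smooth_def using Ck_SucD(1) by blast

lemma smooth_frechet_derivative: "smooth f \<Longrightarrow> smooth (\<lambda>x. frechet_derivative f (at x) v)"
  unfolding smooth_def using Ck_SucD(2) by blast

lemma smooth_continuous_on: "smooth f \<Longrightarrow> continuous_on A f"
  unfolding smooth_def by (metis Ck.simps(1) continuous_on_subset mem_Collect_eq subset_UNIV)

lemma smooth_const: "smooth (\<lambda>x. c)" 
  and smooth_add: "smooth f \<Longrightarrow> smooth g \<Longrightarrow> smooth (\<lambda>x. f x + g x)"
  and smooth_mult: "smooth f \<Longrightarrow> smooth g \<Longrightarrow> smooth (\<lambda>x. f x * g x)"
  and smooth_bounded_linear: "bounded_linear f \<Longrightarrow> smooth f"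
  by (simp_all add: smooth_def Ck_const Ck_add Ck_mult Ck_bounded_linear)

lemma smooth_compose_affine:
  fixes L :: "'a::euclidean_space \<Rightarrow> 'b::euclidean_space"
  shows "bounded_linear L \<Longrightarrow> smooth f \<Longrightarrow> smooth (\<lambda>x. f (L x + a))"
  by (simp add: smooth_def Ck_compose_affine)

lemma smooth_flat_exp: 
  assumes g: "smooth g" shows "smooth (\<lambda>x. flat_exp n (g x))"
proof -
  have "(\<lambda>x. flat_exp n (g x)) \<in> Ck k" for k n
  proof (induction k arbitrary: n)
    case 0
    have "continuous_on UNIV (flat_exp n)"
      by (meson DERIV_continuous_on flat_exp_has_derivative has_field_derivative_at_within)
    then show ?case
      using smooth_continuous_on[OF g] by (auto intro: continuous_on_compose2)
  next
    case (Suc k)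
    have "((\<lambda>x. flat_exp n (g x)) has_derivative
        (\<lambda>v. (flat_exp (n+2) (g x) + (- real n) * flat_exp (n+1) (g x)) * frechet_derivative g (at x) v)) (at x)" for x
      using has_derivative_compose[OF smooth_has_derivative[OF g] flat_exp_has_derivative[unfolded has_field_derivative_def]]
      by (simp add: algebra_simps)
    then show ?case
      by (rule Ck_SucI)
        (intro Ck_mult Ck_add Ck_const Suc.IH smooth_frechet_derivative[OF g, unfolded smooth_def, rule_format])
  qed
  then show ?thesis by (simp add: smooth_def)
qed

lemma smooth_exp:
  assumes g: "smooth g" shows "smooth (\<lambda>x. exp (g x))"
proof -
  have "(\<lambda>x. exp (g x)) \<in> Ck k" for k
  proof (induction k)
    case 0
    then show ?case using smooth_continuous_on[OF g] by (auto intro: continuous_intros)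
  next
    case (Suc k)
    have "((\<lambda>x. exp (g x)) has_derivative (\<lambda>v. exp (g x) * frechet_derivative g (at x) v)) (at x)" for x
      by (auto intro!: derivative_eq_intros smooth_has_derivative[OF g])
    then show ?case
      by (rule Ck_SucI) (intro Ck_mult Suc.IH smooth_frechet_derivative[OF g, unfolded smooth_def, rule_format])
  qed
  then show ?thesis by (simp add: smooth_def)
qed

lemma smooth_prod:
  assumes "finite I" "\<And>i. i \<in> I \<Longrightarrow> smooth (f i)" shows "smooth (\<lambda>x. \<Prod>i\<in>I. f i x)"
  using assms by (induction I rule: finite_induct) (auto intro: smooth_const smooth_mult)

lemma smooth_inner_self: "smooth (\<lambda>x::'a::euclidean_space. x \<bullet> x)"
proof -
  have "smooth (\<lambda>x::'a. \<Sum>b\<in>S. (x \<bullet> b) * (x \<bullet> b))" if "finite S" for S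
    using that
  proof (induction S rule: finite_induct)
    case (insert b S)
    have "smooth (\<lambda>x::'a. (x \<bullet> b) * (x \<bullet> b))"
      by (intro smooth_mult smooth_bounded_linear bounded_linear_inner_left)
    from smooth_add[OF this insert.IH] insert.hyps show ?case by simp
  qed (simp add: smooth_const)
  moreover have "(\<lambda>x::'a. x \<bullet> x) = (\<lambda>x. \<Sum>b\<in>Basis. (x \<bullet> b) * (x \<bullet> b))"
    by (rule ext) (rule euclidean_inner)
  ultimately show ?thesis by simp
qed

section \<open>Test functions and their supports\<close>

lemma test_function_smooth: "test_function f \<Longrightarrow> smooth f"
  by (simp add: test_function_def)

lemma test_functionI:
  assumes "smooth f" "compact K" "\<And>x. x \<notin> K \<Longrightarrow> f x = 0" 
  shows "test_function f"
proof -
  have "closure {x. f x \<noteq> 0} \<subseteq> K"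
    by (intro closure_minimal) (use assms compact_imp_closed in auto)
  with assms show ?thesis 
    unfolding test_function_def by (metis closed_closure compact_Int_closed inf.absorb_iff2)
qed

lemma test_function_support:
  assumes "test_function f"
  obtains K where "compact K" "\<And>x. x \<notin> K \<Longrightarrow> f x = 0" "\<And>x v. x \<notin> K \<Longrightarrow> frechet_derivative f (at x) v = 0"
proof
  let ?K = "closure {x. f x \<noteq> 0}"
  show "compact ?K" using assms by (simp add: test_function_def)
  show z: "x \<notin> ?K \<Longrightarrow> f x = 0" for x using closure_subset[of "{x. f x \<noteq> 0}"] by auto
  show "frechet_derivative f (at x) v = 0" if "x \<notin> ?K" for x v
  proof -
    have "((\<lambda>x. 0) has_derivative (\<lambda>_. 0)) (at x)" by simp
    then have "(f has_derivative (\<lambda>_. 0)) (at x)"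
      by (rule has_derivative_transform_within_open[of _ _ _ _ "- ?K"]) (use that in \<open>simp_all only: open_Compl closed_closure Compl_iff not_False_eq_True z\<close>)
    from fun_cong[OF frechet_derivative_at[OF this], of v] show ?thesis by simp
  qed
qed

lemma test_function_mult_smooth:
  assumes "test_function f" "smooth g" shows "test_function (\<lambda>x. f x * g x)"
proof -
  obtain K where "compact K" "\<And>x. x \<notin> K \<Longrightarrow> f x = 0" using test_function_support assms by metis
  then show ?thesis using assms by (intro test_functionI[of _ K]) (auto intro: smooth_mult test_function_smooth)
qed

lemma test_function_frechet_derivative:
  assumes "test_function f" shows "test_function (\<lambda>x. frechet_derivative f (at x) v)"
proof -
  obtain K where "compact K" "\<And>x v. x \<notin> K \<Longrightarrow> frechet_derivative f (at x) v = 0" 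
    using test_function_support assms by metis
  then show ?thesis using assms
    by (intro test_functionI[of _ K]) (auto intro: smooth_frechet_derivative test_function_smooth)
qed

lemma test_function_continuous_on: "test_function f \<Longrightarrow> continuous_on A f"
  by (simp add: smooth_continuous_on test_function_smooth)

lemma test_function_bounded:
  assumes "test_function f" obtains B where "B > 0" "\<And>x. \<bar>f x\<bar> \<le> B"
proof -
  obtain K where K: "compact K" "\<And>x. x \<notin> K \<Longrightarrow> f x = 0" using test_function_support assms by metis
  have "bounded (f ` K)"
    using compact_continuous_image[OF test_function_continuous_on[OF assms] K(1)] compact_imp_bounded by blast
  then obtain B where "B > 0" "\<And>x. x \<in> K \<Longrightarrow> \<bar>f x\<bar> \<le> B"
    unfolding bounded_pos by auto
  with K(2) show ?thesis by (intro that[of B]) (auto, metis abs_zero less_eq_real_def)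
qed

lemma test_function_compose_affine:
  fixes L :: "'a::euclidean_space \<Rightarrow> 'a"
  assumes f: "test_function f" and L: "bounded_linear L" and M: "bounded_linear M" and inv: "\<And>x. M (L x) = x"
  shows "test_function (\<lambda>x. f (L x + a))"
proof -
  obtain K where K: "compact K" "\<And>x. x \<notin> K \<Longrightarrow> f x = 0" using test_function_support f by metis
  have c: "compact ((\<lambda>y. M (y - a)) ` K)"
    by (intro compact_continuous_image K continuous_intros bounded_linear.continuous_on[OF M])
  show ?thesis
  proof (rule test_functionI[OF _ c])
    show "smooth (\<lambda>x. f (L x + a))" by (intro smooth_compose_affine L test_function_smooth f)
    fix x assume x: "x \<notin> (\<lambda>y. M (y - a)) ` K"
    have "x = M ((L x + a) - a)" using inv by simp
    with x have "L x + a \<notin> K" by blast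
    then show "f (L x + a) = 0" by (rule K)
  qed
qed

lemma frechet_derivative_compose_affine:
  fixes L :: "'a::euclidean_space \<Rightarrow> 'b::euclidean_space"
  assumes f: "smooth f" and L: "bounded_linear L"
  shows "frechet_derivative (\<lambda>x. f (L x + a)) (at x) v = frechet_derivative f (at (L x + a)) (L v)"
proof -
  have "((\<lambda>x. f (L x + a)) has_derivative (\<lambda>v. frechet_derivative f (at (L x + a)) (L v))) (at x)"
    by (rule has_derivative_compose[OF _ smooth_has_derivative[OF f]])
      (auto intro!: derivative_eq_intros bounded_linear_imp_has_derivative L)
  from fun_cong[OF frechet_derivative_at[OF this], of v] show ?thesis by simp
qed

lemma frechet_derivative_mult_smooth:
  assumes "smooth f" "smooth g"
  shows "frechet_derivative (\<lambda>x. f x * g x) (at x) v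
    = f x * frechet_derivative g (at x) v + frechet_derivative f (at x) v * g x"
  using fun_cong[OF frechet_derivative_at[OF has_derivative_mult[OF smooth_has_derivative[OF assms(1), of x]
        smooth_has_derivative[OF assms(2), of x]]], of v] by simp

definition ball_bump :: "'a::euclidean_space \<Rightarrow> real" where
  "ball_bump x = flat_exp 0 (1 - x \<bullet> x)"

lemma test_function_ball_bump: "test_function ball_bump"
proof (rule test_functionI[of _ "cball 0 1"])
  have "smooth (\<lambda>x::'a. 1 + (-1) * (x \<bullet> x))"
    by (intro smooth_add smooth_mult smooth_const smooth_inner_self)
  from smooth_flat_exp[OF this, of 0] show "smooth (ball_bump :: 'a \<Rightarrow> real)"
    by (simp add: ball_bump_def[abs_def])
  fix x :: 'a assume "x \<notin> cball 0 1"
  then have "norm x > 1" by simp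
  then have "x \<bullet> x > 1" by (metis one_less_power power2_norm_eq_inner zero_less_numeral)
  then show "ball_bump x = 0" by (simp add: ball_bump_def flat_exp_def)
qed simp

lemma ball_bump_0_pos: "ball_bump 0 > 0" "ball_bump x \<ge> 0"
  by (simp_all add: ball_bump_def flat_exp_pos_iff flat_exp_nonneg)

section \<open>Locally integrable functions\<close>

lemma nn_integral_lborel_affine:
  fixes t :: "'a::euclidean_space"
  assumes [measurable]: "f \<in> borel_measurable borel" and c: "c \<noteq> 0"
  shows "(\<integral>\<^sup>+x. f x \<partial>lborel) = ennreal (\<bar>c\<bar> ^ DIM('a)) * (\<integral>\<^sup>+x. f (t + c *\<^sub>R x) \<partial>lborel)"
  by (subst lborel_affine[OF c, of t])
    (simp add: nn_integral_density nn_integral_distr nn_integral_cmult)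

lemma
  fixes t :: "'a::euclidean_space" and f :: "'a \<Rightarrow> 'b::{banach,second_countable_topology}"
  assumes [measurable]: "f \<in> borel_measurable borel" and c: "c \<noteq> 0"
  shows integrable_lborel_affine_iff: "integrable lborel (\<lambda>x. f (t + c *\<^sub>R x)) \<longleftrightarrow> integrable lborel f"
    and integral_lborel_affine: "(\<integral>x. f x \<partial>lborel) = (\<bar>c\<bar> ^ DIM('a)) *\<^sub>R (\<integral>x. f (t + c *\<^sub>R x) \<partial>lborel)"
proof -
  show "integrable lborel (\<lambda>x. f (t + c *\<^sub>R x)) \<longleftrightarrow> integrable lborel f"
  proof -
    have "integrable lborel f \<longleftrightarrow> integrable lborel (\<lambda>x. (\<bar>c\<bar> ^ DIM('a)) *\<^sub>R f (t + c *\<^sub>R x))"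
      using c by (subst lborel_affine[OF c, of t]) (simp add: integrable_density integrable_distr_eq)
    also have "\<dots> \<longleftrightarrow> integrable lborel (\<lambda>x. f (t + c *\<^sub>R x))"
      using c integrable_scaleR_right[of "inverse (\<bar>c\<bar> ^ DIM('a))" lborel "\<lambda>x. (\<bar>c\<bar> ^ DIM('a)) *\<^sub>R f (t + c *\<^sub>R x)"]
      by auto
    finally show ?thesis by simp
  qed
  show "(\<integral>x. f x \<partial>lborel) = (\<bar>c\<bar> ^ DIM('a)) *\<^sub>R (\<integral>x. f (t + c *\<^sub>R x) \<partial>lborel)"
    by (subst lborel_affine[OF c, of t])
      (simp add: integral_density integral_distr)
qed

lemma loc_int_measurable:
  assumes "loc_int u" shows "u \<in> borel_measurable borel"
proof (rule borel_measurable_LIMSEQ_metric)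
  show "(\<lambda>x. indicat_real (cball 0 (real n)) x *\<^sub>R u x) \<in> borel_measurable borel" for n
    using assms unfolding loc_int_def set_integrable_def
    by (metis borel_measurable_integrable compact_cball measurable_lborel2)
  show "(\<lambda>n. indicat_real (cball 0 (real n)) x *\<^sub>R u x) \<longlonglongrightarrow> u x" for x
  proof (rule tendsto_eventually)
    obtain N where "norm x \<le> real N" using real_arch_simple by blast
    then show "\<forall>\<^sub>F n in sequentially. indicat_real (cball 0 (real n)) x *\<^sub>R u x = u x"
      using eventually_sequentiallyI[of N] by (smt (verit) eventually_sequentiallyI indicator_simps(1) mem_cball_0 of_nat_mono scaleR_one)
  qed
qed

lemma loc_int_integrable_scaleR:
  assumes "loc_int u" "compact K" and m: "g \<in> borel_measurable borel" 
    and g: "\<And>x. \<bar>g x\<bar> \<le> B" "\<And>x. x \<notin> K \<Longrightarrow> g x = 0"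
  shows "integrable lborel (\<lambda>x. g x *\<^sub>R u x)"
proof -
  have "integrable lborel (\<lambda>x. B *\<^sub>R (indicat_real K x *\<^sub>R u x))"
    using assms(1,2) unfolding loc_int_def set_integrable_def by (intro integrable_scaleR_right) auto
  then show ?thesis
  proof (rule Bochner_Integration.integrable_bound)
    show "(\<lambda>x. g x *\<^sub>R u x) \<in> borel_measurable lborel"
      using m loc_int_measurable[OF assms(1)] by simp
    show "AE x in lborel. norm (g x *\<^sub>R u x) \<le> norm (B *\<^sub>R indicat_real K x *\<^sub>R u x)"
    proof (rule AE_I2)
      fix x show "norm (g x *\<^sub>R u x) \<le> norm (B *\<^sub>R indicat_real K x *\<^sub>R u x)"
        using g[of x] by (cases "x \<in> K") (auto intro!: mult_right_mono)
    qed
  qed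
qed

lemma loc_int_integrable_test:
  assumes "loc_int u" "test_function g"
  shows "integrable lborel (\<lambda>x. g x *\<^sub>R u x)"
proof -
  obtain K where "compact K" "\<And>x. x \<notin> K \<Longrightarrow> g x = 0" using test_function_support assms by metis
  moreover obtain B where "\<And>x. \<bar>g x\<bar> \<le> B" using test_function_bounded assms by metis
  ultimately show ?thesis
    using assms by (intro loc_int_integrable_scaleR[where K=K and B=B])
      (auto intro!: borel_measurable_continuous_onI test_function_continuous_on)
qed

lemma loc_int_continuous:
  fixes u :: "'a::euclidean_space \<Rightarrow> 'b::{banach,second_countable_topology}"
  shows "continuous_on UNIV u \<Longrightarrow> loc_int u"
  unfolding loc_int_def set_integrable_def
  using borel_integrable_compact continuous_on_subset by blast

lemma loc_int_add: "loc_int u \<Longrightarrow> loc_int w \<Longrightarrow> loc_int (\<lambda>x. u x + w x)"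
  unfolding loc_int_def by (auto intro: set_integral_add)

lemma loc_int_diff: "loc_int u \<Longrightarrow> loc_int w \<Longrightarrow> loc_int (\<lambda>x. u x - w x)"
  unfolding loc_int_def by (auto intro: set_integral_diff)

lemma loc_int_bounded_linear: 
  fixes u :: "'a::euclidean_space \<Rightarrow> 'b::{banach,second_countable_topology}"
    and T :: "'b \<Rightarrow> 'c::{banach,second_countable_topology}"
  assumes "bounded_linear T" "loc_int u" shows "loc_int (\<lambda>x. T (u x))"
  unfolding loc_int_def set_integrable_def
proof (intro allI impI)
  fix K :: "'a set" assume "compact K"
  then have "integrable lborel (\<lambda>x. T (indicator K x *\<^sub>R u x))"
    using assms unfolding loc_int_def set_integrable_def by (auto intro: integrable_bounded_linear)
  then show "integrable lborel (\<lambda>x. indicat_real K x *\<^sub>R T (u x))"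
    by (simp add: bounded_linear.linear[OF assms(1)] linear_scale)
qed

lemma loc_int_scaleR_continuous:
  fixes g :: "'a::euclidean_space \<Rightarrow> real"
  assumes "loc_int u" "continuous_on UNIV g" shows "loc_int (\<lambda>x. g x *\<^sub>R u x)"
  unfolding loc_int_def set_integrable_def
proof (intro allI impI)
  fix K :: "'a set" assume K: "compact K"
  have "bounded (g ` K)"
    using compact_continuous_image[OF continuous_on_subset[OF assms(2)] K] compact_imp_bounded by blast
  then obtain B where "B > 0" "\<And>x. x \<in> K \<Longrightarrow> \<bar>g x\<bar> \<le> B" unfolding bounded_pos by auto
  moreover have [measurable]: "g \<in> borel_measurable borel" "K \<in> sets borel"
    using assms(2) K by (auto intro: borel_measurable_continuous_onI simp: compact_imp_closed)
  ultimately have "integrable lborel (\<lambda>x. (indicator K x * g x) *\<^sub>R u x)"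
    using assms(1) K by (intro loc_int_integrable_scaleR[where K=K and B=B]) (auto simp: indicator_def)
  then show "integrable lborel (\<lambda>x. indicat_real K x *\<^sub>R g x *\<^sub>R u x)" by simp
qed

lemma loc_int_translate:
  fixes u :: "'a::euclidean_space \<Rightarrow> 'b::{banach,second_countable_topology}"
  assumes "loc_int u" shows "loc_int (\<lambda>x. u (a + x))"
  unfolding loc_int_def set_integrable_def
proof (intro allI impI)
  fix K :: "'a set" assume K: "compact K"
  have [measurable]: "u \<in> borel_measurable borel" by (rule loc_int_measurable[OF assms])
  let ?K = "(+) a ` K"
  have c: "compact ?K" using K by (simp add: compact_translation)
  then have [measurable]: "?K \<in> sets borel" by (simp add: compact_imp_closed)
  have "integrable lborel (\<lambda>x. indicat_real ?K (a + 1 *\<^sub>R x) *\<^sub>R u (a + 1 *\<^sub>R x))"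
    using assms c unfolding loc_int_def set_integrable_def
    by (subst integrable_lborel_affine_iff) auto
  then show "integrable lborel (\<lambda>x. indicat_real K x *\<^sub>R u (a + x))"
    by (simp add: indicator_def image_iff cong: if_cong)
qed

text \<open>The indicator of a box is the increasing limit of the test functions
  $1 - \exp(-k p)$, where $p$ is a smooth function that is positive exactly on the box. Hence the
  positive and the negative part of $D$ are densities of measures that agree on boxes.\<close>
lemma loc_int_AE_zero:
  fixes D :: "'a::euclidean_space \<Rightarrow> real"
  assumes D: "loc_int D" and test: "\<And>\<eta>. test_function \<eta> \<Longrightarrow> (\<integral>x. \<eta> x * D x \<partial>lborel) = 0"
  shows "AE x in lborel. D x = 0"
proof -
  have m[measurable]: "D \<in> borel_measurable borel" by (rule loc_int_measurable[OF D])
  have box0: "(\<integral>x. indicat_real (box a b) x * D x \<partial>lborel) = 0"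
    and boxi: "integrable lborel (\<lambda>x. indicat_real (box a b) x * D x)" for a b
  proof -
    define p where "p x = (\<Prod>i\<in>Basis. flat_exp 0 (x \<bullet> i - a \<bullet> i) * flat_exp 0 (b \<bullet> i - x \<bullet> i))" for x
    have sm: "smooth p"
    proof -
      have "smooth (\<lambda>x::'a. x \<bullet> i + (- (a \<bullet> i)))" "smooth (\<lambda>x::'a. b \<bullet> i + (-1) * (x \<bullet> i))" for i
        by (intro smooth_add smooth_mult smooth_const smooth_bounded_linear bounded_linear_inner_left)+
      from smooth_mult[OF smooth_flat_exp[OF this(1)] smooth_flat_exp[OF this(2)], of 0 _ 0]
      show ?thesis unfolding p_def by (intro smooth_prod) auto
    qed
    have p0: "p x \<ge> 0" for x unfolding p_def by (intro prod_nonneg) (auto simp: flat_exp_nonneg)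
    have ppos: "p x > 0" if "x \<in> box a b" for x
      unfolding p_def by (intro prod_pos) (use that in \<open>auto simp: flat_exp_pos_iff box_def\<close>)
    have pz: "p x = 0" if "x \<notin> box a b" for x
    proof -
      from that obtain i where "i \<in> Basis" "\<not> (a \<bullet> i < x \<bullet> i \<and> x \<bullet> i < b \<bullet> i)" by (auto simp: box_def)
      then show ?thesis unfolding p_def by (auto simp: flat_exp_def intro!: bexI[of _ i])
    qed
    define e where "e k x = 1 - exp (- real k * p x)" for k x
    have te: "test_function (e k)" for k
    proof (rule test_functionI[of _ "cbox a b"])
      have "smooth (\<lambda>x. 1 + (-1) * exp ((- real k) * p x))"
        by (intro smooth_add smooth_mult smooth_const smooth_exp sm)
      moreover have "e k = (\<lambda>x. 1 + (-1) * exp ((- real k) * p x))" by (simp add: e_def fun_eq_iff)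
      ultimately show "smooth (e k)" by simp
      show "x \<notin> cbox a b \<Longrightarrow> e k x = 0" for x
        using pz[of x] box_subset_cbox[of a b] by (auto simp: e_def)
    qed simp
    have dom: "integrable lborel (\<lambda>x. \<bar>indicat_real (cbox a b) x * D x\<bar>)"
      using D unfolding loc_int_def set_integrable_def by (intro integrable_abs) (auto dest: spec[of _ "cbox a b"])
    show "integrable lborel (\<lambda>x. indicat_real (box a b) x * D x)"
      using box_subset_cbox[of a b]
      by (intro Bochner_Integration.integrable_bound[OF dom]) (auto simp: indicator_def split: if_splits)
    have "(\<lambda>k. \<integral>x. e k x * D x \<partial>lborel) \<longlonglongrightarrow> (\<integral>x. indicat_real (box a b) x * D x \<partial>lborel)"
    proof (rule integral_dominated_convergence[OF _ _ dom])
      show "(\<lambda>x. e k x * D x) \<in> borel_measurable lborel" for k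
      proof -
        have [measurable]: "e k \<in> borel_measurable borel"
          using te[of k] by (intro borel_measurable_continuous_onI test_function_continuous_on)
        show ?thesis by measurable
      qed
      show "AE x in lborel. (\<lambda>k. e k x * D x) \<longlonglongrightarrow> indicat_real (box a b) x * D x"
      proof (rule AE_I2)
        fix x
        have "(\<lambda>k. e k x) \<longlonglongrightarrow> indicat_real (box a b) x"
        proof (cases "x \<in> box a b")
          case True
          have "(\<lambda>k. exp (- real k * p x)) = (\<lambda>k. (exp (- p x)) ^ k)"
            by (simp add: exp_of_nat_mult[symmetric])
          moreover have "exp (- p x) < 1" using ppos[OF True] by simp
          ultimately have "(\<lambda>k. exp (- real k * p x)) \<longlonglongrightarrow> 0" by (simp add: LIMSEQ_power_zero)
          from tendsto_diff[OF tendsto_const this, of 1] True show ?thesis by (simp add: e_def)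
        next
          case False
          then show ?thesis using pz[OF False] by (simp add: e_def)
        qed
        then show "(\<lambda>k. e k x * D x) \<longlonglongrightarrow> indicat_real (box a b) x * D x" by (intro tendsto_intros)
      qed
      show "AE x in lborel. norm (e k x * D x) \<le> \<bar>indicat_real (cbox a b) x * D x\<bar>" for k
      proof (rule AE_I2)
        fix x
        have "\<bar>e k x\<bar> \<le> indicat_real (cbox a b) x"
          using p0[of x] pz[of x] box_subset_cbox[of a b] by (cases "x \<in> box a b") (auto simp: e_def indicator_def)
        then show "norm (e k x * D x) \<le> \<bar>indicat_real (cbox a b) x * D x\<bar>"
          by (simp add: abs_mult mult_right_mono)
      qed
    qed auto
    then show "(\<integral>x. indicat_real (box a b) x * D x \<partial>lborel) = 0"
      by (simp add: test[OF te] LIMSEQ_const_iff)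
  qed
  let ?P = "\<lambda>x. ennreal (D x)" and ?N = "\<lambda>x. ennreal (- D x)"
  have eqbox: "emeasure (density lborel ?P) (box a b) = emeasure (density lborel ?N) (box a b)"
    and finbox: "emeasure (density lborel ?P) (box a b) \<noteq> \<infinity>" for a b
  proof -
    let ?f = "\<lambda>x. indicat_real (box a b) x * D x"
    have ep: "emeasure (density lborel ?P) (box a b) = (\<integral>\<^sup>+x. ennreal (?f x) \<partial>lborel)"
      by (subst emeasure_density) (auto intro!: nn_integral_cong simp: indicator_def)
    have en: "emeasure (density lborel ?N) (box a b) = (\<integral>\<^sup>+x. ennreal (- ?f x) \<partial>lborel)"
      by (subst emeasure_density) (auto intro!: nn_integral_cong simp: indicator_def)
    have fin: "(\<integral>\<^sup>+x. ennreal (?f x) \<partial>lborel) \<noteq> \<infinity>" "(\<integral>\<^sup>+x. ennreal (- ?f x) \<partial>lborel) \<noteq> \<infinity>"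
      using boxi[of a b] by (auto simp: real_integrable_def)
    have "enn2real (\<integral>\<^sup>+x. ennreal (?f x) \<partial>lborel) = enn2real (\<integral>\<^sup>+x. ennreal (- ?f x) \<partial>lborel)"
      using real_lebesgue_integral_def[OF boxi[of a b]] box0[of a b] by simp
    from arg_cong[OF this, of ennreal]
    show "emeasure (density lborel ?P) (box a b) = emeasure (density lborel ?N) (box a b)"
      unfolding ep en ennreal_enn2real_if using fin by (simp only: infinity_ennreal_def if_False)
    show "emeasure (density lborel ?P) (box a b) \<noteq> \<infinity>" using ep fin by simp
  qed
  have "density lborel ?P = density lborel ?N"
  proof (rule measure_eqI_generator_eq)
    let ?E = "range (\<lambda>(a, b). box a b::'a set)"
    show "Int_stable ?E" by (auto simp: Int_stable_def box_Int_box)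
    show "?E \<subseteq> Pow UNIV" "sets (density lborel ?P) = sigma_sets UNIV ?E" "sets (density lborel ?N) = sigma_sets UNIV ?E"
      by (simp_all add: borel_eq_box)
    let ?A = "\<lambda>n::nat. box (- (real n *\<^sub>R One)) (real n *\<^sub>R One) :: 'a set"
    show "range ?A \<subseteq> ?E" "(\<Union>i. ?A i) = UNIV" unfolding UN_box_eq_UNIV by auto
    show "emeasure (density lborel ?P) (?A i) \<noteq> \<infinity>" for i by (rule finbox)
    show "emeasure (density lborel ?P) X = emeasure (density lborel ?N) X" if "X \<in> ?E" for X
      using that eqbox by auto
  qed
  then have "AE x in lborel. ?P x = ?N x" by (intro sigma_finite_measure.density_unique[OF sigma_finite_lborel]) auto
  then show ?thesis
  proof eventually_elim
    case (elim x)
    have "D x \<le> 0 \<or> - D x \<le> 0" by linarith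
    then show ?case using elim by (auto simp: ennreal_neg ennreal_eq_0_iff)
  qed
qed

section \<open>Weak derivatives of differentiable functions\<close>

lemma directional_quotient_tendsto:
  fixes f :: "'a::real_normed_vector \<Rightarrow> 'b::real_normed_vector"
  assumes "(f has_derivative f') (at x)"
  shows "(\<lambda>n. real (Suc n) *\<^sub>R (f (x + (1 / real (Suc n)) *\<^sub>R b) - f x)) \<longlonglongrightarrow> f' b"
proof -
  have "((\<lambda>t. f (x + t *\<^sub>R b)) has_derivative (\<lambda>t. f' (t *\<^sub>R b))) (at 0)"
    by (rule has_derivative_compose[of "\<lambda>t. x + t *\<^sub>R b"]) (auto intro!: derivative_eq_intros simp: assms)
  then have "((\<lambda>h. norm (f (x + h *\<^sub>R b) - f x - h *\<^sub>R f' b) / norm h) \<longlongrightarrow> 0) (at 0)"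
    by (simp add: has_derivative_at linear_scale[OF has_derivative_linear[OF assms]])
  then have "((\<lambda>h. norm ((f (x + h *\<^sub>R b) - f x) /\<^sub>R h - f' b)) \<longlongrightarrow> 0) (at 0)"
  proof (rule Lim_transform_eventually)
    have "norm (f (x + h *\<^sub>R b) - f x - h *\<^sub>R f' b) / norm h = norm ((f (x + h *\<^sub>R b) - f x) /\<^sub>R h - f' b)"
      if "h \<noteq> 0" for h
    proof -
      have "(f (x + h *\<^sub>R b) - f x) /\<^sub>R h - f' b = (f (x + h *\<^sub>R b) - f x - h *\<^sub>R f' b) /\<^sub>R h"
        using that by (simp add: algebra_simps)
      then show ?thesis by (simp add: divide_inverse mult.commute)
    qed
    then show "\<forall>\<^sub>F h in at 0. norm (f (x + h *\<^sub>R b) - f x - h *\<^sub>R f' b) / norm h = norm ((f (x + h *\<^sub>R b) - f x) /\<^sub>R h - f' b)"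
      by (simp add: eventually_at_filter)
  qed
  then have "((\<lambda>h. (f (x + h *\<^sub>R b) - f x) /\<^sub>R h) \<longlongrightarrow> f' b) (at 0)"
    by (simp add: tendsto_norm_zero_iff LIM_zero_iff)
  moreover have "filterlim (\<lambda>n. 1 / real (Suc n)) (at 0) sequentially"
    using LIMSEQ_Suc[OF lim_1_over_n[where 'a=real]] by (intro filterlim_atI) (simp_all del: of_nat_Suc)
  ultimately have "(\<lambda>n. (f (x + (1 / real (Suc n)) *\<^sub>R b) - f x) /\<^sub>R (1 / real (Suc n))) \<longlonglongrightarrow> f' b"
    by (rule filterlim_compose)
  then show ?thesis by simp
qed

lemma measurable_directional_derivative:
  fixes f :: "'a::euclidean_space \<Rightarrow> 'b::{real_normed_vector,second_countable_topology}"
  assumes d: "\<And>x. (f has_derivative f' x) (at x)"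
  shows "(\<lambda>x. f' x b) \<in> borel_measurable borel"
proof (rule borel_measurable_LIMSEQ_metric)
  have c: "continuous_on UNIV f"
    using d by (meson continuous_at_imp_continuous_on has_derivative_continuous)
  show "(\<lambda>x. real (Suc n) *\<^sub>R (f (x + (1 / real (Suc n)) *\<^sub>R b) - f x)) \<in> borel_measurable borel" for n
    by (intro borel_measurable_continuous_onI continuous_intros continuous_on_compose2[OF c]) auto
  show "(\<lambda>n. real (Suc n) *\<^sub>R (f (x + (1 / real (Suc n)) *\<^sub>R b) - f x)) \<longlonglongrightarrow> f' x b" for x
    by (rule directional_quotient_tendsto[OF d])
qed

lemma directional_mean_value_bound:
  fixes f :: "'a::real_normed_vector \<Rightarrow> 'b::real_normed_vector"
  assumes d: "\<And>x. (f has_derivative f' x) (at x)" and B: "\<And>t. 0 \<le> t \<Longrightarrow> t \<le> h \<Longrightarrow> norm (f' (x + t *\<^sub>R b) b) \<le> C" and "h \<ge> 0"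
  shows "norm (f (x + h *\<^sub>R b) - f x) \<le> C * h"
proof -
  have v: "((\<lambda>t. f (x + t *\<^sub>R b)) has_derivative (\<lambda>s. s *\<^sub>R f' (x + t *\<^sub>R b) b)) (at t within {0..h})" for t
  proof -
    have "((\<lambda>t. f (x + t *\<^sub>R b)) has_derivative (\<lambda>s. f' (x + t *\<^sub>R b) (s *\<^sub>R b))) (at t within {0..h})"
      by (rule has_derivative_compose[of "\<lambda>t. x + t *\<^sub>R b"]) (auto intro!: derivative_eq_intros simp: d)
    then show ?thesis
      by (simp add: linear_scale[OF has_derivative_linear[OF d]])
  qed
  have "norm (f (x + h *\<^sub>R b) - f (x + 0 *\<^sub>R b)) \<le> C * norm (h - 0)"
  proof (rule differentiable_bound[of "{0..h}"])
    show "onorm (\<lambda>s. s *\<^sub>R f' (x + t *\<^sub>R b) b) \<le> C" if "t \<in> {0..h}" for t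
      using B[of t] that by (intro onorm_le) (simp add: mult.commute[of C] mult_left_mono)
  qed (use v \<open>h \<ge> 0\<close> in auto)
  then show ?thesis using \<open>h \<ge> 0\<close> by simp
qed

text \<open>Each difference quotient integrates to 0 by translation invariance, the mean value
  theorem bounds the quotients, and dominated convergence passes to the limit. A bounded partial
  derivative suffices, so continuity of the derivative of the vortex ring never has to be
  shown.\<close>

lemma integral_directional_derivative:
  fixes f :: "'a::euclidean_space \<Rightarrow> 'b::{banach,second_countable_topology}"
  assumes d: "\<And>x. (f has_derivative f' x) (at x)" and B: "\<And>x. norm (f' x b) \<le> C"
    and K: "compact K" "\<And>x. x \<notin> K \<Longrightarrow> f x = 0"
  shows "integrable lborel (\<lambda>x. f' x b)" and "(\<integral>x. f' x b \<partial>lborel) = 0"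
proof -
  define q where "q n x = real (Suc n) *\<^sub>R (f (x + (1 / real (Suc n)) *\<^sub>R b) - f x)" for n x
  have c: "continuous_on UNIV f"
    using d by (meson continuous_at_imp_continuous_on has_derivative_continuous)
  have [measurable]: "f \<in> borel_measurable borel" using c by (rule borel_measurable_continuous_onI)
  have fi: "integrable lborel f"
  proof -
    have "integrable lborel (\<lambda>x. indicator K x *\<^sub>R f x)"
      using borel_integrable_compact[OF K(1) continuous_on_subset[OF c]] by auto
    moreover have "(\<lambda>x. indicator K x *\<^sub>R f x) = f" using K(2) by (auto simp: indicator_def)
    ultimately show ?thesis by simp
  qed
  \<comment> \<open>The support swept backwards along \<open>b\<close> over unit length. It contains
    the supports of all the difference quotients, whose steps are at most 1.\<close>
  let ?K = "(\<lambda>(x, s). x - s *\<^sub>R b) ` (K \<times> {0..1})"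
  have cK: "compact ?K"
    by (intro compact_continuous_image compact_Times K compact_Icc) (auto intro!: continuous_intros simp: split_def)
  have dom: "integrable lborel (\<lambda>x. C * indicat_real ?K x)"
    using borel_integrable_compact[OF cK, of "\<lambda>_. C"] by (simp add: mult.commute)
  have C0: "C \<ge> 0" using B[of 0] norm_ge_zero order_trans by blast
  have lim: "AE x in lborel. (\<lambda>n. q n x) \<longlonglongrightarrow> f' x b"
    unfolding q_def using directional_quotient_tendsto[OF d] by simp
  have bnd: "AE x in lborel. norm (q n x) \<le> C * indicat_real ?K x" for n
  proof (rule AE_I2)
    fix x
    show "norm (q n x) \<le> C * indicat_real ?K x"
    proof (cases "x \<in> ?K")
      case True
      have "norm (f (x + (1 / real (Suc n)) *\<^sub>R b) - f x) \<le> C * (1 / real (Suc n))"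
        by (rule directional_mean_value_bound[OF d]) (auto intro: B)
      then have "real (Suc n) * norm (f (x + (1 / real (Suc n)) *\<^sub>R b) - f x) \<le> real (Suc n) * (C * (1 / real (Suc n)))"
        by (intro mult_left_mono) auto
      also have "\<dots> = C" by simp
      finally show ?thesis using True by (simp add: q_def)
    next
      case False
      have "x \<notin> K" using False by (force intro: image_eqI[of _ _ "(x, 0)"])
      moreover have "x + (1 / real (Suc n)) *\<^sub>R b \<notin> K"
        using False by (force intro: image_eqI[of _ _ "(x + (1 / real (Suc n)) *\<^sub>R b, 1 / real (Suc n))"])
      ultimately show ?thesis using K(2) False by (simp add: q_def)
    qed
  qed
  have mq: "q n \<in> borel_measurable lborel" for n unfolding q_def by measurable
  have mf: "(\<lambda>x. f' x b) \<in> borel_measurable lborel" using measurable_directional_derivative[OF d] by simp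
  show "integrable lborel (\<lambda>x. f' x b)"
    by (rule integrable_dominated_convergence[OF mf mq dom lim bnd])
  have "(\<lambda>n. \<integral>x. q n x \<partial>lborel) \<longlonglongrightarrow> (\<integral>x. f' x b \<partial>lborel)"
    by (rule integral_dominated_convergence[OF mf mq dom lim bnd])
  moreover have "(\<integral>x. q n x \<partial>lborel) = 0" for n
  proof -
    let ?a = "(1 / real (Suc n)) *\<^sub>R b"
    have "integrable lborel (\<lambda>x. f (?a + 1 *\<^sub>R x))" "(\<integral>x. f x \<partial>lborel) = (\<integral>x. f (?a + 1 *\<^sub>R x) \<partial>lborel)"
      using integrable_lborel_affine_iff[of f 1 ?a] integral_lborel_affine[of f 1 ?a] fi by auto
    then show ?thesis unfolding q_def using fi by (simp add: add.commute)
  qed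
  ultimately show "(\<integral>x. f' x b \<partial>lborel) = 0" by (simp add: LIMSEQ_const_iff)
qed

text \<open>The product of \<open>u\<close> with a test function has compact support and a bounded
  derivative along \<open>b\<close>, so the integral of that derivative vanishes; the product rule
  turns this into integration by parts. It is applied to the ring, to the mollification
  \<open>f\<close> and to the phase.\<close>

lemma weak_partial_differentiable:
  fixes u :: "'a::euclidean_space \<Rightarrow> 'b::{banach,second_countable_topology}"
  assumes d: "\<And>x. (u has_derivative u' x) (at x)"
    and B: "\<And>K. compact K \<Longrightarrow> \<exists>C. \<forall>x\<in>K. norm (u' x b) \<le> C"
  shows "weak_partial u b (\<lambda>x. u' x b)"
  unfolding weak_partial_def
proof (intro conjI allI impI)
  have c: "continuous_on UNIV u"
    using d by (meson continuous_at_imp_continuous_on has_derivative_continuous)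
  show lu: "loc_int u" using c by (rule loc_int_continuous)
  have [measurable]: "(\<lambda>x. u' x b) \<in> borel_measurable borel" by (rule measurable_directional_derivative[OF d])
  show lu': "loc_int (\<lambda>x. u' x b)"
    unfolding loc_int_def set_integrable_def
  proof (intro allI impI)
    fix K :: "'a set" assume K: "compact K"
    then have [measurable]: "K \<in> sets borel" by (simp add: compact_imp_closed)
    obtain C where C: "\<forall>x\<in>K. norm (u' x b) \<le> C" using B[OF K] by blast
    have "integrable lborel (\<lambda>x. C * indicat_real K x)"
      using borel_integrable_compact[OF K, of "\<lambda>_. C"] by (simp add: mult.commute)
    then show "integrable lborel (\<lambda>x. indicat_real K x *\<^sub>R u' x b)"
    proof (rule Bochner_Integration.integrable_bound)
      show "AE x in lborel. norm (indicat_real K x *\<^sub>R u' x b) \<le> norm (C * indicat_real K x)"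
        by (rule AE_I2) (use C in \<open>force simp: indicator_def\<close>)
    qed measurable
  qed
  fix p :: "'a \<Rightarrow> real" assume p: "test_function p"
  let ?p' = "\<lambda>x. frechet_derivative p (at x)"
  obtain K where K: "compact K" "\<And>x. x \<notin> K \<Longrightarrow> p x = 0" "\<And>x v. x \<notin> K \<Longrightarrow> ?p' x v = 0"
    using test_function_support p by blast
  have pd: "((\<lambda>x. p x *\<^sub>R u x) has_derivative (\<lambda>v. p x *\<^sub>R u' x v + ?p' x v *\<^sub>R u x)) (at x)" for x
    by (rule has_derivative_scaleR[OF smooth_has_derivative[OF test_function_smooth[OF p]] d])
  obtain C1 where C1: "\<forall>x\<in>K. norm (u' x b) \<le> C1" using B[OF K(1)] by blast
  obtain C2 where C2: "\<forall>x\<in>K. norm (u x) \<le> C2"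
    using compact_imp_bounded[OF compact_continuous_image[OF continuous_on_subset[OF c] K(1)]]
    unfolding bounded_pos by auto
  obtain B1 where B1: "B1 > 0" "\<And>x. \<bar>p x\<bar> \<le> B1" using test_function_bounded[OF p] by blast
  obtain B2 where B2: "B2 > 0" "\<And>x. \<bar>?p' x b\<bar> \<le> B2"
    using test_function_bounded[OF test_function_frechet_derivative[OF p]] by blast
  have bd: "norm (p x *\<^sub>R u' x b + ?p' x b *\<^sub>R u x) \<le> B1 * \<bar>C1\<bar> + B2 * \<bar>C2\<bar>" for x
  proof (cases "x \<in> K")
    case True
    have "norm (p x *\<^sub>R u' x b + ?p' x b *\<^sub>R u x) \<le> \<bar>p x\<bar> * norm (u' x b) + \<bar>?p' x b\<bar> * norm (u x)"
      by (metis norm_scaleR norm_triangle_ineq)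
    also have "\<dots> \<le> B1 * \<bar>C1\<bar> + B2 * \<bar>C2\<bar>"
      using True C1 C2 B1 B2 by (intro add_mono mult_mono) force+
    finally show ?thesis .
  next
    case False
    then show ?thesis using K B1 B2 by simp
  qed
  have i1: "integrable lborel (\<lambda>x. p x *\<^sub>R u' x b)" by (rule loc_int_integrable_test[OF lu' p])
  have i2: "integrable lborel (\<lambda>x. ?p' x b *\<^sub>R u x)"
    by (rule loc_int_integrable_test[OF lu test_function_frechet_derivative[OF p]])
  have "(\<integral>x. p x *\<^sub>R u' x b + ?p' x b *\<^sub>R u x \<partial>lborel) = 0"
    by (rule integral_directional_derivative(2)[OF pd bd K(1)]) (simp add: K(2))
  then show "(\<integral>x. ?p' x b *\<^sub>R u x \<partial>lborel) = - (\<integral>x. p x *\<^sub>R u' x b \<partial>lborel)"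
    using i1 i2 by (simp add: eq_neg_iff_add_eq_0 add.commute)
qed

lemma integral_norm_le:
  fixes f :: "'a \<Rightarrow> 'b::{banach,second_countable_topology}"
  assumes "integrable M g" "\<And>x. norm (f x) \<le> g x"
  shows "norm (integral\<^sup>L M f) \<le> integral\<^sup>L M g"
  using integral_norm_bound[of M f] integral_mono'[OF assms(1), of "\<lambda>x. norm (f x)"] assms(2)
  by (meson norm_ge_zero order_trans)

section \<open>The momentum functional is well defined\<close>

lemma smooth_directional_mvt:
  assumes f: "smooth f" and h: "h > 0"
  obtains \<xi> where "0 < \<xi>" "\<xi> < h" "f (x + h *\<^sub>R v) - f x = h * frechet_derivative f (at (x + \<xi> *\<^sub>R v)) v"
proof -
  have "((\<lambda>t. f (x + t *\<^sub>R v)) has_real_derivative frechet_derivative f (at (x + t *\<^sub>R v)) v) (at t)" for t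
  proof -
    have "((\<lambda>t. f (x + t *\<^sub>R v)) has_derivative (\<lambda>s. frechet_derivative f (at (x + t *\<^sub>R v)) (s *\<^sub>R v))) (at t)"
      by (rule has_derivative_compose[of "\<lambda>t. x + t *\<^sub>R v"])
        (auto intro!: derivative_eq_intros simp: smooth_has_derivative[OF f])
    moreover have "linear (frechet_derivative f (at (x + t *\<^sub>R v)))"
      using smooth_has_derivative[OF f] has_derivative_linear by blast
    ultimately show ?thesis
      by (simp add: has_field_derivative_def linear_scale mult_commute_abs)
  qed
  from MVT2[OF h this] show ?thesis using that by auto
qed

text \<open>The second difference \<open>\<Delta> h v w\<close> is symmetric in \<open>v\<close> and
  \<open>w\<close>. Two applications of the mean value theorem, first along \<open>v\<close> and
  then along \<open>w\<close>, identify \<open>\<Delta> h v w / h^2\<close> with a mixed derivative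
  at a point that tends to \<open>x\<close>; exchanging the directions gives the other
  order.\<close>

lemma smooth_second_derivative_symmetric:
  assumes f: "smooth f"
  shows "frechet_derivative (\<lambda>x. frechet_derivative f (at x) v) (at x) w
    = frechet_derivative (\<lambda>x. frechet_derivative f (at x) w) (at x) v"
proof -
  define D where "D v w y = frechet_derivative (\<lambda>x. frechet_derivative f (at x) v) (at y) w" for v w y
  define \<Delta> where "\<Delta> h v w = f (x + h *\<^sub>R v + h *\<^sub>R w) - f (x + h *\<^sub>R v) - f (x + h *\<^sub>R w) + f x" for h v w
  have lim: "(\<lambda>n. \<Delta> (1 / real (Suc n)) v w / (1 / real (Suc n))\<^sup>2) \<longlonglongrightarrow> D v w x" for v w
  proof -
    have ex: "\<exists>y. norm (y - x) \<le> h * (norm v + norm w) \<and> \<Delta> h v w / h\<^sup>2 = D v w y" if h: "h > 0" for h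
    proof -
      let ?g = "\<lambda>y. f (y + h *\<^sub>R w) + (-1) * f y"
      have sw: "smooth (\<lambda>y. f (y + h *\<^sub>R w))" using smooth_compose_affine[OF bounded_linear_ident f] by simp
      have sg: "smooth ?g" by (intro smooth_add smooth_mult smooth_const f sw)
      have dg: "frechet_derivative ?g (at y) v = frechet_derivative f (at (y + h *\<^sub>R w)) v - frechet_derivative f (at y) v" for y
      proof -
        have "((\<lambda>y. f (y + h *\<^sub>R w)) has_derivative frechet_derivative f (at (y + h *\<^sub>R w))) (at y)"
          by (rule has_derivative_compose[of "\<lambda>y. y + h *\<^sub>R w" "\<lambda>v. v"])
            (auto intro!: derivative_eq_intros smooth_has_derivative[OF f])
        then have "(?g has_derivative (\<lambda>v. frechet_derivative f (at (y + h *\<^sub>R w)) v + (-1) * frechet_derivative f (at y) v)) (at y)"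
          by (intro has_derivative_add has_derivative_mult_right smooth_has_derivative[OF f])
        from fun_cong[OF frechet_derivative_at[OF this], of v] show ?thesis by simp
      qed
      obtain \<xi> where \<xi>: "0 < \<xi>" "\<xi> < h" "?g (x + h *\<^sub>R v) - ?g x = h * frechet_derivative ?g (at (x + \<xi> *\<^sub>R v)) v"
        using smooth_directional_mvt[OF sg h] by blast
      obtain \<zeta> where \<zeta>: "0 < \<zeta>" "\<zeta> < h"
        "frechet_derivative f (at ((x + \<xi> *\<^sub>R v) + h *\<^sub>R w)) v - frechet_derivative f (at (x + \<xi> *\<^sub>R v)) v = h * D v w (x + \<xi> *\<^sub>R v + \<zeta> *\<^sub>R w)"
        using smooth_directional_mvt[OF smooth_frechet_derivative[OF f, of v] h] unfolding D_def by blast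
      have "\<Delta> h v w = ?g (x + h *\<^sub>R v) - ?g x" by (simp add: \<Delta>_def)
      also have "\<dots> = h * (h * D v w (x + \<xi> *\<^sub>R v + \<zeta> *\<^sub>R w))" using \<xi>(3) dg \<zeta>(3) by simp
      finally have "\<Delta> h v w / h\<^sup>2 = D v w (x + \<xi> *\<^sub>R v + \<zeta> *\<^sub>R w)" using h by (simp add: power2_eq_square)
      moreover have "norm (x + \<xi> *\<^sub>R v + \<zeta> *\<^sub>R w - x) \<le> h * (norm v + norm w)"
      proof -
        have "norm (x + \<xi> *\<^sub>R v + \<zeta> *\<^sub>R w - x) \<le> \<xi> * norm v + \<zeta> * norm w"
          using norm_triangle_ineq[of "\<xi> *\<^sub>R v" "\<zeta> *\<^sub>R w"] \<xi> \<zeta> by (simp add: algebra_simps)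
        also have "\<dots> \<le> h * norm v + h * norm w" using \<xi> \<zeta> by (intro add_mono mult_right_mono) auto
        finally show ?thesis by (simp add: algebra_simps)
      qed
      ultimately show ?thesis by blast
    qed
    then have "\<forall>n. \<exists>y. norm (y - x) \<le> (1 / real (Suc n)) * (norm v + norm w) \<and> \<Delta> (1 / real (Suc n)) v w / (1 / real (Suc n))\<^sup>2 = D v w y"
      by (intro allI ex) simp
    then obtain y where y: "\<And>n. norm (y n - x) \<le> (1 / real (Suc n)) * (norm v + norm w)"
      "\<And>n. \<Delta> (1 / real (Suc n)) v w / (1 / real (Suc n))\<^sup>2 = D v w (y n)" by metis
    have "(\<lambda>n. (1 / real (Suc n)) * (norm v + norm w)) \<longlonglongrightarrow> 0 * (norm v + norm w)"
      by (intro tendsto_intros LIMSEQ_Suc lim_1_over_n)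
    then have "(\<lambda>n. y n - x) \<longlonglongrightarrow> 0"
      using y(1) by (intro Lim_null_comparison[of "\<lambda>n. y n - x" "\<lambda>n. (1 / real (Suc n)) * (norm v + norm w)"]) (auto simp del: of_nat_Suc)
    then have "y \<longlonglongrightarrow> x" by (simp add: LIM_zero_iff)
    moreover have "isCont (D v w) x"
      using smooth_continuous_on[OF smooth_frechet_derivative[OF smooth_frechet_derivative[OF f, of v], of w], of UNIV]
      by (simp add: D_def[abs_def] continuous_on_eq_continuous_at)
    ultimately have "(\<lambda>n. D v w (y n)) \<longlonglongrightarrow> D v w x" using isCont_tendsto_compose by blast
    then show ?thesis using y(2) by (simp del: of_nat_Suc)
  qed
  have "\<Delta> h v w = \<Delta> h w v" for h by (simp add: \<Delta>_def add_ac)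
  with lim[of v w] lim[of w v] have "D v w x = D w v x" by (metis (no_types, lifting) LIMSEQ_unique ext)
  then show ?thesis by (simp add: D_def)
qed

lemma e1_Basis: "(e1::'a::euclidean_space) \<in> Basis"
  unfolding e1_def by (rule SOME_Basis)

text \<open>Testing with $\eta(x) = x_2\, \omega(x_1/R, x'/k)$, where $R$ is a large power of $k$:
  $\int v\, \partial_2 \eta$ tends to $\int v$, while $\int \partial_1\phi\, \partial_2\eta
  = \int \partial_2\phi\, \partial_1\eta$ tends to $0$ by the Cauchy-Schwarz inequality. This is where
  $N \ge 2$ is needed.\<close>
lemma integral_zero_of_grad_L2:
  fixes v \<phi> :: "'a::euclidean_space \<Rightarrow> real"
  assumes N2: "DIM('a) \<ge> 2" and v: "integrable lborel v" and G: "grad_L2 \<phi> H"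
    and ae: "AE x in lborel. v x = H e1 x"
  shows "(\<integral>x. v x \<partial>lborel) = 0"
proof -
  let ?e = "e1::'a"
  have eB: "?e \<in> Basis" by (rule e1_Basis)
  have "\<exists>b2::'a. b2 \<in> Basis \<and> b2 \<noteq> ?e"
  proof (rule ccontr)
    assume "\<not> ?thesis"
    then have "(Basis::'a set) \<subseteq> {?e}" by auto
    then have "card (Basis::'a set) \<le> card {?e}" by (intro card_mono) auto
    then show False using N2 by simp
  qed
  then obtain b2 :: 'a where b2: "b2 \<in> Basis" "b2 \<noteq> ?e" by auto
  have ip: "?e \<bullet> ?e = 1" "b2 \<bullet> b2 = 1" "b2 \<bullet> ?e = 0" "?e \<bullet> b2 = 0" using eB b2 by (auto simp: inner_Basis)
  define \<omega> where "\<omega> y = ball_bump y * (1 / ball_bump (0::'a))" for y :: 'a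
  have t\<omega>: "test_function \<omega>" unfolding \<omega>_def by (intro test_function_mult_smooth test_function_ball_bump smooth_const)
  have s\<omega>: "smooth \<omega>" by (rule test_function_smooth[OF t\<omega>])
  have \<omega>0: "\<omega> 0 = 1" by (simp add: \<omega>_def less_imp_neq[OF ball_bump_0_pos(1), symmetric])
  define \<omega>' where "\<omega>' y = frechet_derivative \<omega> (at y)" for y
  have lin\<omega>': "linear (\<omega>' y)" for y
    unfolding \<omega>'_def using smooth_has_derivative[OF s\<omega>] has_derivative_linear by blast
  have t2: "test_function (\<lambda>y. \<omega>' y w * (y \<bullet> b2))" for w
    unfolding \<omega>'_def by (intro test_function_mult_smooth test_function_frechet_derivative t\<omega> smooth_bounded_linear bounded_linear_inner_left)
  \<comment> \<open>In the stretched variable \<open>L k x\<close>, \<open>g\<close> is the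
    derivative of \<open>\<eta> k\<close> along \<open>b2\<close>, and \<open>g1\<close> below is
    its derivative along \<open>e1\<close> up to the factor \<open>k/k^m\<close>. The value
    \<open>g 0 = 1\<close> is what leaves the integral of \<open>v\<close> in the limit.\<close>
  define g where "g y = \<omega> y + \<omega>' y b2 * (y \<bullet> b2)" for y
  have gc: "continuous_on UNIV g"
    unfolding g_def by (intro continuous_intros test_function_continuous_on[OF t\<omega>] test_function_continuous_on[OF t2, of UNIV])
  obtain B0 where "\<And>y. \<bar>\<omega> y\<bar> \<le> B0" using test_function_bounded[OF t\<omega>] by blast
  moreover obtain B1 where "\<And>y. \<bar>\<omega>' y b2 * (y \<bullet> b2)\<bar> \<le> B1" using test_function_bounded[OF t2] by blast
  ultimately have gB: "\<bar>g y\<bar> \<le> B0 + B1" for y unfolding g_def by (metis abs_triangle_ineq add_mono order_trans)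
  define g1 where "g1 y = \<omega>' y ?e * (y \<bullet> b2)" for y
  obtain B where B: "\<And>y. \<bar>g1 y\<bar> \<le> B" using test_function_bounded[OF t2] unfolding g1_def by blast
  obtain K where K: "compact K" "\<And>y. y \<notin> K \<Longrightarrow> g1 y = 0"
    using test_function_support[OF t2[of ?e]] unfolding g1_def by metis
  obtain r where r: "r > 0" "\<And>y. y \<in> K \<Longrightarrow> norm y \<le> r" using compact_imp_bounded[OF K(1)] unfolding bounded_pos by auto
  \<comment> \<open>The test function has length \<open>k^m\<close> along \<open>e1\<close> and
    width \<open>k\<close> in the other directions. This exponent is the one for which
    \<open>k^3 * k * k^m * k^(N-1)\<close>, collected below from the squared derivative, the weight
    and the volume of the box, equals \<open>(k^m)^2\<close>; here \<open>N\<close> is the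
    dimension.\<close>
  define m where "m = DIM('a) + 3"
  define L where "L k x = (1/k) *\<^sub>R x + ((1/k^m - 1/k) * (x \<bullet> ?e)) *\<^sub>R ?e" for k :: real and x :: 'a
  have blL: "bounded_linear (L k)" for k
    unfolding L_def by (intro bounded_linear_intros bounded_linear_add bounded_linear_scaleR_right
        bounded_linear_compose[OF bounded_linear_scaleR_left] bounded_linear_mult_right[THEN bounded_linear_compose] bounded_linear_inner_left)
  have Le: "L k x \<bullet> ?e = (x \<bullet> ?e) / k^m" for k x
    by (simp add: L_def inner_simps ip algebra_simps)
  have Lb: "L k x \<bullet> b = (x \<bullet> b) / k" if "b \<in> Basis" "b \<noteq> ?e" for k x b
    using that eB by (simp add: L_def inner_simps inner_Basis)
  have Le1: "L k ?e = (1/k^m) *\<^sub>R ?e" for k by (simp add: L_def ip algebra_simps)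
  have Lb2: "L k b2 = (1/k) *\<^sub>R b2" for k by (simp add: L_def ip)
  define \<eta> where "\<eta> k x = \<omega> (L k x) * (x \<bullet> b2)" for k x
  have tL: "test_function (\<lambda>x. \<omega> (L k x))" if "k > 0" for k
  proof -
    define M where "M x = k *\<^sub>R x + ((k^m - k) * (x \<bullet> ?e)) *\<^sub>R ?e" for x
    have "bounded_linear M"
      unfolding M_def by (intro bounded_linear_intros bounded_linear_add bounded_linear_scaleR_right
        bounded_linear_compose[OF bounded_linear_scaleR_left] bounded_linear_mult_right[THEN bounded_linear_compose] bounded_linear_inner_left)
    moreover have "M (L k x) = x" for x
    proof -
      have "M (L k x) = k *\<^sub>R L k x + ((k^m - k) * ((x \<bullet> ?e) / k^m)) *\<^sub>R ?e" by (simp add: M_def Le)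
      also have "k *\<^sub>R L k x = x + ((k/k^m - 1) * (x \<bullet> ?e)) *\<^sub>R ?e"
        using that by (simp add: L_def scaleR_add_right field_simps)
      also have "x + ((k/k^m - 1) * (x \<bullet> ?e)) *\<^sub>R ?e + ((k^m - k) * ((x \<bullet> ?e) / k^m)) *\<^sub>R ?e
          = x + ((k/k^m - 1) * (x \<bullet> ?e) + (k^m - k) * ((x \<bullet> ?e) / k^m)) *\<^sub>R ?e"
        by (simp add: scaleR_add_left)
      also have "(k/k^m - 1) * (x \<bullet> ?e) + (k^m - k) * ((x \<bullet> ?e) / k^m) = 0"
        using that by (simp add: field_simps)
      finally show ?thesis by simp
    qed
    ultimately show ?thesis
      using test_function_compose_affine[OF t\<omega> blL[of k], of M 0] by simp
  qed
  have t\<eta>: "test_function (\<eta> k)" if "k > 0" for k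
    unfolding \<eta>_def by (intro test_function_mult_smooth tL that smooth_bounded_linear bounded_linear_inner_left)
  have d\<eta>: "frechet_derivative (\<eta> k) (at x) w = \<omega> (L k x) * (w \<bullet> b2) + \<omega>' (L k x) (L k w) * (x \<bullet> b2)" if "k > 0" for k x w
  proof -
    have i: "frechet_derivative (\<lambda>x::'a. x \<bullet> b2) (at x) = (\<lambda>x. x \<bullet> b2)"
      using frechet_derivative_at[OF bounded_linear_imp_has_derivative[OF bounded_linear_inner_left]] by metis
    have "frechet_derivative (\<lambda>x. \<omega> (L k x)) (at x) w = \<omega>' (L k x) (L k w)"
      using frechet_derivative_compose_affine[OF s\<omega> blL[of k], of 0 x w] by (simp add: \<omega>'_def)
    then show ?thesis
      unfolding \<eta>_def using frechet_derivative_mult_smooth[OF test_function_smooth[OF tL[OF that]] smooth_bounded_linear[OF bounded_linear_inner_left], of b2 x w] i by simp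
  qed
  have d2: "frechet_derivative (\<eta> k) (at x) b2 = g (L k x)" if "k > 0" for k x
    using that Lb[OF b2] by (simp add: d\<eta> Lb2 ip linear_scale[OF lin\<omega>'] g_def)
  have d1: "frechet_derivative (\<eta> k) (at x) ?e = (k/k^m) * g1 (L k x)" if "k > 0" for k x
    using that Lb[OF b2] by (simp add: d\<eta> Le1 ip linear_scale[OF lin\<omega>'] g1_def)
  have Hm[measurable]: "H b \<in> borel_measurable borel" if "b \<in> Basis" for b
    using G that unfolding grad_L2_def weak_partial_def by (auto intro: loc_int_measurable)
  have I: "(\<integral>x. g (L k x) * v x \<partial>lborel) = (\<integral>x. (k/k^m) * g1 (L k x) * H b2 x \<partial>lborel)" if k: "k > 0" for k
  proof -
    let ?d = "\<lambda>w x. frechet_derivative (\<eta> k) (at x) w"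
    have 1: "(\<integral>x. frechet_derivative (?d b2) (at x) ?e *\<^sub>R \<phi> x \<partial>lborel) = - (\<integral>x. ?d b2 x *\<^sub>R H ?e x \<partial>lborel)"
      using G eB test_function_frechet_derivative[OF t\<eta>[OF k]] unfolding grad_L2_def weak_partial_def by blast
    have 2: "(\<integral>x. frechet_derivative (?d ?e) (at x) b2 *\<^sub>R \<phi> x \<partial>lborel) = - (\<integral>x. ?d ?e x *\<^sub>R H b2 x \<partial>lborel)"
      using G b2 test_function_frechet_derivative[OF t\<eta>[OF k]] unfolding grad_L2_def weak_partial_def by blast
    have "(\<integral>x. ?d b2 x *\<^sub>R H ?e x \<partial>lborel) = (\<integral>x. ?d ?e x *\<^sub>R H b2 x \<partial>lborel)"
      using 1 2 smooth_second_derivative_symmetric[OF test_function_smooth[OF t\<eta>[OF k]], of b2 _ ?e] by simp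
    moreover have "(\<integral>x. g (L k x) * v x \<partial>lborel) = (\<integral>x. ?d b2 x *\<^sub>R H ?e x \<partial>lborel)"
    proof (rule integral_cong_AE)
      have [measurable]: "g \<in> borel_measurable borel" "L k \<in> borel_measurable borel"
        using gc by (auto intro: borel_measurable_continuous_onI linear_continuous_on[OF blL])
      show "(\<lambda>x. g (L k x) * v x) \<in> borel_measurable lborel" using v by measurable
      show "(\<lambda>x. ?d b2 x *\<^sub>R H ?e x) \<in> borel_measurable lborel" using eB Hm[OF eB] by (simp add: d2[OF k])
      show "AE x in lborel. g (L k x) * v x = ?d b2 x *\<^sub>R H ?e x" using ae by eventually_elim (simp add: d2[OF k])
    qed
    ultimately show ?thesis by (simp add: d1[OF k])
  qed
  have H2: "integrable lborel (\<lambda>x. (H b2 x)\<^sup>2)" using G b2 unfolding grad_L2_def by simp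
  define S where "S = (\<integral>x. (H b2 x)\<^sup>2 \<partial>lborel)"
  define C where "C = B\<^sup>2 * (2 * r) ^ DIM('a)"
  have bound: "\<bar>\<integral>x. (k/k^m) * g1 (L k x) * H b2 x \<partial>lborel\<bar> \<le> (C + S) / k" if k: "k \<ge> 1" for k
  proof -
    define A where "A = (\<Sum>b\<in>Basis. (if b = ?e then r * k^m else r * k) *\<^sub>R b)"
    have Ab: "A \<bullet> b = (if b = ?e then r * k^m else r * k)" if "b \<in> Basis" for b
      unfolding A_def using that by simp
    have sup: "x \<in> cbox (-A) A" if "L k x \<in> K" for x
    proof -
      have "\<bar>x \<bullet> b\<bar> \<le> A \<bullet> b" if b: "b \<in> Basis" for b
      proof -
        have "\<bar>L k x \<bullet> b\<bar> \<le> r" using r(2)[OF \<open>L k x \<in> K\<close>] Basis_le_norm[OF b] order_trans by blast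
        then show ?thesis using Le[of k x] Lb[OF b, of k x] Ab[OF b] k
          by (auto simp: abs_div pos_divide_le_eq split: if_splits)
      qed
      then show ?thesis by (auto simp: mem_box abs_le_iff minus_le_iff)
    qed
    have mb: "measure lborel (cbox (-A) A) = k^m * k^(DIM('a) - 1) * (2 * r) ^ DIM('a)"
    proof -
      have "measure lborel (cbox (-A) A) = (\<Prod>b\<in>Basis. (A - (-A)) \<bullet> b)"
        using Ab k r by (intro measure_lborel_cbox) (auto simp: inner_simps)
      also have "\<dots> = (\<Prod>b\<in>Basis. (2 * r) * (if b = ?e then k^m else k))"
        using Ab by (intro prod.cong) (auto simp: inner_simps)
      also have "\<dots> = (2 * r) ^ DIM('a) * (\<Prod>b\<in>Basis. (if b = ?e then k^m else k))"
        by (simp add: prod.distrib)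
      also have "(\<Prod>b\<in>Basis. (if b = ?e then k^m else k)) = k^m * (\<Prod>b\<in>Basis - {?e}. (if b = ?e then k^m else k))"
        using eB by (subst prod.remove[of _ ?e]) auto
      also have "(\<Prod>b\<in>Basis - {?e}. (if b = ?e then k^m else k)) = (\<Prod>b\<in>Basis - {?e}. k)" by (intro prod.cong) auto
      also have "\<dots> = k ^ (DIM('a) - 1)" using eB by simp
      finally show ?thesis by (simp add: mult_ac)
    qed
    let ?I = "indicat_real (cbox (-A) A)"
    let ?f = "\<lambda>x. (1/k) * (B\<^sup>2 * (k^3 / (k^m)^2) * k * ?I x) + (1/k) * (H b2 x)\<^sup>2"
    have ii: "integrable lborel ?I"
      using borel_integrable_compact[OF compact_cbox[of "- A" A], of "\<lambda>_. 1::real"] by simp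
    have "\<bar>\<integral>x. (k/k^m) * g1 (L k x) * H b2 x \<partial>lborel\<bar> \<le> (\<integral>x. ?f x \<partial>lborel)"
      unfolding real_norm_def[symmetric]
    proof (rule integral_norm_le)
      fix x
      \<comment> \<open>Cauchy-Schwarz in the form of a weighted arithmetic-geometric mean: with
        weight \<open>k\<close> the square of \<open>H b2\<close> enters only with the factor
        \<open>1/k\<close>, and the first term turns out to be of the same order.\<close>
      have "2 * \<bar>(k/k^m) * g1 (L k x) * H b2 x\<bar> \<le> k * ((k/k^m) * g1 (L k x))\<^sup>2 + (1/k) * (H b2 x)\<^sup>2"
      proof -
        have "0 \<le> (k * \<bar>(k/k^m) * g1 (L k x)\<bar> - \<bar>H b2 x\<bar>)\<^sup>2 / k" using k by simp
        also have "\<dots> = k * ((k/k^m) * g1 (L k x))\<^sup>2 + (1/k) * (H b2 x)\<^sup>2 - 2 * \<bar>(k/k^m) * g1 (L k x) * H b2 x\<bar>"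
        proof -
          have "(k * a - b)\<^sup>2 / k = k * a\<^sup>2 + (1/k) * b\<^sup>2 - 2 * (a * b)" for a b
            using k by (simp add: power2_eq_square field_simps)
          from this[of "\<bar>(k/k^m) * g1 (L k x)\<bar>" "\<bar>H b2 x\<bar>"] show ?thesis
            unfolding abs_mult[of "(k/k^m) * g1 (L k x)" "H b2 x"] by (simp only: power2_abs)
        qed
        finally show ?thesis by simp
      qed
      moreover have "(g1 (L k x))\<^sup>2 \<le> B\<^sup>2 * ?I x"
      proof (cases "L k x \<in> K")
        case True
        then show ?thesis using sup[OF True] power_mono[OF B[of "L k x"], of 2] by simp
      next
        case False
        then show ?thesis using K(2) by simp
      qed
      then have "k * ((k/k^m) * g1 (L k x))\<^sup>2 \<le> (1/k) * (B\<^sup>2 * (k^3 / (k^m)^2) * k * ?I x)"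
      proof -
        assume "(g1 (L k x))\<^sup>2 \<le> B\<^sup>2 * ?I x"
        then have "k * (k/k^m)\<^sup>2 * (g1 (L k x))\<^sup>2 \<le> k * (k/k^m)\<^sup>2 * (B\<^sup>2 * ?I x)" using k by (intro mult_left_mono) auto
        then show ?thesis using k by (simp add: power_mult_distrib power_divide power2_eq_square power3_eq_cube algebra_simps)
      qed
      ultimately show "norm ((k/k^m) * g1 (L k x) * H b2 x) \<le> ?f x"
        unfolding real_norm_def by (smt (verit) abs_ge_zero)
    qed (intro Bochner_Integration.integrable_add integrable_mult_right ii H2)
    also have "\<dots> = (1/k) * (B\<^sup>2 * (k^3 / (k^m)^2) * k * measure lborel (cbox (-A) A)) + (1/k) * S"
      using ii H2 by (simp add: S_def)
    also have "\<dots> = (1/k) * (B\<^sup>2 * (2*r)^DIM('a)) * ((k^3 * k * k^m * k^(DIM('a) - 1)) / (k^m)^2) + S / k"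
      unfolding mb by (simp add: field_simps)
    also have "(k^3 * k * k^m * k^(DIM('a) - 1)) / (k^m)^2 = 1"
    proof -
      have "k^3 * k * k^(DIM('a) - 1) = k ^ (3 + 1 + (DIM('a) - 1))" by (simp only: power_add power_one_right)
      also have "3 + 1 + (DIM('a) - 1) = m" using N2 by (simp add: m_def)
      finally have "k^3 * k * k^m * k^(DIM('a) - 1) = k^m * k^m" by (simp add: mult_ac)
      then show ?thesis using k by (simp add: power2_eq_square)
    qed
    finally show ?thesis by (simp add: C_def add_divide_distrib)
  qed
  have "(\<lambda>n. \<integral>x. g (L (real (Suc n)) x) * v x \<partial>lborel) \<longlonglongrightarrow> (\<integral>x. v x \<partial>lborel)"
  proof (rule integral_dominated_convergence[where w="\<lambda>x. (B0 + B1) * \<bar>v x\<bar>"])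
    show "v \<in> borel_measurable lborel" using v by simp
    show "(\<lambda>x. g (L (real (Suc n)) x) * v x) \<in> borel_measurable lborel" for n
    proof -
      have [measurable]: "g \<in> borel_measurable borel" "L (real (Suc n)) \<in> borel_measurable borel"
        using gc by (auto intro: borel_measurable_continuous_onI linear_continuous_on[OF blL])
      show ?thesis using v by measurable
    qed
    show "integrable lborel (\<lambda>x. (B0 + B1) * \<bar>v x\<bar>)" using v by simp
    show "AE x in lborel. norm (g (L (real (Suc n)) x) * v x) \<le> (B0 + B1) * \<bar>v x\<bar>" for n
      using gB by (auto simp: abs_mult intro!: mult_right_mono)
    show "AE x in lborel. (\<lambda>n. g (L (real (Suc n)) x) * v x) \<longlonglongrightarrow> v x"
    proof (rule AE_I2)
      fix x
      have l1: "(\<lambda>n. 1 / real (Suc n)) \<longlonglongrightarrow> 0" using LIMSEQ_Suc[OF lim_1_over_n[where 'a=real]] .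
      have "(\<lambda>n. (1 / real (Suc n)) ^ m) \<longlonglongrightarrow> 0 ^ m" by (intro tendsto_intros l1)
      then have l2: "(\<lambda>n. 1 / real (Suc n) ^ m) \<longlonglongrightarrow> 0" by (simp add: m_def power_one_over power_0_left del: of_nat_Suc)
      have "(\<lambda>n. L (real (Suc n)) x) \<longlonglongrightarrow> 0 *\<^sub>R x + ((0 - 0) * (x \<bullet> ?e)) *\<^sub>R ?e"
        unfolding L_def by (intro tendsto_intros l1 l2)
      then have "(\<lambda>n. L (real (Suc n)) x) \<longlonglongrightarrow> 0" by simp
      moreover have "isCont g 0" using gc by (simp add: continuous_on_eq_continuous_at)
      ultimately have "(\<lambda>n. g (L (real (Suc n)) x)) \<longlonglongrightarrow> g 0" using isCont_tendsto_compose by blast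
      then have "(\<lambda>n. g (L (real (Suc n)) x) * v x) \<longlonglongrightarrow> g 0 * v x" by (intro tendsto_intros)
      then show "(\<lambda>n. g (L (real (Suc n)) x) * v x) \<longlonglongrightarrow> v x" by (simp add: g_def \<omega>0)
    qed
  qed
  moreover have "(\<lambda>n. \<integral>x. g (L (real (Suc n)) x) * v x \<partial>lborel) \<longlonglongrightarrow> 0"
  proof (rule Lim_null_comparison)
    show "\<forall>\<^sub>F n in sequentially. norm (\<integral>x. g (L (real (Suc n)) x) * v x \<partial>lborel) \<le> (C + S) * (1 / real (Suc n))"
      using I bound by (intro always_eventually) (simp del: of_nat_Suc add: I)
    show "(\<lambda>n. (C + S) * (1 / real (Suc n))) \<longlonglongrightarrow> 0"
      using tendsto_mult_right_zero[OF LIMSEQ_Suc[OF lim_1_over_n[where 'a=real]]] .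
  qed
  ultimately show ?thesis by (rule LIMSEQ_unique)
qed

text \<open>Two decompositions of \<open>w\<close> differ by an integrable function that is also the
  derivative along \<open>e1\<close> of a function with square integrable gradient, and such a
  function has integral 0. So any one decomposition evaluates the definite description.\<close>

lemma Lmom_eqI:
  fixes w :: "'a::euclidean_space \<Rightarrow> real"
  assumes N2: "DIM('a) \<ge> 2" and v: "integrable lborel v" and g: "grad_L2 \<phi> H"
    and ae: "AE x in lborel. w x = v x + H e1 x"
  shows "Lmom w = (\<integral>x. v x \<partial>lborel)"
  unfolding Lmom_def
proof (rule the_equality)
  have "loc_int \<phi>" using g e1_Basis unfolding grad_L2_def weak_partial_def by blast
  then show "\<exists>va \<phi> H. integrable lborel va \<and> loc_int \<phi> \<and> grad_L2 \<phi> H \<and>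
      (AE x in lborel. w x = va x + H e1 x) \<and> (\<integral>x. v x \<partial>lborel) = (\<integral>x. va x \<partial>lborel)"
    using assms by blast
next
  fix c
  assume "\<exists>v \<phi> H. integrable lborel v \<and> loc_int \<phi> \<and> grad_L2 \<phi> H \<and>
      (AE x in lborel. w x = v x + H e1 x) \<and> c = (\<integral>x. v x \<partial>lborel)"
  then obtain v' \<phi>' H' where v': "integrable lborel v'" "grad_L2 \<phi>' H'"
      "AE x in lborel. w x = v' x + H' e1 x" "c = (\<integral>x. v' x \<partial>lborel)" by blast
  have "grad_L2 (\<lambda>x. \<phi> x - \<phi>' x) (\<lambda>b x. H b x - H' b x)"
    unfolding grad_L2_def
  proof (intro ballI conjI)
    fix b :: 'a assume b: "b \<in> Basis"
    have w1: "weak_partial \<phi> b (H b)" "integrable lborel (\<lambda>x. (norm (H b x))\<^sup>2)"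
      and w2: "weak_partial \<phi>' b (H' b)" "integrable lborel (\<lambda>x. (norm (H' b x))\<^sup>2)"
      using g v'(2) b unfolding grad_L2_def by auto
    show "weak_partial (\<lambda>x. \<phi> x - \<phi>' x) b (\<lambda>x. H b x - H' b x)"
      unfolding weak_partial_def
    proof (intro conjI allI impI)
      show "loc_int (\<lambda>x. \<phi> x - \<phi>' x)" "loc_int (\<lambda>x. H b x - H' b x)"
        using w1 w2 unfolding weak_partial_def by (auto intro: loc_int_diff)
      fix p :: "'a \<Rightarrow> real" assume p: "test_function p"
      have i: "integrable lborel (\<lambda>x. frechet_derivative p (at x) b *\<^sub>R \<phi> x)" "integrable lborel (\<lambda>x. frechet_derivative p (at x) b *\<^sub>R \<phi>' x)"
        "integrable lborel (\<lambda>x. p x *\<^sub>R H b x)" "integrable lborel (\<lambda>x. p x *\<^sub>R H' b x)"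
        using w1 w2 p test_function_frechet_derivative[OF p] unfolding weak_partial_def
        by (auto intro!: loc_int_integrable_test simp del: real_scaleR_def)
      show "(\<integral>x. frechet_derivative p (at x) b *\<^sub>R (\<phi> x - \<phi>' x) \<partial>lborel) = - (\<integral>x. p x *\<^sub>R (H b x - H' b x) \<partial>lborel)"
        using w1(1) w2(1) p i unfolding weak_partial_def
        by (simp add: right_diff_distrib Bochner_Integration.integral_diff)
    qed
    have m: "H b \<in> borel_measurable borel" "H' b \<in> borel_measurable borel"
      using w1 w2 unfolding weak_partial_def by (auto intro: loc_int_measurable)
    have "integrable lborel (\<lambda>x. 2 * (norm (H b x))\<^sup>2 + 2 * (norm (H' b x))\<^sup>2)" using w1 w2 by simp
    then show "integrable lborel (\<lambda>x. (norm (H b x - H' b x))\<^sup>2)"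
    proof (rule Bochner_Integration.integrable_bound)
      show "AE x in lborel. norm ((norm (H b x - H' b x))\<^sup>2) \<le> norm (2 * (norm (H b x))\<^sup>2 + 2 * (norm (H' b x))\<^sup>2)"
      proof (rule AE_I2)
        fix x
        have "(H b x - H' b x)\<^sup>2 \<le> 2 * (H b x)\<^sup>2 + 2 * (H' b x)\<^sup>2"
          using sum_squares_bound[of "H b x" "- H' b x"] by (simp add: power2_diff)
        then show "norm ((norm (H b x - H' b x))\<^sup>2) \<le> norm (2 * (norm (H b x))\<^sup>2 + 2 * (norm (H' b x))\<^sup>2)" by simp
      qed
    qed (use m in measurable)
  qed
  moreover have "AE x in lborel. v' x - v x = H e1 x - H' e1 x"
    using ae v'(3) by eventually_elim simp
  moreover have "integrable lborel (\<lambda>x. v' x - v x)" using v v' by simp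
  ultimately have "(\<integral>x. v' x - v x \<partial>lborel) = 0" by (intro integral_zero_of_grad_L2[OF N2])
  then show "c = (\<integral>x. v x \<partial>lborel)" using v v' by simp
qed

section \<open>A vortex ring\<close>

text \<open>For the seams of piecewise definitions: the two ends of \<open>sstep\<close>, and the
  points where \<open>ringT\<close> is not positive.\<close>

lemma has_derivative_zero_quadratic:
  fixes f :: "'a::real_normed_vector \<Rightarrow> 'b::real_normed_vector"
  assumes "\<And>y. norm (f y - f x) \<le> C * (norm (y - x))\<^sup>2"
  shows "(f has_derivative (\<lambda>_. 0)) (at x)"
proof (rule has_derivativeI_sandwich[where e=1 and H="\<lambda>y. C * norm (y - x)"])
  show "norm (f y - f x - 0) / norm (y - x) \<le> C * norm (y - x)" if "y \<noteq> x" for y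
    using assms[of y] that by (simp add: divide_le_eq power2_eq_square mult.assoc)
  have "((\<lambda>y. C * norm (y - x)) \<longlongrightarrow> C * norm (x - x)) (at x)" by (intro tendsto_intros)
  then show "((\<lambda>y. C * norm (y - x)) \<longlongrightarrow> 0) (at x)" by simp
qed auto

text \<open>A cubic is enough, because only first derivatives of the ring are used. Its quadratic
  contact at 0 absorbs an inverse power of \<open>ringT\<close> in the gradient near the ring and
  makes the ring differentiable where \<open>ringT\<close> vanishes.\<close>

definition sstep :: "real \<Rightarrow> real" where
  "sstep t = (if t \<le> 0 then 0 else if t \<ge> 1 then 1 else t\<^sup>2 * (3 - 2 * t))"

definition sstep' :: "real \<Rightarrow> real" where
  "sstep' t = (if 0 < t \<and> t < 1 then 6 * t * (1 - t) else 0)"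

lemma sstep_quadratic: "sstep t \<le> 3 * t\<^sup>2" and sstep_nonneg: "0 \<le> sstep t" and sstep_le_1: "sstep t \<le> 1"
proof -
  show "sstep t \<le> 3 * t\<^sup>2"
  proof (cases "0 < t \<and> t < 1")
    case True
    then have "t\<^sup>2 * (3 - 2 * t) \<le> t\<^sup>2 * 3" by (intro mult_left_mono) auto
    then show ?thesis using True by (simp add: sstep_def)
  next
    case False
    moreover have "1 \<le> 3 * t\<^sup>2" if "t \<ge> 1" using that one_le_power[of t 2] by linarith
    ultimately show ?thesis by (auto simp: sstep_def)
  qed
  show "0 \<le> sstep t" by (auto simp: sstep_def intro!: mult_nonneg_nonneg)
  have "1 - t\<^sup>2 * (3 - 2 * t) = (1 - t)\<^sup>2 * (1 + 2 * t)" by (simp add: power2_eq_square algebra_simps)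
  moreover have "0 \<le> (1 - t)\<^sup>2 * (1 + 2 * t)" if "t > 0" using that by simp
  ultimately have "t\<^sup>2 * (3 - 2 * t) \<le> 1" if "t > 0" using that by linarith
  then show "sstep t \<le> 1" by (simp add: sstep_def)
qed

lemma sstep_complement: "1 - sstep t = sstep (1 - t)"
  by (auto simp: sstep_def power2_eq_square algebra_simps)

lemma sstep'_nonneg: "0 \<le> sstep' t" and sstep'_le: "sstep' t \<le> 3 / 2"
proof -
  show "0 \<le> sstep' t" by (auto simp: sstep'_def)
  have "3 / 2 - 6 * t * (1 - t) = 6 * (t - 1/2)\<^sup>2" by (simp add: power2_eq_square algebra_simps)
  moreover have "0 \<le> 6 * (t - 1/2)\<^sup>2" by simp
  ultimately have "6 * t * (1 - t) \<le> 3 / 2" by linarith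
  then show "sstep' t \<le> 3 / 2" by (auto simp: sstep'_def)
qed

lemma sstep_has_derivative: "(sstep has_real_derivative sstep' t) (at t)"
proof -
  have at0: "(sstep has_derivative (\<lambda>_. 0)) (at 0)"
    by (rule has_derivative_zero_quadratic[where C=3]) (use sstep_quadratic sstep_nonneg in \<open>auto simp: sstep_def\<close>)
  have at1: "(sstep has_derivative (\<lambda>_. 0)) (at 1)"
  proof (rule has_derivative_zero_quadratic[where C=3])
    show "norm (sstep y - sstep 1) \<le> 3 * (norm (y - 1))\<^sup>2" for y
      using sstep_complement[of y] sstep_quadratic[of "1 - y"] sstep_nonneg[of "1 - y"]
      by (simp add: sstep_def[of 1] power2_commute)
  qed
  have z: "(*) (0::real) = (\<lambda>_. 0)" by auto
  consider "t < 0" | "t = 0" | "0 < t" "t < 1" | "t = 1" | "t > 1" by linarith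
  then show ?thesis
  proof cases
    case 1
    have "((\<lambda>_. 0) has_real_derivative sstep' t) (at t)" using 1 by (auto simp: sstep'_def)
    then show ?thesis
      by (rule has_field_derivative_transform_within_open[of _ _ _ "{..<0}"]) (use 1 in \<open>auto simp: sstep_def\<close>)
  next
    case 2 then show ?thesis using at0 by (simp add: sstep'_def has_field_derivative_def z)
  next
    case 3
    have "((\<lambda>t. t\<^sup>2 * (3 - 2 * t)) has_real_derivative sstep' t) (at t)"
      using 3 by (auto intro!: derivative_eq_intros simp: sstep'_def power2_eq_square algebra_simps)
    then show ?thesis
      by (rule has_field_derivative_transform_within_open[of _ _ _ "{0<..<1}"]) (use 3 in \<open>auto simp: sstep_def\<close>)
  next
    case 4 then show ?thesis using at1 by (simp add: sstep'_def has_field_derivative_def z)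
  next
    case 5
    have "((\<lambda>_. 1) has_real_derivative sstep' t) (at t)" using 5 by (auto simp: sstep'_def)
    then show ?thesis
      by (rule has_field_derivative_transform_within_open[of _ _ _ "{1<..}"]) (use 5 in \<open>auto simp: sstep_def\<close>)
  qed
qed

lemma sstep_compose_has_derivative:
  "(f has_derivative f') (at x) \<Longrightarrow> ((\<lambda>x. sstep (f x)) has_derivative (\<lambda>v. sstep' (f x) * f' v)) (at x)"
  using has_derivative_compose[OF _ sstep_has_derivative[unfolded has_field_derivative_def]] by blast

section \<open>The lens, the ring and its momentum density\<close>

definition perp :: "'a::euclidean_space \<Rightarrow> 'a" where
  "perp x = x - (x \<bullet> e1) *\<^sub>R e1"

text \<open>Inside the unit cylinder this lies between one and two times
  \<open>1 - norm (perp x)\<close>, so it measures the distance to the singular ring, but as a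
  polynomial it is differentiable on the axis too. It does not vary along \<open>e1\<close>, which
  matters for the momentum.\<close>

definition ringT :: "'a::euclidean_space \<Rightarrow> real" where
  "ringT x = 1 - (norm (perp x))\<^sup>2"

definition ringT' :: "'a::euclidean_space \<Rightarrow> 'a \<Rightarrow> real" where
  "ringT' x v = - 2 * (perp x \<bullet> v)"

lemma e1_inner_self [simp]: "e1 \<bullet> e1 = 1"
  using e1_Basis inner_same_Basis by blast

lemma perp_norm_sq: "(norm (perp x))\<^sup>2 = x \<bullet> x - (x \<bullet> e1)\<^sup>2"
  unfolding power2_norm_eq_inner perp_def by (simp add: inner_simps power2_eq_square inner_commute)

lemma norm_perp_le: "norm (perp x) \<le> norm x"
proof -
  have "(norm (perp x))\<^sup>2 \<le> (norm x)\<^sup>2"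
    unfolding perp_norm_sq by (simp add: power2_norm_eq_inner)
  then show ?thesis by (simp add: power2_le_iff_abs_le)
qed

lemma perp_diff: "perp (x - y) = perp x - perp y"
  by (simp add: perp_def algebra_simps inner_simps)

lemma ringT_le_1: "ringT x \<le> 1" by (simp add: ringT_def)

lemma ringT_has_derivative:
  fixes x :: "'a::euclidean_space" shows "(ringT has_derivative ringT' x) (at x)"
proof -
  have "((\<lambda>x. 1 - (x \<bullet> x - (x \<bullet> e1)\<^sup>2)) has_derivative ringT' x) (at x)"
    by (auto intro!: derivative_eq_intros simp: ringT'_def perp_def inner_simps inner_commute algebra_simps fun_eq_iff)
  moreover have "ringT = (\<lambda>x::'a. 1 - (x \<bullet> x - (x \<bullet> e1)\<^sup>2))" by (simp add: ringT_def fun_eq_iff perp_norm_sq)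
  ultimately show ?thesis by simp
qed

lemma ringT'_bound: "\<bar>ringT' x v\<bar> \<le> 2 * norm (perp x) * norm v"
  using Cauchy_Schwarz_ineq2[of "perp x" v] by (simp add: ringT'_def)

lemma ringT'_e1: "ringT' x e1 = 0"
  by (simp add: ringT'_def perp_def inner_simps)

text \<open>Makes \<open>sstep (ringT y / \<epsilon>)\<close> quadratically small in the distance
  from a point \<open>x\<close> outside the open unit cylinder. This is why the ring is
  differentiable there with derivative 0.\<close>

lemma ringT_growth: 
  assumes "ringT x \<le> 0" "ringT y > 0" shows "ringT y \<le> (norm (perp x) + 1) * norm (y - x)"
proof -
  have y1: "norm (perp y) \<le> 1" using assms(2) by (simp add: ringT_def power_less_one_iff abs_square_less_1 less_imp_le)
  have "ringT y \<le> ringT y - ringT x" using assms by simp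
  also have "\<dots> = (norm (perp x) - norm (perp y)) * (norm (perp x) + norm (perp y))"
    by (simp add: ringT_def power2_eq_square algebra_simps)
  also have "\<dots> \<le> norm (y - x) * (norm (perp x) + 1)"
  proof (rule mult_mono)
    have "norm (perp x) - norm (perp y) \<le> norm (perp (x - y))" unfolding perp_diff by (rule norm_triangle_ineq2)
    also have "\<dots> \<le> norm (y - x)" using norm_perp_le[of "x - y"] by (simp add: norm_minus_commute)
    finally show "norm (perp x) - norm (perp y) \<le> norm (y - x)" .
  qed (use y1 in auto)
  finally show ?thesis by (simp add: mult.commute)
qed

text \<open>The negative orientation makes the momentum positive, since the momentum density of a
  unimodular function is minus the derivative of its phase along \<open>e1\<close>.\<close>

definition ring_phase :: "'a::euclidean_space \<Rightarrow> real" where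
  "ring_phase x = - 2 * pi * sstep ((x \<bullet> e1 / ringT x + 1) / 2)"

definition ring_phase' :: "'a::euclidean_space \<Rightarrow> 'a \<Rightarrow> real" where
  "ring_phase' x v = - pi * sstep' ((x \<bullet> e1 / ringT x + 1) / 2) *
     ((v \<bullet> e1) / ringT x - (x \<bullet> e1) * ringT' x v / (ringT x)\<^sup>2)"

text \<open>The phase turns once around the circle when $x_1$ crosses the lens $|x_1| < T(x')$; the
  amplitude factor removes the singularity on the ring $|x'| = 1$, $x_1 = 0$.\<close>
definition ring :: "real \<Rightarrow> 'a::euclidean_space \<Rightarrow> complex" where
  "ring \<epsilon> x = (if ringT x > 0 then 1 + sstep (ringT x / \<epsilon>) *\<^sub>R (cis (ring_phase x) - 1) else 1)"

definition ring' :: "real \<Rightarrow> 'a::euclidean_space \<Rightarrow> 'a \<Rightarrow> complex" where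
  "ring' \<epsilon> x v = (if ringT x > 0 then
      sstep (ringT x / \<epsilon>) *\<^sub>R (ring_phase' x v *\<^sub>R (\<i> * cis (ring_phase x)))
      + (sstep' (ringT x / \<epsilon>) * (ringT' x v / \<epsilon>)) *\<^sub>R (cis (ring_phase x) - 1) else 0)"

lemma norm_cis_minus_1: "norm (cis t - 1) \<le> 2"
  using norm_triangle_ineq4[of "cis t" 1] by simp

lemma ring_phase_has_derivative:
  assumes "ringT x > 0" shows "(ring_phase has_derivative ring_phase' x) (at x)"
proof -
  have "((\<lambda>x. (x \<bullet> e1 / ringT x + 1) / 2) has_derivative
      (\<lambda>v. ((v \<bullet> e1) / ringT x - (x \<bullet> e1) * ringT' x v / (ringT x)\<^sup>2) / 2)) (at x)"
    using assms by (auto intro!: derivative_eq_intros ringT_has_derivative simp: fun_eq_iff field_simps power2_eq_square)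
  from has_derivative_mult_right[OF sstep_compose_has_derivative[OF this], of "- 2 * pi"]
  show ?thesis unfolding ring_phase_def[abs_def]
    by (rule has_derivative_eq_rhs) (simp add: ring_phase'_def fun_eq_iff)
qed

lemma ring_has_derivative:
  assumes \<epsilon>: "\<epsilon> > 0" shows "(ring \<epsilon> has_derivative ring' \<epsilon> x) (at x)"
proof (cases "ringT x > 0")
  case True
  have 1: "((\<lambda>x. sstep (ringT x / \<epsilon>)) has_derivative (\<lambda>v. sstep' (ringT x / \<epsilon>) * (ringT' x v / \<epsilon>))) (at x)"
    using \<epsilon> by (intro sstep_compose_has_derivative) (auto intro!: derivative_eq_intros ringT_has_derivative)
  have 2: "((\<lambda>x. cis (ring_phase x) - 1) has_derivative (\<lambda>v. ring_phase' x v *\<^sub>R (\<i> * cis (ring_phase x)))) (at x)"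
    using has_derivative_diff[OF has_derivative_cis[OF ring_phase_has_derivative[OF True]] has_derivative_const[of 1]] by simp
  have "((\<lambda>x. 1 + sstep (ringT x / \<epsilon>) *\<^sub>R (cis (ring_phase x) - 1)) has_derivative ring' \<epsilon> x) (at x)"
    using has_derivative_add[OF has_derivative_const[of 1] has_derivative_scaleR[OF 1 2]] True
    by (simp add: ring'_def[abs_def])
  moreover have "open {x::'a. ringT x > 0}"
    by (intro open_Collect_less continuous_intros)
      (meson continuous_at_imp_continuous_on has_derivative_continuous ringT_has_derivative)
  ultimately show ?thesis
    by (rule has_derivative_transform_within_open) (use True in \<open>auto simp: ring_def\<close>)
next
  case False
  have "(ring \<epsilon> has_derivative (\<lambda>_. 0)) (at x)"
  proof (rule has_derivative_zero_quadratic)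
    fix y
    show "norm (ring \<epsilon> y - ring \<epsilon> x) \<le> (6 * ((norm (perp x) + 1) / \<epsilon>)\<^sup>2) * (norm (y - x))\<^sup>2"
    proof (cases "ringT y > 0")
      case True
      have "norm (ring \<epsilon> y - ring \<epsilon> x) = sstep (ringT y / \<epsilon>) * norm (cis (ring_phase y) - 1)"
        using True False by (simp add: ring_def sstep_nonneg)
      also have "\<dots> \<le> 3 * (ringT y / \<epsilon>)\<^sup>2 * 2"
        by (intro mult_mono sstep_quadratic norm_cis_minus_1 sstep_nonneg) auto
      also have "(ringT y / \<epsilon>)\<^sup>2 \<le> ((norm (perp x) + 1) * norm (y - x) / \<epsilon>)\<^sup>2"
        using ringT_growth[of x y] True False \<epsilon> by (intro power_mono divide_right_mono) auto
      also have "((norm (perp x) + 1) * norm (y - x) / \<epsilon>)\<^sup>2 = ((norm (perp x) + 1) / \<epsilon>)\<^sup>2 * (norm (y - x))\<^sup>2"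
        by (simp add: power_mult_distrib power_divide)
      finally show ?thesis by simp
    qed (use False in \<open>simp add: ring_def\<close>)
  qed
  then show ?thesis using False by (simp add: ring'_def[abs_def])
qed

lemma ring_phase_trivial:
  assumes "ringT x > 0" "\<bar>x \<bullet> e1\<bar> \<ge> ringT x"
  shows "cis (ring_phase x) = 1" "ring_phase' x v = 0" "sstep' ((x \<bullet> e1 / ringT x + 1) / 2) = 0"
proof -
  have "x \<bullet> e1 / ringT x \<le> -1 \<or> x \<bullet> e1 / ringT x \<ge> 1"
    using assms by (auto simp: divide_le_eq le_divide_eq)
  then have "sstep ((x \<bullet> e1 / ringT x + 1) / 2) = 0 \<or> sstep ((x \<bullet> e1 / ringT x + 1) / 2) = 1"
    and *: "sstep' ((x \<bullet> e1 / ringT x + 1) / 2) = 0" by (auto simp: sstep_def sstep'_def)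
  then show "cis (ring_phase x) = 1" by (auto simp: ring_phase_def cis.ctr complex_eq_iff)
  show "ring_phase' x v = 0" "sstep' ((x \<bullet> e1 / ringT x + 1) / 2) = 0" using * by (simp_all add: ring_phase'_def)
qed

lemma ring_outside:
  assumes "\<bar>x \<bullet> e1\<bar> \<ge> ringT x"
  shows "ring \<epsilon> x = 1" "ring' \<epsilon> x v = 0"
  using ring_phase_trivial[of x] assms by (cases "ringT x > 0"; simp add: ring_def ring'_def)+

lemma ring_norm_le_1: "norm (ring \<epsilon> x) \<le> 1"
proof (cases "ringT x > 0")
  case True
  let ?s = "sstep (ringT x / \<epsilon>)"
  have "ring \<epsilon> x = (1 - ?s) *\<^sub>R 1 + ?s *\<^sub>R cis (ring_phase x)"
    using True by (simp add: ring_def algebra_simps scaleR_conv_of_real)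
  then have "norm (ring \<epsilon> x) \<le> norm ((1 - ?s) *\<^sub>R (1::complex)) + norm (?s *\<^sub>R cis (ring_phase x))" using norm_triangle_ineq by metis
  also have "\<dots> = 1" using sstep_nonneg[of "ringT x / \<epsilon>"] sstep_le_1[of "ringT x / \<epsilon>"] by simp
  finally show ?thesis .
qed (simp add: ring_def)

lemma ring_norm_eq_1: "\<epsilon> > 0 \<Longrightarrow> ringT x \<ge> \<epsilon> \<Longrightarrow> norm (ring \<epsilon> x) = 1"
  by (simp add: ring_def sstep_def)

text \<open>The phase gradient is at most \<open>15 / ringT x\<close> inside the lens. Where
  \<open>ringT x < \<epsilon>\<close> the quadratic vanishing of the amplitude turns this into
  \<open>45 / \<epsilon>\<close>, and differentiating the amplitude adds
  \<open>6 / \<epsilon>\<close>; hence 51.\<close>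

lemma ring'_bound:
  assumes \<epsilon>: "\<epsilon> > 0" and v: "norm v \<le> 1" and x: "\<bar>x \<bullet> e1\<bar> < ringT x"
  shows "norm (ring' \<epsilon> x v) \<le> 51 / max (ringT x) \<epsilon>"
proof -
  let ?T = "ringT x"
  have T: "?T > 0" using x by linarith
  have Px: "norm (perp x) \<le> 1" using T by (simp add: ringT_def abs_square_less_1 less_imp_le)
  have T': "\<bar>ringT' x v\<bar> \<le> 2"
  proof -
    have "\<bar>ringT' x v\<bar> \<le> 2 * norm (perp x) * norm v" by (rule ringT'_bound)
    also have "\<dots> \<le> 2 * 1 * 1" using Px v by (intro mult_mono) auto
    finally show ?thesis by simp
  qed
  have ph: "\<bar>ring_phase' x v\<bar> \<le> 15 / ?T"
  proof -
    have a: "\<bar>(v \<bullet> e1) / ?T - (x \<bullet> e1) * ringT' x v / ?T\<^sup>2\<bar> \<le> 3 / ?T"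
    proof -
      have "\<bar>v \<bullet> e1\<bar> \<le> 1" using Basis_le_norm[OF e1_Basis, of v] v by simp
      then have "\<bar>(v \<bullet> e1) / ?T\<bar> \<le> 1 / ?T" using T by (simp add: divide_right_mono)
      moreover have "\<bar>(x \<bullet> e1) * ringT' x v / ?T\<^sup>2\<bar> \<le> ?T * 2 / ?T\<^sup>2"
        unfolding abs_divide abs_mult using x T T' by (intro frac_le mult_mono) auto
      moreover have "?T * 2 / ?T\<^sup>2 = 2 / ?T" using T by (simp add: power2_eq_square)
      ultimately show ?thesis using abs_triangle_ineq4[of "(v \<bullet> e1) / ?T" "(x \<bullet> e1) * ringT' x v / ?T\<^sup>2"]
        by (simp add: add_divide_distrib[symmetric])
    qed
    have "\<bar>ring_phase' x v\<bar> = pi * sstep' ((x \<bullet> e1 / ?T + 1) / 2) * \<bar>(v \<bullet> e1) / ?T - (x \<bullet> e1) * ringT' x v / ?T\<^sup>2\<bar>"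
      by (simp add: ring_phase'_def abs_mult sstep'_nonneg)
    also have "\<dots> \<le> (10/3) * (3/2) * (3 / ?T)"
      using pi_less_4 pi_approx T by (intro mult_mono a sstep'_le sstep'_nonneg mult_nonneg_nonneg) auto
    finally show ?thesis by simp
  qed
  have s': "sstep' (?T / \<epsilon>) * \<bar>ringT' x v / \<epsilon>\<bar> * 2 \<le> 6 / max ?T \<epsilon>"
  proof (cases "?T < \<epsilon>")
    case True
    have "sstep' (?T / \<epsilon>) * \<bar>ringT' x v / \<epsilon>\<bar> * 2 \<le> (3/2) * (2 / \<epsilon>) * 2"
      using T' \<epsilon> by (intro mult_mono sstep'_le) (auto intro: divide_right_mono simp: sstep'_nonneg)
    then show ?thesis using True by (simp add: max_def)
  next
    case False
    then have "sstep' (?T / \<epsilon>) = 0" using \<epsilon> by (simp add: sstep'_def)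
    then show ?thesis using T by (simp add: max_def)
  qed
  have s: "sstep (?T / \<epsilon>) * (15 / ?T) \<le> 45 / max ?T \<epsilon>"
  proof (cases "?T < \<epsilon>")
    case True
    have "sstep (?T / \<epsilon>) * (15 / ?T) \<le> 3 * (?T / \<epsilon>)\<^sup>2 * (15 / ?T)"
      using T by (intro mult_right_mono sstep_quadratic) auto
    also have "\<dots> = 45 * (?T / \<epsilon>) / \<epsilon>" using T by (simp add: power2_eq_square field_simps)
    also have "\<dots> \<le> 45 * 1 / \<epsilon>" using True T \<epsilon> by (intro divide_right_mono mult_left_mono) auto
    finally show ?thesis using True by (simp add: max_def)
  next
    case False
    have "sstep (?T / \<epsilon>) * (15 / ?T) \<le> 1 * (15 / ?T)" using T by (intro mult_right_mono sstep_le_1) auto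
    also have "\<dots> \<le> 45 / ?T" using T by (simp add: divide_right_mono)
    finally show ?thesis using False by (simp add: max_def)
  qed
  have "norm (ring' \<epsilon> x v) \<le> norm (sstep (?T / \<epsilon>) *\<^sub>R (ring_phase' x v *\<^sub>R (\<i> * cis (ring_phase x))))
      + norm ((sstep' (?T / \<epsilon>) * (ringT' x v / \<epsilon>)) *\<^sub>R (cis (ring_phase x) - 1))"
    using T by (simp only: ring'_def if_True norm_triangle_ineq)
  also have "\<dots> \<le> sstep (?T / \<epsilon>) * (15 / ?T) + sstep' (?T / \<epsilon>) * \<bar>ringT' x v / \<epsilon>\<bar> * 2"
  proof (rule add_mono)
    show "norm (sstep (?T / \<epsilon>) *\<^sub>R (ring_phase' x v *\<^sub>R (\<i> * cis (ring_phase x)))) \<le> sstep (?T / \<epsilon>) * (15 / ?T)"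
      using ph by (simp add: norm_mult abs_mult sstep_nonneg mult_left_mono del: times_divide_eq_right)
    have "norm ((sstep' (?T / \<epsilon>) * (ringT' x v / \<epsilon>)) *\<^sub>R (cis (ring_phase x) - 1)) = sstep' (?T / \<epsilon>) * \<bar>ringT' x v / \<epsilon>\<bar> * norm (cis (ring_phase x) - 1)"
      by (simp add: abs_mult sstep'_nonneg)
    also have "\<dots> \<le> sstep' (?T / \<epsilon>) * \<bar>ringT' x v / \<epsilon>\<bar> * 2"
      by (intro mult_left_mono norm_cis_minus_1 mult_nonneg_nonneg sstep'_nonneg) auto
    finally show "norm ((sstep' (?T / \<epsilon>) * (ringT' x v / \<epsilon>)) *\<^sub>R (cis (ring_phase x) - 1)) \<le> sstep' (?T / \<epsilon>) * \<bar>ringT' x v / \<epsilon>\<bar> * 2" .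
  qed
  also have "\<dots> \<le> 45 / max ?T \<epsilon> + 6 / max ?T \<epsilon>" by (intro add_mono s s')
  finally show ?thesis by (simp add: add_divide_distrib[symmetric])
qed

definition ring_mom :: "real \<Rightarrow> 'a::euclidean_space \<Rightarrow> real" where
  "ring_mom \<epsilon> x = (if ringT x > 0 then (sstep (ringT x / \<epsilon>))\<^sup>2 * pi * sstep' ((x \<bullet> e1 / ringT x + 1) / 2) / ringT x else 0)"

text \<open>With amplitude \<open>s\<close> the ring is \<open>(1 - s) + s * cis t\<close>. The
  square term gives \<open>ring_mom\<close>, that is \<open>s^2\<close> times minus the phase
  derivative. The cross term is \<open>1 - s\<close> times a derivative along \<open>e1\<close>; as
  \<open>s\<close> does not vary along \<open>e1\<close>, it is itself such a derivative and will
  not contribute to the momentum.\<close>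

lemma ring_momentum_density:
  assumes \<epsilon>: "\<epsilon> > 0"
  shows "Re (\<i> * ring' \<epsilon> x e1 * cnj (ring \<epsilon> x)) = ring_mom \<epsilon> x - (1 - sstep (ringT x / \<epsilon>)) * Im (ring' \<epsilon> x e1)"
proof (cases "ringT x > 0")
  case True
  let ?s = "sstep (ringT x / \<epsilon>)" and ?t = "ring_phase x" and ?d = "ring_phase' x e1"
  have d: "?d = - pi * sstep' ((x \<bullet> e1 / ringT x + 1) / 2) / ringT x"
    by (simp add: ring_phase'_def ringT'_e1)
  have r': "ring' \<epsilon> x e1 = of_real (?s * ?d) * (\<i> * cis ?t)"
    using True by (simp add: ring'_def ringT'_e1 scaleR_conv_of_real)
  have r: "cnj (ring \<epsilon> x) = of_real (1 - ?s) + of_real ?s * cis (- ?t)"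
    using True by (simp add: ring_def scaleR_conv_of_real algebra_simps cis_cnj)
  have "\<i> * ring' \<epsilon> x e1 * cnj (ring \<epsilon> x) = of_real (- ?s * ?d * (1 - ?s)) * cis ?t + of_real (- ?s * ?d * ?s) * (cis ?t * cis (- ?t))"
    unfolding r' r by (simp add: algebra_simps)
  also have "cis ?t * cis (- ?t) = 1" by (simp add: cis_mult)
  finally have "Re (\<i> * ring' \<epsilon> x e1 * cnj (ring \<epsilon> x)) = - ?s * ?d * (1 - ?s) * cos ?t - ?s\<^sup>2 * ?d"
    by (simp add: power2_eq_square)
  moreover have "Im (ring' \<epsilon> x e1) = ?s * ?d * cos ?t" unfolding r' by simp
  moreover have "ring_mom \<epsilon> x = - ?s\<^sup>2 * ?d" using True by (simp add: ring_mom_def d)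
  ultimately show ?thesis by (simp add: algebra_simps)
qed (simp add: ring_mom_def ring'_def)

lemma ring_mom_nonneg: "ring_mom \<epsilon> x \<ge> 0"
  by (auto simp: ring_mom_def sstep'_nonneg)

lemma ring_mom_outside: "\<bar>x \<bullet> e1\<bar> \<ge> ringT x \<Longrightarrow> ring_mom \<epsilon> x = 0"
  using ring_phase_trivial(3)[of x] by (auto simp: ring_mom_def)

lemma ring_mom_bound:
  assumes \<epsilon>: "\<epsilon> > 0" and x: "\<bar>x \<bullet> e1\<bar> < ringT x"
  shows "ring_mom \<epsilon> x \<le> 18 / max (ringT x) \<epsilon>"
proof -
  let ?T = "ringT x" and ?s = "sstep (ringT x / \<epsilon>)"
  have T: "?T > 0" using x by linarith
  have s: "?s\<^sup>2 / ?T \<le> 3 / max ?T \<epsilon>"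
  proof (cases "?T < \<epsilon>")
    case True
    have "?s\<^sup>2 \<le> ?s * 1" unfolding power2_eq_square by (intro mult_left_mono sstep_le_1 sstep_nonneg)
    also have "\<dots> \<le> 3 * (?T / \<epsilon>)\<^sup>2" using sstep_quadratic by simp
    finally have "?s\<^sup>2 / ?T \<le> 3 * (?T / \<epsilon>)\<^sup>2 / ?T" using T by (simp add: divide_right_mono)
    also have "\<dots> = 3 * (?T / \<epsilon>) / \<epsilon>" using T by (simp add: power2_eq_square field_simps)
    also have "\<dots> \<le> 3 * 1 / \<epsilon>" using True T \<epsilon> by (intro divide_right_mono mult_left_mono) auto
    finally show ?thesis using True by (simp add: max_def)
  next
    case False
    have "?s\<^sup>2 \<le> 3" using power_mono[OF sstep_le_1 sstep_nonneg, of "?T / \<epsilon>" 2] by simp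
    then show ?thesis using False T by (simp add: max_def divide_right_mono)
  qed
  have "ring_mom \<epsilon> x = (pi * sstep' ((x \<bullet> e1 / ?T + 1) / 2)) * (?s\<^sup>2 / ?T)" using T by (simp add: ring_mom_def)
  also have "\<dots> \<le> (4 * (3/2)) * (3 / max ?T \<epsilon>)"
    using pi_less_4 T by (intro mult_mono s sstep'_le) (auto simp: sstep'_nonneg)
  finally show ?thesis by simp
qed

text \<open>On this cylinder \<open>ringT\<close> exceeds 3/4, so the amplitude is 1 for all
  admissible \<open>\<epsilon>\<close>, and the argument of \<open>sstep'\<close> lies between 1/3
  and 2/3. The bound is uniform in \<open>\<epsilon>\<close>: shrinking the core does not destroy
  the momentum.\<close>

lemma ring_mom_lower:
  assumes \<epsilon>: "\<epsilon> > 0" "\<epsilon> \<le> 1/2" and x: "\<bar>x \<bullet> e1\<bar> \<le> 1/4" "norm (perp x) < 1/2"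
  shows "ring_mom \<epsilon> x \<ge> 1"
proof -
  let ?T = "ringT x"
  have "(norm (perp x))\<^sup>2 < (1/2)\<^sup>2" using x by (intro power_strict_mono) auto
  then have T: "?T > 3/4" "?T \<le> 1" by (auto simp: ringT_def power2_eq_square)
  define s where "s = (x \<bullet> e1 / ?T + 1) / 2"
  have "\<bar>x \<bullet> e1 / ?T\<bar> \<le> (1/4) / (3/4)" unfolding abs_divide using x T by (intro frac_le) auto
  also have "(1/4) / (3/4) = (1/3::real)" by simp
  finally have z: "\<bar>x \<bullet> e1 / ?T\<bar> \<le> 1/3" .
  have "1/3 \<le> (z + 1) / 2" "(z + 1) / 2 \<le> 2/3" if "\<bar>z\<bar> \<le> 1/3" for z :: real using that by auto
  from this[OF z] have s: "1/3 \<le> s" and s2: "s \<le> 2/3" unfolding s_def by auto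
  have "(s - 1/3) * (2/3 - s) \<ge> 0" using s s2 by simp
  moreover have "(s - 1/3) * (2/3 - s) = s * (1 - s) - 2/9" by (simp add: field_simps)
  ultimately have "s * (1 - s) \<ge> 2/9" by linarith
  then have "6 * (s * (1 - s)) \<ge> 1" by linarith
  then have "sstep' s \<ge> 1" using s s2 by (simp add: sstep'_def mult.assoc)
  have "?T / \<epsilon> \<ge> 1" using T \<epsilon> by (simp add: le_divide_eq)
  then have "sstep (?T / \<epsilon>) = 1" by (simp add: sstep_def)
  then have "ring_mom \<epsilon> x = pi * sstep' s / ?T" using T unfolding ring_mom_def s_def by simp
  also have "\<dots> \<ge> pi * 1 / 1" using T \<open>sstep' s \<ge> 1\<close> by (intro frac_le mult_left_mono) auto
  finally show ?thesis using pi_ge_two by simp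
qed

section \<open>Volumes of the dyadic layers of the lens\<close>

definition cyl :: "real \<Rightarrow> real \<Rightarrow> 'a::euclidean_space set" where
  "cyl a r = {x. \<bar>x \<bullet> e1\<bar> \<le> a \<and> norm (perp x) < r}"

definition lens :: "real \<Rightarrow> 'a::euclidean_space set" where
  "lens \<tau> = {x. \<bar>x \<bullet> e1\<bar> < ringT x \<and> ringT x \<le> \<tau>}"

lemma perp_continuous [continuous_intros]: "continuous_on A perp"
  unfolding perp_def[abs_def] by (intro continuous_intros)

lemma ringT_continuous [continuous_intros]: "continuous_on A ringT"
  unfolding ringT_def[abs_def] by (intro continuous_intros)

lemma perp_measurable [measurable]: "perp \<in> borel_measurable borel"
  and ringT_measurable [measurable]: "ringT \<in> borel_measurable borel"
  by (auto intro!: borel_measurable_continuous_onI continuous_intros)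

lemma cyl_measurable [measurable]: "cyl a r \<in> sets borel"
  unfolding cyl_def by measurable

lemma lens_measurable [measurable]: "lens \<tau> \<in> sets borel"
  unfolding lens_def by measurable

lemma norm_le_perp: "norm x \<le> \<bar>x \<bullet> e1\<bar> + norm (perp x)"
proof -
  have "norm x = norm ((x \<bullet> e1) *\<^sub>R e1 + perp x)" by (simp add: perp_def)
  also have "\<dots> \<le> norm ((x \<bullet> e1) *\<^sub>R (e1::'a)) + norm (perp x)" by (rule norm_triangle_ineq)
  finally show ?thesis using e1_Basis[where 'a='a] by simp
qed

text \<open>The diagonal map that stretches \<open>e1\<close> by \<open>a\<close> and all other
  basis vectors by \<open>r\<close> carries the unit cylinder to this one.\<close>

lemma cyl_scale:
  fixes a r :: real assumes "a > 0" "r > 0"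
  shows "measure lborel (cyl a r :: 'a::euclidean_space set) = a * r ^ (DIM('a) - 1) * measure lborel (cyl 1 1 :: 'a set)"
proof -
  define c where "c j = (if j = (e1::'a) then a else r)" for j
  define T where "T x = 0 + (\<Sum>j\<in>Basis. (c j * (x \<bullet> j)) *\<^sub>R j)" for x :: 'a
  have T: "T x = r *\<^sub>R x + ((a - r) * (x \<bullet> e1)) *\<^sub>R e1" for x
  proof -
    have "T x = (\<Sum>j\<in>Basis. (r * (x \<bullet> j)) *\<^sub>R j + (if j = e1 then ((a - r) * (x \<bullet> e1)) *\<^sub>R e1 else 0))"
      unfolding T_def c_def by (auto intro!: sum.cong simp: algebra_simps)
    also have "\<dots> = r *\<^sub>R (\<Sum>j\<in>Basis. (x \<bullet> j) *\<^sub>R j) + ((a - r) * (x \<bullet> e1)) *\<^sub>R e1"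
      using e1_Basis[where 'a='a] by (simp add: sum.distrib scaleR_sum_right sum.delta)
    finally show ?thesis by (simp add: euclidean_representation)
  qed
  have Te: "T x \<bullet> e1 = a * (x \<bullet> e1)" for x by (simp add: T inner_simps algebra_simps)
  have "perp (T x) = r *\<^sub>R perp x" for x
    unfolding perp_def Te by (simp add: T algebra_simps)
  then have pre: "T -` cyl a r = cyl 1 1"
    using assms by (auto simp: cyl_def Te abs_mult)
  have eq: "lborel = density (distr lborel borel T) (\<lambda>_. ennreal (\<Prod>j\<in>Basis. \<bar>c j\<bar>))"
    unfolding T_def by (rule lborel_affine_euclidean) (use assms in \<open>auto simp: c_def\<close>)
  have [measurable]: "T \<in> borel_measurable borel" unfolding T_def by simp
  have "emeasure lborel (cyl a r :: 'a set) = ennreal (\<Prod>j\<in>Basis. \<bar>c j\<bar>) * emeasure lborel (cyl 1 1 :: 'a set)"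
    by (subst eq) (simp add: emeasure_density nn_integral_cmult emeasure_distr pre)
  moreover have "(\<Prod>j\<in>Basis. \<bar>c j\<bar>) = a * r ^ (DIM('a) - 1)"
  proof -
    have "(\<Prod>j\<in>Basis. \<bar>c j\<bar>) = \<bar>c e1\<bar> * (\<Prod>j\<in>Basis - {e1}. \<bar>c j\<bar>)"
      using e1_Basis by (intro prod.remove) auto
    also have "(\<Prod>j\<in>Basis - {e1::'a}. \<bar>c j\<bar>) = (\<Prod>j\<in>Basis - {e1::'a}. r)" using assms by (intro prod.cong) (auto simp: c_def)
    finally show ?thesis using assms e1_Basis[where 'a='a] by (simp add: c_def)
  qed
  ultimately show ?thesis using assms by (simp add: measure_def enn2real_mult)
qed

lemma cyl_bounded: "cyl a r \<subseteq> cball 0 (a + r)"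
proof
  fix x :: 'a assume "x \<in> cyl a r"
  then show "x \<in> cball 0 (a + r)" using norm_le_perp[of x] by (simp add: cyl_def)
qed

lemma cyl_finite: "emeasure lborel (cyl a r :: 'a::euclidean_space set) < \<infinity>"
proof (rule order_le_less_trans)
  show "emeasure lborel (cyl a r :: 'a set) \<le> emeasure lborel (cball 0 (a + r) :: 'a set)" by (rule emeasure_mono[OF cyl_bounded]) simp
qed (rule emeasure_lborel_cball_finite)

lemma cyl_1_pos: "measure lborel (cyl 1 1 :: 'a::euclidean_space set) > 0"
proof -
  have "ball (0::'a) 1 \<subseteq> cyl 1 1"
  proof
    fix x :: 'a assume "x \<in> ball 0 1"
    then show "x \<in> cyl 1 1" using norm_perp_le[of x] Basis_le_norm[OF e1_Basis, of x] by (auto simp: cyl_def)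
  qed
  then have "measure lborel (ball (0::'a) 1) \<le> measure lborel (cyl 1 1 :: 'a set)"
    using cyl_finite by (intro measure_mono_fmeasurable) (auto simp: fmeasurable_def)
  moreover have "measure lborel (ball (0::'a) 1) > 0" by (rule content_ball_pos) simp
  ultimately show ?thesis by linarith
qed

text \<open>The exponent 2 is the codimension of the ring: on this set both the first coordinate and
  \<open>1 - norm (perp x)\<close> are at most \<open>\<tau>\<close>, so it lies in a cylindrical
  shell of height and thickness of order \<open>\<tau>\<close>. Bernoulli's inequality bounds the
  volume of the shell.\<close>

lemma lens_measure:
  assumes "0 < \<tau>" "\<tau> \<le> 1"
  shows "emeasure lborel (lens \<tau> :: 'a::euclidean_space set) \<le> ennreal (measure lborel (cyl 1 1 :: 'a set) * real DIM('a) * \<tau>\<^sup>2)"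
proof -
  let ?k = "measure lborel (cyl 1 1 :: 'a set)"
  have k0: "?k \<ge> 0" by simp
  have sub: "lens \<tau> \<subseteq> (cyl \<tau> 1 :: 'a set) - cyl \<tau> (1 - \<tau>)"
  proof
    fix x :: 'a assume x: "x \<in> lens \<tau>"
    then have T: "0 < ringT x" "ringT x \<le> \<tau>" "\<bar>x \<bullet> e1\<bar> \<le> \<tau>" by (auto simp: lens_def)
    have "norm (perp x) < 1" using T(1) by (simp add: ringT_def abs_square_less_1)
    moreover have "\<not> norm (perp x) < 1 - \<tau>"
    proof
      assume a: "norm (perp x) < 1 - \<tau>"
      then have "(norm (perp x))\<^sup>2 < (1 - \<tau>)\<^sup>2" by (intro power_strict_mono) auto
      also have "\<dots> = (1 - \<tau>) * (1 - \<tau>)" by (simp add: power2_eq_square)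
      also have "\<dots> \<le> (1 - \<tau>) * 1" using assms by (intro mult_left_mono) auto
      finally show False using T by (simp add: ringT_def)
    qed
    ultimately show "x \<in> cyl \<tau> 1 - cyl \<tau> (1 - \<tau>)" using T by (auto simp: cyl_def)
  qed
  have "emeasure lborel (lens \<tau> :: 'a set) \<le> emeasure lborel ((cyl \<tau> 1 :: 'a set) - cyl \<tau> (1 - \<tau>))"
    by (intro emeasure_mono sub) simp
  also have "\<dots> = ennreal (measure lborel ((cyl \<tau> 1 :: 'a set) - cyl \<tau> (1 - \<tau>)))"
    using cyl_finite[of \<tau> 1, where 'a='a]
    by (intro emeasure_eq_ennreal_measure) (metis Diff_subset cyl_measurable emeasure_mono infinity_ennreal_def not_le sets_lborel)
  also have "measure lborel ((cyl \<tau> 1 :: 'a set) - cyl \<tau> (1 - \<tau>)) = measure lborel (cyl \<tau> 1 :: 'a set) - measure lborel (cyl \<tau> (1 - \<tau>) :: 'a set)"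
    using cyl_finite[of \<tau> 1, where 'a='a] assms by (intro measure_Diff) (auto simp: cyl_def)
  also have "\<dots> \<le> ?k * real DIM('a) * \<tau>\<^sup>2"
  \<comment> \<open>For \<open>\<tau> = 1\<close> the removed cylinder has radius 0, and
    \<open>cyl_scale\<close> needs a positive radius.\<close>
  proof (cases "\<tau> = 1")
    case True
    have "measure lborel (cyl \<tau> 1 :: 'a set) - measure lborel (cyl \<tau> (1 - \<tau>) :: 'a set) \<le> ?k * 1"
      using True by simp
    also have "\<dots> \<le> ?k * real DIM('a)" by (intro mult_left_mono) (auto simp: Suc_leI)
    finally show ?thesis using True by simp
  next
    case False
    have "measure lborel (cyl \<tau> 1 :: 'a set) - measure lborel (cyl \<tau> (1 - \<tau>) :: 'a set) = ?k * (\<tau> * (1 - (1 - \<tau>) ^ (DIM('a) - 1)))"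
      using cyl_scale[of \<tau> 1, where 'a='a] cyl_scale[of \<tau> "1 - \<tau>", where 'a='a] False assms
      by (simp add: algebra_simps)
    also have "\<dots> \<le> ?k * (\<tau> * (real DIM('a) * \<tau>))"
    proof (intro mult_left_mono k0)
      have "1 + real (DIM('a) - 1) * (- \<tau>) \<le> (1 + (- \<tau>)) ^ (DIM('a) - 1)" using assms by (intro Bernoulli_inequality) simp
      then have "1 - (1 - \<tau>) ^ (DIM('a) - 1) \<le> real (DIM('a) - 1) * \<tau>" by simp
      also have "\<dots> \<le> real DIM('a) * \<tau>" using assms by (intro mult_right_mono) auto
      finally show "1 - (1 - \<tau>) ^ (DIM('a) - 1) \<le> real DIM('a) * \<tau>" .
    qed (use assms in auto)
    finally show ?thesis by (simp add: power2_eq_square mult_ac)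
  qed
  finally show ?thesis by (simp add: ennreal_leI)
qed

text \<open>Take the largest \<open>j \<le> K\<close> with \<open>ringT x \<le> (1/2)^j\<close>; the
  index 0 always qualifies because \<open>ringT\<close> is at most 1. Maximality bounds the maximum
  on the left from below by \<open>(1/2)^(j+1)\<close>, and the single summand \<open>j\<close>
  already dominates.\<close>

lemma lens_layers:
  assumes x: "\<bar>x \<bullet> e1\<bar> < ringT x"
  shows "(1 / max (ringT x) ((1/2)^K)) ^ p \<le> (\<Sum>j\<le>K. (2 ^ (j + 1)) ^ p * indicat_real (lens ((1/2)^j)) x)"
proof -
  let ?J = "{j. j \<le> K \<and> ringT x \<le> (1/2)^j}"
  have J: "finite ?J" "0 \<in> ?J" using ringT_le_1 by auto
  define j where "j = Max ?J"
  have j: "j \<le> K" "ringT x \<le> (1/2)^j" using Max_in[OF J(1)] J(2) unfolding j_def by blast+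
  have T: "ringT x > 0" using x by linarith
  have m: "(1/2)^(j+1) \<le> max (ringT x) ((1/2)^K)"
  proof (cases "j = K")
    case True
    then show ?thesis by (simp add: le_max_iff_disj)
  next
    case False
    have "j + 1 \<notin> ?J"
    proof
      assume "j + 1 \<in> ?J"
      then have "j + 1 \<le> Max ?J" by (rule Max_ge[OF J(1)])
      then show False by (simp add: j_def)
    qed
    then have "ringT x > (1/2)^(j+1)" using False j by auto
    then show ?thesis by (simp add: le_max_iff_disj)
  qed
  have "1 / max (ringT x) ((1/2)^K) \<le> 1 / (1/2)^(j+1)" using m by (intro divide_left_mono) (auto simp: max_def T)
  then have "(1 / max (ringT x) ((1/2)^K)) ^ p \<le> (2 ^ (j + 1)) ^ p"
    using T by (intro power_mono) (auto simp: power_divide max_def)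
  also have "\<dots> = (2 ^ (j + 1)) ^ p * indicat_real (lens ((1/2)^j)) x" using x j by (simp add: lens_def)
  also have "\<dots> \<le> (\<Sum>j\<le>K. (2 ^ (j + 1)) ^ p * indicat_real (lens ((1/2)^j)) x)"
    by (rule member_le_sum) (use j in auto)
  finally show ?thesis .
qed

lemma lens_layer_integral:
  fixes f :: "'a::euclidean_space \<Rightarrow> real"
  assumes in_b: "\<And>x. \<bar>x \<bullet> e1\<bar> < ringT x \<Longrightarrow> f x \<le> c * (1 / max (ringT x) ((1/2)^K)) ^ p"
    and out_b: "\<And>x. \<bar>x \<bullet> e1\<bar> \<ge> ringT x \<Longrightarrow> f x = 0" and c: "c \<ge> 0"
  shows "(\<integral>\<^sup>+x. ennreal (f x) \<partial>lborel) \<le> ennreal (c * measure lborel (cyl 1 1 :: 'a set) * real DIM('a) * (\<Sum>j\<le>K. (2 ^ (j + 1)) ^ p * (1/4)^j))"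
proof -
  let ?k = "measure lborel (cyl 1 1 :: 'a set) * real DIM('a)"
  have "(\<integral>\<^sup>+x. ennreal (f x) \<partial>lborel) \<le> (\<integral>\<^sup>+x. (\<Sum>j\<le>K. ennreal (c * (2 ^ (j + 1)) ^ p) * indicator (lens ((1/2)^j) :: 'a set) x) \<partial>lborel)"
  proof (rule nn_integral_mono)
    fix x :: 'a
    have "f x \<le> (\<Sum>j\<le>K. c * (2 ^ (j + 1)) ^ p * indicat_real (lens ((1/2)^j)) x)"
    proof (cases "\<bar>x \<bullet> e1\<bar> < ringT x")
      case True
      from in_b[OF True] mult_left_mono[OF lens_layers[OF True, of K p] c]
      show ?thesis by (simp add: sum_distrib_left mult_ac)
    next
      case False
      then show ?thesis using out_b c by (auto intro!: sum_nonneg)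
    qed
    then have "ennreal (f x) \<le> ennreal (\<Sum>j\<le>K. c * (2 ^ (j + 1)) ^ p * indicat_real (lens ((1/2)^j)) x)" by (rule ennreal_leI)
    also have "\<dots> = (\<Sum>j\<le>K. ennreal (c * (2 ^ (j + 1)) ^ p * indicat_real (lens ((1/2)^j)) x))"
      using c by (intro sum_ennreal[symmetric]) auto
    also have "\<dots> = (\<Sum>j\<le>K. ennreal (c * (2 ^ (j + 1)) ^ p) * indicator (lens ((1/2)^j)) x)"
      by (intro sum.cong refl) (simp add: indicator_def)
    finally show "ennreal (f x) \<le> (\<Sum>j\<le>K. ennreal (c * (2 ^ (j + 1)) ^ p) * indicator (lens ((1/2)^j)) x)" .
  qed
  also have "\<dots> = (\<Sum>j\<le>K. ennreal (c * (2 ^ (j + 1)) ^ p) * emeasure lborel (lens ((1/2)^j) :: 'a set))"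
    by (subst nn_integral_sum) (auto simp: nn_integral_cmult)
  also have "\<dots> \<le> (\<Sum>j\<le>K. ennreal (c * (2 ^ (j + 1)) ^ p) * ennreal (?k * ((1/2)^j)\<^sup>2))"
    by (intro sum_mono mult_left_mono lens_measure) (auto simp: power_le_one)
  also have "\<dots> = (\<Sum>j\<le>K. ennreal (c * (2 ^ (j + 1)) ^ p * (?k * ((1/2)^j)\<^sup>2)))"
    using c by (intro sum.cong refl) (simp add: ennreal_mult')
  also have "\<dots> = ennreal (\<Sum>j\<le>K. c * (2 ^ (j + 1)) ^ p * (?k * ((1/2)^j)\<^sup>2))"
    using c by (intro sum_ennreal) auto
  also have "(\<Sum>j\<le>K. c * (2 ^ (j + 1)) ^ p * (?k * ((1/2)^j)\<^sup>2)) = c * ?k * (\<Sum>j\<le>K. (2 ^ (j + 1)) ^ p * (1/4)^j)"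
  proof -
    have "((1/2)^j)\<^sup>2 = (1/4::real)^j" for j
    proof -
      have "((1/2)^j)\<^sup>2 = ((1/2::real)\<^sup>2)^j" by (simp only: power_mult[symmetric] mult.commute)
      then show ?thesis by (simp add: power2_eq_square)
    qed
    then show ?thesis by (simp add: sum_distrib_left mult_ac)
  qed
  finally show ?thesis by (simp add: mult_ac)
qed

text \<open>The squared gradient is of order \<open>4^(j+1)\<close> on a layer of volume of order
  \<open>4^(-j)\<close>, so all layers contribute equally. With \<open>K\<close> of order
  \<open>ln q\<close> this is the logarithm in the upper bound.\<close>

lemma layer_sum_2: "(\<Sum>j\<le>K. (2 ^ (j + 1)) ^ 2 * (1/4)^j) = 4 * (real K + 1)"
proof -
  have "(2 ^ (j + 1)) ^ 2 * (1/4)^j = (4::real)" for j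
  proof -
    have "(2 ^ (j + 1)) ^ 2 = ((2::real)^2) ^ (j + 1)" by (simp only: power_mult[symmetric] mult.commute)
    also have "(2::real)^2 = 4" by simp
    finally have "(2 ^ (j + 1)) ^ 2 = (4::real) ^ (j + 1)" .
    then show ?thesis by (simp add: power_divide)
  qed
  then show ?thesis by (simp add: algebra_simps)
qed

section \<open>The potential at arguments up to 1\<close>

lemma Vpot_below:
  assumes "continuous_on {0..} F" "0 \<le> s" "s \<le> 1" shows "Vpot F s = integral {s..1} F"
proof -
  have c: "continuous_on {s..1} F" using assms by (auto intro: continuous_on_subset)
  then have "set_integrable lborel {s..1} F" unfolding set_integrable_def
    using borel_integrable_compact[OF compact_Icc c] by simp
  then show ?thesis unfolding Vpot_def one_ereal_def using assms by (intro interval_integral_eq_integral) auto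
qed

lemma Vpot_above:
  assumes "continuous_on {0..} F" "1 \<le> s" shows "Vpot F s = - integral {1..s} F"
proof -
  have c: "continuous_on {1..s} F" using assms by (auto intro: continuous_on_subset)
  then have "set_integrable lborel {1..s} F" unfolding set_integrable_def
    using borel_integrable_compact[OF compact_Icc c] by simp
  then have "(LBINT t=ereal 1..ereal s. F t) = integral {1..s} F" using assms by (intro interval_integral_eq_integral) auto
  then show ?thesis unfolding Vpot_def by (subst interval_integral_endpoints_reverse) (simp add: one_ereal_def)
qed

lemma Vpot_1: "continuous_on {0..} F \<Longrightarrow> Vpot F 1 = 0"
  by (subst Vpot_below) auto

text \<open>The ring has modulus at most 1, so its potential energy involves only these arguments
  and continuity of \<open>F\<close> is enough.\<close>

lemma Vpot_bounded_below_1: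
  assumes "continuous_on {0..} F"
  obtains B where "B > 0" "\<And>s. 0 \<le> s \<Longrightarrow> s \<le> 1 \<Longrightarrow> \<bar>Vpot F s\<bar> \<le> B"
proof -
  have c: "continuous_on {0..1} F" using assms by (auto intro: continuous_on_subset)
  obtain B where B: "B > 0" "\<And>t. t \<in> {0..1} \<Longrightarrow> \<bar>F t\<bar> \<le> B"
    using compact_imp_bounded[OF compact_continuous_image[OF c compact_Icc]] unfolding bounded_pos by auto
  show ?thesis
  proof (rule that[OF B(1)])
    fix s :: real assume s: "0 \<le> s" "s \<le> 1"
    have "norm (integral {s..1} F) \<le> B * (1 - s)"
      by (rule integral_bound) (use s B in \<open>auto intro!: continuous_on_subset[OF c]\<close>)
    also have "\<dots> \<le> B * 1" using B s by (intro mult_left_mono) auto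
    finally show "\<bar>Vpot F s\<bar> \<le> B" using Vpot_below[OF assms s] by simp
  qed
qed

section \<open>The ring scaled by \<open>R\<close>: energy space, momentum, energy\<close>

lemma nn_integral_lborel_scale:
  fixes f :: "'a::euclidean_space \<Rightarrow> ennreal"
  assumes [measurable]: "f \<in> borel_measurable borel" and R: "R > 0"
  shows "(\<integral>\<^sup>+x. f ((1/R) *\<^sub>R x) \<partial>lborel) = ennreal (R ^ DIM('a)) * (\<integral>\<^sup>+x. f x \<partial>lborel)"
proof -
  have "(\<integral>\<^sup>+x. f ((1/R) *\<^sub>R x) \<partial>lborel) = ennreal (\<bar>R\<bar> ^ DIM('a)) * (\<integral>\<^sup>+x. f ((1/R) *\<^sub>R (0 + R *\<^sub>R x)) \<partial>lborel)"
    using R by (intro nn_integral_lborel_affine) auto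
  then show ?thesis using R by simp
qed

lemma outside_lens_bounded:
  assumes "\<bar>x \<bullet> e1\<bar> < ringT x" shows "norm x \<le> 2"
proof -
  have "0 < ringT x" using assms by linarith
  then have "norm (perp x) < 1" by (simp add: ringT_def abs_square_less_1)
  then show ?thesis using norm_le_perp[of x] assms ringT_le_1[of x] by linarith
qed

lemma integrable_bounded_compact_support:
  fixes f :: "'a::euclidean_space \<Rightarrow> 'b::{banach,second_countable_topology}"
  assumes [measurable]: "f \<in> borel_measurable borel" and "\<And>x. norm (f x) \<le> B" "\<And>x. norm x > r \<Longrightarrow> f x = 0"
  shows "integrable lborel f"
proof (rule Bochner_Integration.integrable_bound)
  show "integrable lborel (\<lambda>x::'a. B * indicat_real (cball 0 r) x)"
    using borel_integrable_compact[OF compact_cball[of "0::'a" r], of "\<lambda>_. B"] by (simp add: mult.commute)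
  show "AE x in lborel. norm (f x) \<le> norm (B * indicat_real (cball 0 r) x)"
  proof (rule AE_I2)
    fix x show "norm (f x) \<le> norm (B * indicat_real (cball 0 r) x)"
      using assms(2)[of x] assms(3)[of x] by (cases "norm x \<le> r") (auto simp: indicator_def)
  qed
qed simp

lemma scaled_has_derivative:
  fixes f :: "'a::euclidean_space \<Rightarrow> 'b::real_normed_vector"
  assumes d: "\<And>y. (f has_derivative f' y) (at y)"
  shows "((\<lambda>x. f (c *\<^sub>R x)) has_derivative (\<lambda>v. c *\<^sub>R f' (c *\<^sub>R x) v)) (at x)"
proof -
  have "((\<lambda>x. f (c *\<^sub>R x)) has_derivative (\<lambda>v. f' (c *\<^sub>R x) (c *\<^sub>R v))) (at x)"
    by (rule has_derivative_compose[of "\<lambda>x. c *\<^sub>R x"]) (auto intro!: derivative_eq_intros d)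
  then show ?thesis by (simp add: linear_scale[OF has_derivative_linear[OF d]])
qed

lemma grad_L2_scaled:
  fixes f :: "'a::euclidean_space \<Rightarrow> 'b::{banach,second_countable_topology}"
  assumes d: "\<And>y. (f has_derivative f' y) (at y)" and c: "c > 0"
    and B: "\<And>b y. b \<in> Basis \<Longrightarrow> norm (f' y b) \<le> B" and r: "\<And>b y. norm y > r \<Longrightarrow> f' y b = 0"
  shows "grad_L2 (\<lambda>x. f (c *\<^sub>R x)) (\<lambda>b x. c *\<^sub>R f' (c *\<^sub>R x) b)"
  unfolding grad_L2_def
proof (intro ballI conjI)
  fix b :: 'a assume b: "b \<in> Basis"
  show "weak_partial (\<lambda>x. f (c *\<^sub>R x)) b (\<lambda>x. c *\<^sub>R f' (c *\<^sub>R x) b)"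
    by (rule weak_partial_differentiable[OF scaled_has_derivative[OF d]])
      (use B[OF b] c in \<open>auto intro!: exI[of _ "c * B"]\<close>)
  have [measurable]: "(\<lambda>x. c *\<^sub>R f' (c *\<^sub>R x) b) \<in> borel_measurable borel"
    by (rule measurable_directional_derivative[OF scaled_has_derivative[OF d]])
  show "integrable lborel (\<lambda>x. (norm (c *\<^sub>R f' (c *\<^sub>R x) b))\<^sup>2)"
  proof (rule integrable_bounded_compact_support[where B="(c * B)\<^sup>2" and r="r / c"])
    show "norm ((norm (c *\<^sub>R f' (c *\<^sub>R x) b))\<^sup>2) \<le> (c * B)\<^sup>2" for x
      using B[OF b, of "c *\<^sub>R x"] c by (simp add: power_mult_distrib power_mono mult_left_mono)
    show "r / c < norm x \<Longrightarrow> (norm (c *\<^sub>R f' (c *\<^sub>R x) b))\<^sup>2 = 0" for x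
      using r[of "c *\<^sub>R x" b] c by (simp add: divide_less_eq mult.commute)
  qed measurable
qed

context
  fixes \<epsilon> R :: real and \<psi> :: "'a::euclidean_space \<Rightarrow> complex" and G :: "'a \<Rightarrow> 'a \<Rightarrow> complex"
  assumes \<epsilon>: "\<epsilon> > 0" and R: "R > 0"
  defines "\<psi> \<equiv> \<lambda>x. ring \<epsilon> ((1/R) *\<^sub>R x)" and "G \<equiv> \<lambda>b x. (1/R) *\<^sub>R ring' \<epsilon> ((1/R) *\<^sub>R x) b"
begin

lemma ring'_bound_all: "b \<in> Basis \<Longrightarrow> norm (ring' \<epsilon> (y::'a) b) \<le> 51 / \<epsilon>"
proof (cases "\<bar>y \<bullet> e1\<bar> < ringT y")
  case True
  assume "b \<in> Basis"
  then have "norm (ring' \<epsilon> y b) \<le> 51 / max (ringT y) \<epsilon>" using ring'_bound[OF \<epsilon> _ True] by simp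
  also have "\<dots> \<le> 51 / \<epsilon>" using \<epsilon> by (intro divide_left_mono) auto
  finally show ?thesis .
next
  case False
  then show ?thesis using \<epsilon> by (simp add: ring_outside)
qed

lemma ring_far: "norm y > 2 \<Longrightarrow> \<bar>y \<bullet> e1\<bar> \<ge> ringT (y::'a)"
  using outside_lens_bounded[of y] by linarith

lemma ring_in_E:
  assumes cut: "cutoff_ok \<phi>" shows "in_E \<phi> \<psi> G"
  unfolding in_E_def
proof (intro conjI)
  show g: "grad_L2 \<psi> G"
    unfolding \<psi>_def G_def
    by (rule grad_L2_scaled[where B="51/\<epsilon>" and r=2])
      (use R \<epsilon> ring'_bound_all ring_far in \<open>auto intro!: ring_has_derivative ring_outside\<close>)
  then show "loc_int \<psi>" unfolding grad_L2_def weak_partial_def using e1_Basis by blast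
  have c: "continuous_on UNIV \<psi>"
    unfolding \<psi>_def
    by (auto intro!: continuous_at_imp_continuous_on has_derivative_continuous[OF scaled_has_derivative[OF ring_has_derivative[OF \<epsilon>]]])
  have e: "\<phi> (cmod (\<psi> x)) = cmod (\<psi> x)" for x
  proof -
    have "cmod (\<psi> x) \<in> {0..2}" using ring_norm_le_1[of \<epsilon> "(1/R) *\<^sub>R x"] unfolding \<psi>_def by simp
    then show ?thesis using cut unfolding cutoff_ok_def by blast
  qed
  have [measurable]: "\<psi> \<in> borel_measurable borel" using c by (rule borel_measurable_continuous_onI)
  show "integrable lborel (\<lambda>x. ((\<phi> (cmod (\<psi> x)))\<^sup>2 - 1)\<^sup>2)"
    unfolding e
  proof (rule integrable_bounded_compact_support[where B=1 and r="2 * R"])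
    show "norm (((cmod (\<psi> x))\<^sup>2 - 1)\<^sup>2) \<le> 1" for x
    proof -
      have "(cmod (\<psi> x))\<^sup>2 \<le> 1"
        using ring_norm_le_1[of \<epsilon> "(1/R) *\<^sub>R x"] unfolding \<psi>_def by (simp add: power_le_one)
      then have "\<bar>(cmod (\<psi> x))\<^sup>2 - 1\<bar> \<le> 1" by (auto simp: abs_le_iff)
      then show ?thesis using power_le_one[of "\<bar>(cmod (\<psi> x))\<^sup>2 - 1\<bar>" 2] by simp
    qed
    show "((cmod (\<psi> x))\<^sup>2 - 1)\<^sup>2 = 0" if "2 * R < norm x" for x
      using ring_far[of "(1/R) *\<^sub>R x"] that R unfolding \<psi>_def
      by (simp add: ring_outside less_divide_eq)
  qed measurable
qed

lemma ring_mom_measurable [measurable]: "(ring_mom \<epsilon> :: 'a \<Rightarrow> real) \<in> borel_measurable borel"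
proof -
  have [measurable]: "(\<lambda>x::'a. ring' \<epsilon> x e1) \<in> borel_measurable borel"
    by (rule measurable_directional_derivative[OF ring_has_derivative[OF \<epsilon>]])
  have [measurable]: "(ring \<epsilon> :: 'a \<Rightarrow> complex) \<in> borel_measurable borel"
    by (rule borel_measurable_continuous_onI)
      (meson continuous_at_imp_continuous_on has_derivative_continuous ring_has_derivative[OF \<epsilon>])
  have [measurable]: "sstep \<in> borel_measurable borel"
    by (rule borel_measurable_continuous_onI)
      (meson DERIV_isCont continuous_at_imp_continuous_on sstep_has_derivative)
  have "(ring_mom \<epsilon> :: 'a \<Rightarrow> real) = (\<lambda>x. Re (\<i> * ring' \<epsilon> x e1 * cnj (ring \<epsilon> x)) + (1 - sstep (ringT x / \<epsilon>)) * Im (ring' \<epsilon> x e1))"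
  proof
    fix x :: 'a
    show "ring_mom \<epsilon> x = Re (\<i> * ring' \<epsilon> x e1 * cnj (ring \<epsilon> x)) + (1 - sstep (ringT x / \<epsilon>)) * Im (ring' \<epsilon> x e1)"
      using ring_momentum_density[OF \<epsilon>, of x] by linarith
  qed
  then show ?thesis by simp
qed

lemma ring_mom_integrable: "integrable lborel (ring_mom \<epsilon> :: 'a \<Rightarrow> real)"
proof (rule integrable_bounded_compact_support[where B="18/\<epsilon>" and r=2])
  show "norm (ring_mom \<epsilon> x) \<le> 18 / \<epsilon>" for x :: 'a
  proof (cases "\<bar>x \<bullet> e1\<bar> < ringT x")
    case True
    then have "norm (ring_mom \<epsilon> x) \<le> 18 / max (ringT x) \<epsilon>" using ring_mom_bound[OF \<epsilon> True] ring_mom_nonneg[of \<epsilon> x] by simp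
    also have "\<dots> \<le> 18 / \<epsilon>" using \<epsilon> by (intro divide_left_mono) auto
    finally show ?thesis .
  next
    case False
    then show ?thesis using \<epsilon> by (simp add: ring_mom_outside)
  qed
  show "2 < norm x \<Longrightarrow> ring_mom \<epsilon> x = 0" for x :: 'a using ring_far by (simp add: ring_mom_outside)
qed measurable

text \<open>Volume scales with the dimension as exponent, and the one derivative takes away a factor
  \<open>R\<close>. The rescaled \<open>ring_mom\<close> is the integrable part of the
  decomposition, the rescaled \<open>Z\<close> the potential of the rest.\<close>

lemma ring_Qmom:
  assumes N2: "DIM('a) \<ge> 2"
  shows "Qmom \<psi> G = R ^ (DIM('a) - 1) * (\<integral>x. ring_mom \<epsilon> x \<partial>(lborel::'a measure))"
proof -
  \<comment> \<open>As \<open>ringT\<close> is constant along \<open>e1\<close>, the derivative of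
    \<open>Z\<close> in that direction is exactly the second term of
    \<open>ring_momentum_density\<close>. The gradient of \<open>Z\<close> is bounded and vanishes
    off the lens, so it is square integrable.\<close>
  define Z where "Z y = - ((1 - sstep (ringT y / \<epsilon>)) * Im (ring \<epsilon> y))" for y :: 'a
  define Z' where "Z' y v = - ((1 - sstep (ringT y / \<epsilon>)) * Im (ring' \<epsilon> y v) + (- (sstep' (ringT y / \<epsilon>) * (ringT' y v / \<epsilon>))) * Im (ring \<epsilon> y))" for y v :: 'a
  have Zd: "(Z has_derivative Z' y) (at y)" for y
  proof -
    have 1: "((\<lambda>x. 1 - sstep (ringT x / \<epsilon>)) has_derivative (\<lambda>v. - (sstep' (ringT y / \<epsilon>) * (ringT' y v / \<epsilon>)))) (at y)"
      using has_derivative_diff[OF has_derivative_const[of 1] sstep_compose_has_derivative[of "\<lambda>x. ringT x / \<epsilon>" "\<lambda>v. ringT' y v / \<epsilon>"]]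
        has_derivative_divide'[OF ringT_has_derivative] \<epsilon> by (auto intro!: derivative_eq_intros ringT_has_derivative sstep_compose_has_derivative)
    have 2: "((\<lambda>y. Im (ring \<epsilon> y)) has_derivative (\<lambda>v. Im (ring' \<epsilon> y v))) (at y)"
      by (rule bounded_linear.has_derivative[OF bounded_linear_Im ring_has_derivative[OF \<epsilon>]])
    show ?thesis unfolding Z_def[abs_def] Z'_def[abs_def] by (rule has_derivative_minus[OF has_derivative_mult[OF 1 2]])
  qed
  have Zout: "Z' y v = 0" if "\<bar>y \<bullet> e1\<bar> \<ge> ringT y" for y v using that by (simp add: Z'_def ring_outside)
  have ZB: "norm (Z' y b) \<le> 51 / \<epsilon> + 3 / \<epsilon>" if b: "b \<in> Basis" for y b
  proof (cases "\<bar>y \<bullet> e1\<bar> < ringT y")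
    case True
    then have T: "ringT y > 0" by linarith
    have Py: "norm (perp y) \<le> 1" using T by (simp add: ringT_def abs_square_less_1 less_imp_le)
    have T': "\<bar>ringT' y b\<bar> \<le> 2"
      using ringT'_bound[of y b] Py b by simp
    have i1: "\<bar>Im (ring \<epsilon> y)\<bar> \<le> 1" using abs_Im_le_cmod[of "ring \<epsilon> y"] ring_norm_le_1[of \<epsilon> y] by linarith
    have i2: "\<bar>sstep' (ringT y / \<epsilon>) * (ringT' y b / \<epsilon>)\<bar> \<le> (3/2) * (2 / \<epsilon>)"
      unfolding abs_mult using T' \<epsilon> sstep'_nonneg[of "ringT y / \<epsilon>"] sstep'_le[of "ringT y / \<epsilon>"]
      by (intro mult_mono) (auto simp: abs_divide divide_right_mono)
    have a: "\<bar>(- (sstep' (ringT y / \<epsilon>) * (ringT' y b / \<epsilon>))) * Im (ring \<epsilon> y)\<bar> \<le> (3/2) * (2 / \<epsilon>) * 1"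
      using mult_mono[OF i2 i1] \<epsilon> by (simp add: abs_mult)
    have "\<bar>1 - sstep (ringT y / \<epsilon>)\<bar> \<le> 1" using sstep_nonneg[of "ringT y / \<epsilon>"] sstep_le_1[of "ringT y / \<epsilon>"] by simp
    then have "\<bar>(1 - sstep (ringT y / \<epsilon>)) * Im (ring' \<epsilon> y b)\<bar> \<le> 1 * (51 / \<epsilon>)"
      unfolding abs_mult using abs_Im_le_cmod[of "ring' \<epsilon> y b"] ring'_bound_all[OF b, of y] by (intro mult_mono) auto
    then have b2: "\<bar>(1 - sstep (ringT y / \<epsilon>)) * Im (ring' \<epsilon> y b)\<bar> \<le> 51 / \<epsilon>" by (rule order_trans) simp
    have a2: "\<bar>(- (sstep' (ringT y / \<epsilon>) * (ringT' y b / \<epsilon>))) * Im (ring \<epsilon> y)\<bar> \<le> 3 / \<epsilon>"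
      by (rule order_trans[OF a]) simp
    show ?thesis unfolding Z'_def real_norm_def abs_minus_cancel
      by (rule order_trans[OF abs_triangle_ineq add_mono[OF b2 a2]])
  next
    case False
    then show ?thesis using \<epsilon> by (simp add: Zout)
  qed
  define v where "v x = (1/R) * ring_mom \<epsilon> ((1/R) *\<^sub>R x)" for x :: 'a
  have vi: "integrable lborel v" and vint: "(\<integral>x. v x \<partial>lborel) = R ^ (DIM('a) - 1) * (\<integral>x. ring_mom \<epsilon> x \<partial>(lborel::'a measure))"
  proof -
    have 1: "integrable lborel (\<lambda>x::'a. ring_mom \<epsilon> (0 + (1/R) *\<^sub>R x))"
      using ring_mom_integrable R by (subst integrable_lborel_affine_iff) auto
    then show "integrable lborel v" unfolding v_def by simp
    have "(\<integral>x. ring_mom \<epsilon> x \<partial>(lborel::'a measure)) = \<bar>1/R\<bar> ^ DIM('a) * (\<integral>x. ring_mom \<epsilon> (0 + (1/R) *\<^sub>R x) \<partial>(lborel::'a measure))"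
      using R by (subst integral_lborel_affine[of _ "1/R" 0]) auto
    then have 2: "(\<integral>x. ring_mom \<epsilon> ((1/R) *\<^sub>R x) \<partial>(lborel::'a measure)) = R ^ DIM('a) * (\<integral>x. ring_mom \<epsilon> x \<partial>(lborel::'a measure))"
      using R by (simp add: power_divide)
    have 3: "(1/R) * (R ^ DIM('a) * X) = R ^ (DIM('a) - 1) * X" for X
      using R by (simp add: power_diff Suc_leI)
    have "(\<integral>x. v x \<partial>lborel) = (1/R) * (\<integral>x. ring_mom \<epsilon> ((1/R) *\<^sub>R x) \<partial>(lborel::'a measure))"
      unfolding v_def by (rule integral_mult_right_zero)
    then show "(\<integral>x. v x \<partial>lborel) = R ^ (DIM('a) - 1) * (\<integral>x. ring_mom \<epsilon> x \<partial>(lborel::'a measure))"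
      unfolding 2 3 .
  qed
  have "Lmom (\<lambda>x. Re ((\<i> * G e1 x) * cnj (\<psi> x))) = (\<integral>x. v x \<partial>lborel)"
  proof (rule Lmom_eqI[OF N2 vi])
    show "grad_L2 (\<lambda>x. Z ((1/R) *\<^sub>R x)) (\<lambda>b x. (1/R) *\<^sub>R Z' ((1/R) *\<^sub>R x) b)"
    proof (rule grad_L2_scaled[OF Zd])
      show "norm (Z' y b) \<le> 51 / \<epsilon> + 3 / \<epsilon>" if "b \<in> Basis" for b y by (rule ZB[OF that])
      show "Z' y b = 0" if "norm y > 2" for b y by (rule Zout[OF ring_far[OF that]])
    qed (use R in simp)
    show "AE x in lborel. Re ((\<i> * G e1 x) * cnj (\<psi> x)) = v x + (1/R) *\<^sub>R Z' ((1/R) *\<^sub>R x) e1"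
    proof (rule AE_I2)
      fix x :: 'a
      let ?y = "(1/R) *\<^sub>R x"
      have "Re ((\<i> * G e1 x) * cnj (\<psi> x)) = (1/R) * Re (\<i> * ring' \<epsilon> ?y e1 * cnj (ring \<epsilon> ?y))"
        unfolding G_def \<psi>_def by (simp add: scaleR_conv_of_real diff_divide_distrib del: of_real_divide)
      also have "\<dots> = v x + (1/R) *\<^sub>R Z' ?y e1"
        unfolding ring_momentum_density[OF \<epsilon>] v_def Z'_def ringT'_e1 by (simp add: algebra_simps)
      finally show "Re ((\<i> * G e1 x) * cnj (\<psi> x)) = v x + (1/R) *\<^sub>R Z' ?y e1" .
    qed
  qed
  then show ?thesis unfolding Qmom_def vint .
qed

text \<open>The gradient part scales like \<open>R^(N-2)\<close> in dimension \<open>N\<close> and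
  carries one unit per dyadic layer; 10404 is \<open>4 * 51^2\<close>. The potential vanishes off
  \<open>lens \<epsilon>\<close>, whose volume is of order \<open>\<epsilon>^2\<close>, and scales
  like \<open>R^N\<close>.\<close>

lemma ring_energy:
  assumes K: "\<epsilon> = (1/2)^K" and F: "continuous_on {0..} F" and B: "B \<ge> 0" "\<And>s. 0 \<le> s \<Longrightarrow> s \<le> 1 \<Longrightarrow> \<bar>Vpot F s\<bar> \<le> B"
  shows "energy F \<psi> G \<le> ennreal (measure lborel (cyl 1 1 :: 'a set) * real DIM('a) * R ^ DIM('a) *
     (10404 * real DIM('a) * (real K + 1) / R\<^sup>2 + B * \<epsilon>\<^sup>2))"
proof -
  let ?k = "measure lborel (cyl 1 1 :: 'a set) * real DIM('a)"
  have [measurable]: "(\<lambda>x::'a. ring' \<epsilon> x b) \<in> borel_measurable borel" for b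
    by (rule measurable_directional_derivative[OF ring_has_derivative[OF \<epsilon>]])
  have cr: "continuous_on UNIV (ring \<epsilon> :: 'a \<Rightarrow> complex)"
    by (meson continuous_at_imp_continuous_on has_derivative_continuous ring_has_derivative[OF \<epsilon>])
  have [measurable]: "(ring \<epsilon> :: 'a \<Rightarrow> complex) \<in> borel_measurable borel"
    by (rule borel_measurable_continuous_onI[OF cr])
  let ?g = "\<lambda>y::'a. (\<Sum>b\<in>Basis. (cmod ((1/R) *\<^sub>R ring' \<epsilon> y b))\<^sup>2)"
  have eq: "(\<integral>\<^sup>+x. ennreal (\<Sum>b\<in>Basis. (cmod (G b x))\<^sup>2) \<partial>lborel) = ennreal (R ^ DIM('a)) * (\<integral>\<^sup>+y. ennreal (?g y) \<partial>lborel)"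
    unfolding G_def using R by (subst nn_integral_lborel_scale[symmetric]) auto
  have le: "(\<integral>\<^sup>+y. ennreal (?g y) \<partial>lborel) \<le> ennreal ((real DIM('a) * 2601 / R\<^sup>2) * measure lborel (cyl 1 1 :: 'a set) * real DIM('a) * (\<Sum>j\<le>K. (2 ^ (j + 1)) ^ 2 * (1/4)^j))"
  proof (rule lens_layer_integral)
    fix y :: 'a assume y: "\<bar>y \<bullet> e1\<bar> < ringT y"
    have "?g y \<le> (\<Sum>b\<in>(Basis::'a set). (51 / max (ringT y) \<epsilon> / R)\<^sup>2)"
    proof (intro sum_mono power_mono)
      fix b :: 'a assume "b \<in> Basis"
      then show "cmod ((1/R) *\<^sub>R ring' \<epsilon> y b) \<le> 51 / max (ringT y) \<epsilon> / R"
        using divide_right_mono[OF ring'_bound[OF \<epsilon> _ y, of b], of R] R by simp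
    qed auto
    also have "\<dots> = (real DIM('a) * 2601 / R\<^sup>2) * (1 / max (ringT y) ((1/2)^K)) ^ 2"
      by (simp add: K power_divide power_mult_distrib mult_ac)
    finally show "?g y \<le> (real DIM('a) * 2601 / R\<^sup>2) * (1 / max (ringT y) ((1/2)^K)) ^ 2" .
  qed (auto simp: ring_outside)
  have 1: "(\<integral>\<^sup>+x. ennreal (\<Sum>b\<in>Basis. (cmod (G b x))\<^sup>2) \<partial>lborel)
      \<le> ennreal (R ^ DIM('a)) * ennreal (?k * (10404 * real DIM('a) * (real K + 1) / R\<^sup>2))"
    unfolding eq
  proof (rule mult_left_mono[OF order_trans[OF le]])
    have "real DIM('a) * 2601 / R\<^sup>2 * measure lborel (cyl 1 1 :: 'a set) * real DIM('a) * (4 * (real K + 1))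
      = ?k * (10404 * real DIM('a) * (real K + 1) / R\<^sup>2)" by simp
    then show "ennreal (real DIM('a) * 2601 / R\<^sup>2 * measure lborel (cyl 1 1 :: 'a set) * real DIM('a) * (\<Sum>j\<le>K. (2 ^ (j + 1)) ^ 2 * (1/4)^j))
        \<le> ennreal (?k * (10404 * real DIM('a) * (real K + 1) / R\<^sup>2))" unfolding layer_sum_2 by (simp only: order_refl)
  qed simp
  let ?h = "\<lambda>y::'a. ennreal B * indicator (lens \<epsilon>) y"
  have "(\<integral>\<^sup>+x. ennreal \<bar>Vpot F ((cmod (\<psi> x))\<^sup>2)\<bar> \<partial>lborel) \<le> (\<integral>\<^sup>+x. ?h ((1/R) *\<^sub>R x) \<partial>lborel)"
  proof (rule nn_integral_mono)
    fix x :: 'a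
    let ?y = "(1/R) *\<^sub>R x"
    show "ennreal \<bar>Vpot F ((cmod (\<psi> x))\<^sup>2)\<bar> \<le> ?h ?y"
    proof (cases "?y \<in> lens \<epsilon>")
      case True
      have "\<bar>Vpot F ((cmod (\<psi> x))\<^sup>2)\<bar> \<le> B"
        using ring_norm_le_1[of \<epsilon> ?y] unfolding \<psi>_def by (intro B(2)) (auto simp: power_le_one)
      then show ?thesis using True by (simp add: ennreal_leI)
    next
      case False
      then have "\<bar>?y \<bullet> e1\<bar> \<ge> ringT ?y \<or> ringT ?y \<ge> \<epsilon>" by (auto simp: lens_def)
      then have "cmod (\<psi> x) = 1" unfolding \<psi>_def using ring_outside(1)[of ?y \<epsilon>] ring_norm_eq_1[OF \<epsilon>, of ?y] by fastforce
      then show ?thesis using Vpot_1[OF F] by simp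
    qed
  qed
  also have "\<dots> = ennreal (R ^ DIM('a)) * (ennreal B * emeasure lborel (lens \<epsilon> :: 'a set))"
    using R by (subst nn_integral_lborel_scale) (auto simp: nn_integral_cmult)
  also have "\<dots> \<le> ennreal (R ^ DIM('a)) * (ennreal B * ennreal (?k * \<epsilon>\<^sup>2))"
    using \<epsilon> by (intro mult_left_mono lens_measure) (auto simp: K power_le_one)
  finally have 2: "(\<integral>\<^sup>+x. ennreal \<bar>Vpot F ((cmod (\<psi> x))\<^sup>2)\<bar> \<partial>lborel) \<le> ennreal (R ^ DIM('a)) * ennreal (?k * (B * \<epsilon>\<^sup>2))"
    using B by (simp add: ennreal_mult'[symmetric] mult_ac)
  have "energy F \<psi> G \<le> ennreal (R ^ DIM('a)) * ennreal (?k * (10404 * real DIM('a) * (real K + 1) / R\<^sup>2)) + ennreal (R ^ DIM('a)) * ennreal (?k * (B * \<epsilon>\<^sup>2))"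
    unfolding energy_def by (intro add_mono 1 2)
  also have "\<dots> = ennreal (R ^ DIM('a) * (?k * (10404 * real DIM('a) * (real K + 1) / R\<^sup>2)) + R ^ DIM('a) * (?k * (B * \<epsilon>\<^sup>2)))"
    using R B by (simp add: ennreal_mult'[symmetric] ennreal_plus[symmetric] del: ennreal_plus)
  also have "R ^ DIM('a) * (?k * (10404 * real DIM('a) * (real K + 1) / R\<^sup>2)) + R ^ DIM('a) * (?k * (B * \<epsilon>\<^sup>2))
     = ?k * R ^ DIM('a) * (10404 * real DIM('a) * (real K + 1) / R\<^sup>2 + B * \<epsilon>\<^sup>2)"
    by (simp add: algebra_simps)
  finally show ?thesis .
qed

end

lemma ring_mom_integral_lower_bound:
  assumes K: "K \<ge> 1"
  shows "measure lborel (cyl (1/4) (1/2) :: 'a set) \<le> (\<integral>x. ring_mom ((1/2)^K) x \<partial>(lborel::'a::euclidean_space measure))"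
proof -
  let ?e = "(1/2::real)^K"
  have e: "?e > 0" "?e \<le> 1/2" using K power_decreasing[of 1 K "1/2::real"] by auto
  have i: "integrable lborel (ring_mom ?e :: 'a \<Rightarrow> real)" by (rule ring_mom_integrable[OF e(1), of 1]) simp
  have "(\<integral>x. indicat_real (cyl (1/4) (1/2)) x \<partial>(lborel::'a measure)) \<le> (\<integral>x. ring_mom ?e x \<partial>(lborel::'a measure))"
  proof (rule integral_mono[OF _ i])
    show "integrable lborel (indicat_real (cyl (1/4) (1/2) :: 'a set))"
      using cyl_finite by (intro integrable_real_indicator) auto
    show "indicat_real (cyl (1/4) (1/2)) x \<le> ring_mom ?e x" for x :: 'a
      using ring_mom_lower[OF e, of x] ring_mom_nonneg[of ?e x] by (auto simp: indicator_def cyl_def)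
  qed
  then show ?thesis by simp
qed

section \<open>Size and core of the ring for prescribed momentum\<close>

lemma Emin_upper_bound:
  fixes F \<phi> :: "real \<Rightarrow> real"
  assumes cut: "cutoff_ok \<phi>" and N2: "DIM('a::euclidean_space) \<ge> 2" and A1: "A1 F"
  shows "\<exists>C>0. \<forall>\<^sub>F q in at_top.
    Emin \<phi> F q TYPE('a) \<le> ennreal (C * q powr ((real DIM('a) - 2) / (real DIM('a) - 1)) * ln q)"
proof -
  let ?N = "DIM('a)"
  have F: "continuous_on {0..} F" using A1 by (simp add: A1_def)
  obtain B where B: "B > 0" "\<And>s. 0 \<le> s \<Longrightarrow> s \<le> 1 \<Longrightarrow> \<bar>Vpot F s\<bar> \<le> B" using Vpot_bounded_below_1[OF F] by blast
  define \<kappa> where "\<kappa> = measure lborel (cyl 1 1 :: 'a set)"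
  have \<kappa>: "\<kappa> > 0" unfolding \<kappa>_def by (rule cyl_1_pos)
  define c where "c = measure lborel (cyl (1/4) (1/2) :: 'a set)"
  have c: "c > 0" unfolding c_def using \<kappa> by (subst cyl_scale) (auto simp: \<kappa>_def)
  define a where "a = (1/c) powr (1 / (real ?N - 1))"
  have a: "a > 0" unfolding a_def using c by simp
  define C where "C = \<kappa> * real ?N * (10404 * real ?N * 5 * a ^ (?N - 2) + B * a ^ ?N)"
  have C: "C > 0" unfolding C_def using \<kappa> a B N2 by (intro mult_pos_pos add_pos_pos) auto
  have n1: "real ?N - 1 > 0" "real (?N - 1) = real ?N - 1" "real (?N - 2) = real ?N - 2" using N2 by auto
  have "Emin \<phi> F q TYPE('a) \<le> ennreal (C * q powr ((real ?N - 2) / (real ?N - 1)) * ln q)" if q: "q \<ge> exp 1" for q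
  proof -
    have q1: "q \<ge> 1" using q exp_ge_add_one_self[of 1] by linarith
    have lnq: "ln q \<ge> 1" using q q1 by (subst ln_ge_iff) auto
    define y where "y = q powr (1 / (real ?N - 1))"
    have y: "y \<ge> 1" unfolding y_def using q1 n1 by (intro ge_one_powr_ge_zero) auto
    \<comment> \<open>\<open>2^K \<ge> y\<close> gives \<open>\<epsilon> \<le> 1 / y\<close>. As
      \<open>R\<close> will be at most \<open>a * y\<close>, the core then has bounded width after
      scaling, and the potential energy is of order \<open>y^(N-2)\<close> in dimension
      \<open>N\<close>. The summand 1 ensures \<open>K \<ge> 1\<close>, which the lower bound for
      the momentum integral requires.\<close>
    define K where "K = nat \<lceil>log 2 y\<rceil> + 1"
    have ly: "log 2 y \<ge> 0" using y by simp
    have K1: "K \<ge> 1" by (simp add: K_def)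
    have Ku: "real K \<le> log 2 y + 2" using ly unfolding K_def by linarith
    have "log 2 y \<le> real K" unfolding K_def using ly by linarith
    then have yK: "y \<le> 2 ^ K" using y by (subst (asm) log_le_iff) (auto simp: powr_realpow)
    define \<epsilon> where "\<epsilon> = (1/2::real)^K"
    have \<epsilon>: "\<epsilon> > 0" "\<epsilon> \<le> 1 / y" unfolding \<epsilon>_def using yK y by (auto simp: power_divide frac_le)
    define I where "I = (\<integral>x. ring_mom \<epsilon> x \<partial>(lborel::'a measure))"
    have I: "c \<le> I" using ring_mom_integral_lower_bound[OF K1, where 'a='a] by (simp add: I_def c_def \<epsilon>_def)
    then have I0: "I > 0" using c by linarith
    \<comment> \<open>Solves the momentum constraint exactly. The integral \<open>I\<close> depends
      on \<open>\<epsilon>\<close>, but \<open>\<epsilon>\<close> has already been fixed from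
      \<open>q\<close>, so there is no circularity.\<close>
    define R where "R = (q / I) powr (1 / (real ?N - 1))"
    have R: "R > 0" unfolding R_def using q1 I0 by simp
    have RN: "R ^ (?N - 1) = q / I"
    proof -
      have "R ^ (?N - 1) = R powr (real ?N - 1)" using R n1 by (simp add: powr_realpow[symmetric])
      also have "\<dots> = q / I" unfolding R_def using n1 q1 I0 by (simp add: powr_powr)
      finally show ?thesis .
    qed
    have Ry: "R \<le> a * y"
    proof -
      have "R \<le> (q / c) powr (1 / (real ?N - 1))"
        unfolding R_def using I c q1 n1 by (intro powr_mono2 divide_left_mono) auto
      also have "\<dots> = a * y" unfolding a_def y_def using c q1 by (simp add: powr_mult[symmetric])
      finally show ?thesis .
    qed
    let ?\<psi> = "\<lambda>x::'a. ring \<epsilon> ((1/R) *\<^sub>R x)" and ?G = "\<lambda>b x::'a. (1/R) *\<^sub>R ring' \<epsilon> ((1/R) *\<^sub>R x) b"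
    have inE: "in_E \<phi> ?\<psi> ?G" by (rule ring_in_E[OF \<epsilon>(1) R cut])
    have Q: "Qmom ?\<psi> ?G = q"
      using ring_Qmom[OF \<epsilon>(1) R N2] RN I0 by (simp add: I_def)
    have "Emin \<phi> F q TYPE('a) \<le> energy F ?\<psi> ?G"
      unfolding Emin_def using inE Q by (intro INF_lower2[of "(?\<psi>, ?G)"]) auto
    also have "\<dots> \<le> ennreal (\<kappa> * real ?N * R ^ ?N * (10404 * real ?N * (real K + 1) / R\<^sup>2 + B * \<epsilon>\<^sup>2))"
      unfolding \<kappa>_def using B by (intro ring_energy[OF \<epsilon>(1) R \<epsilon>_def F]) auto
    finally have E: "Emin \<phi> F q TYPE('a) \<le> ennreal (\<kappa> * real ?N * R ^ ?N * (10404 * real ?N * (real K + 1) / R\<^sup>2 + B * \<epsilon>\<^sup>2))" .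
    have "\<kappa> * real ?N * R ^ ?N * (10404 * real ?N * (real K + 1) / R\<^sup>2 + B * \<epsilon>\<^sup>2)
        \<le> C * q powr ((real ?N - 2) / (real ?N - 1)) * ln q"
    proof -
      have yN: "y ^ (?N - 2) = q powr ((real ?N - 2) / (real ?N - 1))"
      proof -
        have "y ^ (?N - 2) = y powr (real ?N - 2)" using y n1 by (simp add: powr_realpow[symmetric])
        then show ?thesis unfolding y_def by (simp add: powr_powr)
      qed
      have Nsplit: "X ^ ?N = X ^ (?N - 2) * X\<^sup>2" for X :: real using N2 by (metis le_add_diff_inverse2 power_add)
      have 1: "R ^ ?N * (10404 * real ?N * (real K + 1) / R\<^sup>2) \<le> (10404 * real ?N * 5 * a ^ (?N - 2)) * y ^ (?N - 2) * ln q"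
      proof -
        \<comment> \<open>\<open>log 2 y\<close> is at most \<open>2 * ln q\<close>, since the
          dimension is at least 2 and \<open>ln 2 \<ge> 1/2\<close>; the additional 3 is absorbed by
          \<open>ln q \<ge> 1\<close>.\<close>
        have "real K + 1 \<le> 5 * ln q"
        proof -
          have "log 2 y = ln q / ((real ?N - 1) * ln 2)" unfolding y_def log_def using q1 by (simp add: ln_powr)
          also have "\<dots> \<le> ln q / (1 * (1/2))"
            using lnq N2 ln2_ge_two_thirds by (intro divide_left_mono mult_mono mult_pos_pos) auto
          finally show ?thesis using Ku lnq by simp
        qed
        moreover have "R ^ (?N - 2) \<le> (a * y) ^ (?N - 2)" using R Ry by (intro power_mono) auto
        ultimately have "10404 * real ?N * ((real K + 1) * R ^ (?N - 2)) \<le> 10404 * real ?N * ((5 * ln q) * (a * y) ^ (?N - 2))"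
          using lnq R by (intro mult_left_mono mult_mono) auto
        moreover have "R ^ ?N * (10404 * real ?N * (real K + 1) / R\<^sup>2) = 10404 * real ?N * ((real K + 1) * R ^ (?N - 2))"
          unfolding Nsplit[of R] using R by (simp add: field_simps)
        ultimately show ?thesis by (simp add: power_mult_distrib mult_ac)
      qed
      have 2: "R ^ ?N * (B * \<epsilon>\<^sup>2) \<le> (B * a ^ ?N) * y ^ (?N - 2) * ln q"
      proof -
        have "R ^ ?N * \<epsilon>\<^sup>2 \<le> (a * y) ^ ?N * (1 / y)\<^sup>2" using R Ry \<epsilon> a y by (intro mult_mono power_mono) auto
        also have "\<dots> = a ^ ?N * y ^ (?N - 2)" unfolding power_mult_distrib Nsplit[of y] using y by (simp add: power_divide)
        also have "\<dots> \<le> a ^ ?N * y ^ (?N - 2) * ln q" using mult_left_mono[OF lnq, of "a ^ ?N * y ^ (?N - 2)"] a y by simp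
        finally have "B * (R ^ ?N * \<epsilon>\<^sup>2) \<le> B * (a ^ ?N * y ^ (?N - 2) * ln q)" using B by (intro mult_left_mono) auto
        then show ?thesis by (simp add: mult_ac)
      qed
      have "\<kappa> * real ?N * R ^ ?N * (10404 * real ?N * (real K + 1) / R\<^sup>2 + B * \<epsilon>\<^sup>2)
         = \<kappa> * real ?N * (R ^ ?N * (10404 * real ?N * (real K + 1) / R\<^sup>2) + R ^ ?N * (B * \<epsilon>\<^sup>2))"
        by (simp add: algebra_simps)
      also have "\<dots> \<le> \<kappa> * real ?N * ((10404 * real ?N * 5 * a ^ (?N - 2)) * y ^ (?N - 2) * ln q + (B * a ^ ?N) * y ^ (?N - 2) * ln q)"
        using \<kappa> by (intro mult_left_mono add_mono 1 2) auto
      also have "\<dots> = C * y ^ (?N - 2) * ln q" unfolding C_def by (simp add: algebra_simps)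
      finally show ?thesis unfolding yN .
    qed
    from order_trans[OF E ennreal_leI[OF this]] show ?thesis .
  qed
  then have "\<forall>\<^sub>F q in at_top. Emin \<phi> F q TYPE('a) \<le> ennreal (C * q powr ((real ?N - 2) / (real ?N - 1)) * ln q)"
    unfolding eventually_at_top_linorder by blast
  with C show ?thesis by blast
qed

section \<open>Translates of functions with weak gradient\<close>

lemma weak_partial_bounded_linear:
  fixes u :: "'a::euclidean_space \<Rightarrow> 'b::{banach,second_countable_topology}"
    and T :: "'b \<Rightarrow> 'c::{banach,second_countable_topology}"
  assumes T: "bounded_linear T" and w: "weak_partial u b g"
  shows "weak_partial (\<lambda>x. T (u x)) b (\<lambda>x. T (g x))"
  unfolding weak_partial_def
proof (intro conjI allI impI)
  have l: "loc_int u" "loc_int g" using w unfolding weak_partial_def by auto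
  show "loc_int (\<lambda>x. T (u x))" "loc_int (\<lambda>x. T (g x))" by (auto intro: loc_int_bounded_linear[OF T] l)
  fix p :: "'a \<Rightarrow> real" assume p: "test_function p"
  have "T (\<integral>x. frechet_derivative p (at x) b *\<^sub>R u x \<partial>lborel) = T (- (\<integral>x. p x *\<^sub>R g x \<partial>lborel))"
    using w p unfolding weak_partial_def by simp
  moreover have "T (\<integral>x. frechet_derivative p (at x) b *\<^sub>R u x \<partial>lborel) = (\<integral>x. T (frechet_derivative p (at x) b *\<^sub>R u x) \<partial>lborel)"
    using loc_int_integrable_test[OF l(1) test_function_frechet_derivative[OF p]] by (simp add: integral_bounded_linear[OF T])
  moreover have "T (- (\<integral>x. p x *\<^sub>R g x \<partial>lborel)) = - (\<integral>x. T (p x *\<^sub>R g x) \<partial>lborel)"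
    using loc_int_integrable_test[OF l(2) p] by (simp add: integral_bounded_linear[OF T] linear_neg[OF bounded_linear.linear[OF T]])
  ultimately show "(\<integral>x. frechet_derivative p (at x) b *\<^sub>R T (u x) \<partial>lborel) = - (\<integral>x. p x *\<^sub>R T (g x) \<partial>lborel)"
    by (simp add: linear_scale[OF bounded_linear.linear[OF T]])
qed

lemma weak_directional:
  fixes u :: "'a::euclidean_space \<Rightarrow> real"
  assumes w: "\<And>b. b \<in> Basis \<Longrightarrow> weak_partial u b (H b)" and p: "test_function p"
  shows "(\<integral>x. frechet_derivative p (at x) y * u x \<partial>lborel) = - (\<integral>x. p x * (\<Sum>b\<in>Basis. (y \<bullet> b) * H b x) \<partial>lborel)"
proof -
  have lu: "loc_int u" using w[OF e1_Basis] unfolding weak_partial_def by simp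
  have lH: "loc_int (H b)" if "b \<in> Basis" for b using w[OF that] unfolding weak_partial_def by simp
  have lin: "frechet_derivative p (at x) y = (\<Sum>b\<in>Basis. (y \<bullet> b) * frechet_derivative p (at x) b)" for x
  proof -
    have "linear (frechet_derivative p (at x))"
      using smooth_has_derivative[OF test_function_smooth[OF p]] has_derivative_linear by blast
    then have "frechet_derivative p (at x) (\<Sum>b\<in>Basis. (y \<bullet> b) *\<^sub>R b) = (\<Sum>b\<in>Basis. (y \<bullet> b) * frechet_derivative p (at x) b)"
      by (simp add: linear_sum linear_scale)
    then show ?thesis by (simp add: euclidean_representation)
  qed
  have i1: "integrable lborel (\<lambda>x. frechet_derivative p (at x) b * u x)" for b
    using loc_int_integrable_test[OF lu test_function_frechet_derivative[OF p]] by simp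
  have i2: "integrable lborel (\<lambda>x. p x * H b x)" if "b \<in> Basis" for b
    using loc_int_integrable_test[OF lH[OF that] p] by simp
  have "(\<integral>x. frechet_derivative p (at x) y * u x \<partial>lborel) = (\<integral>x. (\<Sum>b\<in>Basis. (y \<bullet> b) * (frechet_derivative p (at x) b * u x)) \<partial>lborel)"
    unfolding lin by (simp add: sum_distrib_right mult.assoc)
  also have "\<dots> = (\<Sum>b\<in>Basis. (y \<bullet> b) * (\<integral>x. frechet_derivative p (at x) b * u x \<partial>lborel))"
    using i1 by (subst Bochner_Integration.integral_sum) auto
  also have "\<dots> = (\<Sum>b\<in>Basis. (y \<bullet> b) * (- (\<integral>x. p x * H b x \<partial>lborel)))"
    by (intro sum.cong refl) (use w p in \<open>simp add: weak_partial_def\<close>)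
  also have "\<dots> = - (\<Sum>b\<in>Basis. (y \<bullet> b) * (\<integral>x. p x * H b x \<partial>lborel))" by (simp add: sum_negf)
  also have "(\<Sum>b\<in>Basis. (y \<bullet> b) * (\<integral>x. p x * H b x \<partial>lborel)) = (\<integral>x. (\<Sum>b\<in>Basis. (y \<bullet> b) * (p x * H b x)) \<partial>lborel)"
    using i2 by (subst Bochner_Integration.integral_sum) auto
  also have "\<dots> = (\<integral>x. p x * (\<Sum>b\<in>Basis. (y \<bullet> b) * H b x) \<partial>lborel)" by (simp add: sum_distrib_left mult_ac)
  finally show ?thesis .
qed

lemma nn_integral_lborel_translate:
  fixes y :: "'a::euclidean_space"
  assumes [measurable]: "f \<in> borel_measurable borel"
  shows "(\<integral>\<^sup>+x. f (x + y) \<partial>lborel) = (\<integral>\<^sup>+x. f x \<partial>lborel)"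
  using nn_integral_lborel_affine[OF assms, of 1 y] by (simp add: add.commute)

lemma integral_lborel_translate:
  fixes f :: "'a::euclidean_space \<Rightarrow> 'b::{banach,second_countable_topology}"
  assumes [measurable]: "f \<in> borel_measurable borel"
  shows "(\<integral>x. f (x + y) \<partial>lborel) = (\<integral>x. f x \<partial>lborel)"
  using integral_lborel_affine[OF assms, of 1 y] by (simp add: add.commute)

lemma loc_int_sum:
  assumes "finite I" "\<And>i. i \<in> I \<Longrightarrow> loc_int (f i)" shows "loc_int (\<lambda>x. \<Sum>i\<in>I. f i x)"
  using assms by (induction I rule: finite_induct) (auto intro: loc_int_add loc_int_continuous)

text \<open>Justifies exchanging the integral along the segment with integration against a bounded
  function of compact support. By translation invariance every slice in \<open>t\<close> is bounded
  by one and the same local integral of \<open>g\<close>.\<close>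

lemma loc_int_segment_integrable:
  fixes g :: "'a::euclidean_space \<Rightarrow> real"
  assumes g: "loc_int g" and K: "compact K" and p: "p \<in> borel_measurable borel" "\<And>x. \<bar>p x\<bar> \<le> B" "\<And>x. x \<notin> K \<Longrightarrow> p x = 0"
  shows "integrable (lborel \<Otimes>\<^sub>M lborel) (\<lambda>(x, t). p x * (indicator {0..1} t * g (x + t *\<^sub>R y)))"
proof (rule integrableI_bounded)
  note p(1)[measurable]
  have [measurable]: "g \<in> borel_measurable borel" by (rule loc_int_measurable[OF g])
  show "(\<lambda>(x, t). p x * (indicator {0..1} t * g (x + t *\<^sub>R y))) \<in> borel_measurable (lborel \<Otimes>\<^sub>M lborel)" by measurable
  let ?K = "(\<lambda>(x, s). x + s *\<^sub>R y) ` (K \<times> {0..1})"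
  have cK: "compact ?K"
    by (intro compact_continuous_image compact_Times K compact_Icc) (auto intro!: continuous_intros simp: split_def)
  then have [measurable]: "?K \<in> sets borel" by (simp add: compact_imp_closed)
  have B0: "B \<ge> 0" using p(2)[of undefined] by linarith
  let ?h = "\<lambda>z. ennreal (B * norm (indicator ?K z *\<^sub>R g z))"
  have "(\<integral>\<^sup>+x. ennreal (norm (indicat_real ?K x *\<^sub>R g x)) \<partial>lborel) < \<infinity>"
    using g cK unfolding loc_int_def set_integrable_def integrable_iff_bounded by blast
  then have fin: "(\<integral>\<^sup>+x. ?h x \<partial>lborel) < \<infinity>"
    using B0 by (simp add: ennreal_mult' nn_integral_cmult ennreal_mult_less_top)
  have "(\<integral>\<^sup>+z. ennreal (norm (case z of (x, t) \<Rightarrow> p x * (indicator {0..1} t * g (x + t *\<^sub>R y)))) \<partial>(lborel \<Otimes>\<^sub>M lborel))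
     = (\<integral>\<^sup>+t. \<integral>\<^sup>+x. ennreal (norm (p x * (indicator {0..1} t * g (x + t *\<^sub>R y)))) \<partial>lborel \<partial>lborel)"
    by (subst lborel_pair.nn_integral_snd[symmetric]) auto
  also have "\<dots> \<le> (\<integral>\<^sup>+t. \<integral>\<^sup>+x. indicator {0..1} t * ?h (x + t *\<^sub>R y) \<partial>lborel \<partial>lborel)"
  proof (intro nn_integral_mono)
    fix t :: real and x :: 'a
    show "ennreal (norm (p x * (indicator {0..1} t * g (x + t *\<^sub>R y)))) \<le> indicator {0..1} t * ?h (x + t *\<^sub>R y)"
    proof (cases "x \<in> K \<and> t \<in> {0..1}")
      case True
      then have "x + t *\<^sub>R y \<in> ?K" by force
      then show ?thesis using True p(2)[of x] by (auto simp: abs_mult intro!: ennreal_leI mult_right_mono)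
    qed (use p(3) in \<open>auto simp: indicator_def\<close>)
  qed
  also have "\<dots> = (\<integral>\<^sup>+t. indicator {0..1::real} t * (\<integral>\<^sup>+x. ?h x \<partial>lborel) \<partial>lborel)"
  proof (intro nn_integral_cong)
    fix t :: real
    have "(\<integral>\<^sup>+x. indicator {0..1} t * ?h (x + t *\<^sub>R y) \<partial>lborel) = indicator {0..1} t * (\<integral>\<^sup>+x. ?h (x + t *\<^sub>R y) \<partial>lborel)"
      by (rule nn_integral_cmult) measurable
    also have "(\<integral>\<^sup>+x. ?h (x + t *\<^sub>R y) \<partial>lborel) = (\<integral>\<^sup>+x. ?h x \<partial>lborel)"
      by (rule nn_integral_lborel_translate[of ?h]) measurable
    finally show "(\<integral>\<^sup>+x. indicator {0..1} t * ?h (x + t *\<^sub>R y) \<partial>lborel) = indicator {0..1} t * (\<integral>\<^sup>+x. ?h x \<partial>lborel)" .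
  qed
  also have "\<dots> = (\<integral>\<^sup>+x. ?h x \<partial>lborel)" by (subst nn_integral_multc) auto
  finally show "(\<integral>\<^sup>+z. ennreal (norm (case z of (x, t) \<Rightarrow> p x * (indicator {0..1} t * g (x + t *\<^sub>R y)))) \<partial>(lborel \<Otimes>\<^sub>M lborel)) < \<infinity>"
    using fin by (rule order_le_less_trans)
qed

lemma test_function_translate: "test_function p \<Longrightarrow> test_function (\<lambda>x. p (x + a))"
  using test_function_compose_affine[of p "\<lambda>x. x" "\<lambda>x. x" a] by (simp add: bounded_linear_ident)

lemma frechet_derivative_translate: "smooth p \<Longrightarrow> frechet_derivative (\<lambda>x. p (x + a)) (at x) v = frechet_derivative p (at (x + a)) v"
  using frechet_derivative_compose_affine[of p "\<lambda>x. x" a] by (simp add: bounded_linear_ident)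

lemma smooth_segment_integral:
  assumes p: "smooth p"
  shows "(\<integral>t. indicator {0..1} t * frechet_derivative p (at (x - t *\<^sub>R y)) y \<partial>lborel) = p x - p (x - y)"
proof -
  have d: "((\<lambda>t. - p (x - t *\<^sub>R y)) has_real_derivative frechet_derivative p (at (x - t *\<^sub>R y)) y) (at t)" for t
  proof -
    have "((\<lambda>t. p (x - t *\<^sub>R y)) has_derivative (\<lambda>s. frechet_derivative p (at (x - t *\<^sub>R y)) (- (s *\<^sub>R y)))) (at t)"
      by (rule has_derivative_compose[OF _ smooth_has_derivative[OF p]]) (auto intro!: derivative_eq_intros)
    from has_derivative_minus[OF this]
    have "((\<lambda>t. - p (x - t *\<^sub>R y)) has_derivative (\<lambda>s. - frechet_derivative p (at (x - t *\<^sub>R y)) (- (s *\<^sub>R y)))) (at t)" .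
    moreover have "linear (frechet_derivative p (at (x - t *\<^sub>R y)))"
      using smooth_has_derivative[OF p] has_derivative_linear by blast
    ultimately show ?thesis
      by (simp add: has_field_derivative_def linear_neg linear_scale mult_commute_abs)
  qed
  have c: "continuous_on UNIV (\<lambda>t. frechet_derivative p (at (x - t *\<^sub>R y)) y)"
    by (rule continuous_on_compose2[OF smooth_continuous_on[OF smooth_frechet_derivative[OF p]], of UNIV]) (auto intro!: continuous_intros)
  have "(\<integral>t. frechet_derivative p (at (x - t *\<^sub>R y)) y * indicator {0..1} t \<partial>lborel) = - p (x - 1 *\<^sub>R y) - - p (x - 0 *\<^sub>R y)"
  proof (rule integral_FTC_Icc_real)
    show "isCont (\<lambda>t. frechet_derivative p (at (x - t *\<^sub>R y)) y) t" for t
      using c by (simp add: continuous_on_eq_continuous_at)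
  qed (auto intro: d)
  then show ?thesis by (simp add: mult.commute)
qed

text \<open>The fundamental theorem of calculus along \<open>y\<close> for a weak gradient. No
  approximation is used: both sides are integrated against a test function \<open>p\<close>, Fubini
  and a shift move the translation onto \<open>p\<close>, the weak gradient moves the derivative
  there as well, and the classical theorem for \<open>p\<close> finishes. Equality almost everywhere
  follows because the difference is locally integrable.\<close>

lemma weak_translate_AE:
  fixes u :: "'a::euclidean_space \<Rightarrow> real"
  assumes w: "\<And>b. b \<in> Basis \<Longrightarrow> weak_partial u b (H b)"
  shows "AE x in lborel. u (x + y) - u x = (\<integral>t. indicator {0..1} t * (\<Sum>b\<in>Basis. (y \<bullet> b) * H b (x + t *\<^sub>R y)) \<partial>lborel)"
proof -
  define g where "g x = (\<Sum>b\<in>Basis. (y \<bullet> b) * H b x)" for x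
  have lu: "loc_int u" using w[OF e1_Basis] unfolding weak_partial_def by simp
  have [measurable]: "u \<in> borel_measurable borel" by (rule loc_int_measurable[OF lu])
  have lg: "loc_int g"
    unfolding g_def
  proof (rule loc_int_sum)
    fix b :: 'a assume "b \<in> Basis"
    then have "loc_int (H b)" using w unfolding weak_partial_def by simp
    then show "loc_int (\<lambda>x. (y \<bullet> b) * H b x)" by (rule loc_int_bounded_linear[OF bounded_linear_mult_right])
  qed simp
  have [measurable]: "g \<in> borel_measurable borel" by (rule loc_int_measurable[OF lg])
  define J where "J x = (\<integral>t. indicator {0..1} t * g (x + t *\<^sub>R y) \<partial>lborel)" for x
  have J: "integrable lborel (\<lambda>x. p x * J x)" "(\<integral>x. p x * J x \<partial>lborel) = (\<integral>t. indicator {0..1} t * (\<integral>x. p x * g (x + t *\<^sub>R y) \<partial>lborel) \<partial>lborel)"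
    if p: "p \<in> borel_measurable borel" "\<And>x. \<bar>p x\<bar> \<le> B" "\<And>x. x \<notin> K \<Longrightarrow> p x = 0" and K: "compact K" for p B K
  proof -
    have i: "integrable (lborel \<Otimes>\<^sub>M lborel) (\<lambda>(x, t). p x * (indicator {0..1} t * g (x + t *\<^sub>R y)))"
      by (rule loc_int_segment_integrable[OF lg K p])
    show "integrable lborel (\<lambda>x. p x * J x)"
      using lborel_pair.integrable_fst'[OF i] by (simp add: J_def)
    have "(\<integral>x. p x * J x \<partial>lborel) = (\<integral>x. (\<integral>t. p x * (indicator {0..1} t * g (x + t *\<^sub>R y)) \<partial>lborel) \<partial>lborel)"
      by (simp add: J_def)
    also have "\<dots> = (\<integral>t. (\<integral>x. p x * (indicator {0..1} t * g (x + t *\<^sub>R y)) \<partial>lborel) \<partial>lborel)"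
      using lborel_pair.Fubini_integral[OF i] by simp
    also have "\<dots> = (\<integral>t. indicator {0..1} t * (\<integral>x. p x * g (x + t *\<^sub>R y) \<partial>lborel) \<partial>lborel)"
    proof (rule Bochner_Integration.integral_cong[OF refl])
      fix t :: real
      have "(\<integral>x. p x * (indicator {0..1} t * g (x + t *\<^sub>R y)) \<partial>lborel) = (\<integral>x. indicator {0..1} t * (p x * g (x + t *\<^sub>R y)) \<partial>lborel)"
        by (intro Bochner_Integration.integral_cong refl) (rule mult.left_commute)
      also have "\<dots> = indicator {0..1} t * (\<integral>x. p x * g (x + t *\<^sub>R y) \<partial>lborel)"
        by (rule integral_mult_right_zero)
      finally show "(\<integral>x. p x * (indicator {0..1} t * g (x + t *\<^sub>R y)) \<partial>lborel) = indicator {0..1} t * (\<integral>x. p x * g (x + t *\<^sub>R y) \<partial>lborel)" .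
    qed
    finally show "(\<integral>x. p x * J x \<partial>lborel) = (\<integral>t. indicator {0..1} t * (\<integral>x. p x * g (x + t *\<^sub>R y) \<partial>lborel) \<partial>lborel)" .
  qed
  have lJ: "loc_int J"
    unfolding loc_int_def set_integrable_def
  proof (intro allI impI)
    fix K :: "'a set" assume K: "compact K"
    then have [measurable]: "K \<in> sets borel" by (simp add: compact_imp_closed)
    show "integrable lborel (\<lambda>x. indicat_real K x *\<^sub>R J x)"
      using J(1)[of "indicat_real K" 1 K] K by (simp add: indicator_def)
  qed
  have lD: "loc_int (\<lambda>x. u (x + y) - u x - J x)"
    using loc_int_diff[OF loc_int_diff[OF loc_int_translate[OF lu, of y] lu] lJ] by (simp add: add.commute)
  have "AE x in lborel. u (x + y) - u x - J x = 0"
  proof (rule loc_int_AE_zero[OF lD])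
    fix p :: "'a \<Rightarrow> real" assume p: "test_function p"
    have sp: "smooth p" by (rule test_function_smooth[OF p])
    obtain K where K: "compact K" "\<And>x. x \<notin> K \<Longrightarrow> p x = 0" "\<And>x v. x \<notin> K \<Longrightarrow> frechet_derivative p (at x) v = 0"
      using test_function_support[OF p] by metis
    obtain B where B: "\<And>x. \<bar>p x\<bar> \<le> B" using test_function_bounded[OF p] by blast
    obtain B' where B': "\<And>x. \<bar>frechet_derivative p (at x) y\<bar> \<le> B'"
      using test_function_bounded[OF test_function_frechet_derivative[OF p]] by blast
    have [measurable]: "p \<in> borel_measurable borel"
      by (intro borel_measurable_continuous_onI test_function_continuous_on p)
    have [measurable]: "(\<lambda>x. frechet_derivative p (at x) y) \<in> borel_measurable borel"
      by (intro borel_measurable_continuous_onI test_function_continuous_on test_function_frechet_derivative p)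
    obtain L where cK: "compact L" and outK: "\<And>x t. x \<notin> L \<Longrightarrow> t \<in> {0..1} \<Longrightarrow> x - t *\<^sub>R y \<notin> K"
    proof
      let ?L = "(\<lambda>(x, s). x + s *\<^sub>R y) ` (K \<times> {0..1})"
      show "compact ?L"
        by (intro compact_continuous_image compact_Times K compact_Icc) (auto intro!: continuous_intros simp: split_def)
      fix x t assume xt: "x \<notin> ?L" "t \<in> {0..1::real}"
      show "x - t *\<^sub>R y \<notin> K"
      proof
        assume "x - t *\<^sub>R y \<in> K"
        then have "(\<lambda>(x, s). x + s *\<^sub>R y) (x - t *\<^sub>R y, t) \<in> ?L" using xt(2) by blast
        then show False using xt(1) by simp
      qed
    qed
    have ii: "integrable lborel (indicat_real {0..1::real})" by (rule integrable_real_indicator) auto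
    have [measurable]: "L \<in> sets borel" using cK by (simp add: compact_imp_closed)
    have iu: "integrable lborel (\<lambda>x. indicat_real L x * u x)"
      using lu cK unfolding loc_int_def set_integrable_def by auto
    have iu': "integrable lborel (\<lambda>x. indicat_real L x * \<bar>u x\<bar>)" using integrable_abs[OF iu] by (simp add: abs_mult)
    have i2: "integrable (lborel \<Otimes>\<^sub>M lborel) (\<lambda>(x, t). u x * (indicator {0..1::real} t * frechet_derivative p (at (x - t *\<^sub>R y)) y))"
    proof (rule Bochner_Integration.integrable_bound)
      show "integrable (lborel \<Otimes>\<^sub>M lborel) (\<lambda>(x, t). (indicat_real L x * u x) * (indicator {0..1::real} t * B'))"
      proof (rule lborel_pair.Fubini_integrable)
        show "integrable lborel (\<lambda>x. \<integral>t. norm (case (x, t) of (x, t) \<Rightarrow> indicat_real L x * u x * (indicator {0..1::real} t * B')) \<partial>lborel)"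
          using iu' by (simp add: abs_mult)
        show "AE x in lborel. integrable lborel (\<lambda>t. case (x, t) of (x, t) \<Rightarrow> indicat_real L x * u x * (indicator {0..1::real} t * B'))"
          unfolding prod.case by (intro AE_I2 integrable_mult_right integrable_mult_left ii)
      qed measurable
      show "(\<lambda>(x, t). u x * (indicator {0..1::real} t * frechet_derivative p (at (x - t *\<^sub>R y)) y)) \<in> borel_measurable (lborel \<Otimes>\<^sub>M lborel)"
      proof -
        have "(\<lambda>z::'a\<times>real. frechet_derivative p (at (fst z - snd z *\<^sub>R y)) y) \<in> borel_measurable (lborel \<Otimes>\<^sub>M lborel)"
          by (rule measurable_compose[of "\<lambda>z::'a\<times>real. fst z - snd z *\<^sub>R y" _ borel "\<lambda>x. frechet_derivative p (at x) y"]) measurable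
        then show ?thesis by (simp add: split_def)
      qed
      show "AE z in lborel \<Otimes>\<^sub>M lborel. norm (case z of (x, t) \<Rightarrow> u x * (indicator {0..1::real} t * frechet_derivative p (at (x - t *\<^sub>R y)) y))
          \<le> norm (case z of (x, t) \<Rightarrow> (indicat_real L x * u x) * (indicator {0..1::real} t * B'))"
      proof (rule AE_I2)
        fix z :: "'a \<times> real"
        obtain x t where z: "z = (x, t)" by (cases z)
        have "\<bar>frechet_derivative p (at (x - t *\<^sub>R y)) y\<bar> \<le> indicator L x * \<bar>B'\<bar>" if "t \<in> {0..1}"
          using outK[OF _ that, of x] K(3)[of "x - t *\<^sub>R y" y] B'[of "x - t *\<^sub>R y"] by (cases "x \<in> L") auto
        then show "norm (case z of (x, t) \<Rightarrow> u x * (indicator {0..1::real} t * frechet_derivative p (at (x - t *\<^sub>R y)) y))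
          \<le> norm (case z of (x, t) \<Rightarrow> (indicat_real L x * u x) * (indicator {0..1::real} t * B'))"
          unfolding z by (cases "t \<in> {0..1}") (auto simp: abs_mult mult_left_mono indicator_def split: if_splits)
      qed
    qed
    have "(\<integral>x. p x * J x \<partial>lborel) = (\<integral>t. indicator {0..1} t * (\<integral>x. p x * g (x + t *\<^sub>R y) \<partial>lborel) \<partial>lborel)"
      by (rule J(2)[where B=B and K=K]) (use K B in auto)
    also have "\<dots> = (\<integral>t. indicator {0..1} t * (- (\<integral>x. frechet_derivative p (at (x - t *\<^sub>R y)) y * u x \<partial>lborel)) \<partial>lborel)"
    proof (intro Bochner_Integration.integral_cong refl arg_cong2[where f="(*)"])
      fix t :: real
      have "(\<integral>x. p x * g (x + t *\<^sub>R y) \<partial>lborel) = (\<integral>x. p ((x + t *\<^sub>R y) - t *\<^sub>R y) * g (x + t *\<^sub>R y) \<partial>lborel)" by simp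
      also have "\<dots> = (\<integral>x. p (x - t *\<^sub>R y) * g x \<partial>lborel)"
        by (rule integral_lborel_translate[of "\<lambda>x. p (x - t *\<^sub>R y) * g x"]) measurable
      also have "\<dots> = - (\<integral>x. frechet_derivative (\<lambda>x. p (x - t *\<^sub>R y)) (at x) y * u x \<partial>lborel)"
        using weak_directional[OF w test_function_translate[OF p, of "- (t *\<^sub>R y)"], of y] by (simp add: g_def)
      also have "\<dots> = - (\<integral>x. frechet_derivative p (at (x - t *\<^sub>R y)) y * u x \<partial>lborel)"
        using frechet_derivative_translate[OF sp, of "- (t *\<^sub>R y)"] by simp
      finally show "(\<integral>x. p x * g (x + t *\<^sub>R y) \<partial>lborel) = - (\<integral>x. frechet_derivative p (at (x - t *\<^sub>R y)) y * u x \<partial>lborel)" .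
    qed
    also have "\<dots> = - (\<integral>t. (\<integral>x. u x * (indicator {0..1} t * frechet_derivative p (at (x - t *\<^sub>R y)) y) \<partial>lborel) \<partial>lborel)"
    proof -
      have "indicator {0..1} t * (- (\<integral>x. frechet_derivative p (at (x - t *\<^sub>R y)) y * u x \<partial>lborel))
        = - (\<integral>x. u x * (indicator {0..1} t * frechet_derivative p (at (x - t *\<^sub>R y)) y) \<partial>lborel)" for t :: real
      proof -
        have "indicator {0..1} t * (\<integral>x. frechet_derivative p (at (x - t *\<^sub>R y)) y * u x \<partial>lborel)
          = (\<integral>x. indicator {0..1} t * (frechet_derivative p (at (x - t *\<^sub>R y)) y * u x) \<partial>lborel)"
          by (rule integral_mult_right_zero[symmetric])
        also have "\<dots> = (\<integral>x. u x * (indicator {0..1} t * frechet_derivative p (at (x - t *\<^sub>R y)) y) \<partial>lborel)"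
          by (intro Bochner_Integration.integral_cong refl) (simp add: mult_ac)
        finally show ?thesis by simp
      qed
      then show ?thesis by simp
    qed
    also have "(\<integral>t. (\<integral>x. u x * (indicator {0..1} t * frechet_derivative p (at (x - t *\<^sub>R y)) y) \<partial>lborel) \<partial>lborel)
        = (\<integral>x. (\<integral>t. u x * (indicator {0..1} t * frechet_derivative p (at (x - t *\<^sub>R y)) y) \<partial>lborel) \<partial>lborel)"
      using lborel_pair.Fubini_integral[OF i2] by simp
    also have "\<dots> = (\<integral>x. u x * (p x - p (x - y)) \<partial>lborel)"
      by (simp add: smooth_segment_integral[OF sp])
    finally have Jp: "(\<integral>x. p x * J x \<partial>lborel) = - (\<integral>x. u x * (p x - p (x - y)) \<partial>lborel)" .
    have i3: "integrable lborel (\<lambda>x. p x * u x)" using loc_int_integrable_test[OF lu p] by simp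
    have i4: "integrable lborel (\<lambda>x. p (x - y) * u x)"
      using loc_int_integrable_test[OF lu test_function_translate[OF p, of "- y"]] by simp
    have i5: "integrable lborel (\<lambda>x. p x * u (x + y))"
      using loc_int_integrable_test[OF loc_int_translate[OF lu, of y] p] by (simp add: add.commute)
    have e5: "(\<integral>x. p x * u (x + y) \<partial>lborel) = (\<integral>x. p (x - y) * u x \<partial>lborel)"
      using integral_lborel_translate[of "\<lambda>x. p (x - y) * u x" y] by simp
    have "(\<integral>x. p x * (u (x + y) - u x - J x) \<partial>lborel) = (\<integral>x. p x * u (x + y) \<partial>lborel) - (\<integral>x. p x * u x \<partial>lborel) - (\<integral>x. p x * J x \<partial>lborel)"
      using i5 i3 loc_int_integrable_test[OF lJ p] by (simp add: right_diff_distrib)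
    also have "(\<integral>x. u x * (p x - p (x - y)) \<partial>lborel) = (\<integral>x. p x * u x \<partial>lborel) - (\<integral>x. p (x - y) * u x \<partial>lborel)"
      using i3 i4 by (simp add: left_diff_distrib mult.commute[of "u _"])
    then have "(\<integral>x. p x * u (x + y) \<partial>lborel) - (\<integral>x. p x * u x \<partial>lborel) - (\<integral>x. p x * J x \<partial>lborel) = 0"
      unfolding Jp e5 by simp
    finally show "(\<integral>x. p x * (u (x + y) - u x - J x) \<partial>lborel) = 0" .
  qed
  then show ?thesis by eventually_elim (simp add: J_def g_def)
qed

text \<open>Cauchy-Schwarz in the segment parameter, then Fubini and a shift of each slice. The sets
  \<open>S\<close> and \<open>S'\<close> are there because the estimate is needed on single balls as
  well as on the whole space.\<close>

lemma translate_L2_bound: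
  fixes u :: "'a::euclidean_space \<Rightarrow> real"
  assumes w: "\<And>b. b \<in> Basis \<Longrightarrow> weak_partial u b (H b)"
    and [measurable]: "S \<in> sets borel" "S' \<in> sets borel" and S: "\<And>x t. x \<in> S \<Longrightarrow> 0 \<le> t \<Longrightarrow> t \<le> 1 \<Longrightarrow> x + t *\<^sub>R y \<in> S'"
  shows "(\<integral>\<^sup>+x. indicator S x * ennreal ((u (x + y) - u x)\<^sup>2) \<partial>lborel)
    \<le> ennreal ((norm y)\<^sup>2) * (\<integral>\<^sup>+x. indicator S' x * ennreal (\<Sum>b\<in>Basis. (H b x)\<^sup>2) \<partial>lborel)"
proof -
  have mH[measurable]: "H b \<in> borel_measurable borel" if "b \<in> Basis" for b
    using w[OF that] loc_int_measurable unfolding weak_partial_def by blast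
  define g where "g x = (\<Sum>b\<in>Basis. (y \<bullet> b) * H b x)" for x
  have [measurable]: "g \<in> borel_measurable borel" unfolding g_def by measurable
  have gb: "(g x)\<^sup>2 \<le> (norm y)\<^sup>2 * (\<Sum>b\<in>Basis. (H b x)\<^sup>2)" for x
  proof -
    have "(g x)\<^sup>2 \<le> (\<Sum>b\<in>Basis. (y \<bullet> b)\<^sup>2) * (\<Sum>b\<in>Basis. (H b x)\<^sup>2)"
      unfolding g_def by (rule Cauchy_Schwarz_ineq_sum)
    also have "(\<Sum>b\<in>Basis. (y \<bullet> b)\<^sup>2) = (norm y)\<^sup>2"
    proof -
      have "(norm y)\<^sup>2 = (\<Sum>b\<in>Basis. (y \<bullet> b) * (y \<bullet> b))"
        unfolding power2_norm_eq_inner by (rule euclidean_inner)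
      then show ?thesis by (simp add: power2_eq_square)
    qed
    finally show ?thesis .
  qed
  have jb: "ennreal ((\<integral>t. indicator {0..1} t * g (x + t *\<^sub>R y) \<partial>lborel)\<^sup>2) \<le> (\<integral>\<^sup>+t. indicator {0..1} t * ennreal ((g (x + t *\<^sub>R y))\<^sup>2) \<partial>lborel)" for x
  proof -
    let ?I = "\<integral>t. indicator {0..1} t * g (x + t *\<^sub>R y) \<partial>lborel"
    let ?f = "\<lambda>t. indicator {0..1} t * ennreal \<bar>g (x + t *\<^sub>R y)\<bar>"
    \<comment> \<open>If the integrand along the segment is not integrable, the integral is 0 by
      convention and the inequality is trivial.\<close>
    have "ennreal \<bar>?I\<bar> \<le> (\<integral>\<^sup>+t. ennreal (norm (indicator {0..1} t * g (x + t *\<^sub>R y))) \<partial>lborel)"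
      using integral_norm_bound_ennreal[of lborel "\<lambda>t. indicator {0..1} t * g (x + t *\<^sub>R y)"]
      by (cases "integrable lborel (\<lambda>t. indicator {0..1} t * g (x + t *\<^sub>R y))") (auto simp: not_integrable_integral_eq)
    also have "\<dots> = (\<integral>\<^sup>+t. ?f t * indicator {0..1} t \<partial>lborel)"
      by (intro nn_integral_cong) (auto simp: indicator_def)
    finally have "(ennreal \<bar>?I\<bar>)\<^sup>2 \<le> (\<integral>\<^sup>+t. ?f t * indicator {0..1} t \<partial>lborel)\<^sup>2" by (rule power_mono) simp
    also have "\<dots> \<le> (\<integral>\<^sup>+t. (?f t)^2 \<partial>lborel) * (\<integral>\<^sup>+t. (indicator {0..1::real} t)^2 \<partial>lborel)"
      by (rule Cauchy_Schwarz_nn_integral) measurable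
    also have "(\<integral>\<^sup>+t. (indicator {0..1::real} t)^2 \<partial>lborel) = (\<integral>\<^sup>+t. indicator {0..1::real} t \<partial>lborel)"
      by (intro nn_integral_cong) (auto simp: indicator_def)
    also have "\<dots> = 1" by simp
    also have "(\<integral>\<^sup>+t. (?f t)^2 \<partial>lborel) = (\<integral>\<^sup>+t. indicator {0..1} t * ennreal ((g (x + t *\<^sub>R y))\<^sup>2) \<partial>lborel)"
      by (intro nn_integral_cong) (auto simp: indicator_def ennreal_power)
    finally show ?thesis by (simp add: ennreal_power)
  qed
  have "(\<integral>\<^sup>+x. indicator S x * ennreal ((u (x + y) - u x)\<^sup>2) \<partial>lborel)
     \<le> (\<integral>\<^sup>+x. indicator S x * (\<integral>\<^sup>+t. indicator {0..1} t * ennreal ((g (x + t *\<^sub>R y))\<^sup>2) \<partial>lborel) \<partial>lborel)"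
    using weak_translate_AE[OF w, of y]
    by (intro nn_integral_mono_AE) (auto elim!: eventually_mono intro!: mult_left_mono simp: jb[unfolded g_def] g_def)
  also have "\<dots> = (\<integral>\<^sup>+x. (\<integral>\<^sup>+t. indicator S x * (indicator {0..1} t * ennreal ((g (x + t *\<^sub>R y))\<^sup>2)) \<partial>lborel) \<partial>lborel)"
    by (simp add: nn_integral_cmult)
  also have "\<dots> = (\<integral>\<^sup>+t. (\<integral>\<^sup>+x. indicator S x * (indicator {0..1} t * ennreal ((g (x + t *\<^sub>R y))\<^sup>2)) \<partial>lborel) \<partial>lborel)"
    by (rule lborel_pair.Fubini'[symmetric]) measurable
  also have "\<dots> \<le> (\<integral>\<^sup>+t. (\<integral>\<^sup>+x. indicator {0..1} t * (indicator S' (x + t *\<^sub>R y) * ennreal ((g (x + t *\<^sub>R y))\<^sup>2)) \<partial>lborel) \<partial>lborel)"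
    by (intro nn_integral_mono) (use S in \<open>auto simp: indicator_def\<close>)
  also have "\<dots> = (\<integral>\<^sup>+t. indicator {0..1::real} t * (\<integral>\<^sup>+x. indicator S' x * ennreal ((g x)\<^sup>2) \<partial>lborel) \<partial>lborel)"
  proof (intro nn_integral_cong)
    fix t :: real
    have "(\<integral>\<^sup>+x. indicator {0..1} t * (indicator S' (x + t *\<^sub>R y) * ennreal ((g (x + t *\<^sub>R y))\<^sup>2)) \<partial>lborel)
      = indicator {0..1} t * (\<integral>\<^sup>+x. indicator S' (x + t *\<^sub>R y) * ennreal ((g (x + t *\<^sub>R y))\<^sup>2) \<partial>lborel)"
      by (rule nn_integral_cmult) measurable
    also have "(\<integral>\<^sup>+x. indicator S' (x + t *\<^sub>R y) * ennreal ((g (x + t *\<^sub>R y))\<^sup>2) \<partial>lborel) = (\<integral>\<^sup>+x. indicator S' x * ennreal ((g x)\<^sup>2) \<partial>lborel)"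
      by (rule nn_integral_lborel_translate[of "\<lambda>x. indicator S' x * ennreal ((g x)\<^sup>2)"]) measurable
    finally show "(\<integral>\<^sup>+x. indicator {0..1} t * (indicator S' (x + t *\<^sub>R y) * ennreal ((g (x + t *\<^sub>R y))\<^sup>2)) \<partial>lborel)
      = indicator {0..1} t * (\<integral>\<^sup>+x. indicator S' x * ennreal ((g x)\<^sup>2) \<partial>lborel)" .
  qed
  also have "\<dots> = (\<integral>\<^sup>+x. indicator S' x * ennreal ((g x)\<^sup>2) \<partial>lborel)" by (subst nn_integral_multc) auto
  also have "\<dots> \<le> (\<integral>\<^sup>+x. ennreal ((norm y)\<^sup>2) * (indicator S' x * ennreal (\<Sum>b\<in>Basis. (H b x)\<^sup>2)) \<partial>lborel)"
  proof (intro nn_integral_mono)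
    fix x :: 'a
    have "ennreal ((g x)\<^sup>2) \<le> ennreal ((norm y)\<^sup>2) * ennreal (\<Sum>b\<in>Basis. (H b x)\<^sup>2)"
      using ennreal_leI[OF gb[of x]] by (simp add: ennreal_mult' sum_nonneg)
    then show "indicator S' x * ennreal ((g x)\<^sup>2) \<le> ennreal ((norm y)\<^sup>2) * (indicator S' x * ennreal (\<Sum>b\<in>Basis. (H b x)\<^sup>2))"
      by (auto simp: indicator_def)
  qed
  also have "\<dots> = ennreal ((norm y)\<^sup>2) * (\<integral>\<^sup>+x. indicator S' x * ennreal (\<Sum>b\<in>Basis. (H b x)\<^sup>2) \<partial>lborel)"
    by (rule nn_integral_cmult) measurable
  finally show ?thesis .
qed

section \<open>Mollification\<close>

lemma frechet_derivative_Basis: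
  assumes "smooth p"
  shows "frechet_derivative p (at x) v = (\<Sum>b\<in>Basis. (v \<bullet> b) * frechet_derivative p (at x) b)"
proof -
  have "linear (frechet_derivative p (at x))"
    using smooth_has_derivative[OF assms] has_derivative_linear by blast
  then have "frechet_derivative p (at x) (\<Sum>b\<in>Basis. (v \<bullet> b) *\<^sub>R b) = (\<Sum>b\<in>Basis. (v \<bullet> b) * frechet_derivative p (at x) b)"
    by (simp add: linear_sum linear_scale)
  then show ?thesis by (simp add: euclidean_representation)
qed

lemma test_function_Lipschitz:
  fixes p :: "'a::euclidean_space \<Rightarrow> real"
  assumes p: "test_function p"
  obtains L where "L \<ge> 0" "\<And>z v. \<bar>p (z + v) - p z\<bar> \<le> L * norm v"
proof -
  have "\<forall>b. \<exists>B. \<forall>x. \<bar>frechet_derivative p (at x) b\<bar> \<le> B"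
    using test_function_bounded[OF test_function_frechet_derivative[OF p]] by metis
  then obtain B where B: "\<And>b x. \<bar>frechet_derivative p (at x) b\<bar> \<le> B b" by metis
  have B0: "B b \<ge> 0" for b using B[of 0 b] by linarith
  show ?thesis
  proof (rule that[of "\<Sum>b\<in>Basis. B b"])
    show "(\<Sum>b\<in>Basis. B b) \<ge> 0" using B0 by (rule sum_nonneg)
    fix z v :: 'a
    obtain \<xi> where "p (z + 1 *\<^sub>R v) - p z = 1 * frechet_derivative p (at (z + \<xi> *\<^sub>R v)) v"
      using smooth_directional_mvt[OF test_function_smooth[OF p], of 1 z v] by auto
    then have "p (z + v) - p z = frechet_derivative p (at (z + \<xi> *\<^sub>R v)) v" by simp
    also have "\<dots> = (\<Sum>b\<in>Basis. (v \<bullet> b) * frechet_derivative p (at (z + \<xi> *\<^sub>R v)) b)"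
      by (rule frechet_derivative_Basis[OF test_function_smooth[OF p]])
    finally have "\<bar>p (z + v) - p z\<bar> = \<bar>\<Sum>b\<in>Basis. (v \<bullet> b) * frechet_derivative p (at (z + \<xi> *\<^sub>R v)) b\<bar>" by simp
    also have "\<dots> \<le> (\<Sum>b\<in>Basis. \<bar>v \<bullet> b\<bar> * \<bar>frechet_derivative p (at (z + \<xi> *\<^sub>R v)) b\<bar>)"
      using sum_abs[of "\<lambda>b. (v \<bullet> b) * frechet_derivative p (at (z + \<xi> *\<^sub>R v)) b"] by (simp add: abs_mult)
    also have "\<dots> \<le> (\<Sum>b\<in>Basis. norm v * B b)"
      by (intro sum_mono mult_mono Basis_le_norm B) auto
    finally show "\<bar>p (z + v) - p z\<bar> \<le> (\<Sum>b\<in>Basis. B b) * norm v" by (simp add: sum_distrib_left mult.commute)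
  qed
qed

lemma test_function_Taylor:
  fixes p :: "'a::euclidean_space \<Rightarrow> real"
  assumes p: "test_function p"
  obtains C where "C \<ge> 0" "\<And>z v. \<bar>p (z + v) - p z - frechet_derivative p (at z) v\<bar> \<le> C * (norm v)\<^sup>2"
proof -
  have "\<forall>b. \<exists>L. L \<ge> 0 \<and> (\<forall>z v. \<bar>frechet_derivative p (at (z + v)) b - frechet_derivative p (at z) b\<bar> \<le> L * norm v)"
    using test_function_Lipschitz[OF test_function_frechet_derivative[OF p]] by metis
  then obtain L where L: "\<And>b. L b \<ge> 0" "\<And>b z v. \<bar>frechet_derivative p (at (z + v)) b - frechet_derivative p (at z) b\<bar> \<le> L b * norm v" by metis
  show ?thesis
  proof (rule that[of "\<Sum>b\<in>Basis. L b"])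
    show "(\<Sum>b\<in>Basis. L b) \<ge> 0" using L(1) by (rule sum_nonneg)
    fix z v :: 'a
    obtain \<xi> where \<xi>: "0 < \<xi>" "\<xi> < 1" and e: "p (z + 1 *\<^sub>R v) - p z = 1 * frechet_derivative p (at (z + \<xi> *\<^sub>R v)) v"
      using smooth_directional_mvt[OF test_function_smooth[OF p], of 1 z v] by auto
    let ?d = "\<lambda>b. frechet_derivative p (at (z + \<xi> *\<^sub>R v)) b - frechet_derivative p (at z) b"
    have "p (z + v) - p z - frechet_derivative p (at z) v = (\<Sum>b\<in>Basis. (v \<bullet> b) * ?d b)"
      using e frechet_derivative_Basis[OF test_function_smooth[OF p], of "z + \<xi> *\<^sub>R v" v]
        frechet_derivative_Basis[OF test_function_smooth[OF p], of z v]
      by (simp add: right_diff_distrib sum_subtractf)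
    then have "\<bar>p (z + v) - p z - frechet_derivative p (at z) v\<bar> \<le> (\<Sum>b\<in>Basis. \<bar>v \<bullet> b\<bar> * \<bar>?d b\<bar>)"
      using sum_abs[of "\<lambda>b. (v \<bullet> b) * ?d b" Basis] by (simp add: abs_mult)
    also have "\<dots> \<le> (\<Sum>b\<in>Basis. norm v * (L b * norm v))"
    proof (intro sum_mono mult_mono Basis_le_norm)
      fix b
      have "\<bar>?d b\<bar> \<le> L b * norm (\<xi> *\<^sub>R v)" by (rule L(2))
      also have "\<dots> \<le> L b * norm v" using \<xi> L(1)[of b] by (intro mult_left_mono) (auto simp: mult_left_le_one_le)
      finally show "\<bar>?d b\<bar> \<le> L b * norm v" .
    qed auto
    also have "\<dots> = (\<Sum>b\<in>Basis. L b) * (norm v)\<^sup>2"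
      unfolding sum_distrib_right by (intro sum.cong refl) (simp add: power2_eq_square)
    finally show "\<bar>p (z + v) - p z - frechet_derivative p (at z) v\<bar> \<le> (\<Sum>b\<in>Basis. L b) * (norm v)\<^sup>2" .
  qed
qed

definition mollify :: "('a::euclidean_space \<Rightarrow> real) \<Rightarrow> ('a \<Rightarrow> 'b::{banach,second_countable_topology}) \<Rightarrow> 'a \<Rightarrow> 'b" where
  "mollify k u x = (\<integral>y. k (x - y) *\<^sub>R u y \<partial>lborel)"

lemma test_function_reflect: "test_function k \<Longrightarrow> test_function (\<lambda>y. k (x - y))"
  using test_function_compose_affine[of k "\<lambda>x. - x" "\<lambda>x. - x" x]
  by (simp add: bounded_linear_minus[OF bounded_linear_ident])

lemma mollify_integrable: "loc_int u \<Longrightarrow> test_function k \<Longrightarrow> integrable lborel (\<lambda>y. k (x - y) *\<^sub>R u y)"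
  by (rule loc_int_integrable_test[OF _ test_function_reflect])

text \<open>The second-order Taylor remainder of the kernel is bounded uniformly in its base point.
  So the remainder of the mollification is at most a constant times \<open>(norm w)^2\<close> times
  the integral of \<open>norm (u z)\<close> over one fixed ball.\<close>

lemma mollify_has_derivative:
  fixes u :: "'a::euclidean_space \<Rightarrow> 'b::{banach,second_countable_topology}"
  assumes u: "loc_int u" and k: "test_function k"
  shows "(mollify k u has_derivative (\<lambda>v. mollify (\<lambda>z. frechet_derivative k (at z) v) u x)) (at x)"
proof -
  have dk: "test_function (\<lambda>z. frechet_derivative k (at z) v)" for v by (rule test_function_frechet_derivative[OF k])
  have lin: "linear (frechet_derivative k (at z))" for z
    using smooth_has_derivative[OF test_function_smooth[OF k]] has_derivative_linear by blast
  obtain C where C: "C \<ge> 0" "\<And>z v. \<bar>k (z + v) - k z - frechet_derivative k (at z) v\<bar> \<le> C * (norm v)\<^sup>2"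
    using test_function_Taylor[OF k] by metis
  obtain K where K: "compact K" "\<And>z. z \<notin> K \<Longrightarrow> k z = 0" "\<And>z v. z \<notin> K \<Longrightarrow> frechet_derivative k (at z) v = 0"
    using test_function_support[OF k] by metis
  obtain r where r: "\<And>z. z \<in> K \<Longrightarrow> norm z \<le> r" using compact_imp_bounded[OF K(1)] unfolding bounded_iff by auto
  \<comment> \<open>Radius \<open>r + 1\<close> covers the support of the kernel placed at
    \<open>x\<close> and at every \<open>x + w\<close> with \<open>norm w < 1\<close>.\<close>
  define A where "A = (\<integral>y. norm (indicator (cball x (r + 1)) y *\<^sub>R u y) \<partial>lborel)"
  have iA: "integrable lborel (\<lambda>y. norm (indicat_real (cball x (r + 1)) y *\<^sub>R u y))"
    using u compact_cball[of x "r + 1"] unfolding loc_int_def set_integrable_def by (intro integrable_norm) blast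
  show ?thesis
  proof (rule has_derivativeI_sandwich[where e=1 and H="\<lambda>y. C * A * norm (y - x)"])
    have "linear (\<lambda>v. mollify (\<lambda>z. frechet_derivative k (at z) v) u x)"
    proof (rule linearI)
      show "mollify (\<lambda>z. frechet_derivative k (at z) (a + b)) u x = mollify (\<lambda>z. frechet_derivative k (at z) a) u x + mollify (\<lambda>z. frechet_derivative k (at z) b) u x" for a b
        unfolding mollify_def
        using mollify_integrable[OF u dk] by (simp add: linear_add[OF lin] scaleR_add_left)
      show "mollify (\<lambda>z. frechet_derivative k (at z) (c *\<^sub>R b)) u x = c *\<^sub>R mollify (\<lambda>z. frechet_derivative k (at z) b) u x" for c b
        unfolding mollify_def using mollify_integrable[OF u dk] by (simp add: linear_scale[OF lin] flip: scaleR_scaleR)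
    qed
    then show "bounded_linear (\<lambda>v. mollify (\<lambda>z. frechet_derivative k (at z) v) u x)" by (simp add: linear_conv_bounded_linear)
    have "((\<lambda>y. C * A * norm (y - x)) \<longlongrightarrow> C * A * norm (x - x)) (at x)" by (intro tendsto_intros)
    then show "((\<lambda>y. C * A * norm (y - x)) \<longlongrightarrow> 0) (at x)" by simp
    fix y assume y: "y \<noteq> x" "dist y x < 1"
    define w where "w = y - x"
    have w: "norm w < 1" "y = x + w" using y by (auto simp: w_def dist_norm)
    let ?q = "\<lambda>z. k (x + w - z) - k (x - z) - frechet_derivative k (at (x - z)) w"
    have "mollify k u y - mollify k u x - mollify (\<lambda>z. frechet_derivative k (at z) (y - x)) u x = (\<integral>z. ?q z *\<^sub>R u z \<partial>lborel)"
      unfolding mollify_def w(2)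
      using mollify_integrable[OF u k] mollify_integrable[OF u dk] by (simp add: scaleR_diff_left)
    also have "norm (\<integral>z. ?q z *\<^sub>R u z \<partial>lborel) \<le> (\<integral>z. C * (norm w)\<^sup>2 * norm (indicat_real (cball x (r + 1)) z *\<^sub>R u z) \<partial>lborel)"
    proof (rule integral_norm_le)
      show "integrable lborel (\<lambda>z. C * (norm w)\<^sup>2 * norm (indicat_real (cball x (r + 1)) z *\<^sub>R u z))"
        by (intro integrable_mult_right iA)
      fix z
      show "norm (?q z *\<^sub>R u z) \<le> C * (norm w)\<^sup>2 * norm (indicat_real (cball x (r + 1)) z *\<^sub>R u z)"
      proof (cases "z \<in> cball x (r + 1)")
        case True
        have "\<bar>?q z\<bar> \<le> C * (norm w)\<^sup>2" using C(2)[of "x - z" w] by (simp add: algebra_simps)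
        then show ?thesis using True by (simp add: mult_right_mono)
      next
        case False
        then have "norm (x - z) > r + 1" by (simp add: dist_norm)
        moreover have "norm (x + w - z) \<ge> norm (x - z) - norm w" using norm_triangle_ineq4[of "x + w - z" w] by simp
        ultimately have "x - z \<notin> K" "x + w - z \<notin> K" using r[of "x - z"] r[of "x + w - z"] w(1) by auto
        then show ?thesis using K C(1) by simp
      qed
    qed
    also have "\<dots> = C * (norm w)\<^sup>2 * A" by (simp add: A_def)
    finally have "norm (mollify k u y - mollify k u x - mollify (\<lambda>z. frechet_derivative k (at z) (y - x)) u x) \<le> (C * A * norm w) * norm w"
      by (simp add: power2_eq_square mult_ac)
    then show "norm (mollify k u y - mollify k u x - mollify (\<lambda>z. frechet_derivative k (at z) (y - x)) u x) / norm (y - x) \<le> C * A * norm (y - x)"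
      using y by (simp add: w_def divide_le_eq)
  qed auto
qed

text \<open>A directional derivative of a mollification is a mollification by the differentiated
  kernel, so the induction is over all kernels at once.\<close>

lemma mollify_smooth:
  fixes u :: "'a::euclidean_space \<Rightarrow> real"
  assumes u: "loc_int u" and k: "test_function k"
  shows "smooth (mollify k u)"
proof -
  have "mollify k u \<in> Ck n" if "test_function k" for n k
    using that
  proof (induction n arbitrary: k)
    case 0
    then show ?case
      using mollify_has_derivative[OF u] by (auto intro!: continuous_at_imp_continuous_on has_derivative_continuous)
  next
    case (Suc n)
    show ?case
    proof (rule Ck_SucI[OF mollify_has_derivative[OF u Suc.prems]])
      fix v
      show "(\<lambda>x. mollify (\<lambda>z. frechet_derivative k (at z) v) u x) \<in> Ck n"
        using Suc.IH[OF test_function_frechet_derivative[OF Suc.prems, of v]] by simp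
    qed
  qed
  then show ?thesis using k by (simp add: smooth_def)
qed

text \<open>The sign from reflecting the kernel cancels the sign in the definition of the weak
  derivative.\<close>

lemma mollify_weak_partial:
  assumes w: "weak_partial u b g" and k: "test_function k"
  shows "mollify (\<lambda>z. frechet_derivative k (at z) b) u x = mollify k g x"
proof -
  have lin: "linear (frechet_derivative k (at z))" for z
    using smooth_has_derivative[OF test_function_smooth[OF k]] has_derivative_linear by blast
  have eq: "frechet_derivative (\<lambda>y. k (x - y)) (at y) b = - frechet_derivative k (at (x - y)) b" for y
    using frechet_derivative_compose_affine[OF test_function_smooth[OF k] bounded_linear_minus[OF bounded_linear_ident], of x y b]
    by (simp add: linear_neg[OF lin])
  have "(\<integral>y. frechet_derivative (\<lambda>y. k (x - y)) (at y) b *\<^sub>R u y \<partial>lborel) = - (\<integral>y. k (x - y) *\<^sub>R g y \<partial>lborel)"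
    using w test_function_reflect[OF k, of x] unfolding weak_partial_def by blast
  then show ?thesis unfolding eq by (simp add: mollify_def)
qed

definition mollifier :: "real \<Rightarrow> real \<Rightarrow> ('a::euclidean_space \<Rightarrow> real) \<Rightarrow> bool" where
  "mollifier h M k \<longleftrightarrow> test_function k \<and> (\<forall>x. 0 \<le> k x \<and> k x \<le> M) \<and> (\<forall>x. norm x > h \<longrightarrow> k x = 0) \<and> (\<integral>x. k x \<partial>lborel) = 1"

text \<open>\<open>C / h^N\<close> is the height of a kernel of unit mass on a ball of radius
  \<open>h\<close> in dimension \<open>N\<close>. With this bound a local energy of order
  \<open>\<eta> * h^(N-2)\<close> keeps the gradient of the mollification of order
  \<open>1/h\<close>, hence its oscillation on a ball of radius \<open>h\<close> small.\<close>

lemma mollifier_exists: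
  "\<exists>C>0. \<forall>h>0. \<exists>k::'a::euclidean_space \<Rightarrow> real. mollifier h (C / h ^ DIM('a)) k"
proof -
  have tb: "test_function (ball_bump :: 'a \<Rightarrow> real)" by (rule test_function_ball_bump)
  obtain B where B: "B > 0" "\<And>x::'a. \<bar>ball_bump x\<bar> \<le> B" using test_function_bounded[OF tb] by blast
  have ib: "integrable lborel (ball_bump :: 'a \<Rightarrow> real)"
    using loc_int_integrable_test[OF loc_int_continuous tb, of "\<lambda>_. 1::real"] by simp
  have [measurable]: "(ball_bump :: 'a \<Rightarrow> real) \<in> borel_measurable borel"
    by (intro borel_measurable_continuous_onI test_function_continuous_on tb)
  define m where "m = (\<integral>x. ball_bump x \<partial>(lborel::'a measure))"
  have z: "ball_bump x = 0" if "norm x > 1" for x :: 'a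
  proof -
    have "x \<bullet> x > 1" using that by (metis one_less_power power2_norm_eq_inner zero_less_numeral)
    then show ?thesis by (simp add: ball_bump_def flat_exp_def)
  qed
  have "m > 0"
  proof (rule ccontr)
    assume "\<not> m > 0"
    moreover have "m \<ge> 0" unfolding m_def by (intro integral_nonneg_AE) (auto simp: ball_bump_0_pos)
    ultimately have "m = 0" by simp
    then have ae: "AE x in (lborel::'a measure). ball_bump x = 0"
      unfolding m_def using ib by (subst (asm) integral_nonneg_eq_0_iff_AE) (auto simp: ball_bump_0_pos)
    have pos: "ball_bump x > 0" if "x \<in> ball 0 1" for x :: 'a
    proof -
      have "(norm x)\<^sup>2 < 1" using that by (simp add: abs_square_less_1)
      then show ?thesis by (simp add: ball_bump_def flat_exp_pos_iff power2_norm_eq_inner)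
    qed
    have "AE x in (lborel::'a measure). x \<notin> ball 0 1"
      using ae
    proof eventually_elim
      case (elim x)
      then show ?case using pos[of x] by force
    qed
    then have "ball (0::'a) 1 \<in> null_sets lborel" by (subst AE_iff_null_sets) auto
    then have "emeasure lborel (ball (0::'a) 1) = 0" by (rule null_setsD1)
    then show False using content_ball_pos[of 1 "0::'a"] by (simp add: measure_def)
  qed
  have "\<exists>k::'a \<Rightarrow> real. mollifier h ((B / m) / h ^ DIM('a)) k" if h: "h > 0" for h
  proof
    let ?k = "\<lambda>x::'a. ball_bump ((1/h) *\<^sub>R x) * (1 / (m * h ^ DIM('a)))"
    have t: "test_function (\<lambda>x::'a. ball_bump ((1/h) *\<^sub>R x))"
      using test_function_compose_affine[OF tb, of "\<lambda>x. (1/h) *\<^sub>R x" "\<lambda>x. h *\<^sub>R x" 0] h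
      by (simp add: bounded_linear_scaleR_right)
    have "(\<integral>x. ball_bump x \<partial>(lborel::'a measure)) = \<bar>1/h\<bar> ^ DIM('a) *\<^sub>R (\<integral>x. ball_bump (0 + (1/h) *\<^sub>R x) \<partial>(lborel::'a measure))"
      using h by (intro integral_lborel_affine) auto
    then have i: "(\<integral>x. ball_bump ((1/h) *\<^sub>R x) \<partial>(lborel::'a measure)) = m * h ^ DIM('a)"
      using h by (simp add: m_def power_divide)
    show "mollifier h ((B / m) / h ^ DIM('a)) ?k"
      unfolding mollifier_def
    proof (intro conjI allI impI)
      show "test_function ?k" by (intro test_function_mult_smooth t smooth_const)
      show "0 \<le> ?k x" for x using \<open>m > 0\<close> h by (simp add: ball_bump_0_pos)
      show "?k x \<le> (B / m) / h ^ DIM('a)" for x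
      proof -
        have "ball_bump ((1/h) *\<^sub>R x) \<le> B" using B(2)[of "(1/h) *\<^sub>R x"] by linarith
        then have "?k x \<le> B * (1 / (m * h ^ DIM('a)))" using \<open>m > 0\<close> h by (intro mult_right_mono) auto
        then show ?thesis by simp
      qed
      show "?k x = 0" if "norm x > h" for x using z[of "(1/h) *\<^sub>R x"] that h by (simp add: less_divide_eq)
      have "(\<integral>x. ?k x \<partial>lborel) = (\<integral>x. ball_bump ((1/h) *\<^sub>R x) \<partial>(lborel::'a measure)) * (1 / (m * h ^ DIM('a)))"
        by (rule integral_mult_left_zero)
      then have "(\<integral>x. ?k x \<partial>lborel) = (m * h ^ DIM('a)) * (1 / (m * h ^ DIM('a)))" unfolding i .
      moreover have "m * h ^ DIM('a) \<noteq> 0" using \<open>m > 0\<close> h by simp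
      ultimately show "(\<integral>x. ?k x \<partial>lborel) = 1" by (metis divide_self_if times_divide_eq_right mult.right_neutral)
    qed
  qed
  then show ?thesis using B \<open>m > 0\<close> by (intro exI[of _ "B / m"]) auto
qed

context
  fixes h M :: real and k :: "'a::euclidean_space \<Rightarrow> real"
  assumes mol: "mollifier h M k"
begin

lemma mollifier_test: "test_function k" and mollifier_nonneg: "0 \<le> k x" and mollifier_le: "k x \<le> M"
  and mollifier_support: "norm x > h \<Longrightarrow> k x = 0"
  using mol unfolding mollifier_def by auto

lemma mollifier_measurable [measurable]: "k \<in> borel_measurable borel"
  by (intro borel_measurable_continuous_onI test_function_continuous_on mollifier_test)

lemma mollifier_integrable: "integrable lborel k"
  using loc_int_integrable_test[OF loc_int_continuous mollifier_test, of "\<lambda>_. 1::real"] by simp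

lemma mollifier_nn_integral: "(\<integral>\<^sup>+x. ennreal (k x) \<partial>lborel) = 1"
  using nn_integral_eq_integral[OF mollifier_integrable] mollifier_nonneg mol by (simp add: mollifier_def)

lemma mollifier_nn_integral_diff:
  "(\<integral>\<^sup>+y. ennreal (k (x - y)) \<partial>lborel) = 1" "(\<integral>\<^sup>+x. ennreal (k (x - y)) \<partial>lborel) = 1"
  using nn_integral_lborel_affine[of "\<lambda>x. ennreal (k x)" "-1" x] nn_integral_lborel_affine[of "\<lambda>x. ennreal (k x)" 1 "- y"]
  by (simp_all add: mollifier_nn_integral)

text \<open>Jensen's inequality for the probability density \<open>q\<close>, from Cauchy-Schwarz
  after writing \<open>q\<close> as the square of \<open>sqrt q\<close>. It covers every measurable
  \<open>g\<close>, because a non-integrable integrand has integral 0 by convention.\<close>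

lemma norm_integral_mollifier_sq:
  fixes g :: "'a \<Rightarrow> 'b::{banach,second_countable_topology}"
  assumes [measurable]: "g \<in> borel_measurable borel" "q \<in> borel_measurable borel" and q: "\<And>y. q y \<ge> 0" "(\<integral>\<^sup>+y. ennreal (q y) \<partial>lborel) = 1"
  shows "ennreal ((norm (\<integral>y. q y *\<^sub>R g y \<partial>lborel))\<^sup>2) \<le> (\<integral>\<^sup>+y. ennreal (q y) * ennreal ((norm (g y))\<^sup>2) \<partial>lborel)"
proof -
  have "ennreal (norm (\<integral>y. q y *\<^sub>R g y \<partial>lborel)) \<le> (\<integral>\<^sup>+y. ennreal (norm (q y *\<^sub>R g y)) \<partial>lborel)"
    using integral_norm_bound_ennreal[of lborel "\<lambda>y. q y *\<^sub>R g y"]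
    by (cases "integrable lborel (\<lambda>y. q y *\<^sub>R g y)") (auto simp: not_integrable_integral_eq)
  also have "\<dots> = (\<integral>\<^sup>+y. ennreal (sqrt (q y) * norm (g y)) * ennreal (sqrt (q y)) \<partial>lborel)"
  proof (intro nn_integral_cong)
    fix y
    have "(sqrt (q y) * norm (g y)) * sqrt (q y) = (sqrt (q y) * sqrt (q y)) * norm (g y)" by (simp only: mult_ac)
    then have eq: "norm (q y *\<^sub>R g y) = (sqrt (q y) * norm (g y)) * sqrt (q y)" using q(1)[of y] by simp
    show "ennreal (norm (q y *\<^sub>R g y)) = ennreal (sqrt (q y) * norm (g y)) * ennreal (sqrt (q y))"
      unfolding eq by (rule ennreal_mult) (use q(1)[of y] in auto)
  qed
  finally have "(ennreal (norm (\<integral>y. q y *\<^sub>R g y \<partial>lborel)))\<^sup>2 \<le> (\<integral>\<^sup>+y. ennreal (sqrt (q y) * norm (g y)) * ennreal (sqrt (q y)) \<partial>lborel)\<^sup>2"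
    by (rule power_mono) simp
  also have "\<dots> \<le> (\<integral>\<^sup>+y. ennreal (sqrt (q y) * norm (g y)) ^ 2 \<partial>lborel) * (\<integral>\<^sup>+y. ennreal (sqrt (q y)) ^ 2 \<partial>lborel)"
    by (rule Cauchy_Schwarz_nn_integral) measurable
  also have "(\<integral>\<^sup>+y. ennreal (sqrt (q y)) ^ 2 \<partial>lborel) = 1"
    using q by (simp add: ennreal_power)
  also have "(\<integral>\<^sup>+y. ennreal (sqrt (q y) * norm (g y)) ^ 2 \<partial>lborel) = (\<integral>\<^sup>+y. ennreal (q y) * ennreal ((norm (g y))\<^sup>2) \<partial>lborel)"
    using q(1) by (intro nn_integral_cong) (simp add: ennreal_power power_mult_distrib ennreal_mult)
  finally show ?thesis by (simp add: ennreal_power)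
qed

lemma mollify_norm_sq:
  fixes g :: "'a \<Rightarrow> 'b::{banach,second_countable_topology}"
  assumes [measurable]: "g \<in> borel_measurable borel"
  shows "ennreal ((norm (mollify k g x))\<^sup>2) \<le> (\<integral>\<^sup>+y. ennreal (k (x - y)) * ennreal ((norm (g y))\<^sup>2) \<partial>lborel)"
  unfolding mollify_def
  by (rule norm_integral_mollifier_sq) (auto simp: mollifier_nonneg mollifier_nn_integral_diff)

lemma mollify_local_bound:
  fixes g :: "'a \<Rightarrow> 'b::{banach,second_countable_topology}"
  assumes [measurable]: "g \<in> borel_measurable borel"
  shows "ennreal ((norm (mollify k g x))\<^sup>2) \<le> ennreal M * (\<integral>\<^sup>+y. indicator (cball x h) y * ennreal ((norm (g y))\<^sup>2) \<partial>lborel)"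
proof -
  have "ennreal ((norm (mollify k g x))\<^sup>2) \<le> (\<integral>\<^sup>+y. ennreal (k (x - y)) * ennreal ((norm (g y))\<^sup>2) \<partial>lborel)"
    by (rule mollify_norm_sq) measurable
  also have "\<dots> \<le> (\<integral>\<^sup>+y. ennreal M * (indicator (cball x h) y * ennreal ((norm (g y))\<^sup>2)) \<partial>lborel)"
  proof (intro nn_integral_mono)
    fix y
    have "ennreal (k (x - y)) \<le> ennreal M * indicator (cball x h) y"
      using mollifier_le[of "x - y"] mollifier_support[of "x - y"] by (cases "y \<in> cball x h") (auto simp: dist_norm intro: ennreal_leI)
    then show "ennreal (k (x - y)) * ennreal ((norm (g y))\<^sup>2) \<le> ennreal M * (indicator (cball x h) y * ennreal ((norm (g y))\<^sup>2))"
      by (simp add: mult.assoc[symmetric] mult_right_mono)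
  qed
  also have "\<dots> = ennreal M * (\<integral>\<^sup>+y. indicator (cball x h) y * ennreal ((norm (g y))\<^sup>2) \<partial>lborel)"
    by (intro nn_integral_cmult borel_measurable_times_ennreal borel_measurable_indicator) auto
  finally show ?thesis .
qed

lemma mollify_L2_bound:
  fixes g :: "'a \<Rightarrow> 'b::{banach,second_countable_topology}"
  assumes [measurable]: "g \<in> borel_measurable borel"
  shows "(\<integral>\<^sup>+x. ennreal ((norm (mollify k g x))\<^sup>2) \<partial>lborel) \<le> (\<integral>\<^sup>+y. ennreal ((norm (g y))\<^sup>2) \<partial>lborel)"
proof -
  have "(\<integral>\<^sup>+x. ennreal ((norm (mollify k g x))\<^sup>2) \<partial>lborel) \<le> (\<integral>\<^sup>+x. (\<integral>\<^sup>+y. ennreal (k (x - y)) * ennreal ((norm (g y))\<^sup>2) \<partial>lborel) \<partial>lborel)"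
    by (intro nn_integral_mono mollify_norm_sq) measurable
  also have "\<dots> = (\<integral>\<^sup>+y. (\<integral>\<^sup>+x. ennreal (k (x - y)) * ennreal ((norm (g y))\<^sup>2) \<partial>lborel) \<partial>lborel)"
    by (rule lborel_pair.Fubini'[symmetric]) measurable
  also have "\<dots> = (\<integral>\<^sup>+y. ennreal ((norm (g y))\<^sup>2) \<partial>lborel)"
  proof (intro nn_integral_cong)
    fix y
    have "(\<integral>\<^sup>+x. ennreal (k (x - y)) * ennreal ((norm (g y))\<^sup>2) \<partial>lborel) = (\<integral>\<^sup>+x. ennreal (k (x - y)) \<partial>lborel) * ennreal ((norm (g y))\<^sup>2)"
      by (rule nn_integral_multc) measurable
    then show "(\<integral>\<^sup>+x. ennreal (k (x - y)) * ennreal ((norm (g y))\<^sup>2) \<partial>lborel) = ennreal ((norm (g y))\<^sup>2)"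
      by (simp add: mollifier_nn_integral_diff)
  qed
  finally show ?thesis .
qed

text \<open>The error is the average, with weight \<open>k z\<close>, of the differences
  \<open>u x - u (x - z)\<close> with \<open>norm z \<le> h\<close>. Jensen moves the square inside,
  and the translation bound applies to each \<open>z\<close>.\<close>

lemma mollify_error:
  fixes u :: "'a \<Rightarrow> real"
  assumes w: "\<And>b. b \<in> Basis \<Longrightarrow> weak_partial u b (H b)" and h: "h > 0"
    and S[measurable]: "S \<in> sets borel" "S' \<in> sets borel" and SS: "\<And>x z. x \<in> S \<Longrightarrow> norm z \<le> h \<Longrightarrow> x + z \<in> S'"
  shows "(\<integral>\<^sup>+x. indicator S x * ennreal ((u x - mollify k u x)\<^sup>2) \<partial>lborel)
    \<le> ennreal (h\<^sup>2) * (\<integral>\<^sup>+x. indicator S' x * ennreal (\<Sum>b\<in>Basis. (H b x)\<^sup>2) \<partial>lborel)"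
proof -
  have lu: "loc_int u" using w[OF e1_Basis] unfolding weak_partial_def by simp
  have [measurable]: "u \<in> borel_measurable borel" by (rule loc_int_measurable[OF lu])
  let ?E = "\<integral>\<^sup>+x. indicator S' x * ennreal (\<Sum>b\<in>Basis. (H b x)\<^sup>2) \<partial>lborel"
  have pw: "ennreal ((u x - mollify k u x)\<^sup>2) \<le> (\<integral>\<^sup>+z. ennreal (k z) * ennreal ((u (x + - z) - u x)\<^sup>2) \<partial>lborel)" for x
  proof -
    have 1: "mollify k u x = (\<integral>z. k z * u (x + - z) \<partial>lborel)" and i1: "integrable lborel (\<lambda>z. k z * u (x + - z))"
    proof -
      have "integrable lborel (\<lambda>z. k (x - (x + (-1) *\<^sub>R z)) *\<^sub>R u (x + (-1) *\<^sub>R z))"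
        using mollify_integrable[OF lu mollifier_test, of x] by (subst integrable_lborel_affine_iff) auto
      then show "integrable lborel (\<lambda>z. k z * u (x + - z))" by simp
      have "mollify k u x = \<bar>-1\<bar> ^ DIM('a) *\<^sub>R (\<integral>z. k (x - (x + (-1) *\<^sub>R z)) *\<^sub>R u (x + (-1) *\<^sub>R z) \<partial>lborel)"
        unfolding mollify_def by (intro integral_lborel_affine) auto
      then show "mollify k u x = (\<integral>z. k z * u (x + - z) \<partial>lborel)" by simp
    qed
    have "(\<integral>z. k z * u x \<partial>lborel) = u x" using mol by (simp add: mollifier_def)
    then have "mollify k u x - u x = (\<integral>z. k z *\<^sub>R (u (x + - z) - u x) \<partial>lborel)"
      using i1 mollifier_integrable by (simp add: 1 right_diff_distrib)
    then have "ennreal ((mollify k u x - u x)\<^sup>2) \<le> (\<integral>\<^sup>+z. ennreal (k z) * ennreal ((norm (u (x + - z) - u x))\<^sup>2) \<partial>lborel)"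
      using norm_integral_mollifier_sq[of "\<lambda>z. u (x + - z) - u x" k] mollifier_nonneg mollifier_nn_integral by simp
    then show ?thesis by (simp add: power2_commute[of "u x"])
  qed
  have "(\<integral>\<^sup>+x. indicator S x * ennreal ((u x - mollify k u x)\<^sup>2) \<partial>lborel)
     \<le> (\<integral>\<^sup>+x. indicator S x * (\<integral>\<^sup>+z. ennreal (k z) * ennreal ((u (x + - z) - u x)\<^sup>2) \<partial>lborel) \<partial>lborel)"
    by (intro nn_integral_mono mult_left_mono pw) simp
  also have "\<dots> = (\<integral>\<^sup>+x. (\<integral>\<^sup>+z. indicator S x * (ennreal (k z) * ennreal ((u (x + - z) - u x)\<^sup>2)) \<partial>lborel) \<partial>lborel)"
    by (simp add: nn_integral_cmult)
  also have "\<dots> = (\<integral>\<^sup>+z. (\<integral>\<^sup>+x. indicator S x * (ennreal (k z) * ennreal ((u (x + - z) - u x)\<^sup>2)) \<partial>lborel) \<partial>lborel)"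
    by (rule lborel_pair.Fubini'[symmetric]) measurable
  also have "\<dots> \<le> (\<integral>\<^sup>+z. ennreal (k z) * (ennreal (h\<^sup>2) * ?E) \<partial>lborel)"
  proof (intro nn_integral_mono)
    fix z
    show "(\<integral>\<^sup>+x. indicator S x * (ennreal (k z) * ennreal ((u (x + - z) - u x)\<^sup>2)) \<partial>lborel) \<le> ennreal (k z) * (ennreal (h\<^sup>2) * ?E)"
    proof (cases "norm z \<le> h")
      case True
      have "(\<integral>\<^sup>+x. indicator S x * (ennreal (k z) * ennreal ((u (x + - z) - u x)\<^sup>2)) \<partial>lborel)
         = ennreal (k z) * (\<integral>\<^sup>+x. indicator S x * ennreal ((u (x + - z) - u x)\<^sup>2) \<partial>lborel)"
        by (subst nn_integral_cmult[symmetric]) (auto simp: mult_ac)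
      also have "\<dots> \<le> ennreal (k z) * (ennreal ((norm (- z))\<^sup>2) * ?E)"
      proof (intro mult_left_mono translate_L2_bound[OF w S])
        fix x and t :: real assume "x \<in> S" "0 \<le> t" "t \<le> 1"
        then show "x + t *\<^sub>R (- z) \<in> S'" using True by (intro SS) (auto intro: order_trans[OF mult_left_le_one_le])
      qed auto
      also have "\<dots> \<le> ennreal (k z) * (ennreal (h\<^sup>2) * ?E)"
        using True by (intro mult_left_mono mult_right_mono ennreal_leI power_mono) auto
      finally show ?thesis .
    next
      case False
      then show ?thesis by (simp add: mollifier_support)
    qed
  qed
  also have "\<dots> = ennreal (h\<^sup>2) * ?E"
    by (subst nn_integral_multc) (auto simp: mollifier_nn_integral)
  finally show ?thesis .
qed

end

section \<open>The potential\<close>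

text \<open>One formula on both sides of 1, from which the continuity needed for measurability of
  the potential can be read off.\<close>

lemma Vpot_integral_0:
  assumes F: "continuous_on {0..} F" and s: "s \<ge> 0"
  shows "Vpot F s = integral {0..1} F - integral {0..s} F"
proof -
  have i: "F integrable_on {0..a}" for a
    using F by (intro integrable_continuous_real) (auto intro: continuous_on_subset)
  show ?thesis
  proof (cases "s \<le> 1")
    case True
    then show ?thesis using Vpot_below[OF F s True] Henstock_Kurzweil_Integration.integral_combine[OF s True i] by simp
  next
    case False
    then show ?thesis using Vpot_above[OF F] Henstock_Kurzweil_Integration.integral_combine[of 0 1 s F, OF _ _ i] by simp
  qed
qed

lemma Vpot_measurable:
  assumes F: "continuous_on {0..} F"
  shows "(\<lambda>y. Vpot F (y\<^sup>2)) \<in> borel_measurable borel"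
proof -
  have "continuous_on {0..} (\<lambda>s. integral {0..s} F)"
    unfolding continuous_on_eq_continuous_within
  proof
    fix s :: real assume s: "s \<in> {0..}"
    have "continuous_on {0..s+1} (\<lambda>s. integral {0..s} F)"
      using F by (intro indefinite_integral_continuous_1 integrable_continuous_real) (auto intro: continuous_on_subset)
    then have "continuous (at s within {0..s+1}) (\<lambda>s. integral {0..s} F)" using s by (simp add: continuous_on_eq_continuous_within)
    moreover have "at s within {0..s+1} = at s within {0..}"
      by (rule at_within_nhd[of s "{..<s+1}"]) auto
    ultimately show "continuous (at s within {0..}) (\<lambda>s. integral {0..s} F)" by simp
  qed
  then have "continuous_on UNIV (\<lambda>y::real. integral {0..y\<^sup>2} F)"
    by (rule continuous_on_compose2) (auto intro!: continuous_intros)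
  then have "continuous_on UNIV (\<lambda>y::real. integral {0..1} F - integral {0..y\<^sup>2} F)"
    by (intro continuous_on_diff continuous_on_const)
  then have "(\<lambda>y::real. integral {0..1} F - integral {0..y\<^sup>2} F) \<in> borel_measurable borel" by (rule borel_measurable_continuous_onI)
  then show ?thesis using Vpot_integral_0[OF F] by simp
qed

text \<open>Since \<open>F 1 = 0\<close> and the derivative there is -1, near 1 the graph of
  \<open>F\<close> lies beyond the line \<open>- (t - 1) / 2\<close> on either side; integrating
  gives \<open>(\<sigma> - 1)^2 / 4\<close>, and \<open>\<sigma> = s^2\<close> only helps because
  \<open>s + 1 \<ge> 1\<close>. The window is \<open>2 * \<delta>\<close> rather than
  \<open>\<delta>\<close> because the modulus of \<open>\<psi>\<close> will be compared with that of
  its mollification.\<close>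

lemma Vpot_coercive:
  assumes "A1 F"
  obtains \<delta> where "0 < \<delta>" "\<delta> < 1/4" "\<And>s. s \<ge> 0 \<Longrightarrow> \<bar>s - 1\<bar> \<le> 2 * \<delta> \<Longrightarrow> (s - 1)\<^sup>2 / 4 \<le> \<bar>Vpot F (s\<^sup>2)\<bar>"
proof -
  from assms obtain d0 F' where d0: "d0 > 0" "\<forall>s\<in>{1-d0<..<1+d0}. (F has_real_derivative F' s) (at s)" "F' 1 = -1"
    and F: "continuous_on {0..} F" and F1: "F 1 = 0" unfolding A1_def by auto
  have "(F has_real_derivative -1) (at 1)" using bspec[OF d0(2), of 1] d0(1,3) by simp
  then have "((\<lambda>h. (F (1 + h) - F 1) / h) \<longlongrightarrow> -1) (at 0)" by (simp add: DERIV_def)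
  then have "\<forall>\<^sub>F h in at 0. dist ((F (1 + h) - F 1) / h) (-1) < 1/2" by (rule tendstoD) simp
  then obtain d where d: "d > 0" and d': "\<And>h. h \<noteq> 0 \<Longrightarrow> \<bar>h\<bar> < d \<Longrightarrow> \<bar>F (1 + h) / h + 1\<bar> < 1/2"
    unfolding eventually_at by (auto simp: F1 dist_norm)
  have neg: "F t / (t - 1) \<le> - 1/2" if "t \<noteq> 1" "\<bar>t - 1\<bar> < d" for t
  proof -
    have "z \<le> - 1/2" if "\<bar>z + 1\<bar> < 1/2" for z :: real using that by linarith
    from this[OF d'[of "t - 1"]] show ?thesis using that by simp
  qed
  have up: "F t \<le> - (t - 1) / 2" if "1 \<le> t" "t - 1 < d" for t
  proof (cases "t = 1")
    case False
    then have "F t / (t - 1) \<le> - 1/2" using neg[of t] that by simp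
    then have "F t \<le> - 1/2 * (t - 1)" using False that by (subst (asm) pos_divide_le_eq) auto
    then show ?thesis by linarith
  qed (simp add: F1)
  have lo: "F t \<ge> (1 - t) / 2" if "t \<le> 1" "1 - t < d" for t
  proof (cases "t = 1")
    case False
    then have "F t / (t - 1) \<le> - 1/2" using neg[of t] that by simp
    then have "- 1/2 * (t - 1) \<le> F t" using False that by (subst (asm) neg_divide_le_eq) auto
    moreover have "(1 - t) / 2 = - 1/2 * (t - 1)" by (simp add: field_simps)
    ultimately show ?thesis by (simp only:)
  qed (simp add: F1)
  have iF: "F integrable_on {a..b}" if "a \<ge> 0" for a b
    using F that by (intro integrable_continuous_real) (auto intro: continuous_on_subset)
  have V: "(\<sigma> - 1)\<^sup>2 / 4 \<le> \<bar>Vpot F \<sigma>\<bar>" if \<sigma>: "\<sigma> \<ge> 0" "\<bar>\<sigma> - 1\<bar> < d" for \<sigma>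
  proof (cases "\<sigma> \<le> 1")
    case True
    have "((\<lambda>t. (1 - t) / 2) has_integral (- (1 - 1)\<^sup>2 / 4 - (- (1 - \<sigma>)\<^sup>2 / 4))) {\<sigma>..1}"
      using True by (intro fundamental_theorem_of_calculus)
        (auto intro!: derivative_eq_intros simp: has_real_derivative_iff_has_vector_derivative[symmetric] field_simps)
    then have "((\<lambda>t. (1 - t) / 2) has_integral (1 - \<sigma>)\<^sup>2 / 4) {\<sigma>..1}" by simp
    moreover have "(F has_integral (integral {\<sigma>..1} F)) {\<sigma>..1}" using iF[OF \<sigma>(1)] by (rule integrable_integral)
    ultimately have "(1 - \<sigma>)\<^sup>2 / 4 \<le> integral {\<sigma>..1} F" by (rule has_integral_le) (use lo \<sigma> in auto)
    then show ?thesis using Vpot_below[OF F \<sigma>(1) True] by (simp add: power2_commute)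
  next
    case False
    have "((\<lambda>t. (t - 1) / 2) has_integral ((\<sigma> - 1)\<^sup>2 / 4 - (1 - 1)\<^sup>2 / 4)) {1..\<sigma>}"
      using False by (intro fundamental_theorem_of_calculus)
        (auto intro!: derivative_eq_intros simp: has_real_derivative_iff_has_vector_derivative[symmetric] field_simps)
    then have "((\<lambda>t. (t - 1) / 2) has_integral (\<sigma> - 1)\<^sup>2 / 4) {1..\<sigma>}" by simp
    moreover have "((\<lambda>t. - F t) has_integral (- integral {1..\<sigma>} F)) {1..\<sigma>}"
      using iF[of 1 \<sigma>] by (intro has_integral_neg integrable_integral) auto
    ultimately have "(\<sigma> - 1)\<^sup>2 / 4 \<le> - integral {1..\<sigma>} F" by (rule has_integral_le) (use up \<sigma> in force)
    then show ?thesis using Vpot_above[OF F, of \<sigma>] False by simp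
  qed
  show ?thesis
  \<comment> \<open>Within \<open>2 * \<delta>\<close> of 1 the bound 1/5 gives
    \<open>s + 1 \<le> 3\<close>, and then \<open>d / 7\<close> gives
    \<open>\<bar>s^2 - 1\<bar> \<le> 6 * d / 7 < d\<close>.\<close>
  proof (rule that[of "min (1/5) (d / 7)"])
    fix s :: real assume s: "s \<ge> 0" "\<bar>s - 1\<bar> \<le> 2 * min (1/5) (d / 7)"
    have eq: "s\<^sup>2 - 1 = (s - 1) * (s + 1)" by (simp add: power2_eq_square algebra_simps)
    have "\<bar>s\<^sup>2 - 1\<bar> = \<bar>s - 1\<bar> * (s + 1)" unfolding eq abs_mult using s by simp
    also have "\<dots> \<le> (2 * (d / 7)) * 3"
    proof (rule mult_mono)
      show "\<bar>s - 1\<bar> \<le> 2 * (d / 7)" using s(2) min.cobounded2[of "1/5" "d / 7"] by linarith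
      show "s + 1 \<le> 3" using s(2) min.cobounded1[of "1/5" "d / 7"] by linarith
    qed (use s d in auto)
    also have "\<dots> < d" using d by simp
    finally have "(s\<^sup>2 - 1)\<^sup>2 / 4 \<le> \<bar>Vpot F (s\<^sup>2)\<bar>" by (intro V) auto
    moreover have "(s - 1)\<^sup>2 * 1 \<le> (s - 1)\<^sup>2 * (s + 1)\<^sup>2" using s one_le_power[of "s + 1" 2] by (intro mult_left_mono) auto
    then have "(s - 1)\<^sup>2 \<le> (s\<^sup>2 - 1)\<^sup>2" unfolding eq power_mult_distrib by simp
    ultimately show "(s - 1)\<^sup>2 / 4 \<le> \<bar>Vpot F (s\<^sup>2)\<bar>" by linarith
  qed (use d in auto)
qed

section \<open>Decomposition of the momentum density\<close>

lemma weak_partial_add: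
  assumes "weak_partial u b g" "weak_partial u' b g'"
  shows "weak_partial (\<lambda>x. u x + u' x) b (\<lambda>x. g x + g' x)"
  unfolding weak_partial_def
proof (intro conjI allI impI)
  have l: "loc_int u" "loc_int g" "loc_int u'" "loc_int g'" using assms unfolding weak_partial_def by auto
  show "loc_int (\<lambda>x. u x + u' x)" "loc_int (\<lambda>x. g x + g' x)" by (auto intro: loc_int_add l)
  fix p :: "'a \<Rightarrow> real" assume p: "test_function p"
  show "(\<integral>x. frechet_derivative p (at x) b *\<^sub>R (u x + u' x) \<partial>lborel) = - (\<integral>x. p x *\<^sub>R (g x + g' x) \<partial>lborel)"
    using assms p loc_int_integrable_test[OF l(1) test_function_frechet_derivative[OF p], of b]
      loc_int_integrable_test[OF l(3) test_function_frechet_derivative[OF p], of b]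
      loc_int_integrable_test[OF l(2) p] loc_int_integrable_test[OF l(4) p]
    unfolding weak_partial_def by (simp add: scaleR_add_right)
qed

lemma weak_partial_diff:
  assumes "weak_partial u b g" "weak_partial u' b g'"
  shows "weak_partial (\<lambda>x. u x - u' x) b (\<lambda>x. g x - g' x)"
  using weak_partial_add[OF assms(1) weak_partial_bounded_linear[OF bounded_linear_minus[OF bounded_linear_ident] assms(2)]] by simp

lemma weak_partial_mult_smooth:
  fixes u :: "'a::euclidean_space \<Rightarrow> real"
  assumes w: "weak_partial u b g" and s: "smooth s"
  shows "weak_partial (\<lambda>x. s x * u x) b (\<lambda>x. s x * g x + frechet_derivative s (at x) b * u x)"
  unfolding weak_partial_def
proof (intro conjI allI impI)
  have l: "loc_int u" "loc_int g" using w unfolding weak_partial_def by auto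
  have c: "continuous_on UNIV s" "continuous_on UNIV (\<lambda>x. frechet_derivative s (at x) b)"
    by (intro smooth_continuous_on s smooth_frechet_derivative)+
  show "loc_int (\<lambda>x. s x * u x)" using loc_int_scaleR_continuous[OF l(1) c(1)] by simp
  have l1: "loc_int (\<lambda>x. s x * g x)" using loc_int_scaleR_continuous[OF l(2) c(1)] by simp
  have l2: "loc_int (\<lambda>x. frechet_derivative s (at x) b * u x)" using loc_int_scaleR_continuous[OF l(1) c(2)] by simp
  show "loc_int (\<lambda>x. s x * g x + frechet_derivative s (at x) b * u x)" by (rule loc_int_add[OF l1 l2])
  fix p :: "'a \<Rightarrow> real" assume p: "test_function p"
  have ps: "test_function (\<lambda>x. p x * s x)" by (rule test_function_mult_smooth[OF p s])
  have e: "frechet_derivative (\<lambda>x. p x * s x) (at x) b = p x * frechet_derivative s (at x) b + frechet_derivative p (at x) b * s x" for x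
    by (rule frechet_derivative_mult_smooth[OF test_function_smooth[OF p] s])
  have "(\<integral>x. frechet_derivative (\<lambda>x. p x * s x) (at x) b * u x \<partial>lborel) = - (\<integral>x. (p x * s x) * g x \<partial>lborel)"
    using w ps unfolding weak_partial_def by simp
  moreover have "(\<integral>x. frechet_derivative (\<lambda>x. p x * s x) (at x) b * u x \<partial>lborel)
     = (\<integral>x. p x * (frechet_derivative s (at x) b * u x) + frechet_derivative p (at x) b * (s x * u x) \<partial>lborel)"
    unfolding e by (intro Bochner_Integration.integral_cong) (auto simp: algebra_simps)
  moreover have i1: "integrable lborel (\<lambda>x. p x * (frechet_derivative s (at x) b * u x))"
    using loc_int_integrable_test[OF l2 p] by simp
  moreover have i2: "integrable lborel (\<lambda>x. frechet_derivative p (at x) b * (s x * u x))"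
    using loc_int_integrable_test[OF loc_int_scaleR_continuous[OF l(1) c(1)] test_function_frechet_derivative[OF p]] by simp
  moreover have i3: "integrable lborel (\<lambda>x. (p x * s x) * g x)"
    using loc_int_integrable_test[OF l(2) ps] by simp
  ultimately show "(\<integral>x. frechet_derivative p (at x) b *\<^sub>R (s x * u x) \<partial>lborel) = - (\<integral>x. p x *\<^sub>R (s x * g x + frechet_derivative s (at x) b * u x) \<partial>lborel)"
    by (simp add: distrib_left mult.assoc)
qed

lemma nn_integral_ennreal_finite_integrable:
  fixes f :: "'a \<Rightarrow> real"
  assumes "f \<in> borel_measurable M" "\<And>x. 0 \<le> f x" "(\<integral>\<^sup>+x. ennreal (f x) \<partial>M) \<le> ennreal C" "0 \<le> C"
  shows "integrable M f" "(\<integral>x. f x \<partial>M) \<le> C"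
proof -
  show i: "integrable M f"
    using assms by (intro integrableI_bounded) (auto intro: order_le_less_trans)
  have "ennreal (\<integral>x. f x \<partial>M) = (\<integral>\<^sup>+x. ennreal (f x) \<partial>M)"
    using nn_integral_eq_integral[OF i] assms(2) by simp
  then have "ennreal (\<integral>x. f x \<partial>M) \<le> ennreal C" using assms(3) by simp
  then show "(\<integral>x. f x \<partial>M) \<le> C" using assms(4) by simp
qed

text \<open>\<open>E\<close> is any real bound for the energy, so that it can be fixed before
  \<open>\<psi>\<close>. The condition \<open>h \<ge> 1\<close> lets terms with lower powers of
  \<open>h\<close> be absorbed: \<open>E / h\<close> into \<open>h * E\<close>, and the local
  potential energy into \<open>h^2\<close> times the local energy.\<close>

locale mollified =
  fixes F \<phi> :: "real \<Rightarrow> real" and \<psi> :: "'a::euclidean_space \<Rightarrow> complex" and G :: "'a \<Rightarrow> 'a \<Rightarrow> complex"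
    and k :: "'a \<Rightarrow> real" and h M E :: real
  assumes inE: "in_E \<phi> \<psi> G" and mol: "mollifier h M k" and h: "h \<ge> 1"
    and en: "energy F \<psi> G \<le> ennreal E" and E: "E \<ge> 0" and F: "continuous_on {0..} F"
begin

definition f :: "'a \<Rightarrow> complex" where "f = mollify k \<psi>"
definition f' :: "'a \<Rightarrow> 'a \<Rightarrow> complex" where "f' b = mollify k (G b)"
definition r :: "'a \<Rightarrow> complex" where "r x = \<psi> x - f x"
definition gsq :: "'a \<Rightarrow> real" where "gsq x = (\<Sum>b\<in>Basis. (cmod (G b x))\<^sup>2)"
definition V :: "'a \<Rightarrow> real" where "V x = \<bar>Vpot F ((cmod (\<psi> x))\<^sup>2)\<bar>"

lemma wp: "b \<in> Basis \<Longrightarrow> weak_partial \<psi> b (G b)"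
  using inE unfolding in_E_def grad_L2_def by blast

lemma loc_psi: "loc_int \<psi>" using inE unfolding in_E_def by blast

lemma loc_G: "b \<in> Basis \<Longrightarrow> loc_int (G b)"
  using wp unfolding weak_partial_def by blast

lemma psi_measurable [measurable]: "\<psi> \<in> borel_measurable borel" by (rule loc_int_measurable[OF loc_psi])
lemma G_measurable [measurable]: "b \<in> Basis \<Longrightarrow> G b \<in> borel_measurable borel" by (rule loc_int_measurable[OF loc_G])
lemma gsq_measurable [measurable]: "gsq \<in> borel_measurable borel" unfolding gsq_def[abs_def] by measurable
lemma V_measurable [measurable]: "V \<in> borel_measurable borel"
  unfolding V_def[abs_def] using measurable_compose[OF _ Vpot_measurable[OF F], of "\<lambda>x. cmod (\<psi> x)" borel] by measurable

lemma gsq_nonneg: "gsq x \<ge> 0" unfolding gsq_def by (intro sum_nonneg) auto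
lemma V_nonneg: "V x \<ge> 0" unfolding V_def by simp

lemma gsq_energy: "(\<integral>\<^sup>+x. ennreal (gsq x) \<partial>lborel) \<le> ennreal E"
  and V_energy: "(\<integral>\<^sup>+x. ennreal (V x) \<partial>lborel) \<le> ennreal E"
proof -
  have "(\<integral>\<^sup>+x. ennreal (gsq x) \<partial>lborel) \<le> energy F \<psi> G"
    unfolding energy_def gsq_def by (rule add_increasing2[OF zero_le order_refl])
  then show "(\<integral>\<^sup>+x. ennreal (gsq x) \<partial>lborel) \<le> ennreal E" using en by (rule order_trans)
  have "(\<integral>\<^sup>+x. ennreal (V x) \<partial>lborel) \<le> energy F \<psi> G"
    unfolding energy_def V_def by (rule add_increasing[OF zero_le order_refl])
  then show "(\<integral>\<^sup>+x. ennreal (V x) \<partial>lborel) \<le> ennreal E" using en by (rule order_trans)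
qed

lemma gsq_integrable: "integrable lborel gsq" "(\<integral>x. gsq x \<partial>lborel) \<le> E"
  using nn_integral_ennreal_finite_integrable[OF _ gsq_nonneg gsq_energy E] by auto

lemma V_integrable: "integrable lborel V" "(\<integral>x. V x \<partial>lborel) \<le> E"
  using nn_integral_ennreal_finite_integrable[OF _ V_nonneg V_energy E] by auto

lemma test_k: "test_function k" using mol unfolding mollifier_def by blast

lemma Re_f: "Re (f x) = mollify k (\<lambda>x. Re (\<psi> x)) x" and Im_f: "Im (f x) = mollify k (\<lambda>x. Im (\<psi> x)) x"
proof -
  have i: "integrable lborel (\<lambda>y. k (x - y) *\<^sub>R \<psi> y)" by (rule mollify_integrable[OF loc_psi test_k])
  show "Re (f x) = mollify k (\<lambda>x. Re (\<psi> x)) x" "Im (f x) = mollify k (\<lambda>x. Im (\<psi> x)) x"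
    unfolding f_def mollify_def
    using integral_bounded_linear[OF bounded_linear_Re i] integral_bounded_linear[OF bounded_linear_Im i] by simp_all
qed

lemma smooth_Re_f: "smooth (\<lambda>x. Re (f x))" and smooth_Im_f: "smooth (\<lambda>x. Im (f x))"
proof -
  show "smooth (\<lambda>x. Re (f x))"
    unfolding Re_f by (rule mollify_smooth[OF loc_int_bounded_linear[OF bounded_linear_Re loc_psi] test_k])
  show "smooth (\<lambda>x. Im (f x))"
    unfolding Im_f by (rule mollify_smooth[OF loc_int_bounded_linear[OF bounded_linear_Im loc_psi] test_k])
qed

lemma f_has_derivative: "(f has_derivative (\<lambda>v. \<Sum>b\<in>Basis. (v \<bullet> b) *\<^sub>R f' b x)) (at x)"
proof -
  define D where "D v = mollify (\<lambda>z. frechet_derivative k (at z) v) \<psi> x" for v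
  have d: "(f has_derivative D) (at x)" unfolding f_def D_def by (rule mollify_has_derivative[OF loc_psi test_k])
  have lin: "linear D" by (rule has_derivative_linear[OF d])
  have "D v = (\<Sum>b\<in>Basis. (v \<bullet> b) *\<^sub>R f' b x)" for v
  proof -
    have "D v = D (\<Sum>b\<in>Basis. (v \<bullet> b) *\<^sub>R b)" by (simp add: euclidean_representation)
    also have "\<dots> = (\<Sum>b\<in>Basis. (v \<bullet> b) *\<^sub>R D b)"
      by (simp add: linear_sum[OF lin] linear_scale[OF lin])
    also have "\<dots> = (\<Sum>b\<in>Basis. (v \<bullet> b) *\<^sub>R f' b x)"
      by (intro sum.cong refl) (simp add: D_def f'_def mollify_weak_partial[OF wp test_k])
    finally show ?thesis .
  qed
  then have "D = (\<lambda>v. \<Sum>b\<in>Basis. (v \<bullet> b) *\<^sub>R f' b x)" by (rule ext)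
  with d show ?thesis by simp
qed

lemma f_derivative_Basis: "b \<in> Basis \<Longrightarrow> (\<Sum>b'\<in>Basis. (b \<bullet> b') *\<^sub>R f' b' x) = f' b x"
proof -
  assume b: "b \<in> Basis"
  have "(\<Sum>b'\<in>Basis. (b \<bullet> b') *\<^sub>R f' b' x) = (\<Sum>b'\<in>Basis. if b' = b then f' b x else 0)"
    using b by (intro sum.cong refl) (auto simp: inner_Basis)
  then show ?thesis using b by simp
qed

lemma continuous_f: "continuous_on A f"
  using f_has_derivative by (meson continuous_at_imp_continuous_on has_derivative_continuous)

lemma f_measurable [measurable]: "f \<in> borel_measurable borel"
  by (rule borel_measurable_continuous_onI[OF continuous_f])

lemma continuous_f': "b \<in> Basis \<Longrightarrow> continuous_on A (f' b)"
  unfolding f'_def using mollify_has_derivative[OF loc_G test_k]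
  by (meson continuous_at_imp_continuous_on has_derivative_continuous)

lemma f'_measurable [measurable]: "b \<in> Basis \<Longrightarrow> f' b \<in> borel_measurable borel"
  by (rule borel_measurable_continuous_onI[OF continuous_f'])

lemma r_measurable [measurable]: "r \<in> borel_measurable borel"
  unfolding r_def[abs_def] by measurable

lemma frechet_Re_f: "b \<in> Basis \<Longrightarrow> frechet_derivative (\<lambda>x. Re (f x)) (at x) b = Re (f' b x)"
  and frechet_Im_f: "b \<in> Basis \<Longrightarrow> frechet_derivative (\<lambda>x. Im (f x)) (at x) b = Im (f' b x)"
  using fun_cong[OF frechet_derivative_at[OF bounded_linear.has_derivative[OF bounded_linear_Re f_has_derivative]], of b x]
    fun_cong[OF frechet_derivative_at[OF bounded_linear.has_derivative[OF bounded_linear_Im f_has_derivative]], of b x]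
  by (simp_all add: f_derivative_Basis)

lemma G_sq_le_gsq: "b \<in> Basis \<Longrightarrow> (cmod (G b x))\<^sup>2 \<le> gsq x"
  unfolding gsq_def by (intro member_le_sum) auto

lemma f'_L2: "b \<in> Basis \<Longrightarrow> (\<integral>\<^sup>+x. ennreal ((cmod (f' b x))\<^sup>2) \<partial>lborel) \<le> ennreal E"
proof -
  assume b: "b \<in> Basis"
  have "(\<integral>\<^sup>+x. ennreal ((cmod (f' b x))\<^sup>2) \<partial>lborel) \<le> (\<integral>\<^sup>+x. ennreal ((cmod (G b x))\<^sup>2) \<partial>lborel)"
    unfolding f'_def by (rule mollify_L2_bound[OF mol G_measurable[OF b]])
  also have "\<dots> \<le> (\<integral>\<^sup>+x. ennreal (gsq x) \<partial>lborel)" by (intro nn_integral_mono ennreal_leI G_sq_le_gsq b)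
  also note gsq_energy
  finally show ?thesis .
qed

lemma f'_L2_integral:
  assumes b: "b \<in> Basis" shows "integrable lborel (\<lambda>x. (cmod (f' b x))\<^sup>2)" "(\<integral>x. (cmod (f' b x))\<^sup>2 \<partial>lborel) \<le> E"
  using nn_integral_ennreal_finite_integrable[OF _ _ f'_L2[OF b] E] f'_measurable[OF b] by auto

lemma f'_local: "b \<in> Basis \<Longrightarrow> ennreal ((cmod (f' b x))\<^sup>2) \<le> ennreal M * (\<integral>\<^sup>+y. indicator (cball x h) y * ennreal (gsq y) \<partial>lborel)"
proof -
  assume b: "b \<in> Basis"
  have "ennreal ((cmod (f' b x))\<^sup>2) \<le> ennreal M * (\<integral>\<^sup>+y. indicator (cball x h) y * ennreal ((cmod (G b y))\<^sup>2) \<partial>lborel)"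
    unfolding f'_def by (rule mollify_local_bound[OF mol G_measurable[OF b]])
  also have "\<dots> \<le> ennreal M * (\<integral>\<^sup>+y. indicator (cball x h) y * ennreal (gsq y) \<partial>lborel)"
    by (intro mult_left_mono nn_integral_mono ennreal_leI G_sq_le_gsq b) auto
  finally show ?thesis .
qed

lemma r_local:
  assumes [measurable]: "S \<in> sets borel" "S' \<in> sets borel" and SS: "\<And>x z. x \<in> S \<Longrightarrow> norm z \<le> h \<Longrightarrow> x + z \<in> S'"
  shows "(\<integral>\<^sup>+x. indicator S x * ennreal ((cmod (r x))\<^sup>2) \<partial>lborel) \<le> ennreal (h\<^sup>2) * (\<integral>\<^sup>+x. indicator S' x * ennreal (gsq x) \<partial>lborel)"
proof -
  have h0: "h > 0" using h by simp
  have wRe: "weak_partial (\<lambda>x. Re (\<psi> x)) b (\<lambda>x. Re (G b x))" and wIm: "weak_partial (\<lambda>x. Im (\<psi> x)) b (\<lambda>x. Im (G b x))" if "b \<in> Basis" for b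
    using weak_partial_bounded_linear[OF bounded_linear_Re wp[OF that]] weak_partial_bounded_linear[OF bounded_linear_Im wp[OF that]] by auto
  let ?A = "\<lambda>x. ennreal (\<Sum>b\<in>Basis. (Re (G b x))\<^sup>2)" and ?B = "\<lambda>x. ennreal (\<Sum>b\<in>Basis. (Im (G b x))\<^sup>2)"
  have AB: "ennreal (gsq x) = ?A x + ?B x" for x
    unfolding gsq_def cmod_power2 sum.distrib by (rule ennreal_plus) (auto intro!: sum_nonneg)
  have R: "ennreal ((cmod (r x))\<^sup>2) = ennreal ((Re (\<psi> x) - mollify k (\<lambda>x. Re (\<psi> x)) x)\<^sup>2) + ennreal ((Im (\<psi> x) - mollify k (\<lambda>x. Im (\<psi> x)) x)\<^sup>2)" for x
    unfolding cmod_power2 r_def by (simp add: Re_f Im_f)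
  have [measurable]: "mollify k (\<lambda>x. Re (\<psi> x)) \<in> borel_measurable borel" "mollify k (\<lambda>x. Im (\<psi> x)) \<in> borel_measurable borel"
    using smooth_Re_f smooth_Im_f unfolding Re_f Im_f by (auto intro!: borel_measurable_continuous_onI smooth_continuous_on)
  have "(\<integral>\<^sup>+x. indicator S x * ennreal ((cmod (r x))\<^sup>2) \<partial>lborel)
    = (\<integral>\<^sup>+x. indicator S x * ennreal ((Re (\<psi> x) - mollify k (\<lambda>x. Re (\<psi> x)) x)\<^sup>2) \<partial>lborel) + (\<integral>\<^sup>+x. indicator S x * ennreal ((Im (\<psi> x) - mollify k (\<lambda>x. Im (\<psi> x)) x)\<^sup>2) \<partial>lborel)"
    unfolding R distrib_left by (rule nn_integral_add) measurable
  also have "\<dots> \<le> ennreal (h\<^sup>2) * (\<integral>\<^sup>+x. indicator S' x * ?A x \<partial>lborel) + ennreal (h\<^sup>2) * (\<integral>\<^sup>+x. indicator S' x * ?B x \<partial>lborel)"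
    by (intro add_mono mollify_error[OF mol wRe h0 assms(1,2) SS] mollify_error[OF mol wIm h0 assms(1,2) SS])
  also have "\<dots> = ennreal (h\<^sup>2) * (\<integral>\<^sup>+x. indicator S' x * ennreal (gsq x) \<partial>lborel)"
    unfolding AB distrib_left by (subst nn_integral_add) (auto simp: distrib_left)
  finally show ?thesis .
qed

lemma r_L2: "integrable lborel (\<lambda>x. (cmod (r x))\<^sup>2)" "(\<integral>x. (cmod (r x))\<^sup>2 \<partial>lborel) \<le> h\<^sup>2 * E"
proof -
  have "(\<integral>\<^sup>+x. ennreal ((cmod (r x))\<^sup>2) \<partial>lborel) \<le> ennreal (h\<^sup>2) * (\<integral>\<^sup>+x. ennreal (gsq x) \<partial>lborel)"
    using r_local[of UNIV UNIV] by simp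
  also have "\<dots> \<le> ennreal (h\<^sup>2) * ennreal E" by (intro mult_left_mono gsq_energy) simp
  also have "\<dots> = ennreal (h\<^sup>2 * E)" using E by (simp add: ennreal_mult')
  finally have "(\<integral>\<^sup>+x. ennreal ((cmod (r x))\<^sup>2) \<partial>lborel) \<le> ennreal (h\<^sup>2 * E)" .
  from nn_integral_ennreal_finite_integrable[OF _ _ this] E
  show "integrable lborel (\<lambda>x. (cmod (r x))\<^sup>2)" "(\<integral>x. (cmod (r x))\<^sup>2 \<partial>lborel) \<le> h\<^sup>2 * E" by auto
qed

end

context mollified
begin

text \<open>Outside an exceptional set \<open>B\<close> the mollified function has modulus close to $1$ and phase \<open>\<theta>\<close>.
  Writing $\psi = f + r$, the momentum density of $\psi$ is the sum of
  $\partial_1(\langle i r, f\rangle - \theta)$ and of terms that are integrable with the stated bound.\<close>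
lemma momentum_bound:
  fixes \<theta> :: "'a \<Rightarrow> real"
  assumes N2: "DIM('a) \<ge> 2"
    and B[measurable]: "B \<in> sets borel" and Bfin: "emeasure lborel B < \<infinity>"
    and d\<theta>: "\<And>x. (\<theta> has_derivative \<theta>' x) (at x)"
    and \<theta>B: "\<And>b x. b \<in> Basis \<Longrightarrow> x \<in> B \<Longrightarrow> \<bar>\<theta>' x b\<bar> \<le> C\<theta>"
    and near: "\<And>x. x \<notin> B \<Longrightarrow> \<bar>cmod (f x) - 1\<bar> \<le> 1/2"
    and \<theta>out: "\<And>b x. b \<in> Basis \<Longrightarrow> x \<notin> B \<Longrightarrow> \<theta>' x b = Im (f' b x / f x)"
    and fB: "\<And>x. x \<in> B \<Longrightarrow> cmod (f x) \<le> Cf"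
    and D: "(\<integral>\<^sup>+x. indicator (- B) x * ennreal ((cmod (f x) - 1)\<^sup>2) \<partial>lborel) \<le> ennreal D" "D \<ge> 0"
    and L: "\<And>b x. b \<in> Basis \<Longrightarrow> cmod (f' b x) \<le> L"
    and C0: "C\<theta> \<ge> 0" "Cf \<ge> 0"
  shows "\<bar>Qmom \<psi> G\<bar> \<le> 5 * h * E + 3 * D / h + (Cf * L + C\<theta>) * measure lborel B"
proof -
  let ?e = "e1::'a"
  have eB: "?e \<in> Basis" by (rule e1_Basis)
  have h0: "h > 0" using h by simp
  have L0: "L \<ge> 0" using L[OF eB, of 0] norm_ge_zero order_trans by blast
  have fpos: "cmod (f x) \<ge> 1/2" "cmod (f x) \<le> 3/2" if "x \<notin> B" for x
    using abs_le_D1[OF near[OF that]] abs_le_D2[OF near[OF that]] by auto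
  have \<theta>b: "\<bar>\<theta>' x b\<bar> \<le> 2 * cmod (f' b x)" if "b \<in> Basis" "x \<notin> B" for b x
  proof -
    have "\<bar>\<theta>' x b\<bar> \<le> cmod (f' b x / f x)" unfolding \<theta>out[OF that] by (rule abs_Im_le_cmod)
    also have "\<dots> \<le> cmod (f' b x) / (1/2)" unfolding norm_divide using fpos[OF that(2)] by (intro divide_left_mono) auto
    finally show ?thesis by simp
  qed
  have \<theta>all: "\<bar>\<theta>' x b\<bar> \<le> C\<theta> + 2 * L" if "b \<in> Basis" for b x
    using \<theta>b[OF that, of x] \<theta>B[OF that, of x] L[OF that, of x] L0 C0 by (cases "x \<in> B") auto
  have \<theta>m[measurable]: "(\<lambda>x. \<theta>' x b) \<in> borel_measurable borel" for b
    by (rule measurable_directional_derivative[OF d\<theta>])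
  have fall: "cmod (f x) \<le> 3/2 + Cf" for x using fpos(2)[of x] fB[of x] C0 by (cases "x \<in> B") auto
  define R where "R b x = G b x - f' b x" for b x
  have wr: "weak_partial r b (R b)" if b: "b \<in> Basis" for b
  proof -
    have "weak_partial f b (\<lambda>x. \<Sum>b'\<in>Basis. (b \<bullet> b') *\<^sub>R f' b' x)"
      by (rule weak_partial_differentiable[OF f_has_derivative]) (use L[OF b] in \<open>auto simp: f_derivative_Basis[OF b]\<close>)
    then have "weak_partial f b (f' b)" by (simp add: f_derivative_Basis[OF b])
    from weak_partial_diff[OF wp[OF b] this] show ?thesis unfolding r_def[abs_def] R_def[abs_def] .
  qed
  \<comment> \<open>The bracket is \<open>Re (\<i> * r x * cnj (f x))\<close> written in
    coordinates, so that the weak product rule for real functions applies.\<close>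
  define \<Phi> where "\<Phi> x = (Im (f x) * Re (r x) - Re (f x) * Im (r x)) - \<theta> x" for x
  define H where "H b x = ((Im (f x) * Re (R b x) + Im (f' b x) * Re (r x)) - (Re (f x) * Im (R b x) + Re (f' b x) * Im (r x))) - \<theta>' x b" for b x
  have grad: "grad_L2 \<Phi> H"
    unfolding grad_L2_def
  proof (intro ballI conjI)
    fix b :: 'a assume b: "b \<in> Basis"
    have 1: "weak_partial (\<lambda>x. Im (f x) * Re (r x)) b (\<lambda>x. Im (f x) * Re (R b x) + Im (f' b x) * Re (r x))"
      using weak_partial_mult_smooth[OF weak_partial_bounded_linear[OF bounded_linear_Re wr[OF b]] smooth_Im_f] by (simp add: frechet_Im_f[OF b])
    have 2: "weak_partial (\<lambda>x. Re (f x) * Im (r x)) b (\<lambda>x. Re (f x) * Im (R b x) + Re (f' b x) * Im (r x))"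
      using weak_partial_mult_smooth[OF weak_partial_bounded_linear[OF bounded_linear_Im wr[OF b]] smooth_Re_f] by (simp add: frechet_Re_f[OF b])
    have 3: "weak_partial \<theta> b (\<lambda>x. \<theta>' x b)"
      by (rule weak_partial_differentiable[OF d\<theta>]) (use \<theta>all[OF b] in auto)
    show "weak_partial \<Phi> b (H b)"
      unfolding \<Phi>_def[abs_def] H_def[abs_def] by (rule weak_partial_diff[OF weak_partial_diff[OF 1 2] 3])
    have [measurable]: "G b \<in> borel_measurable borel" "f' b \<in> borel_measurable borel" using b by auto
    have iB: "integrable lborel (indicat_real B)" using Bfin by (intro integrable_real_indicator) auto
    let ?g = "\<lambda>x. 3 * ((4 * (3/2 + Cf)\<^sup>2) * (2 * gsq x + 2 * (cmod (f' b x))\<^sup>2) + 4 * L\<^sup>2 * (cmod (r x))\<^sup>2 + (4 * (cmod (f' b x))\<^sup>2 + C\<theta>\<^sup>2 * indicat_real B x))"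
    have ig: "integrable lborel ?g"
      by (intro integrable_mult_right Bochner_Integration.integrable_add gsq_integrable f'_L2_integral[OF b] r_L2 iB)
    show "integrable lborel (\<lambda>x. (norm (H b x))\<^sup>2)"
    proof (rule Bochner_Integration.integrable_bound[OF ig])
      show "(\<lambda>x. (norm (H b x))\<^sup>2) \<in> borel_measurable lborel" unfolding H_def R_def by measurable
      show "AE x in lborel. norm ((norm (H b x))\<^sup>2) \<le> norm (?g x)"
      proof (rule AE_I2)
        fix x
        have a1: "\<bar>Im (f x) * Re (R b x) - Re (f x) * Im (R b x)\<bar> \<le> 2 * ((3/2 + Cf) * cmod (R b x))"
        proof -
          have "\<bar>Im (f x) * Re (R b x)\<bar> \<le> (3/2 + Cf) * cmod (R b x)" "\<bar>Re (f x) * Im (R b x)\<bar> \<le> (3/2 + Cf) * cmod (R b x)"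
            unfolding abs_mult using C0 by (intro mult_mono order_trans[OF abs_Im_le_cmod fall] order_trans[OF abs_Re_le_cmod fall] abs_Re_le_cmod abs_Im_le_cmod; simp)+
          then show ?thesis by linarith
        qed
        have a2: "\<bar>Im (f' b x) * Re (r x) - Re (f' b x) * Im (r x)\<bar> \<le> 2 * (L * cmod (r x))"
        proof -
          have "\<bar>Im (f' b x) * Re (r x)\<bar> \<le> L * cmod (r x)" "\<bar>Re (f' b x) * Im (r x)\<bar> \<le> L * cmod (r x)"
            unfolding abs_mult using L0 by (intro mult_mono order_trans[OF abs_Im_le_cmod L[OF b]] order_trans[OF abs_Re_le_cmod L[OF b]] abs_Re_le_cmod abs_Im_le_cmod; simp)+
          then show ?thesis by linarith
        qed
        have "\<bar>H b x\<bar> \<le> \<bar>Im (f x) * Re (R b x) - Re (f x) * Im (R b x)\<bar> + \<bar>Im (f' b x) * Re (r x) - Re (f' b x) * Im (r x)\<bar> + \<bar>\<theta>' x b\<bar>"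
          unfolding H_def by linarith
        also have "\<dots> \<le> 2 * ((3/2 + Cf) * cmod (R b x)) + 2 * (L * cmod (r x)) + \<bar>\<theta>' x b\<bar>" using a1 a2 by linarith
        finally have "(H b x)\<^sup>2 \<le> (2 * ((3/2 + Cf) * cmod (R b x)) + 2 * (L * cmod (r x)) + \<bar>\<theta>' x b\<bar>)\<^sup>2"
          by (metis abs_ge_zero power2_abs power_mono)
        also have "\<dots> \<le> 3 * ((2 * ((3/2 + Cf) * cmod (R b x)))\<^sup>2 + (2 * (L * cmod (r x)))\<^sup>2 + (\<theta>' x b)\<^sup>2)"
        proof -
          have "(a + b + c)\<^sup>2 \<le> 3 * (a\<^sup>2 + b\<^sup>2 + c\<^sup>2)" for a b c :: real
            using sum_squares_bound[of a b] sum_squares_bound[of a c] sum_squares_bound[of b c]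
            by (simp add: power2_eq_square algebra_simps)
          from this[of "2 * ((3/2 + Cf) * cmod (R b x))" "2 * (L * cmod (r x))" "\<bar>\<theta>' x b\<bar>"] show ?thesis by simp
        qed
        also have "\<dots> \<le> ?g x"
        proof -
          have "(cmod (R b x))\<^sup>2 \<le> 2 * (cmod (G b x))\<^sup>2 + 2 * (cmod (f' b x))\<^sup>2"
          proof -
            have "cmod (R b x) \<le> cmod (G b x) + cmod (f' b x)" unfolding R_def by (rule norm_triangle_ineq4)
            then have "(cmod (R b x))\<^sup>2 \<le> (cmod (G b x) + cmod (f' b x))\<^sup>2" by (rule power_mono) simp
            also have "\<dots> \<le> 2 * (cmod (G b x))\<^sup>2 + 2 * (cmod (f' b x))\<^sup>2"
              using sum_squares_bound[of "cmod (G b x)" "cmod (f' b x)"] by (simp add: power2_sum)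
            finally show ?thesis .
          qed
          then have "(cmod (R b x))\<^sup>2 \<le> 2 * gsq x + 2 * (cmod (f' b x))\<^sup>2" using G_sq_le_gsq[OF b, of x] by linarith
          then have t1: "(2 * ((3/2 + Cf) * cmod (R b x)))\<^sup>2 \<le> (4 * (3/2 + Cf)\<^sup>2) * (2 * gsq x + 2 * (cmod (f' b x))\<^sup>2)"
            unfolding power_mult_distrib mult.assoc by (intro mult_mono) auto
          have t2: "(2 * (L * cmod (r x)))\<^sup>2 \<le> 4 * L\<^sup>2 * (cmod (r x))\<^sup>2" by (simp add: power_mult_distrib)
          have t3: "(\<theta>' x b)\<^sup>2 \<le> 4 * (cmod (f' b x))\<^sup>2 + C\<theta>\<^sup>2 * indicat_real B x"
          proof (cases "x \<in> B")
            case True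
            have "(\<theta>' x b)\<^sup>2 \<le> C\<theta>\<^sup>2" using power_mono[OF \<theta>B[OF b True], of 2] by simp
            then show ?thesis using True by (simp add: add_increasing)
          next
            case False
            have "(\<theta>' x b)\<^sup>2 \<le> (2 * cmod (f' b x))\<^sup>2" using power_mono[OF \<theta>b[OF b False], of 2] by simp
            then show ?thesis using False by (simp add: power_mult_distrib)
          qed
          show ?thesis by (intro mult_left_mono add_mono t1 t2 t3) simp
        qed
        finally show "norm ((norm (H b x))\<^sup>2) \<le> norm (?g x)" by simp
      qed
    qed
  qed
  \<comment> \<open>In the expansion of the density the term \<open>Re (\<i> * R * cnj f)\<close> is
    not a product of two square integrable factors; it equals the derivative of
    \<open>Re (\<i> * r * cnj f)\<close> minus \<open>Re (\<i> * r * cnj f')\<close>. Likewise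
    \<open>Re (\<i> * f' * cnj f)\<close> is minus \<open>(cmod f)^2\<close> times the phase
    derivative off \<open>B\<close>, and adding the phase derivative leaves the small factor
    \<open>1 - (cmod f)^2\<close>.\<close>
  define v where "v x = Re (\<i> * G ?e x * cnj (r x)) - Re (\<i> * r x * cnj (f' ?e x)) + (Re (\<i> * f' ?e x * cnj (f x)) + \<theta>' x ?e)" for x
  have [measurable]: "G ?e \<in> borel_measurable borel" "f' ?e \<in> borel_measurable borel" using eB by auto
  have [measurable]: "cnj \<in> borel_measurable borel" by (intro borel_measurable_continuous_onI continuous_intros)
  have vm: "v \<in> borel_measurable lborel" unfolding v_def using eB by measurable
  have id: "Re ((\<i> * G ?e x) * cnj (\<psi> x)) = v x + H ?e x" for x
    unfolding v_def H_def R_def r_def by (simp add: algebra_simps)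
  have iB: "integrable lborel (indicat_real B)" using Bfin by (intro integrable_real_indicator) auto
  let ?m = "\<lambda>x. indicat_real (- B) x * (cmod (f x) - 1)\<^sup>2"
  have im: "integrable lborel ?m" "(\<integral>x. ?m x \<partial>lborel) \<le> D"
  proof -
    have "(\<integral>\<^sup>+x. ennreal (?m x) \<partial>lborel) \<le> ennreal D"
    proof -
      have "ennreal (?m x) = indicator (- B) x * ennreal ((cmod (f x) - 1)\<^sup>2)" for x by (auto simp: indicator_def)
      then show ?thesis using D(1) by simp
    qed
    from nn_integral_ennreal_finite_integrable[OF _ _ this D(2)] show "integrable lborel ?m" "(\<integral>x. ?m x \<partial>lborel) \<le> D" by auto
  qed
  \<comment> \<open>The weights balance the sizes: the square of \<open>r\<close> integrates to at
    most \<open>h^2 * E\<close>, the squared gradients to at most \<open>E\<close>. The coefficients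
    1, 1/2 and 7/2 add up to the 5 in \<open>5 * h * E\<close>.\<close>
  let ?g = "\<lambda>x. (1/h) * (cmod (r x))\<^sup>2 + (h/2) * gsq x + (7*h/2) * (cmod (f' ?e x))\<^sup>2 + (3/h) * ?m x + (Cf * L + C\<theta>) * indicat_real B x"
  have ig: "integrable lborel ?g"
    by (intro integrable_mult_right Bochner_Integration.integrable_add gsq_integrable f'_L2_integral[OF eB] r_L2 iB im)
  have amgm: "a * b \<le> (1/(2*h)) * a\<^sup>2 + (h/2) * b\<^sup>2" for a b
  proof -
    have "0 \<le> (a - h * b)\<^sup>2 / (2 * h)" using h0 by simp
    also have "\<dots> = (1/(2*h)) * a\<^sup>2 + (h/2) * b\<^sup>2 - a * b" using h0 by (simp add: power2_eq_square field_simps)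
    finally show ?thesis by simp
  qed
  have vb: "\<bar>v x\<bar> \<le> ?g x" for x
  proof -
    have p1: "\<bar>Re (\<i> * G ?e x * cnj (r x))\<bar> \<le> (1/(2*h)) * (cmod (r x))\<^sup>2 + (h/2) * gsq x"
    proof -
      have "\<bar>Re (\<i> * G ?e x * cnj (r x))\<bar> \<le> cmod (\<i> * G ?e x * cnj (r x))" by (rule abs_Re_le_cmod)
      also have "\<dots> = cmod (r x) * cmod (G ?e x)" by (simp add: norm_mult mult.commute)
      also have "\<dots> \<le> (1/(2*h)) * (cmod (r x))\<^sup>2 + (h/2) * (cmod (G ?e x))\<^sup>2" by (rule amgm)
      also have "\<dots> \<le> (1/(2*h)) * (cmod (r x))\<^sup>2 + (h/2) * gsq x" using G_sq_le_gsq[OF eB, of x] h0 by (intro add_left_mono mult_left_mono) auto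
      finally show ?thesis .
    qed
    have p2: "\<bar>Re (\<i> * r x * cnj (f' ?e x))\<bar> \<le> (1/(2*h)) * (cmod (r x))\<^sup>2 + (h/2) * (cmod (f' ?e x))\<^sup>2"
    proof -
      have "\<bar>Re (\<i> * r x * cnj (f' ?e x))\<bar> \<le> cmod (\<i> * r x * cnj (f' ?e x))" by (rule abs_Re_le_cmod)
      also have "\<dots> = cmod (r x) * cmod (f' ?e x)" by (simp add: norm_mult)
      also note amgm
      finally show ?thesis .
    qed
    have p3: "\<bar>Re (\<i> * f' ?e x * cnj (f x)) + \<theta>' x ?e\<bar> \<le> (3/h) * ?m x + (3*h) * (cmod (f' ?e x))\<^sup>2 + (Cf * L + C\<theta>) * indicat_real B x"
    proof (cases "x \<in> B")
      case True
      have "\<bar>Re (\<i> * f' ?e x * cnj (f x))\<bar> \<le> cmod (\<i> * f' ?e x * cnj (f x))" by (rule abs_Re_le_cmod)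
      also have "\<dots> = cmod (f x) * cmod (f' ?e x)" by (simp add: norm_mult mult.commute)
      also have "\<dots> \<le> Cf * L" using C0 by (intro mult_mono fB True L eB) auto
      finally have "\<bar>Re (\<i> * f' ?e x * cnj (f x)) + \<theta>' x ?e\<bar> \<le> Cf * L + C\<theta>" using \<theta>B[OF eB True] by linarith
      moreover have "0 \<le> (3*h) * (cmod (f' ?e x))\<^sup>2" using h0 by simp
      ultimately show ?thesis using True by simp
    next
      case False
      have f0: "f x \<noteq> 0" using fpos[OF False] by auto
      have "\<theta>' x ?e = Im (f' ?e x * cnj (f x)) / (cmod (f x))\<^sup>2"
        unfolding \<theta>out[OF eB False] by (subst complex_div_cnj) simp
      then have th: "Im (f' ?e x * cnj (f x)) = (cmod (f x))\<^sup>2 * \<theta>' x ?e" using f0 by simp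
      have "Re (\<i> * f' ?e x * cnj (f x)) = - Im (f' ?e x * cnj (f x))" by (simp add: mult.assoc)
      then have "\<bar>Re (\<i> * f' ?e x * cnj (f x)) + \<theta>' x ?e\<bar> = \<bar>(1 - (cmod (f x))\<^sup>2) * \<theta>' x ?e\<bar>" unfolding th by (simp add: algebra_simps)
      also have "\<dots> = \<bar>cmod (f x) - 1\<bar> * (1 + cmod (f x)) * \<bar>\<theta>' x ?e\<bar>"
      proof -
        have "1 - (cmod (f x))\<^sup>2 = (1 - cmod (f x)) * (1 + cmod (f x))" by (simp add: power2_eq_square algebra_simps)
        then show ?thesis by (simp add: abs_mult abs_minus_commute)
      qed
      also have "\<dots> \<le> \<bar>cmod (f x) - 1\<bar> * 3 * (2 * cmod (f' ?e x))"
        using fpos[OF False] by (intro mult_mono \<theta>b eB False mult_left_mono) auto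
      also have "\<dots> = 6 * (\<bar>cmod (f x) - 1\<bar> * cmod (f' ?e x))" by simp
      also have "\<dots> \<le> 6 * ((1/(2*h)) * \<bar>cmod (f x) - 1\<bar>\<^sup>2 + (h/2) * (cmod (f' ?e x))\<^sup>2)" by (intro mult_left_mono amgm) simp
      also have "\<dots> = (3/h) * ?m x + (3*h) * (cmod (f' ?e x))\<^sup>2" using False by (simp add: algebra_simps)
      finally show ?thesis using False by simp
    qed
    have "\<bar>v x\<bar> \<le> \<bar>Re (\<i> * G ?e x * cnj (r x))\<bar> + \<bar>Re (\<i> * r x * cnj (f' ?e x))\<bar> + \<bar>Re (\<i> * f' ?e x * cnj (f x)) + \<theta>' x ?e\<bar>"
      unfolding v_def by linarith
    also have "\<dots> \<le> ((1/(2*h)) * (cmod (r x))\<^sup>2 + (h/2) * gsq x) + ((1/(2*h)) * (cmod (r x))\<^sup>2 + (h/2) * (cmod (f' ?e x))\<^sup>2)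
        + ((3/h) * ?m x + (3*h) * (cmod (f' ?e x))\<^sup>2 + (Cf * L + C\<theta>) * indicat_real B x)"
      by (intro add_mono p1 p2 p3)
    also have "\<dots> = ?g x"
    proof -
      have "(1/(2*h)) * a + (1/(2*h)) * a = (1/h) * a" for a :: real by (simp add: field_simps)
      moreover have "(h/2) * a + (3*h) * a = (7*h/2) * a" for a :: real by (simp add: field_simps)
      ultimately show ?thesis by (smt (verit))
    qed
    finally show ?thesis .
  qed
  have vi: "integrable lborel v"
    using vb by (intro Bochner_Integration.integrable_bound[OF ig vm]) (auto intro: order_trans[OF _ abs_ge_self])
  have Q: "Qmom \<psi> G = (\<integral>x. v x \<partial>lborel)"
    unfolding Qmom_def by (rule Lmom_eqI[OF N2 vi grad]) (intro AE_I2 id)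
  have 1: "\<bar>\<integral>x. v x \<partial>lborel\<bar> \<le> (\<integral>x. ?g x \<partial>lborel)"
    using integral_norm_le[OF ig, of v] vb by simp
  have hb: "has_bochner_integral lborel ?g ((1/h) * (\<integral>x. (cmod (r x))\<^sup>2 \<partial>lborel) + (h/2) * (\<integral>x. gsq x \<partial>lborel) + (7*h/2) * (\<integral>x. (cmod (f' ?e x))\<^sup>2 \<partial>lborel)
      + (3/h) * (\<integral>x. ?m x \<partial>lborel) + (Cf * L + C\<theta>) * (\<integral>x. indicat_real B x \<partial>lborel))"
    by (rule has_bochner_integral_add has_bochner_integral_mult_right has_bochner_integral_integrable
          gsq_integrable(1) f'_L2_integral(1)[OF eB] r_L2(1) iB im(1))+
  have 2: "(\<integral>x. ?g x \<partial>lborel) = (1/h) * (\<integral>x. (cmod (r x))\<^sup>2 \<partial>lborel) + (h/2) * (\<integral>x. gsq x \<partial>lborel) + (7*h/2) * (\<integral>x. (cmod (f' ?e x))\<^sup>2 \<partial>lborel)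
      + (3/h) * (\<integral>x. ?m x \<partial>lborel) + (Cf * L + C\<theta>) * (\<integral>x. indicat_real B x \<partial>lborel)"
    by (rule has_bochner_integral_integral_eq[OF hb])
  have 3: "(\<integral>x. indicat_real B x \<partial>lborel) = measure lborel B" by simp
  have h4: "0 \<le> 1/h" "0 \<le> h/2" "0 \<le> 7*h/2" "0 \<le> 3/h" using h0 by auto
  have 4: "(1/h) * (\<integral>x. (cmod (r x))\<^sup>2 \<partial>lborel) + (h/2) * (\<integral>x. gsq x \<partial>lborel) + (7*h/2) * (\<integral>x. (cmod (f' ?e x))\<^sup>2 \<partial>lborel)
      + (3/h) * (\<integral>x. ?m x \<partial>lborel) + (Cf * L + C\<theta>) * measure lborel B
    \<le> (1/h) * (h\<^sup>2 * E) + (h/2) * E + (7*h/2) * E + (3/h) * D + (Cf * L + C\<theta>) * measure lborel B"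
    using mult_left_mono[OF r_L2(2) h4(1)] mult_left_mono[OF gsq_integrable(2) h4(2)]
      mult_left_mono[OF f'_L2_integral(2)[OF eB] h4(3)] mult_left_mono[OF im(2) h4(4)] by linarith
  have 5: "(1/h) * (h\<^sup>2 * E) + (h/2) * E + (7*h/2) * E + (3/h) * D = 5 * h * E + 3 * D / h"
    using h0 by (simp add: power2_eq_square field_simps)
  show ?thesis using 1 4 unfolding Q 2 3 5 by (rule order_trans)
qed

end

section \<open>Regions of small local energy\<close>

text \<open>The cutoff is the identity up to 2 and at least 2 beyond. So square integrability of
  \<open>(\<phi> s)^2 - 1\<close> sees every deviation of the modulus from 1, including those about
  which the potential gives no information.\<close>

lemma cutoff_away_from_1:
  assumes cut: "cutoff_ok \<phi>" and s: "s \<ge> 0" "\<bar>s - 1\<bar> \<ge> d" and d: "d \<le> 1"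
  shows "\<bar>(\<phi> s)\<^sup>2 - 1\<bar> \<ge> d"
proof (cases "s \<le> 2")
  case True
  then have "\<phi> s = s" using cut s unfolding cutoff_ok_def by auto
  moreover have eq: "s\<^sup>2 - 1 = (s - 1) * (s + 1)" by (simp add: power2_eq_square algebra_simps)
  have "\<bar>s - 1\<bar> * 1 \<le> \<bar>s - 1\<bar> * (s + 1)" using s by (intro mult_left_mono) auto
  then have "\<bar>s - 1\<bar> \<le> \<bar>s\<^sup>2 - 1\<bar>" unfolding eq abs_mult using s by simp
  ultimately show ?thesis using s by (simp only:)
next
  case False
  have sm: "smooth \<phi>" using cut by (simp add: cutoff_ok_def)
  have "\<phi> 2 \<le> \<phi> s"
  proof (rule DERIV_nonneg_imp_nondecreasing[where f=\<phi> and a=2 and b=s])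
    show "2 \<le> s" using False by simp
    fix t
    have "\<phi> differentiable (at t)" using smooth_has_derivative[OF sm] by (auto simp: differentiable_def)
    then have "DERIV \<phi> t :> deriv \<phi> t" by (simp add: DERIV_deriv_iff_real_differentiable)
    moreover have "0 \<le> deriv \<phi> t" using cut by (simp add: cutoff_ok_def)
    ultimately show "\<exists>y. DERIV \<phi> t :> y \<and> 0 \<le> y" by blast
  qed
  moreover have "\<phi> 2 = 2" using cut by (simp add: cutoff_ok_def)
  ultimately have "(\<phi> s)\<^sup>2 \<ge> 2\<^sup>2" by (intro power_mono) auto
  then show ?thesis using d by simp
qed

text \<open>Near \<open>x\<close> the continuous logarithm agrees with
  \<open>g x + Ln (f y / f x)\<close>: by continuity the imaginary part of \<open>g y - g x\<close>
  is smaller than 1, hence than pi, and the principal branch returns it.\<close>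

lemma log_has_derivative:
  fixes f g :: "'a::real_normed_vector \<Rightarrow> complex"
  assumes U: "open U" "x \<in> U" and g: "continuous_on U g" "\<And>y. y \<in> U \<Longrightarrow> f y = exp (g y)"
    and f: "(f has_derivative f') (at x)"
  shows "(g has_derivative (\<lambda>v. f' v / f x)) (at x)"
proof -
  have f0: "f x \<noteq> 0" using g(2)[OF U(2)] by simp
  have "isCont g x" using g(1) U by (simp add: continuous_on_eq_continuous_at)
  then have "\<forall>\<^sub>F y in nhds x. dist (g y) (g x) < 1" by (intro tendstoD) (auto simp: isCont_def tendsto_nhds_iff)
  moreover have "\<forall>\<^sub>F y in nhds x. y \<in> U" using U by (rule eventually_nhds_in_open)
  ultimately have "\<forall>\<^sub>F y in nhds x. dist (g y) (g x) < 1 \<and> y \<in> U" by (rule eventually_conj)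
  then obtain W where W: "open W" "x \<in> W" "\<And>y. y \<in> W \<Longrightarrow> dist (g y) (g x) < 1 \<and> y \<in> U"
    unfolding eventually_nhds by blast
  have eq: "g x + Ln (f y / f x) = g y" if "y \<in> W" for y
  proof -
    have "f y / f x = exp (g y - g x)" using g(2) W(3)[OF that] U(2) by (simp add: exp_diff)
    moreover have "\<bar>Im (g y - g x)\<bar> < 1" using W(3)[OF that] abs_Im_le_cmod[of "g y - g x"] by (simp add: dist_norm)
    then have "- pi < Im (g y - g x)" "Im (g y - g x) \<le> pi" using pi_gt3 by auto
    ultimately show ?thesis by (simp add: Ln_exp)
  qed
  have one: "f x / f x = 1" using f0 by simp
  have "(Ln has_field_derivative 1) (at 1)" by (auto intro!: derivative_eq_intros)
  then have "(Ln has_derivative (\<lambda>z. z)) (at (f x / f x))"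
    unfolding one has_field_derivative_def by (rule has_derivative_eq_rhs) auto
  moreover have "((\<lambda>y. f y / f x) has_derivative (\<lambda>v. f' v / f x)) (at x)"
    using bounded_linear.has_derivative[OF bounded_linear_divide f] .
  ultimately have "((\<lambda>y. Ln (f y / f x)) has_derivative (\<lambda>v. f' v / f x)) (at x)"
    using has_derivative_compose[of "\<lambda>y. f y / f x" "\<lambda>v. f' v / f x" x UNIV Ln "\<lambda>z. z"] by simp
  then have "((\<lambda>y. g x + Ln (f y / f x)) has_derivative (\<lambda>v. f' v / f x)) (at x)"
    using has_derivative_add[OF has_derivative_const[of "g x"]] by fastforce
  then show ?thesis by (rule has_derivative_transform_within_open[OF _ W(1,2)]) (use eq in auto)
qed

section \<open>Local energy and the modulus of the mollification\<close>

context mollified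
begin

lemma energy_total: "(\<integral>\<^sup>+x. ennreal (gsq x + V x) \<partial>lborel) \<le> ennreal E"
proof -
  have "(\<integral>\<^sup>+x. ennreal (gsq x + V x) \<partial>lborel) = (\<integral>\<^sup>+x. ennreal (gsq x) + ennreal (V x) \<partial>lborel)"
    by (simp add: gsq_nonneg V_nonneg)
  also have "\<dots> = (\<integral>\<^sup>+x. ennreal (gsq x) \<partial>lborel) + (\<integral>\<^sup>+x. ennreal (V x) \<partial>lborel)"
    by (rule nn_integral_add) measurable
  also have "\<dots> = energy F \<psi> G" unfolding energy_def gsq_def V_def ..
  finally show ?thesis using en by simp
qed

text \<open>On the ball of radius \<open>h\<close> around \<open>x\<close> both the gradient of
  \<open>f\<close> and the remainder \<open>r\<close> depend on the energy within a further distance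
  \<open>h\<close>, hence the radius \<open>2 * h\<close>.\<close>

definition loc :: "'a \<Rightarrow> ennreal" where
  "loc x = (\<integral>\<^sup>+y. indicator (cball x (2 * h)) y * ennreal (gsq y + V y) \<partial>lborel)"

lemma loc_le: "loc x \<le> ennreal E"
proof -
  have "loc x \<le> (\<integral>\<^sup>+y. ennreal (gsq y + V y) \<partial>lborel)"
    unfolding loc_def by (intro nn_integral_mono) (auto simp: indicator_def)
  then show ?thesis using energy_total by (rule order_trans)
qed

lemma f'_global: "b \<in> Basis \<Longrightarrow> cmod (f' b x) \<le> sqrt (M * E)"
proof -
  assume b: "b \<in> Basis"
  have M0: "M \<ge> 0" using mol unfolding mollifier_def by (meson order_trans)
  have "ennreal ((cmod (f' b x))\<^sup>2) \<le> ennreal M * (\<integral>\<^sup>+y. indicator (cball x h) y * ennreal (gsq y) \<partial>lborel)"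
    by (rule f'_local[OF b])
  also have "\<dots> \<le> ennreal M * (\<integral>\<^sup>+y. ennreal (gsq y) \<partial>lborel)"
    by (intro mult_left_mono nn_integral_mono) (auto simp: indicator_def)
  also have "\<dots> \<le> ennreal M * ennreal E" by (intro mult_left_mono gsq_energy) simp
  also have "\<dots> = ennreal (M * E)" using M0 by (simp add: ennreal_mult')
  finally have "(cmod (f' b x))\<^sup>2 \<le> M * E" using M0 E by simp
  then show ?thesis by (simp add: real_le_rsqrt)
qed

lemma derivative_bound:
  assumes "\<And>b. b \<in> Basis \<Longrightarrow> cmod (f' b x) \<le> c"
  shows "cmod (\<Sum>b\<in>Basis. (v \<bullet> b) *\<^sub>R f' b x) \<le> real DIM('a) * norm v * c"
proof -
  have "cmod (\<Sum>b\<in>Basis. (v \<bullet> b) *\<^sub>R f' b x) \<le> (\<Sum>b\<in>(Basis::'a set). norm v * c)"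
    by (intro sum_norm_le) (auto intro!: mult_mono assms Basis_le_norm)
  then show ?thesis by simp
qed

lemma f_segment_bound:
  assumes c: "\<And>b t. b \<in> Basis \<Longrightarrow> 0 \<le> t \<Longrightarrow> t \<le> 1 \<Longrightarrow> cmod (f' b (x + t *\<^sub>R (y - x))) \<le> c"
  shows "cmod (f y - f x) \<le> real DIM('a) * norm (y - x) * c"
proof -
  have "cmod (f (x + 1 *\<^sub>R (y - x)) - f x) \<le> (real DIM('a) * norm (y - x) * c) * 1"
  proof (rule directional_mean_value_bound[OF f_has_derivative])
    fix t :: real assume "0 \<le> t" "t \<le> 1"
    then show "cmod (\<Sum>b\<in>Basis. ((y - x) \<bullet> b) *\<^sub>R f' b (x + t *\<^sub>R (y - x))) \<le> real DIM('a) * norm (y - x) * c"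
      by (intro derivative_bound c)
  qed simp
  then show ?thesis by simp
qed

text \<open>Where the modulus of \<open>\<psi>\<close> is within \<open>2 * \<delta>\<close> of 1,
  coercivity bounds its deviation by the potential, and \<open>r\<close> accounts for the passage to
  \<open>f\<close>. Elsewhere \<open>cmod (r x)\<close> is at least \<open>\<delta>\<close> and so
  dominates the deviation of \<open>f\<close> by itself.\<close>

lemma near_L2:
  assumes co: "\<And>s. s \<ge> 0 \<Longrightarrow> \<bar>s - 1\<bar> \<le> 2 * \<delta> \<Longrightarrow> (s - 1)\<^sup>2 / 4 \<le> \<bar>Vpot F (s\<^sup>2)\<bar>" and \<delta>: "\<delta> > 0"
    and S: "\<And>x. x \<in> S \<Longrightarrow> \<bar>cmod (f x) - 1\<bar> \<le> \<delta>"
  shows "(\<integral>\<^sup>+x. indicator S x * ennreal ((cmod (f x) - 1)\<^sup>2) \<partial>lborel) \<le> ennreal (8 * E + 2 * h\<^sup>2 * E)"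
proof -
  have pw: "(cmod (f x) - 1)\<^sup>2 \<le> 8 * V x + 2 * (cmod (r x))\<^sup>2" if "x \<in> S" for x
  proof -
    have rr: "\<bar>cmod (\<psi> x) - cmod (f x)\<bar> \<le> cmod (r x)" unfolding r_def by (rule norm_triangle_ineq3)
    show ?thesis
    proof (cases "\<bar>cmod (\<psi> x) - 1\<bar> \<le> 2 * \<delta>")
      case True
      have v: "(cmod (\<psi> x) - 1)\<^sup>2 \<le> 4 * V x" using co[OF norm_ge_zero True] by (simp add: V_def)
      have "(cmod (f x) - 1)\<^sup>2 \<le> (\<bar>cmod (\<psi> x) - 1\<bar> + cmod (r x))\<^sup>2"
        using rr by (intro power2_le_imp_le[THEN power_mono, of _ 1, simplified] abs_le_square_iff[THEN iffD1]) auto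
      also have "\<dots> \<le> 2 * (cmod (\<psi> x) - 1)\<^sup>2 + 2 * (cmod (r x))\<^sup>2"
        using sum_squares_bound[of "\<bar>cmod (\<psi> x) - 1\<bar>" "cmod (r x)"] by (simp add: power2_sum)
      finally show ?thesis using v by linarith
    next
      case False
      then have "\<bar>cmod (f x) - 1\<bar> \<le> cmod (r x)" using S[OF that] rr by linarith
      then have "(cmod (f x) - 1)\<^sup>2 \<le> (cmod (r x))\<^sup>2" using power_mono[of "\<bar>cmod (f x) - 1\<bar>" "cmod (r x)" 2] by simp
      moreover have "0 \<le> (cmod (r x))\<^sup>2" by simp
      ultimately show ?thesis using V_nonneg[of x] by linarith
    qed
  qed
  have "(\<integral>\<^sup>+x. indicator S x * ennreal ((cmod (f x) - 1)\<^sup>2) \<partial>lborel) \<le> (\<integral>\<^sup>+x. ennreal (8 * V x + 2 * (cmod (r x))\<^sup>2) \<partial>lborel)"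
    by (intro nn_integral_mono) (auto simp: indicator_def intro!: ennreal_leI pw)
  also have "\<dots> = ennreal (\<integral>x. 8 * V x + 2 * (cmod (r x))\<^sup>2 \<partial>lborel)"
    using V_integrable r_L2 V_nonneg by (intro nn_integral_eq_integral) auto
  also have "\<dots> \<le> ennreal (8 * E + 2 * h\<^sup>2 * E)"
    using V_integrable r_L2 by (intro ennreal_leI) simp
  finally show ?thesis .
qed

text \<open>Where the modulus of \<open>f\<close> is far from 1, either \<open>r\<close> or the
  cutoff expression in the definition of the energy space is bounded below, and both are square
  integrable. The result is qualitative: the energy does not control the cutoff expression, so no
  bound in terms of \<open>E\<close> is obtained.\<close>

lemma far_finite:
  assumes cut: "cutoff_ok \<phi>" and \<delta>: "0 < \<delta>" "\<delta> < 1" and W[measurable]: "W \<in> sets borel"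
    and far: "\<And>x. x \<in> W \<Longrightarrow> \<bar>cmod (f x) - 1\<bar> \<ge> \<delta>"
  shows "emeasure lborel W < \<infinity>"
proof -
  let ?c = "\<lambda>x. ((\<phi> (cmod (\<psi> x)))\<^sup>2 - 1)\<^sup>2"
  have ic: "integrable lborel ?c" using inE unfolding in_E_def by blast
  have pw: "(\<delta>/2)\<^sup>2 \<le> (cmod (r x))\<^sup>2 + ?c x" if "x \<in> W" for x
  proof -
    have rr: "\<bar>cmod (\<psi> x) - cmod (f x)\<bar> \<le> cmod (r x)" unfolding r_def by (rule norm_triangle_ineq3)
    have far': "\<delta> \<le> \<bar>cmod (f x) - 1\<bar>" by (rule far[OF that])
    consider "\<delta>/2 \<le> cmod (r x)" | "\<delta>/2 \<le> \<bar>cmod (\<psi> x) - 1\<bar>" using far' rr by linarith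
    then show ?thesis
    proof cases
      case 1
      then have "(\<delta>/2)\<^sup>2 \<le> (cmod (r x))\<^sup>2" using \<delta> by (intro power_mono) auto
      then show ?thesis by (simp add: add_increasing2)
    next
      case 2
      then have "\<delta>/2 \<le> \<bar>(\<phi> (cmod (\<psi> x)))\<^sup>2 - 1\<bar>" using \<delta> by (intro cutoff_away_from_1[OF cut]) auto
      then have "(\<delta>/2)\<^sup>2 \<le> ?c x" using \<delta> power_mono[of "\<delta>/2" "\<bar>(\<phi> (cmod (\<psi> x)))\<^sup>2 - 1\<bar>" 2] by simp
      then show ?thesis by (simp add: add_increasing)
    qed
  qed
  have "ennreal ((\<delta>/2)\<^sup>2) * emeasure lborel W = (\<integral>\<^sup>+x. ennreal ((\<delta>/2)\<^sup>2) * indicator W x \<partial>lborel)" by (simp add: nn_integral_cmult)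
  also have "\<dots> \<le> (\<integral>\<^sup>+x. ennreal ((cmod (r x))\<^sup>2 + ?c x) \<partial>lborel)"
  proof (rule nn_integral_mono)
    fix x
    show "ennreal ((\<delta>/2)\<^sup>2) * indicator W x \<le> ennreal ((cmod (r x))\<^sup>2 + ?c x)"
      using ennreal_leI[OF pw, of x] by (cases "x \<in> W") simp_all
  qed
  also have "\<dots> = ennreal (\<integral>x. (cmod (r x))\<^sup>2 + ?c x \<partial>lborel)" using ic r_L2 by (intro nn_integral_eq_integral) auto
  also have "\<dots> < \<infinity>" by simp
  finally show ?thesis using \<delta> by (auto simp: ennreal_mult_less_top)
qed

context
  fixes \<delta> \<eta> C\<rho> :: real
  assumes co: "\<And>s. s \<ge> 0 \<Longrightarrow> \<bar>s - 1\<bar> \<le> 2 * \<delta> \<Longrightarrow> (s - 1)\<^sup>2 / 4 \<le> \<bar>Vpot F (s\<^sup>2)\<bar>" and \<delta>: "0 < \<delta>" "\<delta> < 1/4"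
    and M: "M = C\<rho> / h ^ DIM('a)" and C\<rho>: "C\<rho> > 0"
    and \<eta>: "\<eta> > 0" "real DIM('a) * sqrt (C\<rho> * \<eta>) \<le> \<delta>/8" "2 * \<eta> < \<delta>\<^sup>2 / 64 * unit_ball_vol (real DIM('a))"
begin

text \<open>The second condition on \<open>\<eta>\<close> keeps the oscillation of \<open>f\<close>
  on the ball of radius \<open>h\<close> below \<open>\<delta>/8\<close>. If the modulus at
  \<open>x\<close> were in the gap, then at each point of the ball either \<open>r\<close> is at
  least \<open>\<delta>/8\<close> or \<open>\<psi>\<close> lies in the coercive window away from 1.
  This forces more energy into the ball than is available; the third condition on
  \<open>\<eta>\<close> gives the contradiction.\<close>

lemma modulus_dichotomy:
  assumes x: "loc x \<le> ennreal (\<eta> * h ^ DIM('a) / h\<^sup>2)"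
  shows "\<not> (\<delta>/2 \<le> \<bar>cmod (f x) - 1\<bar> \<and> \<bar>cmod (f x) - 1\<bar> \<le> \<delta>)"
proof
  assume m: "\<delta>/2 \<le> \<bar>cmod (f x) - 1\<bar> \<and> \<bar>cmod (f x) - 1\<bar> \<le> \<delta>"
  have h0: "h > 0" using h by simp
  have M0: "M > 0" using M C\<rho> h0 by simp
  have grad: "cmod (f' b z) \<le> sqrt (C\<rho> * \<eta>) / h" if b: "b \<in> Basis" and z: "z \<in> cball x h" for b z
  proof -
    have "ennreal ((cmod (f' b z))\<^sup>2) \<le> ennreal M * (\<integral>\<^sup>+y. indicator (cball z h) y * ennreal (gsq y) \<partial>lborel)"
      by (rule f'_local[OF b])
    also have "\<dots> \<le> ennreal M * loc x"
      unfolding loc_def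
    proof (intro mult_left_mono nn_integral_mono mult_mono ennreal_leI)
      fix y
      have "y \<in> cball x (2 * h)" if "y \<in> cball z h" using that z dist_triangle[of x y z] by simp
      then show "indicator (cball z h) y \<le> (indicator (cball x (2 * h)) y :: ennreal)" by (auto simp: indicator_def)
      show "gsq y \<le> gsq y + V y" using V_nonneg by simp
    qed auto
    also have "\<dots> \<le> ennreal M * ennreal (\<eta> * h ^ DIM('a) / h\<^sup>2)" by (intro mult_left_mono x) simp
    also have "\<dots> = ennreal (M * (\<eta> * h ^ DIM('a) / h\<^sup>2))" using M0 by (intro ennreal_mult'[symmetric]) simp
    also have "M * (\<eta> * h ^ DIM('a) / h\<^sup>2) = C\<rho> * \<eta> / h\<^sup>2" unfolding M using h0 by simp
    finally have "(cmod (f' b z))\<^sup>2 \<le> C\<rho> * \<eta> / h\<^sup>2" using C\<rho> \<eta> by simp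
    then have "cmod (f' b z) \<le> sqrt (C\<rho> * \<eta> / h\<^sup>2)" by (rule real_le_rsqrt)
    then show ?thesis using h0 by (simp add: real_sqrt_divide)
  qed
  have osc: "cmod (f y - f x) \<le> \<delta>/8" if y: "y \<in> cball x h" for y
  proof -
    have "cmod (f y - f x) \<le> real DIM('a) * norm (y - x) * (sqrt (C\<rho> * \<eta>) / h)"
    proof (rule f_segment_bound)
      fix b :: 'a and t :: real assume "b \<in> Basis" "0 \<le> t" "t \<le> 1"
      moreover have "x + t *\<^sub>R (y - x) \<in> cball x h" using y \<open>0 \<le> t\<close> \<open>t \<le> 1\<close>
        by (auto simp: dist_norm norm_minus_commute intro: order_trans[OF mult_left_le_one_le])
      ultimately show "cmod (f' b (x + t *\<^sub>R (y - x))) \<le> sqrt (C\<rho> * \<eta>) / h" by (intro grad)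
    qed
    also have "\<dots> \<le> real DIM('a) * h * (sqrt (C\<rho> * \<eta>) / h)"
      using y h0 C\<rho> \<eta> by (intro mult_right_mono mult_left_mono) (auto simp: dist_norm norm_minus_commute)
    also have "\<dots> = real DIM('a) * sqrt (C\<rho> * \<eta>)" using h0 by simp
    also have "\<dots> \<le> \<delta>/8" by (rule \<eta>)
    finally show ?thesis .
  qed
  \<comment> \<open>Both alternatives give the same constant: \<open>(\<delta>/8)^2\<close> from the
    remainder, and \<open>(\<delta>/4)^2 / 4\<close> from coercivity.\<close>
  have low: "\<delta>\<^sup>2 / 64 \<le> (cmod (r y))\<^sup>2 + V y" if y: "y \<in> cball x h" for y
  proof (cases "cmod (r y) \<ge> \<delta>/8")
    case True
    then have "(\<delta>/8)\<^sup>2 \<le> (cmod (r y))\<^sup>2" using \<delta> by (intro power_mono) auto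
    then show ?thesis using V_nonneg[of y] by (simp add: power_divide)
  next
    case False
    have "\<bar>cmod (\<psi> y) - cmod (f x)\<bar> \<le> cmod (\<psi> y - f x)" by (rule norm_triangle_ineq3)
    also have "\<psi> y - f x = r y + (f y - f x)" by (simp add: r_def)
    also have "cmod \<dots> \<le> cmod (r y) + cmod (f y - f x)" by (rule norm_triangle_ineq)
    also have "\<dots> \<le> \<delta>/8 + \<delta>/8" using False osc[OF y] by linarith
    finally have d: "\<bar>cmod (\<psi> y) - cmod (f x)\<bar> \<le> \<delta>/4" by simp
    then have lo: "\<delta>/4 \<le> \<bar>cmod (\<psi> y) - 1\<bar>" and up: "\<bar>cmod (\<psi> y) - 1\<bar> \<le> 2 * \<delta>" using m \<delta> by linarith+
    have "(\<delta>/4)\<^sup>2 \<le> (cmod (\<psi> y) - 1)\<^sup>2" using power_mono[OF lo, of 2] \<delta> by simp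
    moreover have "(cmod (\<psi> y) - 1)\<^sup>2 / 4 \<le> V y" using co[OF norm_ge_zero up] by (simp add: V_def)
    ultimately have "\<delta>\<^sup>2 / 64 \<le> V y" by (simp add: power_divide)
    then show ?thesis by (simp add: add_increasing)
  qed
  let ?B = "cball x h"
  have "ennreal (\<delta>\<^sup>2 / 64) * emeasure lborel ?B = (\<integral>\<^sup>+y. ennreal (\<delta>\<^sup>2 / 64) * indicator ?B y \<partial>lborel)"
    by (rule nn_integral_cmult_indicator[symmetric]) simp
  also have "\<dots> \<le> (\<integral>\<^sup>+y. indicator ?B y * ennreal ((cmod (r y))\<^sup>2) + indicator ?B y * ennreal (V y) \<partial>lborel)"
  proof (intro nn_integral_mono)
    fix y
    have "ennreal (\<delta>\<^sup>2 / 64) \<le> ennreal ((cmod (r y))\<^sup>2) + ennreal (V y)" if "y \<in> ?B"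
      using ennreal_leI[OF low[OF that]] by (simp add: V_nonneg)
    then show "ennreal (\<delta>\<^sup>2 / 64) * indicator ?B y \<le> indicator ?B y * ennreal ((cmod (r y))\<^sup>2) + indicator ?B y * ennreal (V y)"
      by (auto simp: indicator_def)
  qed
  also have "\<dots> = (\<integral>\<^sup>+y. indicator ?B y * ennreal ((cmod (r y))\<^sup>2) \<partial>lborel) + (\<integral>\<^sup>+y. indicator ?B y * ennreal (V y) \<partial>lborel)"
    by (intro nn_integral_add borel_measurable_times_ennreal borel_measurable_indicator) auto
  also have "\<dots> \<le> ennreal (h\<^sup>2) * loc x + loc x"
  proof (rule add_mono)
    have "(\<integral>\<^sup>+y. indicator ?B y * ennreal ((cmod (r y))\<^sup>2) \<partial>lborel) \<le> ennreal (h\<^sup>2) * (\<integral>\<^sup>+y. indicator (cball x (2 * h)) y * ennreal (gsq y) \<partial>lborel)"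
    proof (rule r_local)
      fix y z :: 'a assume "y \<in> ?B" "norm z \<le> h"
      then show "y + z \<in> cball x (2 * h)" using dist_triangle[of x "y + z" y] by (simp add: dist_norm)
    qed auto
    also have "\<dots> \<le> ennreal (h\<^sup>2) * loc x" unfolding loc_def
      by (intro mult_left_mono nn_integral_mono ennreal_leI) (auto simp: V_nonneg)
    finally show "(\<integral>\<^sup>+y. indicator ?B y * ennreal ((cmod (r y))\<^sup>2) \<partial>lborel) \<le> ennreal (h\<^sup>2) * loc x" .
    show "(\<integral>\<^sup>+y. indicator ?B y * ennreal (V y) \<partial>lborel) \<le> loc x"
      unfolding loc_def using h0 by (intro nn_integral_mono mult_mono ennreal_leI) (auto simp: gsq_nonneg indicator_def)
  qed
  \<comment> \<open>The potential part comes without the factor \<open>h^2\<close>; it is inserted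
    at no cost because \<open>h \<ge> 1\<close>, so that both parts give \<open>\<eta> * h^N\<close>
    in dimension \<open>N\<close>.\<close>
  also have "\<dots> \<le> ennreal (h\<^sup>2) * ennreal (\<eta> * h ^ DIM('a) / h\<^sup>2) + ennreal (h\<^sup>2) * ennreal (\<eta> * h ^ DIM('a) / h\<^sup>2)"
  proof (intro add_mono mult_left_mono x)
    have "loc x \<le> ennreal (\<eta> * h ^ DIM('a) / h\<^sup>2)" by (rule x)
    also have "\<dots> \<le> ennreal (h\<^sup>2 * (\<eta> * h ^ DIM('a) / h\<^sup>2))"
    proof (rule ennreal_leI)
      have "1 * (\<eta> * h ^ DIM('a) / h\<^sup>2) \<le> h\<^sup>2 * (\<eta> * h ^ DIM('a) / h\<^sup>2)"
        using \<eta> h one_le_power[OF h, of 2] by (intro mult_right_mono) auto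
      then show "\<eta> * h ^ DIM('a) / h\<^sup>2 \<le> h\<^sup>2 * (\<eta> * h ^ DIM('a) / h\<^sup>2)" by simp
    qed
    also have "\<dots> = ennreal (h\<^sup>2) * ennreal (\<eta> * h ^ DIM('a) / h\<^sup>2)" by (rule ennreal_mult') simp
    finally show "loc x \<le> ennreal (h\<^sup>2) * ennreal (\<eta> * h ^ DIM('a) / h\<^sup>2)" .
  qed simp
  also have "\<dots> = ennreal (2 * \<eta> * h ^ DIM('a))"
    using h0 \<eta> by (simp add: ennreal_mult'[symmetric] ennreal_plus[symmetric] del: ennreal_plus)
  finally have le: "ennreal (\<delta>\<^sup>2 / 64) * emeasure lborel ?B \<le> ennreal (2 * \<eta> * h ^ DIM('a))" .
  have eB: "emeasure lborel ?B = ennreal (unit_ball_vol (real DIM('a)) * h ^ DIM('a))"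
    using h0 by (simp add: emeasure_cball)
  have "ennreal (\<delta>\<^sup>2 / 64 * (unit_ball_vol (real DIM('a)) * h ^ DIM('a)))
      = ennreal (\<delta>\<^sup>2 / 64) * ennreal (unit_ball_vol (real DIM('a)) * h ^ DIM('a))"
    by (rule ennreal_mult') simp
  then have "ennreal (\<delta>\<^sup>2 / 64 * (unit_ball_vol (real DIM('a)) * h ^ DIM('a))) \<le> ennreal (2 * \<eta> * h ^ DIM('a))"
    using le unfolding eB by (simp only:)
  then have "\<delta>\<^sup>2 / 64 * (unit_ball_vol (real DIM('a)) * h ^ DIM('a)) \<le> 2 * \<eta> * h ^ DIM('a)"
    using \<eta> h0 by (subst (asm) ennreal_le_iff) auto
  then have "(\<delta>\<^sup>2 / 64 * unit_ball_vol (real DIM('a))) * h ^ DIM('a) \<le> (2 * \<eta>) * h ^ DIM('a)" by (simp add: mult_ac)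
  then have "\<delta>\<^sup>2 / 64 * unit_ball_vol (real DIM('a)) \<le> 2 * \<eta>" using h0 by (simp add: mult_le_cancel_right)
  then show False using \<eta>(3) by linarith
qed

text \<open>Connectedness prevents the modulus from jumping over the forbidden gap, and the far
  alternative would make \<open>S\<close> a set of finite measure.\<close>

lemma modulus_near_on_connected:
  assumes cut: "cutoff_ok \<phi>" and S: "connected S" "S \<in> sets borel" "emeasure lborel S = \<infinity>"
    and x: "\<And>x. x \<in> S \<Longrightarrow> loc x \<le> ennreal (\<eta> * h ^ DIM('a) / h\<^sup>2)"
  shows "\<And>x. x \<in> S \<Longrightarrow> \<bar>cmod (f x) - 1\<bar> < \<delta>/2"
proof -
  let ?m = "\<lambda>x. \<bar>cmod (f x) - 1\<bar>"
  have c: "continuous_on UNIV ?m" by (intro continuous_intros continuous_f)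
  have oU: "open {x. ?m x < \<delta>/2}" and oW: "open {x. ?m x > \<delta>}"
    using c by (auto intro!: open_Collect_less continuous_intros)
  have cover: "S \<subseteq> {x. ?m x < \<delta>/2} \<union> {x. ?m x > \<delta>}" using modulus_dichotomy[OF x] by force
  have disj: "{x. ?m x < \<delta>/2} \<inter> {x. ?m x > \<delta>} \<inter> S = {}" using \<delta> by auto
  have "{x. ?m x < \<delta>/2} \<inter> S = {} \<or> {x. ?m x > \<delta>} \<inter> S = {}"
    using connectedD[OF S(1) oU oW disj cover] by blast
  moreover have "{x. ?m x < \<delta>/2} \<inter> S \<noteq> {}"
  proof
    assume "{x. ?m x < \<delta>/2} \<inter> S = {}"
    then have "\<And>x. x \<in> S \<Longrightarrow> ?m x \<ge> \<delta>" using cover by force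
    then have "emeasure lborel S < \<infinity>" using \<delta> by (intro far_finite[OF cut, of \<delta>]) (auto simp: S)
    then show False using S by simp
  qed
  ultimately have "{x. ?m x > \<delta>} \<inter> S = {}" by blast
  then show "\<And>x. x \<in> S \<Longrightarrow> ?m x < \<delta>/2" using cover by blast
qed

text \<open>The total energy is below the local threshold, so the exceptional set is empty and
  \<open>f\<close> has a continuous logarithm on the whole space. The constant is 5 + 24 + 6, the
  last two from \<open>24 * E / h\<close> and \<open>6 * h * E\<close> in the bound for the
  deviation of the modulus.\<close>

lemma momentum_bound_small_energy:
  assumes cut: "cutoff_ok \<phi>" and N2: "DIM('a) \<ge> 2" and sm: "E \<le> \<eta> * h ^ DIM('a) / h\<^sup>2"
  shows "\<bar>Qmom \<psi> G\<bar> \<le> 35 * h * E"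
proof -
  have loc: "loc x \<le> ennreal (\<eta> * h ^ DIM('a) / h\<^sup>2)" for x using loc_le ennreal_leI[OF sm] by (rule order_trans)
  have "emeasure lborel (UNIV :: 'a set) = \<infinity>" by simp
  then have near: "\<bar>cmod (f x) - 1\<bar> < \<delta>/2" for x
    using modulus_near_on_connected[OF cut connected_UNIV] loc by simp
  have f0: "f x \<noteq> 0" for x using near[of x] \<delta> by auto
  obtain g where g: "continuous_on UNIV g" "\<And>x. x \<in> UNIV \<Longrightarrow> f x = exp (g x)"
    using continuous_logarithm_on_contractible[of UNIV f] continuous_f f0 contractible_UNIV by auto
  let ?D = "\<lambda>x v. \<Sum>b\<in>Basis. (v \<bullet> b) *\<^sub>R f' b x"
  have dg: "(g has_derivative (\<lambda>v. ?D x v / f x)) (at x)" for x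
    by (rule log_has_derivative[OF open_UNIV UNIV_I g f_has_derivative])
  have d\<theta>: "((\<lambda>x. Im (g x)) has_derivative (\<lambda>v. Im (?D x v / f x))) (at x)" for x
    by (rule bounded_linear.has_derivative[OF bounded_linear_Im dg])
  have "\<bar>Qmom \<psi> G\<bar> \<le> 5 * h * E + 3 * (8 * E + 2 * h\<^sup>2 * E) / h + (0 * sqrt (M * E) + 0) * measure lborel ({}::'a set)"
  proof (rule momentum_bound[OF N2 _ _ d\<theta>])
    show "\<bar>cmod (f x) - 1\<bar> \<le> 1/2" for x using near[of x] \<delta> by linarith
    show "Im (?D x b / f x) = Im (f' b x / f x)" if "b \<in> Basis" for b x by (simp add: f_derivative_Basis[OF that])
    show "(\<integral>\<^sup>+x. indicator (- {}) x * ennreal ((cmod (f x) - 1)\<^sup>2) \<partial>lborel) \<le> ennreal (8 * E + 2 * h\<^sup>2 * E)"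
    proof (rule near_L2[OF co \<delta>(1)])
      show "\<bar>cmod (f x) - 1\<bar> \<le> \<delta>" for x using near[of x] \<delta> by linarith
    qed
    show "0 \<le> 8 * E + 2 * h\<^sup>2 * E" using E by simp
  qed (auto intro: f'_global)
  also have "\<dots> \<le> 35 * h * E"
  proof -
    have "3 * (8 * E + 2 * h\<^sup>2 * E) / h = 24 * E / h + 6 * h * E" using h by (simp add: power2_eq_square field_simps)
    moreover have "24 * E / h \<le> 24 * h * E"
    proof -
      have "24 * E / h \<le> 24 * E / 1" using h E by (intro divide_left_mono) auto
      also have "\<dots> \<le> 24 * h * E" using h E mult_right_mono[of 1 h "24 * E"] by simp
      finally show ?thesis .
    qed
    ultimately show ?thesis by (simp add: mult_ac)
  qed
  finally show ?thesis .
qed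

end

end

\<comment> \<open>Its premise contains variables that do not occur in the conclusion.\<close>
declare mollifier_measurable [measurable del]

section \<open>A planar phase\<close>

text \<open>Cauchy-Schwarz on a side of length \<open>2 * s\<close>. The energy bound
  \<open>\<kappa> / s\<close> is the one that makes the oscillation independent of the size of the
  square.\<close>

lemma oscillation_L2:
  fixes g :: "real \<Rightarrow> complex"
  assumes d: "\<And>t. (g has_vector_derivative g' t) (at t)" and c: "continuous_on UNIV g'"
    and s: "s > 0" and e: "(\<integral>\<^sup>+t. indicator {-s..s} t * ennreal ((cmod (g' t))\<^sup>2) \<partial>lborel) \<le> ennreal (\<kappa> / s)" and \<kappa>: "\<kappa> \<ge> 0"
    and xy: "x \<in> {-s..s}" "y \<in> {-s..s}"
  shows "cmod (g x - g y) \<le> sqrt (2 * \<kappa>)"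
proof -
  have *: "cmod (g x - g y) \<le> sqrt (2 * \<kappa>)" if xy: "x \<in> {-s..s}" "y \<in> {-s..s}" "x \<le> y" for x y
  proof -
    have [measurable]: "g' \<in> borel_measurable borel" using c by (rule borel_measurable_continuous_onI)
    have i: "(\<integral>t. indicator {x..y} t *\<^sub>R g' t \<partial>lborel) = g y - g x"
      by (rule integral_FTC_atLeastAtMost) (use that d c in \<open>auto intro: has_vector_derivative_at_within continuous_on_subset\<close>)
    have "ennreal (cmod (g y - g x)) \<le> (\<integral>\<^sup>+t. ennreal (norm (indicator {x..y} t *\<^sub>R g' t)) \<partial>lborel)"
      unfolding i[symmetric] using borel_integrable_compact[OF compact_Icc[of x y] continuous_on_subset[OF c]]
      by (intro integral_norm_bound_ennreal) auto
    also have "\<dots> \<le> (\<integral>\<^sup>+t. (indicator {-s..s} t * ennreal (cmod (g' t))) * indicator {-s..s} t \<partial>lborel)"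
      using that by (intro nn_integral_mono) (auto simp: indicator_def)
    finally have "(ennreal (cmod (g y - g x)))\<^sup>2 \<le> (\<integral>\<^sup>+t. (indicator {-s..s} t * ennreal (cmod (g' t))) * indicator {-s..s} t \<partial>lborel)\<^sup>2"
      by (rule power_mono) simp
    also have "\<dots> \<le> (\<integral>\<^sup>+t. (indicator {-s..s} t * ennreal (cmod (g' t)))^2 \<partial>lborel) * (\<integral>\<^sup>+t. (indicator {-s..s} t)^2 \<partial>lborel)"
      by (rule Cauchy_Schwarz_nn_integral) measurable
    also have "(\<integral>\<^sup>+t. (indicator {-s..s} t * ennreal (cmod (g' t)))^2 \<partial>lborel) = (\<integral>\<^sup>+t. indicator {-s..s} t * ennreal ((cmod (g' t))\<^sup>2) \<partial>lborel)"
      by (intro nn_integral_cong) (auto simp: indicator_def ennreal_power)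
    also have "(\<integral>\<^sup>+t. (indicator {-s..s} t)^2 \<partial>lborel) = (\<integral>\<^sup>+t. indicator {-s..s} t \<partial>lborel)"
      by (intro nn_integral_cong) (auto simp: indicator_def)
    also have "\<dots> = ennreal (2 * s)" using s by simp
    also have "(\<integral>\<^sup>+t. indicator {-s..s} t * ennreal ((cmod (g' t))\<^sup>2) \<partial>lborel) * ennreal (2 * s) \<le> ennreal (\<kappa> / s) * ennreal (2 * s)"
      by (intro mult_right_mono e) simp
    also have "\<dots> = ennreal (\<kappa> / s * (2 * s))" using \<kappa> s by (intro ennreal_mult[symmetric]) auto
    also have "\<kappa> / s * (2 * s) = 2 * \<kappa>" using s by simp
    finally have "(cmod (g y - g x))\<^sup>2 \<le> 2 * \<kappa>" using \<kappa> by (simp add: ennreal_power)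
    then show ?thesis by (simp add: real_le_rsqrt norm_minus_commute)
  qed
  show ?thesis
  proof (cases "x \<le> y")
    case True then show ?thesis using *[OF xy] by simp
  next
    case False then show ?thesis using *[OF xy(2,1)] by (simp add: norm_minus_commute)
  qed
qed

text \<open>If two points are too close for the current radius, drop one of them and enlarge the
  radius so that the ball about the other covers both; this happens at most \<open>n\<close> times.
  The point of the order of quantifiers is that \<open>Rm\<close> does not depend on the positions
  of the points.\<close>

lemma cluster:
  fixes \<Lambda> :: real assumes \<Lambda>: "\<Lambda> \<ge> 1"
  shows "\<exists>Rm\<ge>R1. \<forall>P::'a::euclidean_space set. finite P \<and> card P \<le> n \<longrightarrow>
    (\<exists>R P'. R1 \<le> R \<and> R \<le> Rm \<and> P' \<subseteq> P \<and> (\<forall>p\<in>P. \<exists>p'\<in>P'. cball p R1 \<subseteq> cball p' R) \<and>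
      (\<forall>p\<in>P'. \<forall>q\<in>P'. p \<noteq> q \<longrightarrow> dist p q > 8 * \<Lambda> * R))"
proof (induction n arbitrary: R1)
  case 0
  show ?case by (intro exI[of _ R1]) auto
next
  case (Suc n)
  \<comment> \<open>Two points are merged at distance up to \<open>8 * \<Lambda> * R1\<close>, so
    the ball of radius \<open>R2\<close> about one contains the old balls of both. Taking the
    maximum gives \<open>R1 \<le> R2\<close> for negative \<open>R1\<close> too.\<close>
  define R2 where "R2 = max R1 (R1 + 8 * \<Lambda> * R1)"
  obtain Rm where RmIH: "R2 \<le> Rm \<and> (\<forall>P::'a set. finite P \<and> card P \<le> n \<longrightarrow>
    (\<exists>R P'. R2 \<le> R \<and> R \<le> Rm \<and> P' \<subseteq> P \<and> (\<forall>p\<in>P. \<exists>p'\<in>P'. cball p R2 \<subseteq> cball p' R) \<and>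
      (\<forall>p\<in>P'. \<forall>q\<in>P'. p \<noteq> q \<longrightarrow> dist p q > 8 * \<Lambda> * R)))"
    using Suc.IH[of R2] by (rule exE)
  note Rm = conjunct1[OF RmIH] and IH = conjunct2[OF RmIH]
  have R12: "R1 \<le> R2" by (simp add: R2_def)
  show ?case
  proof (rule exI[of _ Rm], intro conjI allI impI)
    show "R1 \<le> Rm" using R12 Rm by simp
    fix P :: "'a set" assume P: "finite P \<and> card P \<le> Suc n"
    show "\<exists>R P'. R1 \<le> R \<and> R \<le> Rm \<and> P' \<subseteq> P \<and> (\<forall>p\<in>P. \<exists>p'\<in>P'. cball p R1 \<subseteq> cball p' R) \<and>
      (\<forall>p\<in>P'. \<forall>q\<in>P'. p \<noteq> q \<longrightarrow> dist p q > 8 * \<Lambda> * R)"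
    proof (cases "\<forall>p\<in>P. \<forall>q\<in>P. p \<noteq> q \<longrightarrow> dist p q > 8 * \<Lambda> * R1")
      case True
      then show ?thesis using R12 Rm by (intro exI[of _ R1] exI[of _ P]) auto
    next
      case False
      then obtain p q where pq: "p \<in> P" "q \<in> P" "p \<noteq> q" "dist p q \<le> 8 * \<Lambda> * R1" by force
      have "finite (P - {q}) \<and> card (P - {q}) \<le> n" using P pq by auto
      from IH[rule_format, OF this] obtain R P' where R: "R2 \<le> R" "R \<le> Rm" "P' \<subseteq> P - {q}"
        "\<forall>p\<in>P - {q}. \<exists>p'\<in>P'. cball p R2 \<subseteq> cball p' R" "\<forall>p\<in>P'. \<forall>q\<in>P'. p \<noteq> q \<longrightarrow> dist p q > 8 * \<Lambda> * R" by blast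
      have "\<exists>p'\<in>P'. cball x R1 \<subseteq> cball p' R" if x: "x \<in> P" for x
      proof (cases "x = q")
        case True
        have "cball q R1 \<subseteq> cball p R2"
        proof
          fix z assume "z \<in> cball q R1"
          then show "z \<in> cball p R2" using dist_triangle[of p z q] pq(4) by (simp add: R2_def)
        qed
        then show ?thesis using R(4) pq True by blast
      next
        case False
        moreover have "cball x R1 \<subseteq> cball x R2" using R12 by (rule subset_cball)
        ultimately show ?thesis using R(4) x by blast
      qed
      then show ?thesis using R R12 by (intro exI[of _ R] exI[of _ P']) auto
    qed
  qed
qed

text \<open>A closed set does not separate space if none of its components does. Here the components
  are the single balls, and the complement of a bounded convex set is connected in dimension at
  least 2.\<close>

lemma connected_complement_disjoint_cballs:
  fixes P :: "'a::euclidean_space set"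
  assumes N2: "DIM('a) \<ge> 2" and P: "finite P" and R: "R > 0" and sep: "\<And>p q. p \<in> P \<Longrightarrow> q \<in> P \<Longrightarrow> p \<noteq> q \<Longrightarrow> dist p q > 2 * R"
  shows "connected (- (\<Union>p\<in>P. cball p R))"
proof -
  let ?S = "\<Union>p\<in>P. cball p R"
  have cl: "closed ?S" using P by (intro closed_UN) auto
  have "connected (- C)" if C: "C \<in> components ?S" for C
  proof -
    obtain x where x: "x \<in> ?S" "C = connected_component_set ?S x" using C unfolding components_def by blast
    then obtain p where p: "p \<in> P" "x \<in> cball p R" by blast
    have Cc: "connected C" "C \<subseteq> ?S" by (rule in_components_connected[OF C], rule in_components_subset[OF C])
    have "C \<subseteq> cball p R"
    proof (rule ccontr)
      assume n: "\<not> C \<subseteq> cball p R"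
      let ?T = "\<Union>q\<in>P - {p}. cball q R"
      have clT: "closed ?T" using P by (intro closed_UN) auto
      have 1: "C \<subseteq> cball p R \<union> ?T" using Cc(2) by blast
      have 2: "cball p R \<inter> ?T \<inter> C = {}"
      proof -
        have "cball p R \<inter> cball q R = {}" if "q \<in> P - {p}" for q
        proof -
          have "dist p q \<le> 2 * R" if "z \<in> cball p R" "z \<in> cball q R" for z
            using that dist_triangle[of p q z] by (simp add: dist_commute)
          then show ?thesis using sep[OF p(1), of q] that by force
        qed
        then show ?thesis by blast
      qed
      have "x \<in> C" unfolding x(2) using connected_component_refl[OF x(1)] by simp
      then have 3: "cball p R \<inter> C \<noteq> {}" using p by blast
      have 4: "?T \<inter> C \<noteq> {}" using n 1 by blast
      show False using Cc(1) 1 2 3 4 clT closed_cball unfolding connected_closed by blast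
    qed
    moreover have "cball p R \<subseteq> C"
      using connected_component_maximal[of x "cball p R" ?S] p x by (auto simp: connected_cball)
    ultimately have "C = cball p R" by blast
    then show ?thesis using connected_complement_bounded_convex[of "cball p R"] N2 by simp
  qed
  then show ?thesis using nonseparation_by_component_eq[of ?S] cl by blast
qed

lemma infinite_measure_complement:
  assumes "emeasure lborel (B :: 'a::euclidean_space set) < \<infinity>" "B \<in> sets borel"
  shows "emeasure lborel (- B) = \<infinity>"
proof (rule ccontr)
  assume "emeasure lborel (- B) \<noteq> \<infinity>"
  moreover have "emeasure lborel (UNIV :: 'a set) \<le> emeasure lborel B + emeasure lborel (- B)"
    using emeasure_subadditive[of B lborel "- B"] assms by (simp add: Un_commute)
  ultimately show False using assms by (simp add: top_unique)
qed

section \<open>Coordinates and squares in the plane\<close>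

locale planar =
  fixes e2 :: "'a::euclidean_space"
  assumes basis: "Basis = {e1, e2}" and ne: "e1 \<noteq> e2"
begin

lemma e2_Basis: "e2 \<in> Basis"
  unfolding basis by blast

lemma planar_inner: "e1 \<bullet> e2 = 0" "e2 \<bullet> e1 = 0" "e2 \<bullet> e2 = 1"
  using e1_Basis[where 'a='a] e2_Basis ne by (auto simp: inner_Basis)

lemma planar_representation: "x = (x \<bullet> e1) *\<^sub>R e1 + (x \<bullet> e2) *\<^sub>R e2"
proof -
  have "(\<Sum>b\<in>{e1, e2}. (x \<bullet> b) *\<^sub>R b) = x" using euclidean_representation[of x] unfolding basis .
  then show ?thesis using ne by simp
qed

definition pt :: "'a \<Rightarrow> real \<Rightarrow> real \<Rightarrow> 'a" where "pt p a b = p + a *\<^sub>R e1 + b *\<^sub>R e2"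

lemma pt_inner: "(pt p a b - p) \<bullet> e1 = a" "(pt p a b - p) \<bullet> e2 = b"
  by (simp_all add: pt_def inner_simps planar_inner)

lemma pt_coords: "pt p ((x - p) \<bullet> e1) ((x - p) \<bullet> e2) = x"
  using planar_representation[of "x - p"] by (simp add: pt_def algebra_simps)

lemma nn_integral_planar:
  assumes [measurable]: "F \<in> borel_measurable borel"
  shows "(\<integral>\<^sup>+x. F x \<partial>lborel) = (\<integral>\<^sup>+a. (\<integral>\<^sup>+b. F (pt p a b) \<partial>lborel) \<partial>lborel)"
proof -
  let ?T = "\<lambda>(a, b). pt p a b"
  have mT[measurable]: "?T \<in> borel_measurable (lborel \<Otimes>\<^sub>M lborel)"
    unfolding pt_def by measurable
  have eq: "(lborel :: 'a measure) = distr (lborel \<Otimes>\<^sub>M lborel) borel ?T"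
  proof (rule lborel_eqI)
    fix l u :: 'a assume le: "\<And>b. b \<in> Basis \<Longrightarrow> l \<bullet> b \<le> u \<bullet> b"
    have "?T -` box l u = {(l - p) \<bullet> e1 <..< (u - p) \<bullet> e1} \<times> {(l - p) \<bullet> e2 <..< (u - p) \<bullet> e2}"
      by (auto simp: mem_box basis pt_def inner_simps planar_inner)
    then have "emeasure (distr (lborel \<Otimes>\<^sub>M lborel) borel ?T) (box l u)
      = emeasure (lborel \<Otimes>\<^sub>M lborel) ({(l - p) \<bullet> e1 <..< (u - p) \<bullet> e1} \<times> {(l - p) \<bullet> e2 <..< (u - p) \<bullet> e2})"
      by (subst emeasure_distr) (auto simp: space_pair_measure)
    also have "\<dots> = ennreal ((u - l) \<bullet> e1) * ennreal ((u - l) \<bullet> e2)"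
      using le[OF e1_Basis] le[OF e2_Basis] by (subst lborel.emeasure_pair_measure_Times) (auto simp: inner_simps)
    also have "\<dots> = ennreal (\<Prod>b\<in>Basis. (u - l) \<bullet> b)"
      using le[OF e1_Basis] le[OF e2_Basis] ne by (simp add: basis ennreal_mult inner_simps)
    finally show "emeasure (distr (lborel \<Otimes>\<^sub>M lborel) borel ?T) (box l u) = ennreal (\<Prod>b\<in>Basis. (u - l) \<bullet> b)" .
  qed simp
  have "(\<integral>\<^sup>+x. F x \<partial>lborel) = (\<integral>\<^sup>+z. F (?T z) \<partial>(lborel \<Otimes>\<^sub>M lborel))"
    by (subst eq) (simp add: nn_integral_distr)
  also have "\<dots> = (\<integral>\<^sup>+a. (\<integral>\<^sup>+b. F (pt p a b) \<partial>lborel) \<partial>lborel)"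
    by (subst lborel.nn_integral_fst[symmetric]) (auto simp: split_def)
  finally show ?thesis .
qed

text \<open>The maximum norm about \<open>p\<close> in the coordinates. Its level sets are squares
  with sides parallel to the axes, so averaging over them needs only Fubini, not polar
  coordinates.\<close>

definition sq :: "'a \<Rightarrow> 'a \<Rightarrow> real" where "sq p x = max \<bar>(x - p) \<bullet> e1\<bar> \<bar>(x - p) \<bullet> e2\<bar>"

lemma sq_continuous: "continuous_on A (sq p)"
  unfolding sq_def by (intro continuous_intros)

lemma sq_le_norm: "sq p x \<le> norm (x - p)"
  unfolding sq_def using Basis_le_norm[OF e1_Basis, of "x - p"] Basis_le_norm[OF e2_Basis, of "x - p"] by simp

lemma norm_le_sq: "norm (x - p) \<le> 2 * sq p x"
proof -
  have "norm (x - p) \<le> (\<Sum>b\<in>Basis. \<bar>(x - p) \<bullet> b\<bar>)" by (rule norm_le_l1)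
  then show ?thesis using ne unfolding basis sq_def by simp
qed

text \<open>If every size \<open>s\<close> between \<open>R\<close> and \<open>\<Lambda> * R\<close>
  carried tangential energy above \<open>\<kappa> / s\<close>, integration over \<open>s\<close>
  would give \<open>\<kappa> * ln \<Lambda> \<le> 4 * E\<close>. On the square found, each side has
  oscillation at most \<open>sqrt (2 * \<kappa>)\<close>, and every boundary point is reached from
  the corner along at most two sides.\<close>

lemma quiet_square:
  fixes f :: "'a \<Rightarrow> complex" and f' :: "'a \<Rightarrow> 'a \<Rightarrow> complex"
  assumes d: "\<And>x. (f has_derivative (\<lambda>v. \<Sum>b\<in>Basis. (v \<bullet> b) *\<^sub>R f' b x)) (at x)"
    and c: "\<And>b. b \<in> Basis \<Longrightarrow> continuous_on UNIV (f' b)"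
    and e: "\<And>b. b \<in> Basis \<Longrightarrow> (\<integral>\<^sup>+x. ennreal ((cmod (f' b x))\<^sup>2) \<partial>lborel) \<le> ennreal E" and E: "E \<ge> 0"
    and R: "R > 0" and \<kappa>: "\<kappa> > 0" and \<Lambda>: "\<Lambda> > 1" "4 * E < \<kappa> * ln \<Lambda>"
  obtains s where "R < s" "s < \<Lambda> * R" "\<And>x. sq p x = s \<Longrightarrow> cmod (f x - f (pt p s s)) \<le> 2 * sqrt (2 * \<kappa>)"
proof -
  have cont: "continuous_on UNIV (\<lambda>t. f' b (p + t *\<^sub>R v + w))" if "b \<in> Basis" for b v w
    by (rule continuous_on_compose2[OF c[OF that]]) (auto intro!: continuous_intros)
  have [measurable]: "f' e1 \<in> borel_measurable borel" "f' e2 \<in> borel_measurable borel"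
    using c e1_Basis e2_Basis by (auto intro: borel_measurable_continuous_onI)
  have mpt[measurable]: "(\<lambda>z::real\<times>real. pt p (fst z) (snd z)) \<in> borel_measurable (lborel \<Otimes>\<^sub>M lborel)" unfolding pt_def by measurable
  have mpt2[measurable]: "(\<lambda>z::real\<times>real. pt p (snd z) (fst z)) \<in> borel_measurable (lborel \<Otimes>\<^sub>M lborel)" unfolding pt_def by measurable
  have mpt3[measurable]: "(\<lambda>b. pt p a b) \<in> borel_measurable borel" "(\<lambda>b. pt p b a) \<in> borel_measurable borel" for a
    unfolding pt_def by measurable
  let ?v = "\<lambda>a s. \<integral>\<^sup>+b. indicator {-s..s} b * ennreal ((cmod (f' e2 (pt p a b)))\<^sup>2) \<partial>lborel"
  let ?w = "\<lambda>b s. \<integral>\<^sup>+a. indicator {-s..s} a * ennreal ((cmod (f' e1 (pt p a b)))\<^sup>2) \<partial>lborel"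
  \<comment> \<open>Integrals over whole lines rather than sides. They bound the side integrals and
    depend on a single variable, so integrating over \<open>s\<close> gives at most \<open>E\<close>
    for each of the four families of sides.\<close>
  let ?V = "\<lambda>a. \<integral>\<^sup>+b. ennreal ((cmod (f' e2 (pt p a b)))\<^sup>2) \<partial>lborel"
  let ?W = "\<lambda>b. \<integral>\<^sup>+a. ennreal ((cmod (f' e1 (pt p a b)))\<^sup>2) \<partial>lborel"
  have mV[measurable]: "?V \<in> borel_measurable borel"
    using lborel.borel_measurable_nn_integral_fst[of "\<lambda>z. ennreal ((cmod (f' e2 (pt p (fst z) (snd z))))\<^sup>2)" lborel] by simp
  have mW[measurable]: "?W \<in> borel_measurable borel"
    using lborel.borel_measurable_nn_integral_fst[of "\<lambda>z. ennreal ((cmod (f' e1 (pt p (snd z) (fst z))))\<^sup>2)" lborel] by simp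
  have V: "(\<integral>\<^sup>+a. ?V a \<partial>lborel) \<le> ennreal E"
    using e[OF e2_Basis] nn_integral_planar[of "\<lambda>x. ennreal ((cmod (f' e2 x))\<^sup>2)" p] by simp
  have W: "(\<integral>\<^sup>+b. ?W b \<partial>lborel) \<le> ennreal E"
  proof -
    have "(\<integral>\<^sup>+b. ?W b \<partial>lborel) = (\<integral>\<^sup>+a. (\<integral>\<^sup>+b. ennreal ((cmod (f' e1 (pt p a b)))\<^sup>2) \<partial>lborel) \<partial>lborel)"
      by (rule lborel_pair.Fubini') (simp add: split_def)
    then show ?thesis using e[OF e1_Basis] nn_integral_planar[of "\<lambda>x. ennreal ((cmod (f' e1 x))\<^sup>2)" p] by simp
  qed
  have refl: "(\<integral>\<^sup>+a. H (- a) \<partial>lborel) = (\<integral>\<^sup>+a. H a \<partial>lborel)" if [measurable]: "H \<in> borel_measurable borel" for H :: "real \<Rightarrow> ennreal"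
    using nn_integral_real_affine[of H "-1" 0] by simp
  have "\<exists>s. R < s \<and> s < \<Lambda> * R \<and> ?V s + ?V (- s) + ?W s + ?W (- s) \<le> ennreal (\<kappa> / s)"
  proof (rule ccontr)
    assume "\<not> ?thesis"
    then have big: "ennreal (\<kappa> / s) \<le> ?V s + ?V (- s) + ?W s + ?W (- s)" if "R < s" "s < \<Lambda> * R" for s
      using that by (meson le_cases)
    have RL: "R \<le> \<Lambda> * R" using R \<Lambda> by simp
    have "(\<integral>\<^sup>+s. ennreal (\<kappa> / s) * indicator {R..\<Lambda> * R} s \<partial>lborel) = ennreal (\<kappa> * ln (\<Lambda> * R) - \<kappa> * ln R)"
    proof (rule nn_integral_FTC_Icc[where F="\<lambda>x. \<kappa> * ln x"])
      show "((\<lambda>x. \<kappa> * ln x) has_real_derivative \<kappa> / x) (at x)" if "x \<in> {R..\<Lambda> * R}" for x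
        using that R by (auto intro!: derivative_eq_intros)
    qed (use R \<kappa> RL in auto)
    also have "\<kappa> * ln (\<Lambda> * R) - \<kappa> * ln R = \<kappa> * ln \<Lambda>" using R \<Lambda> by (simp add: ln_mult algebra_simps)
    finally have "ennreal (\<kappa> * ln \<Lambda>) = (\<integral>\<^sup>+s. ennreal (\<kappa> / s) * indicator {R..\<Lambda> * R} s \<partial>lborel)" by simp
    also have "\<dots> \<le> (\<integral>\<^sup>+s. ?V s + ?V (- s) + ?W s + ?W (- s) \<partial>lborel)"
    proof (rule nn_integral_mono_AE)
      have "AE s in lborel. s \<noteq> R" "AE s in lborel. s \<noteq> \<Lambda> * R" by (rule AE_lborel_singleton)+
      then show "AE s in lborel. ennreal (\<kappa> / s) * indicator {R..\<Lambda> * R} s \<le> ?V s + ?V (- s) + ?W s + ?W (- s)"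
      proof eventually_elim
        case (elim s)
        then show ?case using big[of s] by (auto simp: indicator_def)
      qed
    qed
    also have "\<dots> = (\<integral>\<^sup>+s. ?V s \<partial>lborel) + (\<integral>\<^sup>+s. ?V (- s) \<partial>lborel) + (\<integral>\<^sup>+s. ?W s \<partial>lborel) + (\<integral>\<^sup>+s. ?W (- s) \<partial>lborel)"
      using mV mW measurable_compose[OF _ mV, of uminus borel] measurable_compose[OF _ mW, of uminus borel]
      by (simp add: nn_integral_add)
    also have "\<dots> \<le> ennreal E + ennreal E + ennreal E + ennreal E"
      unfolding refl[OF mV] refl[OF mW] by (intro add_mono V W)
    also have "\<dots> = ennreal (4 * E)" using E by (simp add: ennreal_plus[symmetric] del: ennreal_plus)
    finally show False using \<Lambda> E by (simp add: ennreal_le_iff2)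
  qed
  then obtain s where s: "R < s" "s < \<Lambda> * R" and q: "?V s + ?V (- s) + ?W s + ?W (- s) \<le> ennreal (\<kappa> / s)" by blast
  have s0: "s > 0" using s R by simp
  have vle: "?v a s \<le> ?V a" and wle: "?w a s \<le> ?W a" for a
    by (intro nn_integral_mono; auto simp: indicator_def)+
  have part: "A \<le> ennreal (\<kappa> / s)" if "A \<le> B" "B + C + D + F \<le> ennreal (\<kappa> / s) \<or> C + B + D + F \<le> ennreal (\<kappa> / s) \<or> C + D + B + F \<le> ennreal (\<kappa> / s) \<or> C + D + F + B \<le> ennreal (\<kappa> / s)"
    for A B C D F :: ennreal
  proof -
    have "B \<le> ennreal (\<kappa> / s)"
      using that(2) by (elim disjE) (erule order_trans[rotated], simp add: add_increasing add_increasing2)+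
    then show ?thesis using that(1) by (rule order_trans[rotated])
  qed
  have q4: "?v s s \<le> ennreal (\<kappa> / s)" "?v (- s) s \<le> ennreal (\<kappa> / s)" "?w s s \<le> ennreal (\<kappa> / s)" "?w (- s) s \<le> ennreal (\<kappa> / s)"
    using part[OF vle[of s]] part[OF vle[of "- s"]] part[OF wle[of s]] part[OF wle[of "- s"]] q by blast+
  have dv: "((\<lambda>b. f (pt p a b)) has_vector_derivative f' e2 (pt p a b)) (at b)" for a b
  proof -
    have "((\<lambda>b. f (pt p a b)) has_derivative (\<lambda>t. \<Sum>b'\<in>Basis. ((t *\<^sub>R e2) \<bullet> b') *\<^sub>R f' b' (pt p a b))) (at b)"
      by (rule has_derivative_compose[OF _ d]) (auto intro!: derivative_eq_intros simp: pt_def)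
    then show ?thesis using ne by (simp add: has_vector_derivative_def basis planar_inner)
  qed
  have dw: "((\<lambda>a. f (pt p a b)) has_vector_derivative f' e1 (pt p a b)) (at a)" for a b
  proof -
    have "((\<lambda>a. f (pt p a b)) has_derivative (\<lambda>t. \<Sum>b'\<in>Basis. ((t *\<^sub>R e1) \<bullet> b') *\<^sub>R f' b' (pt p a b))) (at a)"
      by (rule has_derivative_compose[OF _ d]) (auto intro!: derivative_eq_intros simp: pt_def)
    then show ?thesis using ne by (simp add: has_vector_derivative_def basis planar_inner)
  qed
  have cv: "continuous_on UNIV (\<lambda>b. f' e2 (pt p a b))" "continuous_on UNIV (\<lambda>b. f' e1 (pt p b a))" for a
    unfolding pt_def by (rule continuous_on_compose2[OF c[OF e2_Basis]] continuous_on_compose2[OF c[OF e1_Basis]]; auto intro!: continuous_intros)+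
  have \<kappa>0: "\<kappa> \<ge> 0" using \<kappa> by simp
  have right: "cmod (f (pt p s b) - f (pt p s b')) \<le> sqrt (2 * \<kappa>)" if "b \<in> {-s..s}" "b' \<in> {-s..s}" for b b'
    by (rule oscillation_L2[OF dv cv(1) s0 q4(1) \<kappa>0 that])
  have left: "cmod (f (pt p (-s) b) - f (pt p (-s) b')) \<le> sqrt (2 * \<kappa>)" if "b \<in> {-s..s}" "b' \<in> {-s..s}" for b b'
    by (rule oscillation_L2[OF dv cv(1) s0 q4(2) \<kappa>0 that])
  have upper: "cmod (f (pt p a s) - f (pt p a' s)) \<le> sqrt (2 * \<kappa>)" if "a \<in> {-s..s}" "a' \<in> {-s..s}" for a a'
    by (rule oscillation_L2[OF dw cv(2) s0 q4(3) \<kappa>0 that])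
  have lower: "cmod (f (pt p a (-s)) - f (pt p a' (-s))) \<le> sqrt (2 * \<kappa>)" if "a \<in> {-s..s}" "a' \<in> {-s..s}" for a a'
    by (rule oscillation_L2[OF dw cv(2) s0 q4(4) \<kappa>0 that])
  have k0: "sqrt (2 * \<kappa>) \<ge> 0" using \<kappa> by simp
  show ?thesis
  proof (rule that[OF s])
    fix x assume x: "sq p x = s"
    define a where "a = (x - p) \<bullet> e1"
    define b where "b = (x - p) \<bullet> e2"
    have xab: "x = pt p a b" by (simp add: a_def b_def pt_coords)
    have ab: "a \<in> {-s..s}" "b \<in> {-s..s}" "\<bar>a\<bar> = s \<or> \<bar>b\<bar> = s" using x unfolding sq_def a_def b_def by (auto simp: max_def split: if_splits)
    have ss: "s \<in> {-s..s}" "- s \<in> {-s..s}" using s0 by auto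
    consider "a = s" | "a = - s" | "b = s" | "b = - s" using ab(3) by linarith
    then show "cmod (f x - f (pt p s s)) \<le> 2 * sqrt (2 * \<kappa>)"
    proof cases
      case 1
      have "cmod (f x - f (pt p s s)) \<le> sqrt (2 * \<kappa>)" using right[OF ab(2) ss(1)] 1 by (simp add: xab)
      then show ?thesis using k0 by linarith
    next
      case 2
      have "cmod (f x - f (pt p s s)) \<le> cmod (f x - f (pt p (-s) s)) + cmod (f (pt p (-s) s) - f (pt p s s))"
        using norm_triangle_ineq[of "f x - f (pt p (-s) s)" "f (pt p (-s) s) - f (pt p s s)"] by simp
      moreover have "cmod (f x - f (pt p (-s) s)) \<le> sqrt (2 * \<kappa>)" using left[OF ab(2) ss(1)] 2 by (simp add: xab)
      ultimately show ?thesis using upper[OF ss(2,1)] by linarith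
    next
      case 3
      have "cmod (f x - f (pt p s s)) \<le> sqrt (2 * \<kappa>)" using upper[OF ab(1) ss(1)] 3 by (simp add: xab)
      then show ?thesis using k0 by linarith
    next
      case 4
      have "cmod (f x - f (pt p s s)) \<le> cmod (f x - f (pt p s (-s))) + cmod (f (pt p s (-s)) - f (pt p s s))"
        using norm_triangle_ineq[of "f x - f (pt p s (-s))" "f (pt p s (-s)) - f (pt p s s)"] by simp
      moreover have "cmod (f x - f (pt p s (-s))) \<le> sqrt (2 * \<kappa>)" using lower[OF ab(1) ss(1)] 4 by (simp add: xab)
      ultimately show ?thesis using right[OF ss(2,1)] by linarith
    qed
  qed
qed

text \<open>This is where the absence of winding is used. The boundary values of each square lie in
  a disc that omits 0, so they extend into the square without zeros; the squares are treated one
  after the other.\<close>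

lemma planar_fill:
  fixes f :: "'a \<Rightarrow> complex"
  assumes f: "continuous_on UNIV f" and P: "finite P"
    and disj: "\<And>p q x. p \<in> P \<Longrightarrow> q \<in> P \<Longrightarrow> p \<noteq> q \<Longrightarrow> sq p x \<le> s p \<Longrightarrow> sq q x > s q"
    and bd: "\<And>p x. p \<in> P \<Longrightarrow> sq p x = s p \<Longrightarrow> f x \<in> ball (c p) (cmod (c p))" and c: "\<And>p. p \<in> P \<Longrightarrow> c p \<noteq> 0"
  shows "\<exists>F. continuous_on UNIV F \<and> (\<forall>x. (\<forall>p\<in>P. sq p x > s p) \<longrightarrow> F x = f x) \<and> (\<forall>p\<in>P. \<forall>x. sq p x \<le> s p \<longrightarrow> F x \<noteq> 0)"
  using P disj bd c
proof (induction P rule: finite_induct)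
  case empty
  then show ?case using f by (intro exI[of _ f]) auto
next
  case (insert p P)
  have "\<exists>F. continuous_on UNIV F \<and> (\<forall>x. (\<forall>p\<in>P. sq p x > s p) \<longrightarrow> F x = f x) \<and> (\<forall>p\<in>P. \<forall>x. sq p x \<le> s p \<longrightarrow> F x \<noteq> 0)"
    by (rule insert.IH) (use insert.prems in auto)
  then obtain F0 where F0: "continuous_on UNIV F0" "\<And>x. (\<And>p. p \<in> P \<Longrightarrow> sq p x > s p) \<Longrightarrow> F0 x = f x"
    "\<And>p x. p \<in> P \<Longrightarrow> sq p x \<le> s p \<Longrightarrow> F0 x \<noteq> 0" by blast
  have eqf: "F0 x = f x" if "sq p x \<le> s p" for x
    using insert.prems(1)[of p _ x] insert.hyps(2) that by (intro F0(2)) auto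
  let ?S = "{x. sq p x = s p}"
  have clS: "closed ?S" by (intro closed_Collect_eq sq_continuous continuous_on_const)
  \<comment> \<open>The extension keeps its values in the convex disc, and 0 is not in the open disc
    because its radius is the modulus of its centre.\<close>
  obtain w where w: "continuous_on UNIV w" "w ` UNIV \<subseteq> ball (c p) (cmod (c p))" "\<And>x. x \<in> ?S \<Longrightarrow> w x = f x"
  proof (rule Dugundji[of "ball (c p) (cmod (c p))" UNIV ?S f])
    show "ball (c p) (cmod (c p)) \<noteq> {}" using insert.prems(3)[of p] by simp
    show "closedin (top_of_set UNIV) ?S" using clS by simp
    show "continuous_on ?S f" using f by (rule continuous_on_subset) simp
    show "f ` ?S \<subseteq> ball (c p) (cmod (c p))" using insert.prems(2)[of p] by blast
  qed auto
  have w0: "w x \<noteq> 0" for x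
  proof
    assume "w x = 0"
    then have "0 \<in> ball (c p) (cmod (c p))" using w(2) by (metis UNIV_I imageI subsetD)
    then show False by simp
  qed
  let ?F = "\<lambda>x. if sq p x \<le> s p then w x else F0 x"
  have "continuous_on ({x. sq p x \<le> s p} \<union> {x. s p \<le> sq p x}) ?F"
  proof (rule continuous_on_cases)
    show "closed {x. sq p x \<le> s p}" "closed {x. s p \<le> sq p x}"
      by (intro closed_Collect_le sq_continuous continuous_on_const)+
    show "continuous_on {x. sq p x \<le> s p} w" "continuous_on {x. s p \<le> sq p x} F0"
      using w(1) F0(1) by (auto intro: continuous_on_subset)
    show "\<forall>x. x \<in> {x. sq p x \<le> s p} \<and> \<not> sq p x \<le> s p \<or> x \<in> {x. s p \<le> sq p x} \<and> sq p x \<le> s p \<longrightarrow> w x = F0 x"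
      using w(3) eqf by auto
  qed
  moreover have "{x. sq p x \<le> s p} \<union> {x. s p \<le> sq p x} = UNIV" by auto
  ultimately have cF: "continuous_on UNIV ?F" by simp
  show ?case
  proof (intro exI[of _ ?F] conjI allI impI ballI)
    show "continuous_on UNIV ?F" by (rule cF)
    show "?F x = f x" if "\<forall>q\<in>insert p P. s q < sq q x" for x using that F0(2)[of x] by auto
    show "?F x \<noteq> 0" if "q \<in> insert p P" "sq q x \<le> s q" for q x
      using that w0[of x] F0(3)[of q x] insert.prems(1)[of p q x] insert.hyps(2) by (cases "q = p") auto
  qed
qed

end

section \<open>Cutting off the planar phase near the clusters\<close>

context planar
begin

lemma dim2: "DIM('a) = 2"
  using ne by (simp add: basis)

text \<open>A point at distance \<open>\<rho>\<close> of \<open>p\<close> is joined to $p + 2 a e_1$ by an arc and a radial segment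
  on which \<open>g\<close> is differentiable.\<close>
lemma annulus_oscillation:
  fixes g :: "'a \<Rightarrow> real"
  assumes a: "a > 0" and K: "K \<ge> 0"
    and d: "\<And>y. 2 * a \<le> norm (y - p) \<Longrightarrow> norm (y - p) \<le> 3 * a \<Longrightarrow> (g has_derivative g' y) (at y)"
    and b: "\<And>y v. 2 * a \<le> norm (y - p) \<Longrightarrow> norm (y - p) \<le> 3 * a \<Longrightarrow> \<bar>g' y v\<bar> \<le> K * norm v"
    and x: "2 * a \<le> norm (x - p)" "norm (x - p) \<le> 3 * a"
  shows "\<bar>g x - g (p + (2 * a) *\<^sub>R e1)\<bar> \<le> 22 * K * a"
proof -
  define \<rho> where "\<rho> = norm (x - p)"
  have \<rho>: "2 * a \<le> \<rho>" "\<rho> \<le> 3 * a" "\<rho> > 0" using x a by (auto simp: \<rho>_def)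
  have nsq: "(norm (\<alpha> *\<^sub>R e1 + \<beta> *\<^sub>R e2))\<^sup>2 = \<alpha>\<^sup>2 + \<beta>\<^sup>2" for \<alpha> \<beta>
    unfolding power2_norm_eq_inner by (simp add: inner_simps planar_inner power2_eq_square)
  have "((x - p) \<bullet> e1 / \<rho>)\<^sup>2 + ((x - p) \<bullet> e2 / \<rho>)\<^sup>2 = 1"
  proof -
    have "((x - p) \<bullet> e1)\<^sup>2 + ((x - p) \<bullet> e2)\<^sup>2 = \<rho>\<^sup>2"
      unfolding \<rho>_def using nsq[of "(x - p) \<bullet> e1" "(x - p) \<bullet> e2"] planar_representation[of "x - p"] by simp
    then show ?thesis using \<rho> by (simp add: power_divide add_divide_distrib[symmetric])
  qed
  then obtain t where t: "0 \<le> t" "t < 2 * pi" "(x - p) \<bullet> e1 / \<rho> = cos t" "(x - p) \<bullet> e2 / \<rho> = sin t"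
    using sincos_total_2pi by metis
  define c where "c \<tau> = p + \<rho> *\<^sub>R (cos \<tau> *\<^sub>R e1 + sin \<tau> *\<^sub>R e2)" for \<tau>
  have cn: "norm (c \<tau> - p) = \<rho>" for \<tau>
  proof -
    have "(norm (cos \<tau> *\<^sub>R e1 + sin \<tau> *\<^sub>R e2))\<^sup>2 = 1" unfolding nsq by simp
    then have "norm (cos \<tau> *\<^sub>R e1 + sin \<tau> *\<^sub>R e2) = 1" by (simp add: power2_eq_1_iff) (smt (verit) norm_ge_zero)
    then show ?thesis using \<rho> by (simp add: c_def)
  qed
  have ct: "c t = x"
  proof -
    have "\<rho> *\<^sub>R (cos t *\<^sub>R e1 + sin t *\<^sub>R e2) = ((x - p) \<bullet> e1) *\<^sub>R e1 + ((x - p) \<bullet> e2) *\<^sub>R e2"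
      using t \<rho> by (simp add: scaleR_add_right field_simps)
    then show ?thesis using planar_representation[of "x - p"] by (simp add: c_def)
  qed
  have dc: "(c has_derivative (\<lambda>s. s *\<^sub>R (\<rho> *\<^sub>R ((- sin \<tau>) *\<^sub>R e1 + cos \<tau> *\<^sub>R e2)))) (at \<tau> within {0..t})" for \<tau>
    unfolding c_def by (auto intro!: derivative_eq_intros simp: algebra_simps)
  have nd: "norm (\<rho> *\<^sub>R ((- sin \<tau>) *\<^sub>R e1 + cos \<tau> *\<^sub>R e2)) = \<rho>" for \<tau>
  proof -
    have "(norm ((- sin \<tau>) *\<^sub>R e1 + cos \<tau> *\<^sub>R e2))\<^sup>2 = 1" unfolding nsq by simp
    then have "norm ((- sin \<tau>) *\<^sub>R e1 + cos \<tau> *\<^sub>R e2) = 1" by (simp add: power2_eq_1_iff) (smt (verit) norm_ge_zero)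
    then show ?thesis using \<rho> by simp
  qed
  have arc: "norm (g (c t) - g (c 0)) \<le> (K * \<rho>) * norm (t - 0)"
  proof (rule differentiable_bound[of "{0..t}" "\<lambda>\<tau>. g (c \<tau>)"])
    fix \<tau> assume "\<tau> \<in> {0..t}"
    show "((\<lambda>\<tau>. g (c \<tau>)) has_derivative (\<lambda>s. g' (c \<tau>) (s *\<^sub>R (\<rho> *\<^sub>R ((- sin \<tau>) *\<^sub>R e1 + cos \<tau> *\<^sub>R e2))))) (at \<tau> within {0..t})"
      by (rule has_derivative_compose[OF dc d]) (use \<rho> cn in auto)
    show "onorm (\<lambda>s. g' (c \<tau>) (s *\<^sub>R (\<rho> *\<^sub>R ((- sin \<tau>) *\<^sub>R e1 + cos \<tau> *\<^sub>R e2)))) \<le> K * \<rho>"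
    proof (rule onorm_le)
      fix s
      have "norm (g' (c \<tau>) (s *\<^sub>R (\<rho> *\<^sub>R ((- sin \<tau>) *\<^sub>R e1 + cos \<tau> *\<^sub>R e2)))) \<le> K * norm (s *\<^sub>R (\<rho> *\<^sub>R ((- sin \<tau>) *\<^sub>R e1 + cos \<tau> *\<^sub>R e2)))"
        unfolding real_norm_def by (rule b) (use \<rho> cn in auto)
      also have "\<dots> = K * \<rho> * norm s" unfolding norm_scaleR[of s] nd by simp
      finally show "norm (g' (c \<tau>) (s *\<^sub>R (\<rho> *\<^sub>R ((- sin \<tau>) *\<^sub>R e1 + cos \<tau> *\<^sub>R e2)))) \<le> K * \<rho> * norm s" .
    qed
  qed (use t in auto)
  have radial: "norm (g (p + \<rho> *\<^sub>R e1) - g (p + (2 * a) *\<^sub>R e1)) \<le> K * norm (\<rho> - 2 * a)"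
  proof (rule differentiable_bound[of "{2 * a..\<rho>}" "\<lambda>\<tau>. g (p + \<tau> *\<^sub>R e1)"])
    fix \<tau> assume \<tau>: "\<tau> \<in> {2 * a..\<rho>}"
    have n: "norm (p + \<tau> *\<^sub>R e1 - p) = \<tau>" using \<tau> a e1_Basis[where 'a='a] by simp
    show "((\<lambda>\<tau>. g (p + \<tau> *\<^sub>R e1)) has_derivative (\<lambda>s. g' (p + \<tau> *\<^sub>R e1) (s *\<^sub>R e1))) (at \<tau> within {2 * a..\<rho>})"
      by (rule has_derivative_compose[OF _ d]) (use \<tau> \<rho> n in \<open>auto intro!: derivative_eq_intros\<close>)
    show "onorm (\<lambda>s. g' (p + \<tau> *\<^sub>R e1) (s *\<^sub>R e1)) \<le> K"
    proof (rule onorm_le)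
      fix s :: real
      have "norm (g' (p + \<tau> *\<^sub>R e1) (s *\<^sub>R e1)) \<le> K * norm (s *\<^sub>R (e1::'a))"
        unfolding real_norm_def by (rule b) (use \<tau> \<rho> n in auto)
      then show "norm (g' (p + \<tau> *\<^sub>R e1) (s *\<^sub>R e1)) \<le> K * norm s" using e1_Basis[where 'a='a] by simp
    qed
  qed (use \<rho> in auto)
  have c0: "c 0 = p + \<rho> *\<^sub>R e1" by (simp add: c_def)
  have "\<bar>g x - g (p + (2 * a) *\<^sub>R e1)\<bar> \<le> (K * \<rho>) * t + K * (\<rho> - 2 * a)"
    using arc radial t \<rho> unfolding ct c0 by simp
  \<comment> \<open>The angle is less than 2 pi, hence less than 7, on a circle of radius at most
    \<open>3 * a\<close>; the radial segment has length at most \<open>a\<close>.\<close>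
  also have "\<dots> \<le> (K * (3 * a)) * 7 + K * a"
    using t \<rho> K a pi_less_4 pi_approx by (intro add_mono mult_mono mult_left_mono) auto
  finally show ?thesis by simp
qed

text \<open>The argument of \<open>sstep\<close> is 0 at distance \<open>2 * a\<close> and 1 at
  distance \<open>3 * a\<close> from \<open>p\<close>. Using the squared distance keeps the formula
  differentiable at \<open>p\<close>.\<close>

definition bump :: "real \<Rightarrow> 'a \<Rightarrow> 'a \<Rightarrow> real" where
  "bump a p x = 1 - sstep (((norm (x - p))\<^sup>2 / a\<^sup>2 - 4) / 5)"

definition bump' :: "real \<Rightarrow> 'a \<Rightarrow> 'a \<Rightarrow> 'a \<Rightarrow> real" where
  "bump' a p x v = - (sstep' (((norm (x - p))\<^sup>2 / a\<^sup>2 - 4) / 5) * (2 * ((x - p) \<bullet> v) / a\<^sup>2 / 5))"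

lemma bump_has_derivative: "(bump a p has_derivative bump' a p x) (at x)"
proof -
  have "((\<lambda>x. ((x - p) \<bullet> (x - p) / a\<^sup>2 - 4) / 5) has_derivative (\<lambda>v. 2 * ((x - p) \<bullet> v) / a\<^sup>2 / 5)) (at x)"
  proof -
    have "((\<lambda>x. (x - p) \<bullet> (x - p)) has_derivative (\<lambda>v. 2 * ((x - p) \<bullet> v))) (at x)"
      by (auto intro!: derivative_eq_intros simp: inner_commute)
    from has_derivative_diff[OF bounded_linear.has_derivative[OF bounded_linear_divide this] has_derivative_const]
    have "((\<lambda>x. (x - p) \<bullet> (x - p) / a\<^sup>2 - 4) has_derivative (\<lambda>v. 2 * ((x - p) \<bullet> v) / a\<^sup>2 - 0)) (at x)" .
    from bounded_linear.has_derivative[OF bounded_linear_divide this] show ?thesis by simp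
  qed
  then have "((\<lambda>x. 1 - sstep (((x - p) \<bullet> (x - p) / a\<^sup>2 - 4) / 5)) has_derivative
      (\<lambda>v. 0 - sstep' (((x - p) \<bullet> (x - p) / a\<^sup>2 - 4) / 5) * (2 * ((x - p) \<bullet> v) / a\<^sup>2 / 5))) (at x)"
    by (intro has_derivative_diff has_derivative_const sstep_compose_has_derivative)
  then show ?thesis by (simp add: bump_def[abs_def] bump'_def[abs_def] power2_norm_eq_inner)
qed

lemma bump_range: "0 \<le> bump a p x" "bump a p x \<le> 1"
  using sstep_le_1 sstep_nonneg by (simp_all add: bump_def)

lemma bump_inside: "a > 0 \<Longrightarrow> norm (x - p) \<le> 2 * a \<Longrightarrow> bump a p x = 1 \<and> bump' a p x v = 0"
proof -
  assume a: "a > 0" and n: "norm (x - p) \<le> 2 * a"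
  have "(norm (x - p))\<^sup>2 \<le> (2 * a)\<^sup>2" using n by (intro power_mono) auto
  then have "(norm (x - p))\<^sup>2 / a\<^sup>2 \<le> 4" using a by (simp add: power_mult_distrib divide_le_eq)
  then show ?thesis by (simp add: bump_def bump'_def sstep_def sstep'_def)
qed

lemma bump_outside: "a > 0 \<Longrightarrow> norm (x - p) \<ge> 3 * a \<Longrightarrow> bump a p x = 0 \<and> bump' a p x v = 0"
proof -
  assume a: "a > 0" and n: "norm (x - p) \<ge> 3 * a"
  have "(3 * a)\<^sup>2 \<le> (norm (x - p))\<^sup>2" using n a by (intro power_mono) auto
  then have "(norm (x - p))\<^sup>2 / a\<^sup>2 \<ge> 9" using a by (simp add: power_mult_distrib le_divide_eq)
  then show ?thesis by (simp add: bump_def bump'_def sstep_def sstep'_def)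
qed

lemma bump'_bound: "a \<ge> 4 \<Longrightarrow> b \<in> Basis \<Longrightarrow> \<bar>bump' a p x b\<bar> \<le> 1"
proof (cases "norm (x - p) < 3 * a")
  case True
  assume a: "a \<ge> 4" and b: "b \<in> Basis"
  have "\<bar>(x - p) \<bullet> b\<bar> \<le> 3 * a" using Basis_le_norm[OF b, of "x - p"] True by linarith
  then have "\<bar>2 * ((x - p) \<bullet> b) / a\<^sup>2 / 5\<bar> \<le> 2 * (3 * a) / a\<^sup>2 / 5"
    using a by (simp add: abs_mult divide_right_mono)
  also have "\<dots> = 6 / (5 * a)" using a by (simp add: power2_eq_square field_simps)
  also have "\<dots> \<le> 6 / (5 * 4)" using a by (intro divide_left_mono) auto
  finally have *: "\<bar>2 * ((x - p) \<bullet> b) / a\<^sup>2 / 5\<bar> \<le> 3/10" by simp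
  have "\<bar>bump' a p x b\<bar> = sstep' (((norm (x - p))\<^sup>2 / a\<^sup>2 - 4) / 5) * \<bar>2 * ((x - p) \<bullet> b) / a\<^sup>2 / 5\<bar>"
    unfolding bump'_def abs_minus_cancel abs_mult[of "sstep' _"] by (simp add: sstep'_nonneg)
  also have "\<dots> \<le> (3/2) * (3/10)" by (intro mult_mono sstep'_le *) auto
  finally show ?thesis by simp
next
  case False
  assume "a \<ge> 4"
  then show ?thesis using bump_outside[of a x p b] False by simp
qed

lemma planar_phase:
  fixes E L \<nu> :: real and n :: nat
  assumes E: "E \<ge> 0" and L0: "L \<ge> 0" and \<nu>: "\<nu> \<le> 1/2"
  shows "\<exists>C\<ge>0. \<forall>(f :: 'a \<Rightarrow> complex) (f' :: 'a \<Rightarrow> 'a \<Rightarrow> complex) P.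
    (\<forall>x. (f has_derivative (\<lambda>v. \<Sum>b\<in>Basis. (v \<bullet> b) *\<^sub>R f' b x)) (at x)) \<longrightarrow>
    (\<forall>b\<in>Basis. continuous_on UNIV (f' b)) \<longrightarrow>
    (\<forall>b\<in>Basis. (\<integral>\<^sup>+x. ennreal ((cmod (f' b x))\<^sup>2) \<partial>lborel) \<le> ennreal E) \<longrightarrow>
    (\<forall>b\<in>Basis. \<forall>x. cmod (f' b x) \<le> L) \<longrightarrow> finite P \<longrightarrow> card P \<le> n \<longrightarrow>
    (\<forall>S. connected S \<longrightarrow> S \<in> sets borel \<longrightarrow> emeasure lborel S = \<infinity> \<longrightarrow> S \<inter> (\<Union>p\<in>P. cball p 4) = {} \<longrightarrow>
       (\<forall>x\<in>S. \<bar>cmod (f x) - 1\<bar> \<le> \<nu>)) \<longrightarrow>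
    (\<exists>B \<theta> \<theta>'. B \<in> sets borel \<and> emeasure lborel B \<le> ennreal C \<and> (\<forall>x. (\<theta> has_derivative \<theta>' x) (at x)) \<and>
       (\<forall>b\<in>Basis. \<forall>x\<in>B. \<bar>\<theta>' x b\<bar> \<le> C) \<and> (\<forall>x. x \<notin> B \<longrightarrow> \<bar>cmod (f x) - 1\<bar> \<le> \<nu>) \<and>
       (\<forall>b\<in>Basis. \<forall>x. x \<notin> B \<longrightarrow> \<theta>' x b = Im (f' b x / f x)) \<and> (\<forall>x\<in>B. cmod (f x) \<le> C))"
proof -
  \<comment> \<open>Makes the oscillation on a quiet square 1/8, less than the lower bound 1/2 for
    the modulus at its corner, so that the boundary values stay in the disc about the corner value
    that omits 0.\<close>
  define \<kappa> where "\<kappa> = (1/512::real)"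
  have \<kappa>: "\<kappa> > 0" "2 * sqrt (2 * \<kappa>) = 1/8"
  proof -
    have "sqrt (2 * \<kappa>) = sqrt ((1/16)\<^sup>2)" by (simp add: \<kappa>_def power2_eq_square)
    then show "\<kappa> > 0" "2 * sqrt (2 * \<kappa>) = 1/8" by (simp_all add: \<kappa>_def real_sqrt_abs)
  qed
  \<comment> \<open>Then \<open>\<kappa> * ln \<Lambda>\<close> equals \<open>4 * E + 1\<close>,
    just enough for a quiet square. The length of the annulus is therefore exponential in
    \<open>E\<close>.\<close>
  define \<Lambda> where "\<Lambda> = exp ((4 * E + 1) / \<kappa>)"
  have ln\<Lambda>: "4 * E < \<kappa> * ln \<Lambda>" using \<kappa> E by (simp add: \<Lambda>_def)
  have \<Lambda>1: "\<Lambda> > 1" unfolding \<Lambda>_def using \<kappa> E by simp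
  then have \<Lambda>: "\<Lambda> \<ge> 1" by simp
  obtain Rm where RmP: "4 \<le> Rm \<and> (\<forall>P::'a set. finite P \<and> card P \<le> n \<longrightarrow>
    (\<exists>R P'. 4 \<le> R \<and> R \<le> Rm \<and> P' \<subseteq> P \<and> (\<forall>p\<in>P. \<exists>p'\<in>P'. cball p 4 \<subseteq> cball p' R) \<and>
      (\<forall>p\<in>P'. \<forall>q\<in>P'. p \<noteq> q \<longrightarrow> dist p q > 8 * \<Lambda> * R)))"
    using cluster[OF \<Lambda>, of 4 n, where 'a='a] by (rule exE)
  define A where "A = \<Lambda> * Rm"
  have A0: "A \<ge> 4" unfolding A_def using RmP \<Lambda> mult_mono[of 1 \<Lambda> 4 Rm] by simp
  define C where "C = real n * (unit_ball_vol 2 * (3 * A)\<^sup>2) + (2 * L + 22 * (4 * L) * A) + (3/2 + 2 * (5 * A) * L)"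
  have uv: "unit_ball_vol (2::real) \<ge> 0" using unit_ball_vol_nonneg[of 2] by simp
  have C1: "real n * (unit_ball_vol 2 * (3 * A)\<^sup>2) \<le> C" "2 * L + 22 * (4 * L) * A \<le> C" "3/2 + 2 * (5 * A) * L \<le> C" "C \<ge> 0"
    using A0 L0 uv by (auto simp: C_def add_nonneg_nonneg)
  show ?thesis
  proof (intro exI[of _ C] conjI allI impI)
    show "C \<ge> 0" by (rule C1)
    fix f :: "'a \<Rightarrow> complex" and f' :: "'a \<Rightarrow> 'a \<Rightarrow> complex" and P :: "'a set"
    assume d0: "\<forall>x. (f has_derivative (\<lambda>v. \<Sum>b\<in>Basis. (v \<bullet> b) *\<^sub>R f' b x)) (at x)"
      and c: "\<forall>b\<in>Basis. continuous_on UNIV (f' b)"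
      and e: "\<forall>b\<in>Basis. (\<integral>\<^sup>+x. ennreal ((cmod (f' b x))\<^sup>2) \<partial>lborel) \<le> ennreal E"
      and L: "\<forall>b\<in>Basis. \<forall>x. cmod (f' b x) \<le> L" and P: "finite P" "card P \<le> n"
      and near0: "\<forall>S. connected S \<longrightarrow> S \<in> sets borel \<longrightarrow> emeasure lborel S = \<infinity> \<longrightarrow> S \<inter> (\<Union>p\<in>P. cball p 4) = {} \<longrightarrow>
       (\<forall>x\<in>S. \<bar>cmod (f x) - 1\<bar> \<le> \<nu>)"
    define D where "D x v = (\<Sum>b\<in>Basis. (v \<bullet> b) *\<^sub>R f' b x)" for x v
    have d: "(f has_derivative D x) (at x)" for x using d0 by (simp add: D_def[abs_def])
    have Db: "cmod (D x v) \<le> 2 * L * norm v" for x v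
    proof -
      have "cmod (D x v) \<le> (\<Sum>b\<in>(Basis::'a set). norm v * L)"
        unfolding D_def using L by (intro sum_norm_le) (auto intro!: mult_mono Basis_le_norm)
      then show ?thesis by (simp add: dim2 mult_ac)
    qed
    have DB: "D x b = f' b x" if b: "b \<in> Basis" for x b
    proof -
      have "D x b = (\<Sum>b'\<in>Basis. if b' = b then f' b x else 0)"
        unfolding D_def using b by (intro sum.cong refl) (auto simp: inner_Basis)
      then show ?thesis using b by simp
    qed
    have cf: "continuous_on UNIV f" using d by (meson continuous_at_imp_continuous_on has_derivative_continuous)
    obtain R P' where R: "4 \<le> R" "R \<le> Rm" "P' \<subseteq> P" "\<forall>p\<in>P. \<exists>p'\<in>P'. cball p 4 \<subseteq> cball p' R"
      and sep: "\<forall>p\<in>P'. \<forall>q\<in>P'. p \<noteq> q \<longrightarrow> dist p q > 8 * \<Lambda> * R"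
      using conjunct2[OF RmP, rule_format, of P] P by blast
    define a where "a = \<Lambda> * R"
    have aR: "R \<le> a" unfolding a_def using mult_right_mono[OF \<Lambda>, of R] R by simp
    have a4: "a \<ge> 4" "a > 0" using aR R by auto
    have aA: "a \<le> A" unfolding a_def A_def using R \<Lambda> by (intro mult_left_mono) auto
    have sep': "dist p q > 8 * a" if "p \<in> P'" "q \<in> P'" "p \<noteq> q" for p q using sep that by (auto simp: a_def mult.assoc)
    have fP': "finite P'" "card P' \<le> n" using R(3) P finite_subset card_mono[OF P(1) R(3)] by auto
    \<comment> \<open>The separation \<open>8 * a\<close> minus \<open>3 * a\<close>: the discs of
      radius \<open>3 * a\<close> are disjoint, and at most one bump is active at any point.\<close>
    have only: "norm (x - q) > 5 * a" if "p \<in> P'" "q \<in> P'" "p \<noteq> q" "norm (x - p) \<le> 3 * a" for p q x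
      using sep'[OF that(1-3)] that(4) dist_triangle[of p q x] by (simp add: dist_norm norm_minus_commute)
    let ?S = "- (\<Union>p\<in>P'. cball p R)"
    have clK: "closed (\<Union>p\<in>P'. cball p R)" using fP' by (intro closed_UN) auto
    have near: "\<bar>cmod (f x) - 1\<bar> \<le> \<nu>" if "\<And>p. p \<in> P' \<Longrightarrow> norm (x - p) > R" for x
    proof -
      have "connected ?S"
      proof (intro connected_complement_disjoint_cballs fP')
        show "2 * R < dist p q" if "p \<in> P'" "q \<in> P'" "p \<noteq> q" for p q using sep'[OF that] aR R by linarith
      qed (use R in \<open>auto simp: dim2\<close>)
      moreover have "emeasure lborel ?S = \<infinity>"
      proof (rule infinite_measure_complement)
        have "emeasure lborel (\<Union>p\<in>P'. cball p R) \<le> (\<Sum>p\<in>P'. emeasure lborel (cball p R))"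
          using fP' by (intro emeasure_subadditive_finite) auto
        also have "\<dots> < \<infinity>" using fP' by (simp add: emeasure_bounded_finite[OF bounded_cball, unfolded infinity_ennreal_def])
        finally show "emeasure lborel (\<Union>p\<in>P'. cball p R) < \<infinity>" .
        show "(\<Union>p\<in>P'. cball p R) \<in> sets borel" using clK by simp
      qed
      moreover have "?S \<inter> (\<Union>p\<in>P. cball p 4) = {}" using R(4) by blast
      moreover have "?S \<in> sets borel" using clK by (intro borel_open) (simp only: open_Compl)
      moreover have "x \<in> ?S" using that by (force simp: dist_norm norm_minus_commute)
      ultimately show ?thesis using near0 by blast
    qed
    have "\<exists>s. R < s \<and> s < a \<and> (\<forall>x. sq p x = s \<longrightarrow> cmod (f x - f (pt p s s)) \<le> 1/8)" if "p \<in> P'" for p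
    proof -
      obtain s where "R < s" "s < \<Lambda> * R" "\<And>x. sq p x = s \<Longrightarrow> cmod (f x - f (pt p s s)) \<le> 2 * sqrt (2 * \<kappa>)"
        by (rule quiet_square[of f f' E R \<kappa> \<Lambda> p]) (use d0 c e E R \<kappa> \<Lambda>1 ln\<Lambda> in auto)
      then show ?thesis unfolding \<kappa>(2) a_def by blast
    qed
    then obtain s where s: "\<And>p. p \<in> P' \<Longrightarrow> R < s p \<and> s p < a"
      and osc: "\<And>p x. p \<in> P' \<Longrightarrow> sq p x = s p \<Longrightarrow> cmod (f x - f (pt p (s p) (s p))) \<le> 1/8" by metis
    have out: "\<bar>cmod (f x) - 1\<bar> \<le> \<nu>" if "\<And>p. p \<in> P' \<Longrightarrow> s p \<le> sq p x" for x
    proof (rule near)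
      fix p assume "p \<in> P'"
      then show "norm (x - p) > R" using s[of p] that[of p] sq_le_norm[of p x] by auto
    qed
    have sqfar: "norm (x - p) \<ge> 2 * a \<Longrightarrow> sq p x > s p" if "p \<in> P'" for p x
      using norm_le_sq[of x p] s[OF that] by linarith
    have sq_in: "sq p x \<le> s p \<Longrightarrow> norm (x - p) < 2 * a" if "p \<in> P'" for p x
      using norm_le_sq[of x p] s[OF that] by linarith
    have disj: "sq q x > s q" if "p \<in> P'" "q \<in> P'" "p \<noteq> q" "sq p x \<le> s p" for p q x
    proof (rule sqfar[OF that(2)])
      have "norm (x - p) \<le> 3 * a" using sq_in[OF that(1,4)] a4 by linarith
      from only[OF that(1-3) this] a4 show "2 * a \<le> norm (x - q)" by linarith
    qed
    have outG: "\<bar>cmod (f x) - 1\<bar> \<le> \<nu>" if "p \<in> P'" "sq p x = s p" for p x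
    proof (rule out)
      fix q assume "q \<in> P'"
      then show "s q \<le> sq q x" using disj[of p q x] that by (cases "q = p") (auto intro: less_imp_le)
    qed
    define cc where "cc p = f (pt p (s p) (s p))" for p
    have ptsq: "sq p (pt p t t) = t" if "t \<ge> 0" for p t unfolding sq_def pt_inner using that by simp
    have ccn: "cmod (cc p) \<ge> 1/2" if "p \<in> P'" for p
    proof -
      have "sq p (pt p (s p) (s p)) = s p" using s[OF that] R by (intro ptsq) auto
      from outG[OF that this] show ?thesis unfolding cc_def using \<nu> by linarith
    qed
    obtain F where F: "continuous_on UNIV F" "\<And>x. (\<And>p. p \<in> P' \<Longrightarrow> sq p x > s p) \<Longrightarrow> F x = f x" "\<And>p x. p \<in> P' \<Longrightarrow> sq p x \<le> s p \<Longrightarrow> F x \<noteq> 0"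
    proof -
      have "\<exists>F. continuous_on UNIV F \<and> (\<forall>x. (\<forall>p\<in>P'. sq p x > s p) \<longrightarrow> F x = f x) \<and> (\<forall>p\<in>P'. \<forall>x. sq p x \<le> s p \<longrightarrow> F x \<noteq> 0)"
      proof (rule planar_fill[OF cf fP'(1) disj])
        show "f x \<in> ball (cc p) (cmod (cc p))" if "p \<in> P'" "sq p x = s p" for p x
          using osc[OF that] ccn[OF that(1)] unfolding cc_def by (simp add: dist_norm norm_minus_commute)
        show "cc p \<noteq> 0" if "p \<in> P'" for p using ccn[OF that] by auto
      qed auto
      then show ?thesis using that by blast
    qed
    have F0: "F x \<noteq> 0" for x
    proof (cases "\<exists>p\<in>P'. sq p x \<le> s p")
      case True then show ?thesis using F(3) by blast
    next
      case False
      then have "F x = f x" by (intro F(2)) force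
      moreover have "\<bar>cmod (f x) - 1\<bar> \<le> \<nu>" using False by (intro out) force
      ultimately show ?thesis using \<nu> by auto
    qed
    obtain G where G: "continuous_on UNIV G" "\<And>x. x \<in> UNIV \<Longrightarrow> F x = exp (G x)"
      using continuous_logarithm_on_contractible[of UNIV F] F(1) F0 contractible_UNIV by auto
    define U where "U = {x. \<forall>p\<in>P'. sq p x > s p}"
    have oU: "open U"
    proof -
      have "U = (\<Inter>p\<in>P'. {x. s p < sq p x})" by (auto simp: U_def)
      moreover have "open (\<Inter>p\<in>P'. {x. s p < sq p x})"
        using fP' by (intro open_INT ballI open_Collect_less sq_continuous continuous_on_const)
      ultimately show ?thesis by simp
    qed
    define g where "g x = Im (G x)" for x
    have dg: "(g has_derivative (\<lambda>v. Im (D x v / f x))) (at x)" if "x \<in> U" for x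
    proof -
      have "f y = exp (G y)" if "y \<in> U" for y using F(2)[of y] G(2)[of y] that by (simp add: U_def)
      then have "(G has_derivative (\<lambda>v. D x v / f x)) (at x)"
        using G(1) by (intro log_has_derivative[OF oU that _ _ d]) (auto intro: continuous_on_subset)
      then show ?thesis unfolding g_def[abs_def] by (rule bounded_linear.has_derivative[OF bounded_linear_Im])
    qed
    have fU: "\<bar>cmod (f x) - 1\<bar> \<le> \<nu>" if "x \<in> U" for x using that by (intro out) (auto simp: U_def intro: less_imp_le)
    have gb: "\<bar>Im (D x v / f x)\<bar> \<le> 2 * cmod (D x v)" if "x \<in> U" for x v
    proof -
      have "\<bar>Im (D x v / f x)\<bar> \<le> cmod (D x v / f x)" by (rule abs_Im_le_cmod)
      also have "\<dots> = cmod (D x v) / cmod (f x)" by (rule norm_divide)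
      also have "\<dots> \<le> cmod (D x v) / (1/2)" using fU[OF that] \<nu> by (intro divide_left_mono) auto
      finally show ?thesis by simp
    qed
    \<comment> \<open>The value of the phase at one point of the inner circle of the annulus; the
      annulus estimate bounds how far the phase deviates from it there.\<close>
    define \<gamma> where "\<gamma> p = g (p + (2 * a) *\<^sub>R e1)" for p
    define \<theta> where "\<theta> x = g x + (\<Sum>p\<in>P'. bump a p x * (\<gamma> p - g x))" for x
    \<comment> \<open>Off \<open>U\<close>, where the phase need not be differentiable, the value 0
      is correct: such a point lies within \<open>2 * a\<close> of a centre, and there
      \<open>\<theta>\<close> is constant.\<close>
    define \<theta>' where "\<theta>' x v = (if x \<in> U then Im (D x v / f x) + (\<Sum>p\<in>P'. bump a p x * (0 - Im (D x v / f x)) + bump' a p x v * (\<gamma> p - g x)) else 0)" for x v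
    have farU: "x \<in> U" if "\<And>p. p \<in> P' \<Longrightarrow> norm (x - p) \<ge> 2 * a" for x using that sqfar by (auto simp: U_def)
    have sum1: "(\<Sum>q\<in>P'. h q) = h p" if "p \<in> P'" "\<And>q. q \<in> P' \<Longrightarrow> q \<noteq> p \<Longrightarrow> h q = 0" for h :: "'a \<Rightarrow> real" and p
      using that fP' by (subst sum.remove[of _ p]) auto
    have others: "bump a q x = 0 \<and> bump' a q x v = 0" if "p \<in> P'" "norm (x - p) \<le> 3 * a" "q \<in> P'" "q \<noteq> p" for p q x v
      using only[OF that(1,3) _ that(2)] that(4) a4 by (intro bump_outside) auto
    have d\<theta>: "(\<theta> has_derivative \<theta>' x) (at x)" for x
    proof (cases "\<exists>p\<in>P'. norm (x - p) < 2 * a")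
      case True
      then obtain p where p: "p \<in> P'" "norm (x - p) < 2 * a" by blast
      have const: "\<theta> y = \<gamma> p" if "norm (y - p) < 2 * a" for y
      proof -
        have "(\<Sum>q\<in>P'. bump a q y * (\<gamma> q - g y)) = bump a p y * (\<gamma> p - g y)"
          using others[OF p(1), of y] that a4 by (intro sum1[OF p(1)]) auto
        then show ?thesis unfolding \<theta>_def using bump_inside[OF a4(2), of y p] that by simp
      qed
      have z: "\<theta>' x = (\<lambda>v. 0)"
      proof (rule ext)
        fix v
        have b1: "bump a p x = 1" "bump' a p x v = 0" using bump_inside[OF a4(2), of x p v] p by auto
        have "(\<Sum>q\<in>P'. bump a q x * (0 - Im (D x v / f x)) + bump' a q x v * (\<gamma> q - g x)) = bump a p x * (0 - Im (D x v / f x)) + bump' a p x v * (\<gamma> p - g x)"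
          using others[OF p(1), of x _ v] p a4 by (intro sum1[OF p(1)]) auto
        then show "\<theta>' x v = 0" unfolding \<theta>'_def b1 by simp
      qed
      have "((\<lambda>_. \<gamma> p) has_derivative (\<lambda>v. 0)) (at x)" by simp
      then show ?thesis unfolding z
      proof (rule has_derivative_transform_within_open)
        show "open {y. norm (y - p) < 2 * a}" by (intro open_Collect_less continuous_intros)
      qed (use p const in auto)
    next
      case False
      then have xU: "x \<in> U" by (intro farU) force
      show ?thesis
        unfolding \<theta>_def[abs_def]
        by (rule has_derivative_eq_rhs[OF has_derivative_add[OF dg[OF xU] has_derivative_sum[OF has_derivative_mult[OF bump_has_derivative has_derivative_diff[OF has_derivative_const dg[OF xU]]]]]])
          (simp add: \<theta>'_def xU fun_eq_iff)
    qed
    let ?B = "\<Union>p\<in>P'. cball p (3 * a)"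
    have clB: "closed ?B" using fP' by (intro closed_UN) auto
    have outB: "norm (x - p) > 3 * a" if "x \<notin> ?B" "p \<in> P'" for x p using that by (force simp: dist_norm norm_minus_commute)
    have gosc: "\<bar>g x - \<gamma> p\<bar> \<le> 22 * (4 * L) * a" if p: "p \<in> P'" and x: "2 * a \<le> norm (x - p)" "norm (x - p) \<le> 3 * a" for p x
      unfolding \<gamma>_def
    proof (rule annulus_oscillation[OF a4(2) _ _ _ x])
      fix y assume y: "2 * a \<le> norm (y - p)" "norm (y - p) \<le> 3 * a"
      have yU: "y \<in> U"
      proof (rule farU)
        fix q assume "q \<in> P'"
        then show "2 * a \<le> norm (y - q)" using only[OF p, of q y] y a4 by (cases "q = p") auto
      qed
      show "(g has_derivative (\<lambda>v. Im (D y v / f y))) (at y)" by (rule dg[OF yU])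
      show "\<bar>Im (D y v / f y)\<bar> \<le> (4 * L) * norm v" for v using gb[OF yU, of v] Db[of y v] by linarith
    qed (use L0 in simp)
    show "\<exists>B \<theta> \<theta>'. B \<in> sets borel \<and> emeasure lborel B \<le> ennreal C \<and> (\<forall>x. (\<theta> has_derivative \<theta>' x) (at x)) \<and>
       (\<forall>b\<in>Basis. \<forall>x\<in>B. \<bar>\<theta>' x b\<bar> \<le> C) \<and> (\<forall>x. x \<notin> B \<longrightarrow> \<bar>cmod (f x) - 1\<bar> \<le> \<nu>) \<and>
       (\<forall>b\<in>Basis. \<forall>x. x \<notin> B \<longrightarrow> \<theta>' x b = Im (f' b x / f x)) \<and> (\<forall>x\<in>B. cmod (f x) \<le> C)"
    proof (rule exI[of _ ?B], rule exI[of _ \<theta>], rule exI[of _ \<theta>'], intro conjI allI ballI impI)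
      show "?B \<in> sets borel" using clB by simp
      show "(\<theta> has_derivative \<theta>' x) (at x)" for x by (rule d\<theta>)
      have "emeasure lborel ?B \<le> (\<Sum>p\<in>P'. emeasure lborel (cball p (3 * a)))"
        using fP' by (intro emeasure_subadditive_finite) auto
      also have "\<dots> = (\<Sum>p\<in>P'. ennreal (unit_ball_vol 2 * (3 * a)\<^sup>2))"
        using a4 by (intro sum.cong refl) (simp add: emeasure_cball dim2)
      also have "\<dots> = ennreal (real (card P') * (unit_ball_vol 2 * (3 * a)\<^sup>2))"
        by (simp add: ennreal_of_nat_eq_real_of_nat ennreal_mult')
      also have "\<dots> \<le> ennreal C"
      proof (rule ennreal_leI)
        have "real (card P') * (unit_ball_vol 2 * (3 * a)\<^sup>2) \<le> real n * (unit_ball_vol 2 * (3 * A)\<^sup>2)"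
          using fP' a4 aA uv by (intro mult_mono power_mono) auto
        then show "real (card P') * (unit_ball_vol 2 * (3 * a)\<^sup>2) \<le> C" using C1(1) by linarith
      qed
      finally show "emeasure lborel ?B \<le> ennreal C" .
      show "\<bar>\<theta>' x b\<bar> \<le> C" if b: "b \<in> Basis" and x: "x \<in> ?B" for b x
      proof -
        obtain p where p: "p \<in> P'" "norm (x - p) \<le> 3 * a" using x by (auto simp: dist_norm norm_minus_commute)
        have sm: "(\<Sum>q\<in>P'. bump a q x * (0 - Im (D x b / f x)) + bump' a q x b * (\<gamma> q - g x)) = bump a p x * (0 - Im (D x b / f x)) + bump' a p x b * (\<gamma> p - g x)"
          using others[OF p, of _ b] by (intro sum1[OF p(1)]) auto
        show ?thesis
        proof (cases "x \<in> U \<and> norm (x - p) \<ge> 2 * a")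
          case True
          let ?i = "Im (D x b / f x)"
          have i: "\<bar>?i\<bar> \<le> 2 * L" using gb[of x b] True L b by (simp add: DB[OF b]) (smt (verit))
          have "\<theta>' x b = (1 - bump a p x) * ?i + bump' a p x b * (\<gamma> p - g x)" unfolding \<theta>'_def sm using True by (simp add: algebra_simps)
          also have "\<bar>\<dots>\<bar> \<le> \<bar>1 - bump a p x\<bar> * \<bar>?i\<bar> + \<bar>bump' a p x b\<bar> * \<bar>\<gamma> p - g x\<bar>"
            by (metis abs_mult abs_triangle_ineq)
          also have "\<dots> \<le> 1 * (2 * L) + 1 * (22 * (4 * L) * a)"
            using bump_range[of a p x] gosc[OF p(1) conjunct2[OF True] p(2)] bump'_bound[OF a4(1) b, of p x] i
            by (intro add_mono mult_mono) (auto simp: abs_minus_commute)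
          also have "\<dots> \<le> 2 * L + 22 * (4 * L) * A" using aA L0 by (simp add: mult_left_mono)
          finally show ?thesis using C1(2) by linarith
        next
          case False
          then consider "x \<notin> U" | "norm (x - p) < 2 * a" by linarith
          then have "\<theta>' x b = 0"
          proof cases
            case 1 then show ?thesis by (simp add: \<theta>'_def)
          next
            case 2
            have b1: "bump a p x = 1" "bump' a p x b = 0" using bump_inside[OF a4(2), of x p b] 2 by auto
            show ?thesis unfolding \<theta>'_def sm b1 by simp
          qed
          then show ?thesis using C1(4) by simp
        qed
      qed
      show "\<bar>cmod (f x) - 1\<bar> \<le> \<nu>" if "x \<notin> ?B" for x
      proof (rule near)
        fix p assume "p \<in> P'"
        then show "norm (x - p) > R" using outB[OF that, of p] aR a4 by linarith
      qed
      show "\<theta>' x b = Im (f' b x / f x)" if b: "b \<in> Basis" and x: "x \<notin> ?B" for b x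
      proof -
        have "x \<in> U" using outB[OF x] a4 by (intro farU) (smt (verit))
        moreover have "(\<Sum>p\<in>P'. bump a p x * (0 - Im (D x b / f x)) + bump' a p x b * (\<gamma> p - g x)) = 0"
        proof (rule sum.neutral, rule ballI)
          fix p assume "p \<in> P'"
          then have "bump a p x = 0" "bump' a p x b = 0" using bump_outside[OF a4(2), of x p b] outB[OF x, of p] by auto
          then show "bump a p x * (0 - Im (D x b / f x)) + bump' a p x b * (\<gamma> p - g x) = 0" by simp
        qed
        ultimately show ?thesis by (simp add: \<theta>'_def DB[OF b])
      qed
      show "cmod (f x) \<le> C" if x: "x \<in> ?B" for x
      proof -
        obtain p where p: "p \<in> P'" "norm (x - p) \<le> 3 * a" using x by (auto simp: dist_norm norm_minus_commute)
        \<comment> \<open>A reference point at distance \<open>2 * a\<close> from the centre, where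
          the modulus is known to be close to 1. The Lipschitz bound for \<open>f\<close> then
          controls the modulus on the whole disc.\<close>
        define y where "y = p + (2 * a) *\<^sub>R (e1::'a)"
        have ny: "norm (y - p) = 2 * a" using a4 e1_Basis[where 'a='a] by (simp add: y_def)
        have "\<bar>cmod (f y) - 1\<bar> \<le> \<nu>"
        proof (rule near)
          fix q assume "q \<in> P'"
          then show "norm (y - q) > R" using only[OF p(1), of q y] ny aR a4 by (cases "q = p") auto
        qed
        then have fy: "cmod (f y) \<le> 3/2" using \<nu> by linarith
        have nxy: "norm (x - y) \<le> 5 * a" using norm_triangle_ineq4[of "x - p" "y - p"] p ny by simp
        have "cmod (f (y + 1 *\<^sub>R (x - y)) - f y) \<le> (2 * L * norm (x - y)) * 1"
          by (rule directional_mean_value_bound[OF d]) (auto intro: Db)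
        also have "\<dots> = 2 * L * norm (x - y)" by simp
        also have "\<dots> \<le> 2 * L * (5 * A)" using nxy aA L0 by (intro mult_left_mono) auto
        finally have "cmod (f x - f y) \<le> 2 * (5 * A) * L" by (simp add: mult_ac)
        then have "cmod (f x) \<le> 3/2 + 2 * (5 * A) * L" using norm_triangle_ineq2[of "f x" "f y"] fy by linarith
        then show ?thesis using C1(3) by linarith
      qed
    qed
  qed
qed

end

section \<open>Counting the balls of concentrated energy\<close>

context mollified
begin

text \<open>Take a largest set of points with large local energy at mutual distance more than
  \<open>4 * h\<close>. The balls of radius \<open>2 * h\<close> about them are disjoint, so each
  costs energy \<open>\<eta>\<close> and their number is bounded; by maximality every other point of
  large local energy is within \<open>4 * h\<close> of one of them.\<close>

lemma concentration_points:
  assumes \<eta>: "\<eta> > 0"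
  shows "\<exists>P. finite P \<and> card P \<le> nat \<lceil>E / \<eta>\<rceil> \<and> (\<forall>x. x \<notin> (\<Union>p\<in>P. cball p (4 * h)) \<longrightarrow> loc x \<le> ennreal \<eta>)"
proof -
  define ok where "ok P \<longleftrightarrow> finite P \<and> (\<forall>p\<in>P. \<not> loc p \<le> ennreal \<eta>) \<and> (\<forall>p\<in>P. \<forall>q\<in>P. p \<noteq> q \<longrightarrow> dist p q > 4 * h)" for P
  let ?e = "\<lambda>y. ennreal (gsq y + V y)"
  have eM: "?e \<in> borel_measurable lborel" by measurable
  have bd: "card P \<le> nat \<lceil>E / \<eta>\<rceil>" if P: "ok P" for P
  proof -
    have fin: "finite P" using P by (simp add: ok_def)
    have one: "(\<Sum>p\<in>P. indicator (cball p (2 * h)) y) \<le> (1::ennreal)" for y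
    proof (cases "\<exists>p\<in>P. y \<in> cball p (2 * h)")
      case True
      then obtain p where p: "p \<in> P" "dist p y \<le> 2 * h" by auto
      have "indicator (cball q (2 * h)) y = (0::ennreal)" if q: "q \<in> P" "q \<noteq> p" for q
      proof -
        have "dist p q > 4 * h" using P p q by (auto simp: ok_def)
        moreover have "dist p q \<le> dist p y + dist q y" by (rule dist_triangle2)
        ultimately show ?thesis using p by (auto simp: indicator_def)
      qed
      then have "(\<Sum>p\<in>P. indicator (cball p (2 * h)) y) = (indicator (cball p (2 * h)) y :: ennreal)"
        using fin p by (subst sum.remove[of _ p]) auto
      then show ?thesis by (simp add: indicator_def)
    next
      case False
      then have "(\<Sum>p\<in>P. indicator (cball p (2 * h)) y) = (0::ennreal)" by (intro sum.neutral) (auto simp: indicator_def)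
      then show ?thesis by simp
    qed
    have "ennreal (real (card P) * \<eta>) = (\<Sum>p\<in>P. ennreal \<eta>)"
      using \<eta> by (simp add: ennreal_of_nat_eq_real_of_nat ennreal_mult')
    also have "\<dots> \<le> (\<Sum>p\<in>P. loc p)" using P by (intro sum_mono) (auto simp: ok_def)
    also have "\<dots> = (\<integral>\<^sup>+y. (\<Sum>p\<in>P. indicator (cball p (2 * h)) y * ?e y) \<partial>lborel)"
      unfolding loc_def by (intro nn_integral_sum[symmetric] borel_measurable_times_ennreal borel_measurable_indicator eM) simp
    also have "\<dots> \<le> (\<integral>\<^sup>+y. ?e y \<partial>lborel)"
    proof (rule nn_integral_mono)
      fix y
      have "(\<Sum>p\<in>P. indicator (cball p (2 * h)) y) * ?e y \<le> 1 * ?e y" by (intro mult_right_mono one) simp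
      then show "(\<Sum>p\<in>P. indicator (cball p (2 * h)) y * ?e y) \<le> ?e y" by (simp add: sum_distrib_right)
    qed
    also note energy_total
    finally have "real (card P) * \<eta> \<le> E" using E by simp
    then have "real (card P) \<le> E / \<eta>" using \<eta> by (simp add: le_divide_eq)
    then show ?thesis by linarith
  qed
  have ok0: "ok {}" by (simp add: ok_def)
  have "\<exists>P. ok P \<and> (\<forall>P'. ok P' \<longrightarrow> card P' \<le> card P)"
    by (rule ex_has_greatest_nat[of ok "{}" card "Suc (nat \<lceil>E / \<eta>\<rceil>)", OF ok0]) (auto dest: bd)
  then obtain P where P: "ok P" and mx: "\<And>P'. ok P' \<Longrightarrow> card P' \<le> card P" by metis
  have "loc x \<le> ennreal \<eta>" if x: "x \<notin> (\<Union>p\<in>P. cball p (4 * h))" for x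
  proof (rule ccontr)
    assume bad: "\<not> loc x \<le> ennreal \<eta>"
    have far: "dist p x > 4 * h" if "p \<in> P" for p using x that by auto
    have "ok (insert x P)" using P bad far unfolding ok_def by (auto simp: dist_commute)
    moreover have "x \<notin> P" using far[of x] h by auto
    ultimately show False using mx[of "insert x P"] P by (simp add: ok_def)
  qed
  then show ?thesis using P bd[OF P] unfolding ok_def by blast
qed

end

section \<open>Bounding the momentum by the energy\<close>

lemma small_threshold_exists:
  assumes "\<delta> > 0" "C\<rho> > 0"
  obtains \<eta> where "\<eta> > 0" "real DIM('a::euclidean_space) * sqrt (C\<rho> * \<eta>) \<le> \<delta>/8" "2 * \<eta> < \<delta>\<^sup>2 / 64 * unit_ball_vol (real DIM('a))"
proof -
  let ?N = "real DIM('a)"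
  have N: "?N > 0" by simp
  define w where "w = \<delta>\<^sup>2 / 64 * unit_ball_vol ?N"
  have w: "w > 0" unfolding w_def using assms by simp
  define \<eta> where "\<eta> = min ((\<delta> / (8 * ?N))\<^sup>2 / C\<rho>) (w / 4)"
  have "\<eta> > 0" unfolding \<eta>_def using assms w N by simp
  moreover have "?N * sqrt (C\<rho> * \<eta>) \<le> \<delta>/8"
  proof -
    have "C\<rho> * \<eta> \<le> C\<rho> * ((\<delta> / (8 * ?N))\<^sup>2 / C\<rho>)" unfolding \<eta>_def using assms by (intro mult_left_mono) auto
    also have "\<dots> = (\<delta> / (8 * ?N))\<^sup>2" using assms by simp
    finally have "sqrt (C\<rho> * \<eta>) \<le> \<delta> / (8 * ?N)" using assms by (simp add: real_le_lsqrt)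
    then have "?N * sqrt (C\<rho> * \<eta>) \<le> ?N * (\<delta> / (8 * ?N))" by (intro mult_left_mono) auto
    then show ?thesis by simp
  qed
  moreover have "2 * \<eta> < w" unfolding \<eta>_def using w by simp
  ultimately show ?thesis using that by (simp add: w_def)
qed

context planar
begin

text \<open>Mollification at unit scale suffices. The bound depends on \<open>E\<close> through the
  radius of the clusters, which grows at least exponentially in \<open>E\<close>; this is enough for
  divergence of the minimal energy.\<close>

lemma planar_momentum_bound:
  assumes cut: "cutoff_ok \<phi>" and A1: "A1 F" and E: "E \<ge> 0"
  shows "\<exists>K. \<forall>(\<psi>::'a \<Rightarrow> complex) G. in_E \<phi> \<psi> G \<longrightarrow> energy F \<psi> G \<le> ennreal E \<longrightarrow> \<bar>Qmom \<psi> G\<bar> \<le> K"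
proof -
  obtain \<delta> where \<delta>: "0 < \<delta>" "\<delta> < 1/4" and co: "\<And>s. s \<ge> 0 \<Longrightarrow> \<bar>s - 1\<bar> \<le> 2 * \<delta> \<Longrightarrow> (s - 1)\<^sup>2 / 4 \<le> \<bar>Vpot F (s\<^sup>2)\<bar>"
    using Vpot_coercive[OF A1] by blast
  obtain C\<rho> where C\<rho>: "C\<rho> > 0" and ex: "\<forall>h>0. \<exists>k::'a \<Rightarrow> real. mollifier h (C\<rho> / h ^ DIM('a)) k"
    using mollifier_exists[where 'a='a] by blast
  define M where "M = C\<rho> / 1 ^ DIM('a)"
  obtain k :: "'a \<Rightarrow> real" where k: "mollifier 1 M k" using ex[rule_format, of 1] unfolding M_def by auto
  obtain \<eta> where \<eta>: "\<eta> > 0" "real DIM('a) * sqrt (C\<rho> * \<eta>) \<le> \<delta>/8" "2 * \<eta> < \<delta>\<^sup>2 / 64 * unit_ball_vol (real DIM('a))"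
    using small_threshold_exists[OF \<delta>(1) C\<rho>, where 'a='a] by blast
  define L where "L = sqrt (M * E)"
  have L: "L \<ge> 0" unfolding L_def M_def using C\<rho> E by simp
  have \<nu>: "\<delta>/2 \<le> 1/2" using \<delta> by simp
  note ph = planar_phase[OF E L \<nu>, of "nat \<lceil>E / \<eta>\<rceil>"]
  from ph obtain C where C: "C \<ge> 0" and Cp: "\<forall>(f :: 'a \<Rightarrow> complex) (f' :: 'a \<Rightarrow> 'a \<Rightarrow> complex) P.
    (\<forall>x. (f has_derivative (\<lambda>v. \<Sum>b\<in>Basis. (v \<bullet> b) *\<^sub>R f' b x)) (at x)) \<longrightarrow>
    (\<forall>b\<in>Basis. continuous_on UNIV (f' b)) \<longrightarrow>
    (\<forall>b\<in>Basis. (\<integral>\<^sup>+x. ennreal ((cmod (f' b x))\<^sup>2) \<partial>lborel) \<le> ennreal E) \<longrightarrow>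
    (\<forall>b\<in>Basis. \<forall>x. cmod (f' b x) \<le> L) \<longrightarrow> finite P \<longrightarrow> card P \<le> nat \<lceil>E / \<eta>\<rceil> \<longrightarrow>
    (\<forall>S. connected S \<longrightarrow> S \<in> sets borel \<longrightarrow> emeasure lborel S = \<infinity> \<longrightarrow> S \<inter> (\<Union>p\<in>P. cball p 4) = {} \<longrightarrow>
       (\<forall>x\<in>S. \<bar>cmod (f x) - 1\<bar> \<le> \<delta>/2)) \<longrightarrow>
    (\<exists>B \<theta> \<theta>'. B \<in> sets borel \<and> emeasure lborel B \<le> ennreal C \<and> (\<forall>x. (\<theta> has_derivative \<theta>' x) (at x)) \<and>
       (\<forall>b\<in>Basis. \<forall>x\<in>B. \<bar>\<theta>' x b\<bar> \<le> C) \<and> (\<forall>x. x \<notin> B \<longrightarrow> \<bar>cmod (f x) - 1\<bar> \<le> \<delta>/2) \<and>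
       (\<forall>b\<in>Basis. \<forall>x. x \<notin> B \<longrightarrow> \<theta>' x b = Im (f' b x / f x)) \<and> (\<forall>x\<in>B. cmod (f x) \<le> C))" by (elim exE conjE) (rule that)
  show ?thesis
  \<comment> \<open>With \<open>h = 1\<close> the terms off the exceptional set give
    \<open>5 * E + 3 * (8 * E + 2 * E)\<close>; the rest is the contribution of a set of measure at
    most \<open>C\<close>.\<close>
  proof (intro exI[of _ "35 * E + (C * L + C) * C"] allI impI)
    fix \<psi> :: "'a \<Rightarrow> complex" and G
    assume "in_E \<phi> \<psi> G" "energy F \<psi> G \<le> ennreal E"
    then interpret m: mollified F \<phi> \<psi> G k 1 M E
      using k E A1 by unfold_locales (auto simp: A1_def)
    obtain P where P: "finite P" "card P \<le> nat \<lceil>E / \<eta>\<rceil>" and quiet: "\<And>x. x \<notin> (\<Union>p\<in>P. cball p 4) \<Longrightarrow> m.loc x \<le> ennreal \<eta>"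
      using m.concentration_points[OF \<eta>(1)] by auto
    have nearS: "\<bar>cmod (m.f x) - 1\<bar> \<le> \<delta>/2"
      if "connected S" "S \<in> sets borel" "emeasure lborel S = \<infinity>" "S \<inter> (\<Union>p\<in>P. cball p 4) = {}" "x \<in> S" for S x
    proof (rule less_imp_le, rule m.modulus_near_on_connected[OF co \<delta> M_def C\<rho> \<eta> cut that(1-3) _ that(5)])
      show "m.loc y \<le> ennreal (\<eta> * 1 ^ DIM('a) / 1\<^sup>2)" if "y \<in> S" for y
        using quiet[of y] that \<open>S \<inter> (\<Union>p\<in>P. cball p 4) = {}\<close> by (simp add: disjoint_iff del: mem_cball)
    qed
    have "\<exists>B \<theta> \<theta>'. B \<in> sets borel \<and> emeasure lborel B \<le> ennreal C \<and> (\<forall>x. (\<theta> has_derivative \<theta>' x) (at x)) \<and>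
       (\<forall>b\<in>Basis. \<forall>x\<in>B. \<bar>\<theta>' x b\<bar> \<le> C) \<and> (\<forall>x. x \<notin> B \<longrightarrow> \<bar>cmod (m.f x) - 1\<bar> \<le> \<delta>/2) \<and>
       (\<forall>b\<in>Basis. \<forall>x. x \<notin> B \<longrightarrow> \<theta>' x b = Im (m.f' b x / m.f x)) \<and> (\<forall>x\<in>B. cmod (m.f x) \<le> C)"
    proof (rule Cp[THEN spec, THEN spec, THEN spec, THEN mp, THEN mp, THEN mp, THEN mp, THEN mp, THEN mp, THEN mp])
      show "\<forall>x. (m.f has_derivative (\<lambda>v. \<Sum>b\<in>Basis. (v \<bullet> b) *\<^sub>R m.f' b x)) (at x)" by (intro allI m.f_has_derivative)
      show "\<forall>b\<in>Basis. continuous_on UNIV (m.f' b)" by (intro ballI m.continuous_f')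
      show "\<forall>b\<in>Basis. (\<integral>\<^sup>+x. ennreal ((cmod (m.f' b x))\<^sup>2) \<partial>lborel) \<le> ennreal E" by (intro ballI m.f'_L2)
      show "\<forall>b\<in>Basis. \<forall>x. cmod (m.f' b x) \<le> L" unfolding L_def by (intro ballI allI m.f'_global)
      show "finite P" "card P \<le> nat \<lceil>E / \<eta>\<rceil>" by (rule P)+
      show "\<forall>S. connected S \<longrightarrow> S \<in> sets borel \<longrightarrow> emeasure lborel S = \<infinity> \<longrightarrow> S \<inter> (\<Union>p\<in>P. cball p 4) = {} \<longrightarrow>
       (\<forall>x\<in>S. \<bar>cmod (m.f x) - 1\<bar> \<le> \<delta>/2)" by (intro allI impI ballI nearS)
    qed
    then obtain B \<theta> \<theta>' where B: "B \<in> sets borel" "emeasure lborel B \<le> ennreal C" and d\<theta>: "\<And>x. (\<theta> has_derivative \<theta>' x) (at x)"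
      and \<theta>B: "\<And>b x. b \<in> Basis \<Longrightarrow> x \<in> B \<Longrightarrow> \<bar>\<theta>' x b\<bar> \<le> C" and near: "\<And>x. x \<notin> B \<Longrightarrow> \<bar>cmod (m.f x) - 1\<bar> \<le> \<delta>/2"
      and \<theta>out: "\<And>b x. b \<in> Basis \<Longrightarrow> x \<notin> B \<Longrightarrow> \<theta>' x b = Im (m.f' b x / m.f x)" and fB: "\<And>x. x \<in> B \<Longrightarrow> cmod (m.f x) \<le> C"
      by blast
    have "\<bar>Qmom \<psi> G\<bar> \<le> 5 * 1 * E + 3 * (8 * E + 2 * 1\<^sup>2 * E) / 1 + (C * L + C) * measure lborel B"
    proof (rule m.momentum_bound[OF _ B(1) _ d\<theta> \<theta>B _ \<theta>out fB _ _ _ C C])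
      show "DIM('a) \<ge> 2" using dim2 by simp
      show "emeasure lborel B < \<infinity>" using B(2) by (simp add: le_less_trans)
      show "\<bar>cmod (m.f x) - 1\<bar> \<le> 1/2" if "x \<notin> B" for x using near[OF that] \<delta> by linarith
      show "cmod (m.f' b x) \<le> L" if "b \<in> Basis" for b x unfolding L_def by (rule m.f'_global[OF that])
      show "(\<integral>\<^sup>+x. indicator (- B) x * ennreal ((cmod (m.f x) - 1)\<^sup>2) \<partial>lborel) \<le> ennreal (8 * E + 2 * 1\<^sup>2 * E)"
      proof (rule m.near_L2[OF co \<delta>(1)])
        show "\<bar>cmod (m.f x) - 1\<bar> \<le> \<delta>" if "x \<in> - B" for x using near[of x] that \<delta> by fastforce
      qed
      show "0 \<le> 8 * E + 2 * 1\<^sup>2 * E" using E by simp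
    qed
    moreover have "(C * L + C) * measure lborel B \<le> (C * L + C) * C"
      using B(2) C L unfolding measure_def by (intro mult_left_mono enn2real_leI) auto
    ultimately show "\<bar>Qmom \<psi> G\<bar> \<le> 35 * E + (C * L + C) * C" by simp
  qed
qed

end

lemma planar_exists:
  assumes "DIM('a::euclidean_space) = 2"
  obtains e2 :: "'a::euclidean_space" where "planar e2"
proof -
  obtain x y :: 'a where xy: "Basis = {x, y}" "x \<noteq> y" using assms by (auto simp: card_2_iff)
  have "e1 = x \<or> e1 = y" using e1_Basis[where 'a='a] xy by blast
  then show ?thesis
  proof
    assume "e1 = x" then show ?thesis using xy by (intro that[of y]) (auto simp: planar_def)
  next
    assume "e1 = y" then show ?thesis using xy by (intro that[of x]) (auto simp: planar_def)
  qed
qed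

text \<open>The scale is the smallest \<open>h \<ge> 1\<close> with
  \<open>E \<le> \<eta> * h^(N-2)\<close> in dimension \<open>N\<close>, for which the small energy
  bound applies on the whole space. Such a scale exists because the exponent is positive in
  dimension at least 3; the maximum covers small energies.\<close>

lemma momentum_bound_dim3:
  assumes cut: "cutoff_ok \<phi>" and A1: "A1 F" and N3: "DIM('a::euclidean_space) \<ge> 3"
  obtains \<eta> where "\<eta> > 0" "\<And>(\<psi>::'a \<Rightarrow> complex) G E. in_E \<phi> \<psi> G \<Longrightarrow> energy F \<psi> G \<le> ennreal E \<Longrightarrow> E \<ge> 0 \<Longrightarrow>
    \<bar>Qmom \<psi> G\<bar> \<le> 35 * max 1 ((E / \<eta>) powr (1 / (real DIM('a) - 2))) * E"
proof -
  let ?N = "DIM('a)"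
  obtain \<delta> where \<delta>: "0 < \<delta>" "\<delta> < 1/4" and co: "\<And>s. s \<ge> 0 \<Longrightarrow> \<bar>s - 1\<bar> \<le> 2 * \<delta> \<Longrightarrow> (s - 1)\<^sup>2 / 4 \<le> \<bar>Vpot F (s\<^sup>2)\<bar>"
    using Vpot_coercive[OF A1] by blast
  obtain C\<rho> where C\<rho>: "C\<rho> > 0" and ex: "\<forall>h>0. \<exists>k::'a \<Rightarrow> real. mollifier h (C\<rho> / h ^ DIM('a)) k"
    using mollifier_exists[where 'a='a] by blast
  obtain \<eta> where \<eta>: "\<eta> > 0" "real DIM('a) * sqrt (C\<rho> * \<eta>) \<le> \<delta>/8" "2 * \<eta> < \<delta>\<^sup>2 / 64 * unit_ball_vol (real DIM('a))"
    using small_threshold_exists[OF \<delta>(1) C\<rho>, where 'a='a] by blast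
  have "\<bar>Qmom \<psi> G\<bar> \<le> 35 * max 1 ((E / \<eta>) powr (1 / (real ?N - 2))) * E"
    if a: "in_E \<phi> \<psi> G" "energy F \<psi> G \<le> ennreal E" "E \<ge> 0" for \<psi> :: "'a \<Rightarrow> complex" and G E
  proof -
    define h where "h = max 1 ((E / \<eta>) powr (1 / (real ?N - 2)))"
    have h: "h \<ge> 1" by (simp add: h_def)
    obtain k :: "'a \<Rightarrow> real" where k: "mollifier h (C\<rho> / h ^ DIM('a)) k" using ex h by fastforce
    interpret m: mollified F \<phi> \<psi> G k h "C\<rho> / h ^ DIM('a)" E
      using k h A1 a by unfold_locales (auto simp: A1_def)
    have "E / \<eta> \<le> h ^ (?N - 2)"
    proof (cases "E = 0")
      case False
      then have p: "E / \<eta> > 0" using a \<eta> by simp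
      have "E / \<eta> = ((E / \<eta>) powr (1 / (real ?N - 2))) powr (real ?N - 2)"
        using powr_one[OF less_imp_le[OF p]] N3 by (simp only: powr_powr) simp
      also have "\<dots> \<le> h powr (real ?N - 2)" unfolding h_def using N3 by (intro powr_mono2) auto
      also have "\<dots> = h ^ (?N - 2)" using h N3 by (simp add: powr_realpow[symmetric])
      finally show ?thesis .
    qed (use h in simp)
    then have "E \<le> \<eta> * h ^ (?N - 2)" using \<eta> by (simp add: divide_le_eq mult.commute)
    also have "\<dots> = \<eta> * h ^ ?N / h\<^sup>2"
    proof -
      have "h ^ (?N - 2 + 2) = h ^ (?N - 2) * h\<^sup>2" by (rule power_add)
      moreover have "?N - 2 + 2 = ?N" using N3 by simp
      ultimately have "h ^ ?N = h ^ (?N - 2) * h\<^sup>2" by metis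
      then show ?thesis using h by simp
    qed
    finally show ?thesis unfolding h_def[symmetric]
      using N3 by (intro m.momentum_bound_small_energy[OF co \<delta> refl C\<rho> \<eta> cut]) auto
  qed
  then show ?thesis using that \<eta>(1) by blast
qed

lemma momentum_bounded_by_energy:
  assumes cut: "cutoff_ok \<phi>" and A1: "A1 F" and N2: "DIM('a::euclidean_space) \<ge> 2" and E: "E \<ge> 0"
  shows "\<exists>K. \<forall>(\<psi>::'a \<Rightarrow> complex) G. in_E \<phi> \<psi> G \<longrightarrow> energy F \<psi> G \<le> ennreal E \<longrightarrow> \<bar>Qmom \<psi> G\<bar> \<le> K"
proof (cases "DIM('a) = 2")
  case True
  then obtain e2 :: 'a where "planar e2" by (rule planar_exists)
  then show ?thesis by (rule planar.planar_momentum_bound[OF _ cut A1 E])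
next
  case False
  then have "DIM('a) \<ge> 3" using N2 by simp
  from momentum_bound_dim3[OF cut A1 this] E show ?thesis by metis
qed

section \<open>From momentum bounds to the minimal energy\<close>

lemma Emin_tendsto_top:
  assumes cut: "cutoff_ok \<phi>" and A1: "A1 F" and N2: "DIM('a::euclidean_space) \<ge> 2"
  shows "((\<lambda>q. Emin \<phi> F q TYPE('a)) \<longlongrightarrow> top) at_top"
proof (rule order_tendstoI)
  fix l :: ennreal assume "l < top"
  then obtain l' where l': "l' \<ge> 0" "l = ennreal l'" by (cases l) auto
  \<comment> \<open>The level \<open>l' + 1\<close> instead of \<open>l'\<close> makes the resulting
    inequality for the infimum strict.\<close>
  obtain K where K: "\<And>(\<psi>::'a \<Rightarrow> complex) G. in_E \<phi> \<psi> G \<Longrightarrow> energy F \<psi> G \<le> ennreal (l' + 1) \<Longrightarrow> \<bar>Qmom \<psi> G\<bar> \<le> K"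
    using momentum_bounded_by_energy[OF cut A1 N2, of "l' + 1"] l' by auto
  have "l < Emin \<phi> F q TYPE('a)" if "q > K" for q
  proof -
    have "l < ennreal (l' + 1)" using l' by (simp add: ennreal_less_iff)
    also have "\<dots> \<le> Emin \<phi> F q TYPE('a)"
      unfolding Emin_def
    proof (rule INF_greatest, clarsimp)
      fix \<psi> :: "'a \<Rightarrow> complex" and G assume "in_E \<phi> \<psi> G" "q = Qmom \<psi> G"
      then show "ennreal (l' + 1) \<le> energy F \<psi> G" using K[of \<psi> G] that linear[of "ennreal (l' + 1)" "energy F \<psi> G"] by auto
    qed
    finally show ?thesis .
  qed
  then show "\<forall>\<^sub>F q in at_top. l < Emin \<phi> F q TYPE('a)" using eventually_gt_at_top[of K] by (rule eventually_mono[rotated])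
qed simp

text \<open>Inverts the momentum bound: \<open>q\<close> is at most a constant times
  \<open>E\<close> to the power \<open>1 + 1 / (N - 2)\<close> in dimension \<open>N\<close>, and
  \<open>\<alpha>\<close> is the reciprocal of that exponent. The constant \<open>C\<close> is what
  remains when the inequality is solved for \<open>E\<close>.\<close>

lemma Emin_lower_bound:
  assumes cut: "cutoff_ok \<phi>" and A1: "A1 F" and N3: "DIM('a::euclidean_space) \<ge> 3"
  shows "\<exists>C>0. \<forall>\<^sub>F q in at_top. ennreal (C * q powr ((real DIM('a) - 2) / (real DIM('a) - 1))) \<le> Emin \<phi> F q TYPE('a)"
proof -
  let ?N = "real DIM('a)"
  define \<alpha> where "\<alpha> = (?N - 2) / (?N - 1)"
  have \<alpha>: "\<alpha> > 0" unfolding \<alpha>_def using N3 by simp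
  have \<alpha>p: "(1 + 1 / (?N - 2)) * \<alpha> = 1" unfolding \<alpha>_def using N3 by (simp add: divide_simps)
  obtain \<eta> where \<eta>: "\<eta> > 0" and Q: "\<And>(\<psi>::'a \<Rightarrow> complex) G E. in_E \<phi> \<psi> G \<Longrightarrow> energy F \<psi> G \<le> ennreal E \<Longrightarrow> E \<ge> 0 \<Longrightarrow>
    \<bar>Qmom \<psi> G\<bar> \<le> 35 * max 1 ((E / \<eta>) powr (1 / (?N - 2))) * E"
    using momentum_bound_dim3[OF cut A1 N3] by blast
  define C where "C = \<eta> / (35 * \<eta>) powr \<alpha>"
  have C: "C > 0" unfolding C_def using \<eta> by simp
  have "ennreal (C * q powr \<alpha>) \<le> Emin \<phi> F q TYPE('a)" if q: "q > 35 * \<eta>" for q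
    unfolding Emin_def
  proof (rule INF_greatest, clarsimp)
    fix \<psi> :: "'a \<Rightarrow> complex" and G assume inE: "in_E \<phi> \<psi> G" and qQ: "q = Qmom \<psi> G"
    have "ennreal (C * q powr \<alpha>) \<le> energy F \<psi> G"
    proof (cases "energy F \<psi> G")
      case (real E)
      have qb: "q \<le> 35 * max 1 ((E / \<eta>) powr (1 / (?N - 2))) * E" using Q[OF inE, of E] real qQ by auto
      \<comment> \<open>The condition \<open>q > 35 * \<eta>\<close> excludes energies below
        \<open>\<eta>\<close>, for which the scale would be 1 and the momentum at most
        \<open>35 * E\<close>. Hence the maximum in the bound is the power.\<close>
      have big: "E / \<eta> \<ge> 1"
      proof (rule ccontr)
        assume n: "\<not> E / \<eta> \<ge> 1"
        then have "(E / \<eta>) powr (1 / (?N - 2)) \<le> 1" using real \<eta> N3 by (intro powr_le1) auto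
        then have "q \<le> 35 * E" using qb by (simp add: max_def split: if_splits)
        then show False using n q \<eta> by (simp add: le_divide_eq)
      qed
      have "(E / \<eta>) powr (1 / (?N - 2)) \<ge> 1" using big N3 by (intro ge_one_powr_ge_zero) auto
      then have "q \<le> 35 * (E / \<eta>) powr (1 / (?N - 2)) * E" using qb by (simp add: max_def split: if_splits)
      also have "\<dots> = 35 * \<eta> * (E / \<eta>) powr (1 + 1 / (?N - 2))" using big \<eta> by (simp add: powr_add field_simps)
      finally have "q / (35 * \<eta>) \<le> (E / \<eta>) powr (1 + 1 / (?N - 2))" using \<eta> by (simp add: divide_le_eq mult_ac)
      then have "(q / (35 * \<eta>)) powr \<alpha> \<le> ((E / \<eta>) powr (1 + 1 / (?N - 2))) powr \<alpha>"
        using q \<eta> \<alpha> by (intro powr_mono2) auto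
      also have "\<dots> = E / \<eta>" using big powr_one[of "E / \<eta>"] by (simp only: powr_powr \<alpha>p)
      finally have "q powr \<alpha> / (35 * \<eta>) powr \<alpha> \<le> E / \<eta>" using q \<eta> by (simp add: powr_divide)
      then have "\<eta> * (q powr \<alpha> / (35 * \<eta>) powr \<alpha>) \<le> \<eta> * (E / \<eta>)" using \<eta> by (intro mult_left_mono) auto
      then have "C * q powr \<alpha> \<le> E" unfolding C_def using \<eta> by simp
      then show ?thesis unfolding real by (rule ennreal_leI)
    qed simp
    then show "ennreal (C * Qmom \<psi> G powr \<alpha>) \<le> energy F \<psi> G" unfolding qQ .
  qed
  then have "\<forall>\<^sub>F q in at_top. ennreal (C * q powr \<alpha>) \<le> Emin \<phi> F q TYPE('a)"
    by (rule eventually_mono[OF eventually_gt_at_top[of "35 * \<eta>"]])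
  with C show ?thesis unfolding \<alpha>_def[symmetric] by (intro exI[of _ C] conjI)
qed

theorem theorem4p17:
  fixes F \<phi> :: "real \<Rightarrow> real"
  assumes cut: "cutoff_ok \<phi>"
    and N2: "DIM('a::euclidean_space) \<ge> 2"
    and A1: "A1 F"
  shows "(\<exists>C>0. \<forall>\<^sub>F q in at_top.
            Emin \<phi> F q TYPE('a) \<le> ennreal (C * q powr ((real DIM('a) - 2) / (real DIM('a) - 1)) * ln q))
       \<and> (A2 DIM('a) F \<longrightarrow>
            ((\<lambda>q. Emin \<phi> F q TYPE('a)) \<longlongrightarrow> top) at_top \<and>
            (DIM('a) \<ge> 3 \<longrightarrow> (\<exists>C>0. \<forall>\<^sub>F q in at_top.
               ennreal (C * q powr ((real DIM('a) - 2) / (real DIM('a) - 1))) \<le> Emin \<phi> F q TYPE('a))))"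
  using Emin_upper_bound[OF cut N2 A1] Emin_tendsto_top[OF cut A1 N2] Emin_lower_bound[OF cut A1, where 'a='a] by blast

end
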